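(* Let $\alpha\neq0$ and $\beta$ be real numbers, let $s>-\frac12$, let $u_0\in H^s(\mathbb{R})$, and let $u$ be the solution of the Kawahara equation $$u_t+\alpha\partial_x^5u+\beta\partial_x^3u+\partial_x(u^2)=0,\qquad u(x,0)=u_0(x).$$ Then $$\lim_{t\to0}\ \sup_{x\in\mathbb{R}}|u(x,t)-U(t)u_0(x)|=0.$$
   Context: $H^s(\mathbb{R})$ is the completion of the Schwartz functions in the norm $\|f\|_{H^s}=\|\langle\xi\rangle^s\mathscr{F}_xf\|_{L^2_\xi}$, where $\langle\xi\rangle=(1+|\xi|^2)^{1/2}$ and $\mathscr{F}_xf(\xi)=\frac{1}{\sqrt{2\pi}}\int_{\mathbb{R}}e^{-ix\xi}f(x)\,dx$. Let $\phi(\xi)=\alpha\xi^5-\beta\xi^3$ and $U(t)f=\frac{1}{\sqrt{2\pi}}\int_{\mathbb{R}}e^{ix\xi-it\phi(\xi)}\mathscr{F}_xf(\xi)\,d\xi$ (the free evolution, a unitary group on $H^s$). Let $\eta$ be a smooth function on $\mathbb{R}$ with $\eta=1$ for $|t|\leq1$ and $\eta=0$ for $|t|>2$. $X_{s,b}$ is the completion of the Schwartz functions on $\mathbb{R}^2$ in the norm $\|u\|_{X_{s,b}}=\|\langle\xi\rangle^s\langle\tau+\phi(\xi)\rangle^b\mathscr{F}u\|_{L^2_{\xi\tau}}$, with $\mathscr{F}u(\xi,\tau)=\frac{1}{2\pi}\int_{\mathbb{R}^2}e^{-ix\xi-it\tau}u(x,t)\,dx\,dt$; for $b>\frac12$ one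 has $X_{s,b}\hookrightarrow C(\mathbb{R};H^s(\mathbb{R}))$. The solution: fix a sufficiently small $\epsilon>0$ (depending on $s$) and put $b=\frac12+\frac\epsilon2$. There is a constant $C_0\ge 1$ such that $\|\eta(t)U(t)f\|_{X_{s,b}}\le C_0\|f\|_{H^s}$ and $\|\eta(t/T)\int_0^tU(t-t')\partial_x(vw)(t')\,dt'\|_{X_{s,b}}\le C_0T^{3\epsilon/2}\|v\|_{X_{s,b}}\|w\|_{X_{s,b}}$ for $0<T<1$ (the bilinear map being extended from Schwartz functions $v,w$ to $X_{s,b}$ by density). For $T\in(0,1)$ with $8C_0^2T^{3\epsilon/2}\|u_0\|_{H^s}\le1$, the solution $u$ on the time interval $[-T,T]$ is the unique $u\in X_{s,b}$ with $\|u\|_{X_{s,b}}\le2C_0\|u_0\|_{H^s}$ satisfying $$u(t)=\eta(t)U(t)u_0-\eta\Big(\frac tT\Big)\int_0^tU(t-t')\partial_x(u^2)(t')\,dt'.$$ Here $u(\cdot,t)$ denotes the value at time $t$ of $u\in C([-T,T];H^s(\mathbb{R}))$, and $\sup_{x}|v(x)|$ denotes the $L^\infty$ norm of the tempered distribution $v=u(\cdot,t)-U(t)u_0$ (equal to $+\infty$ if $v\notin L^\infty$). *)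

theory Defs
  imports "HOL-Analysis.Analysis" "HOL-Probability.Essential_Supremum"
begin

section \<open>Schwartz functions and the Fourier transform\<close>

definition partial_deriv ::
    "'a::euclidean_space \<Rightarrow> ('a \<Rightarrow> 'b::real_normed_vector) \<Rightarrow> 'a \<Rightarrow> 'b" where
  "partial_deriv i f x = frechet_derivative f (at x) i"

definition smooth :: "('a::euclidean_space \<Rightarrow> 'b::real_normed_vector) \<Rightarrow> bool" where
  "smooth f \<longleftrightarrow> (\<forall>is \<in> lists Basis. \<forall>x. foldr partial_deriv is f differentiable (at x))"

definition schwartz :: "('a::euclidean_space \<Rightarrow> complex) \<Rightarrow> bool" where
  "schwartz f \<longleftrightarrow> smooth f \<and>
     (\<forall>is \<in> lists Basis. \<forall>k::nat. bounded (range (\<lambda>x. norm x ^ k *\<^sub>R foldr partial_deriv is f x)))"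

definition fourier :: "('a::euclidean_space \<Rightarrow> complex) \<Rightarrow> 'a \<Rightarrow> complex" where
  "fourier f \<xi> =
     complex_of_real ((2 * pi) powr (- real DIM('a) / 2)) *
     (LINT x|lborel. exp (- (\<i> * complex_of_real (x \<bullet> \<xi>))) * f x)"

section \<open>Distributions and completions of the Schwartz space\<close>

lemma schwartz_zero: "schwartz (\<lambda>x::'a::euclidean_space. 0)"
proof -
  have "foldr partial_deriv is (\<lambda>x::'a. 0::complex) = (\<lambda>x. 0)" for "is"
    by (induction "is") (auto simp: partial_deriv_def)
  then show ?thesis
    by (simp add: schwartz_def smooth_def image_constant_conv)
qed

typedef (overloaded) 'a test_fun = "{\<psi> :: 'a::euclidean_space \<Rightarrow> complex. schwartz \<psi>}"
  using schwartz_zero by blast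

text \<open>Linearity and continuity are not part of the following type; they hold automatically for
  the functionals considered below, which are limits of Schwartz functions.\<close>

type_synonym 'a distribution = "'a test_fun \<Rightarrow> complex"

text \<open>The completion of the Schwartz functions in a norm \<open>N\<close> is realised inside the tempered
  distributions: its elements are the distributional limits of the \<open>N\<close>-Cauchy sequences of Schwartz
  functions. (For the norms used below, an \<open>N\<close>-Cauchy sequence with distributional limit \<open>0\<close> tends
  to \<open>0\<close> in \<open>N\<close>, so this is the abstract completion, and \<open>approximates N f v\<close> says that \<open>f\<close>
  converges to \<open>v\<close> in it.)\<close>

definition approximates ::
    "(('a::euclidean_space \<Rightarrow> complex) \<Rightarrow> real) \<Rightarrow> (nat \<Rightarrow> 'a \<Rightarrow> complex) \<Rightarrow> 'a distribution \<Rightarrow> bool"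
  where
  "approximates N f v \<longleftrightarrow>
     (\<forall>n. schwartz (f n)) \<and>
     (\<forall>e>0. \<exists>M. \<forall>m\<ge>M. \<forall>n\<ge>M. N (\<lambda>x. f m x - f n x) < e) \<and>
     (\<forall>\<psi>. (\<lambda>n. LINT x|lborel. f n x * Rep_test_fun \<psi> x) \<longlonglongrightarrow> v \<psi>)"

definition schwartz_completion ::
    "(('a::euclidean_space \<Rightarrow> complex) \<Rightarrow> real) \<Rightarrow> 'a distribution set" where
  "schwartz_completion N = {v. \<exists>f. approximates N f v}"

definition completion_norm ::
    "(('a::euclidean_space \<Rightarrow> complex) \<Rightarrow> real) \<Rightarrow> 'a distribution \<Rightarrow> real" where
  "completion_norm N v = (THE r. \<forall>f. approximates N f v \<longrightarrow> (\<lambda>n. N (f n)) \<longlonglongrightarrow> r)"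

text \<open>Extension by density of a linear (bilinear) map on Schwartz functions that is bounded with
  respect to the norms \<open>N\<close> and \<open>N'\<close>.\<close>

definition extension ::
    "(('a::euclidean_space \<Rightarrow> complex) \<Rightarrow> real) \<Rightarrow> (('b::euclidean_space \<Rightarrow> complex) \<Rightarrow> real) \<Rightarrow>
     (('a \<Rightarrow> complex) \<Rightarrow> 'b \<Rightarrow> complex) \<Rightarrow> 'a distribution \<Rightarrow> 'b distribution" where
  "extension N N' A v =
     (THE z. \<forall>f. approximates N f v \<longrightarrow> approximates N' (\<lambda>n. A (f n)) z)"

definition bilinear_extension ::
    "(('a::euclidean_space \<Rightarrow> complex) \<Rightarrow> real) \<Rightarrow> (('b::euclidean_space \<Rightarrow> complex) \<Rightarrow> real) \<Rightarrow>
     (('a \<Rightarrow> complex) \<Rightarrow> ('a \<Rightarrow> complex) \<Rightarrow> 'b \<Rightarrow> complex) \<Rightarrow>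
     'a distribution \<Rightarrow> 'a distribution \<Rightarrow> 'b distribution" where
  "bilinear_extension N N' B v w =
     (THE z. \<forall>f g. approximates N f v \<and> approximates N g w \<longrightarrow>
        approximates N' (\<lambda>n. B (f n) (g n)) z)"

text \<open>The infimum is over the (almost everywhere equal) functions representing the distribution, and
  is \<open>\<infinity>\<close> if there is none. A representing \<open>g\<close> that is not essentially bounded contributes \<open>\<infinity>\<close>.\<close>

definition Linfty_norm :: "'a::euclidean_space distribution \<Rightarrow> ereal" where
  "Linfty_norm v =
     (INF g \<in> {g \<in> borel_measurable lborel. \<forall>\<psi>. v \<psi> = (LINT x|lborel. g x * Rep_test_fun \<psi> x)}.
        esssup lborel (\<lambda>x. ereal (cmod (g x))))"

section \<open>Sobolev and Bourgain norms\<close>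

definition japanese :: "real \<Rightarrow> real" where
  "japanese \<xi> = sqrt (1 + \<xi>\<^sup>2)"

definition Hs_norm :: "real \<Rightarrow> (real \<Rightarrow> complex) \<Rightarrow> real" where
  "Hs_norm s f = sqrt (LINT \<xi>|lborel. (japanese \<xi> powr s * cmod (fourier f \<xi>))\<^sup>2)"

definition dispersion :: "real \<Rightarrow> real \<Rightarrow> real \<Rightarrow> real" where
  "dispersion \<alpha> \<beta> \<xi> = \<alpha> * \<xi> ^ 5 - \<beta> * \<xi> ^ 3"

text \<open>Functions of space and time live on \<^typ>\<open>real \<times> real\<close>, with points \<open>(x, t)\<close> and dual variables
  \<open>(\<xi>, \<tau>)\<close>.\<close>

definition X_norm :: "(real \<Rightarrow> real) \<Rightarrow> real \<Rightarrow> real \<Rightarrow> (real \<times> real \<Rightarrow> complex) \<Rightarrow> real" where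
  "X_norm \<phi> s b u =
     sqrt (LINT p|lborel.
       (case p of (\<xi>, \<tau>) \<Rightarrow>
          japanese \<xi> powr s * japanese (\<tau> + \<phi> \<xi>) powr b * cmod (fourier u (\<xi>, \<tau>)))\<^sup>2)"

section \<open>The integral equation\<close>

definition cutoff :: "(real \<Rightarrow> real) \<Rightarrow> bool" where
  "cutoff \<eta> \<longleftrightarrow> smooth \<eta> \<and> (\<forall>t. \<bar>t\<bar> \<le> 1 \<longrightarrow> \<eta> t = 1) \<and> (\<forall>t. \<bar>t\<bar> > 2 \<longrightarrow> \<eta> t = 0)"

definition free_evolution ::
    "(real \<Rightarrow> real) \<Rightarrow> real \<Rightarrow> (real \<Rightarrow> complex) \<Rightarrow> real \<Rightarrow> complex" where
  "free_evolution \<phi> t f x =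
     complex_of_real (1 / sqrt (2 * pi)) *
     (LINT \<xi>|lborel. exp (\<i> * complex_of_real (x * \<xi>) - \<i> * complex_of_real (t * \<phi> \<xi>)) * fourier f \<xi>)"

definition local_free_evolution ::
    "(real \<Rightarrow> real) \<Rightarrow> (real \<Rightarrow> real) \<Rightarrow> (real \<Rightarrow> complex) \<Rightarrow> real \<times> real \<Rightarrow> complex" where
  "local_free_evolution \<phi> \<eta> f = (\<lambda>(x, t). complex_of_real (\<eta> t) * free_evolution \<phi> t f x)"

text \<open>\<^term>\<open>LBINT t'=0..t. F t'\<close> is the oriented integral, so negative \<open>t\<close> are covered; the
  direction \<open>(1, 0)\<close> gives the derivative in \<open>x\<close>.\<close>

definition local_duhamel ::
    "(real \<Rightarrow> real) \<Rightarrow> (real \<Rightarrow> real) \<Rightarrow> real \<Rightarrow>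
     (real \<times> real \<Rightarrow> complex) \<Rightarrow> (real \<times> real \<Rightarrow> complex) \<Rightarrow> real \<times> real \<Rightarrow> complex" where
  "local_duhamel \<phi> \<eta> T v w = (\<lambda>(x, t).
     complex_of_real (\<eta> (t / T)) *
     (LBINT t'=0..t.
        free_evolution \<phi> (t - t') (\<lambda>y. partial_deriv (1, 0) (\<lambda>p. v p * w p) (y, t')) x))"

definition admissible_constant ::
    "(real \<Rightarrow> real) \<Rightarrow> (real \<Rightarrow> real) \<Rightarrow> real \<Rightarrow> real \<Rightarrow> real \<Rightarrow> bool" where
  "admissible_constant \<phi> \<eta> s \<epsilon> C\<^sub>0 \<longleftrightarrow>
     C\<^sub>0 \<ge> 1 \<and>
     (\<forall>f. schwartz f \<longrightarrow>
        X_norm \<phi> s (1/2 + \<epsilon>/2) (local_free_evolution \<phi> \<eta> f) \<le> C\<^sub>0 * Hs_norm s f) \<and>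
     (\<forall>T v w. 0 < T \<longrightarrow> T < 1 \<longrightarrow> schwartz v \<longrightarrow> schwartz w \<longrightarrow>
        X_norm \<phi> s (1/2 + \<epsilon>/2) (local_duhamel \<phi> \<eta> T v w)
          \<le> C\<^sub>0 * T powr (3 * \<epsilon> / 2) * X_norm \<phi> s (1/2 + \<epsilon>/2) v * X_norm \<phi> s (1/2 + \<epsilon>/2) w)"

definition solution ::
    "(real \<Rightarrow> real) \<Rightarrow> (real \<Rightarrow> real) \<Rightarrow> real \<Rightarrow> real \<Rightarrow> real \<Rightarrow> real \<Rightarrow>
     real distribution \<Rightarrow> (real \<times> real) distribution \<Rightarrow> bool" where
  "solution \<phi> \<eta> s b C\<^sub>0 T u\<^sub>0 u \<longleftrightarrow>
     u \<in> schwartz_completion (X_norm \<phi> s b) \<and>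
     completion_norm (X_norm \<phi> s b) u \<le> 2 * C\<^sub>0 * completion_norm (Hs_norm s) u\<^sub>0 \<and>
     (\<forall>\<psi>. u \<psi> =
        extension (Hs_norm s) (X_norm \<phi> s b) (local_free_evolution \<phi> \<eta>) u\<^sub>0 \<psi> -
        bilinear_extension (X_norm \<phi> s b) (X_norm \<phi> s b) (local_duhamel \<phi> \<eta> T) u u \<psi>)"

text \<open>The embedding of \<open>X\<^bsub>s,b\<^esub>\<close> into \<open>C(\<real>; H\<^sup>s)\<close> for \<open>b > 1/2\<close>: evaluation at time \<open>t\<close> extends
  from Schwartz functions by density.\<close>

definition at_time ::
    "(real \<Rightarrow> real) \<Rightarrow> real \<Rightarrow> real \<Rightarrow> real \<Rightarrow> (real \<times> real) distribution \<Rightarrow> real distribution" where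
  "at_time \<phi> s b t = extension (X_norm \<phi> s b) (Hs_norm s) (\<lambda>u x. u (x, t))"

definition evolution :: "(real \<Rightarrow> real) \<Rightarrow> real \<Rightarrow> real \<Rightarrow> real distribution \<Rightarrow> real distribution" where
  "evolution \<phi> s t = extension (Hs_norm s) (Hs_norm s) (free_evolution \<phi> t)"

end

theory Submission
  imports Defs "HOL-Probability.Characteristic_Functions" "HOL-Probability.Sinc_Integral"
begin

text \<open>
  For \<open>|t| \<le> T\<close> the difference \<open>u(t) - U(t) u\<^sub>0\<close> is minus the Duhamel term, and the supremum of the
  Duhamel term of Schwartz functions \<open>v\<close>, \<open>w\<close> is at most the \<open>L\<^sup>1\<close> norm of its Fourier transform in \<open>x\<close>.
  Writing \<open>v\<close>, \<open>w\<close> as superpositions of free solutions with modulations \<open>\<sigma>\<^sub>1\<close>, \<open>\<sigma>\<^sub>2\<close> and integrating the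
  phase over \<open>[0, t]\<close> reduces that norm to a bilinear form with kernel
  \<open>|x + y| \<langle>x\<rangle>\<^sup>-\<^sup>s \<langle>y\<rangle>\<^sup>-\<^sup>s / (1 + |H(x, y) + \<sigma>\<^sub>1 + \<sigma>\<^sub>2|)\<close>, where
  \<open>H(x, y) = \<phi>(x + y) - \<phi>(x) - \<phi>(y)\<close> is the resonance function; since \<open>b > 1/2\<close>, only \<open>L\<^sup>2\<close> bounds that
  are uniform in the modulations are needed. By symmetry let \<open>|y| \<le> |x|\<close>. If \<open>y\<close> is large, the Schur
  test applies: columns are controlled by \<open>|\<partial>\<^sub>x H| \<ge> c |x|\<^sup>3 |y|\<close>, rows by \<open>\<partial>\<^sub>y H\<close> away from its
  zero \<open>x + 2 y = 0\<close>. If \<open>y\<close> is bounded, the kernel is Hilbert-Schmidt, precisely because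
  \<open>s > - 1/2\<close>. Hence the Duhamel term extends from Schwartz functions to \<open>X\<^bsub>s,b\<^esub>\<close> as a map into bounded
  functions, and, being a uniform limit of terms that are \<open>O(t)\<close>, it tends to \<open>0\<close> uniformly in \<open>x\<close>.
\<close>

section \<open>Calculus of Schwartz functions\<close>

text \<open>For s <= 1/2 neither u(t) nor U(t) u_0 has to be a bounded function; only the difference
  is, so boundedness has to be carried by Schwartz approximations and not by the two terms. The
  extensions by density are definite descriptions, and each of them has to be shown to be attained.
  This rests on closability of the Fourier-weighted norms: a Cauchy sequence whose distributional
  limit is 0 is null in norm.

  In the Schur test the factor 1 / m, with m = 1 + |H + sigma|, is split unevenly as m^(-1/4)
  m^(-3/4). Squaring leaves m^(-3/2) in the columns, which is integrable in the variable H and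
  therefore absorbs a full factor |d_x H|, that is, the growth |x|^3 |y| of the squared weights. The
  rows keep m^(-1/2) and no growth; they only have to be integrable over |y| <= |x|, uniformly in x.
  An even split would leave 1 / m in the columns, which misses integrability by a logarithm.\<close>

definition rapid :: "('a::real_normed_vector \<Rightarrow> complex) \<Rightarrow> bool" where
  "rapid f \<longleftrightarrow> (\<forall>k::nat. \<exists>B. \<forall>x. (1 + norm x) ^ k * cmod (f x) \<le> B)"

definition slow :: "('a::real_normed_vector \<Rightarrow> complex) \<Rightarrow> bool" where
  "slow f \<longleftrightarrow> (\<exists>k::nat. \<exists>B. \<forall>x. cmod (f x) \<le> B * (1 + norm x) ^ k)"

text \<open>With \<open>rapid\<close> in place of \<open>R\<close> this is the Schwartz class, with
  \<open>slow\<close> the class of its multipliers (every derivative grows at most polynomially).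
  One treatment of iterated derivatives serves both.\<close>

definition all_derivs ::
    "(('a::euclidean_space \<Rightarrow> complex) \<Rightarrow> bool) \<Rightarrow> ('a \<Rightarrow> complex) \<Rightarrow> bool" where
  "all_derivs R f \<longleftrightarrow> (\<forall>is \<in> lists Basis.
     (\<forall>x. foldr partial_deriv is f differentiable (at x)) \<and> R (foldr partial_deriv is f))"

abbreviation moderate :: "('a::euclidean_space \<Rightarrow> complex) \<Rightarrow> bool" where
  "moderate \<equiv> all_derivs slow"

lemma one_plus_power_le:
  fixes n :: real assumes "n \<ge> 0" shows "(1 + n) ^ k \<le> 2 ^ k * (1 + n ^ k)"
proof (cases "n \<le> 1")
  case True
  then have "(1 + n) ^ k \<le> 2 ^ k" using assms by (intro power_mono) auto
  also have "\<dots> \<le> 2 ^ k * (1 + n ^ k)" using assms by simp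
  finally show ?thesis .
next
  case False
  then have "(1 + n) ^ k \<le> (2 * n) ^ k" using assms by (intro power_mono) auto
  also have "\<dots> \<le> 2 ^ k * (1 + n ^ k)" using assms by (simp add: power_mult_distrib)
  finally show ?thesis .
qed

text \<open>Weights \<open>(1 + norm x) ^ k\<close> multiply cleanly and also see the origin, which
  \<open>norm x ^ k\<close> with \<open>k > 0\<close> does not; the exponents 0 and \<open>k\<close>
  of the latter together control the former.\<close>

lemma rapid_iff_bounded:
  "rapid f \<longleftrightarrow> (\<forall>k::nat. bounded (range (\<lambda>x. norm x ^ k *\<^sub>R f x)))"
proof
  assume r: "rapid f"
  show "\<forall>k::nat. bounded (range (\<lambda>x. norm x ^ k *\<^sub>R f x))"
  proof
    fix k :: nat
    from r obtain B where B: "\<And>x. (1 + norm x) ^ k * cmod (f x) \<le> B" unfolding rapid_def by blast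
    have "norm x ^ k * cmod (f x) \<le> B" for x
      by (rule order_trans[OF mult_right_mono B]) (auto intro: power_mono)
    then show "bounded (range (\<lambda>x. norm x ^ k *\<^sub>R f x))"
      by (intro boundedI[of _ B]) auto
  qed
next
  assume b: "\<forall>k::nat. bounded (range (\<lambda>x. norm x ^ k *\<^sub>R f x))"
  show "rapid f"
    unfolding rapid_def
  proof
    fix k :: nat
    from b[rule_format, of 0] obtain B0 where B0: "\<And>x. cmod (f x) \<le> B0"
      by (auto simp: bounded_iff)
    from b[rule_format, of k] obtain B1 where B1: "\<And>x. norm x ^ k * cmod (f x) \<le> B1"
      by (auto simp: bounded_iff)
    have "(1 + norm x) ^ k * cmod (f x) \<le> 2 ^ k * (B0 + B1)" for x
    proof -
      have "(1 + norm x) ^ k * cmod (f x) \<le> 2 ^ k * (1 + norm x ^ k) * cmod (f x)"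
        by (intro mult_right_mono one_plus_power_le) auto
      also have "\<dots> = 2 ^ k * (cmod (f x) + norm x ^ k * cmod (f x))"
        by (simp add: algebra_simps)
      also have "\<dots> \<le> 2 ^ k * (B0 + B1)"
        using B0 B1 by (intro mult_left_mono add_mono) auto
      finally show ?thesis .
    qed
    then show "\<exists>B. \<forall>x. (1 + norm x) ^ k * cmod (f x) \<le> B" by blast
  qed
qed

lemma schwartz_iff: "schwartz f \<longleftrightarrow> all_derivs rapid f"
  unfolding schwartz_def all_derivs_def smooth_def rapid_iff_bounded by blast

lemma all_derivs_differentiable: "all_derivs R f \<Longrightarrow> f differentiable (at x)"
  unfolding all_derivs_def by (drule bspec[of _ _ "[]"]) auto

lemma all_derivs_self: "all_derivs R f \<Longrightarrow> R f"
  unfolding all_derivs_def by (drule bspec[of _ _ "[]"]) auto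

lemma all_derivs_partial:
  assumes "all_derivs R f" "i \<in> Basis" shows "all_derivs R (partial_deriv i f)"
  unfolding all_derivs_def
proof
  fix js :: "'a list" assume "js \<in> lists Basis"
  \<comment> \<open>\<open>foldr\<close> applies the last direction first, so the inner derivative
    is appended to the list.\<close>
  then have "js @ [i] \<in> lists Basis" using assms by auto
  from assms(1)[unfolded all_derivs_def, rule_format, OF this]
  show "(\<forall>x. foldr partial_deriv js (partial_deriv i f) differentiable (at x)) \<and>
    R (foldr partial_deriv js (partial_deriv i f))" by simp
qed

lemma all_derivs_mono: "all_derivs R f \<Longrightarrow> (\<And>g. R g \<Longrightarrow> R' g) \<Longrightarrow> all_derivs R' f"
  unfolding all_derivs_def by blast

lemma has_derivative_partial_deriv:
  "f differentiable (at x) \<Longrightarrow> (f has_derivative (\<lambda>h. partial_deriv h f x)) (at x)"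
  unfolding partial_deriv_def using frechet_derivative_works by blast

lemma partial_deriv_eq:
  "(f has_derivative f') (at x) \<Longrightarrow> partial_deriv i f x = f' i"
  unfolding partial_deriv_def by (simp add: frechet_derivative_at[symmetric])

lemma partial_deriv_add:
  assumes "f differentiable (at x)" "g differentiable (at x)"
  shows "partial_deriv i (\<lambda>x. f x + g x) x = partial_deriv i f x + partial_deriv i g x"
  by (rule partial_deriv_eq[OF has_derivative_add[OF assms[THEN has_derivative_partial_deriv]]])

lemma partial_deriv_mult:
  fixes f g :: "'a::euclidean_space \<Rightarrow> complex"
  assumes "f differentiable (at x)" "g differentiable (at x)"
  shows "partial_deriv i (\<lambda>x. f x * g x) x = f x * partial_deriv i g x + partial_deriv i f x * g x"
  by (rule partial_deriv_eq[OF has_derivative_mult[OF assms[THEN has_derivative_partial_deriv]]])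

text \<open>The point is that the set of finite sums of members of \<open>C\<close> is closed under partial derivatives.\<close>

lemma all_derivs_coinduct:
  assumes "C f"
    and diff: "\<And>g x. C g \<Longrightarrow> g differentiable (at x)"
    and R: "\<And>g. C g \<Longrightarrow> R g"
    and add: "\<And>g h. R g \<Longrightarrow> R h \<Longrightarrow> R (\<lambda>x. g x + h x)"
    and pd: "\<And>g i. C g \<Longrightarrow> i \<in> Basis \<Longrightarrow> C (partial_deriv i g) \<or>
       (\<exists>g1 g2. C g1 \<and> C g2 \<and> (\<forall>x. partial_deriv i g x = g1 x + g2 x))"
  shows "all_derivs R f"
proof -
  \<comment> \<open>Taking the least set that contains \<open>C\<close> and is closed under sums
    makes the inclusion of \<open>D\<close> in \<open>E\<close> an induction over sums.\<close>
  define D :: "('a \<Rightarrow> complex) set" where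
    "D = \<Inter>{S. Collect C \<subseteq> S \<and> (\<forall>g\<in>S. \<forall>h\<in>S. (\<lambda>x. g x + h x) \<in> S)}"
  have base: "C g \<Longrightarrow> g \<in> D" for g unfolding D_def by blast
  have sum: "g \<in> D \<Longrightarrow> h \<in> D \<Longrightarrow> (\<lambda>x. g x + h x) \<in> D" for g h unfolding D_def by blast
  define E where "E = {g. (\<forall>x. g differentiable (at x)) \<and> R g \<and> (\<forall>i\<in>Basis. partial_deriv i g \<in> D)}"
  have "D \<subseteq> E"
  proof -
    have "Collect C \<subseteq> E"
    proof
      fix g assume "g \<in> Collect C"
      then have g: "C g" by simp
      have "partial_deriv i g \<in> D" if "i \<in> Basis" for i
        using pd[OF g that]
      proof
        assume "C (partial_deriv i g)" then show ?thesis by (rule base)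
      next
        assume "\<exists>g1 g2. C g1 \<and> C g2 \<and> (\<forall>x. partial_deriv i g x = g1 x + g2 x)"
        then obtain g1 g2 where "C g1" "C g2" "\<And>x. partial_deriv i g x = g1 x + g2 x" by blast
        moreover from this have "partial_deriv i g = (\<lambda>x. g1 x + g2 x)" by auto
        ultimately show ?thesis using base sum by simp
      qed
      then show "g \<in> E" unfolding E_def using diff[OF g] R[OF g] by auto
    qed
    moreover have "(\<lambda>x. g x + h x) \<in> E" if "g \<in> E" "h \<in> E" for g h
    proof -
      have "partial_deriv i (\<lambda>x. g x + h x) = (\<lambda>x. partial_deriv i g x + partial_deriv i h x)" for i
        using that partial_deriv_add unfolding E_def by fastforce
      then show ?thesis using that sum add unfolding E_def
        by (auto intro: differentiable_add)
    qed
    ultimately show ?thesis unfolding D_def by (intro Inter_lower) auto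
  qed
  have "foldr partial_deriv js f \<in> D" if "js \<in> lists Basis" for js
    using that by (induction js) (use base[OF assms(1)] \<open>D \<subseteq> E\<close> E_def in auto)
  then show ?thesis unfolding all_derivs_def using \<open>D \<subseteq> E\<close> E_def by auto
qed

section \<open>Sums and products of rapid, slow and moderate functions\<close>

lemma rapid_add: assumes "rapid f" "rapid g" shows "rapid (\<lambda>x. f x + g x)"
  unfolding rapid_def
proof
  fix k
  from assms obtain B C where "\<And>x. (1 + norm x) ^ k * cmod (f x) \<le> B" "\<And>x. (1 + norm x) ^ k * cmod (g x) \<le> C"
    unfolding rapid_def by metis
  then have "(1 + norm x) ^ k * cmod (f x) + (1 + norm x) ^ k * cmod (g x) \<le> B + C" for x
    by (intro add_mono) auto
  then have "(1 + norm x) ^ k * cmod (f x + g x) \<le> B + C" for x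
    by (rule order_trans[rotated]) (auto simp flip: distrib_left intro!: mult_left_mono norm_triangle_ineq)
  then show "\<exists>B. \<forall>x. (1 + norm x) ^ k * cmod (f x + g x) \<le> B" by blast
qed

lemma slowE:
  assumes "slow f" obtains k B where "B \<ge> 0" "\<And>x. cmod (f x) \<le> B * (1 + norm x) ^ k"
proof -
  from assms obtain k B where B: "\<And>x. cmod (f x) \<le> B * (1 + norm x) ^ k" unfolding slow_def by blast
  have "B \<ge> 0" using B[of 0] norm_ge_zero[of "f 0"] by (simp del: norm_ge_zero)
  then show ?thesis using that[of B k] B by blast
qed

lemma slow_add: assumes "slow f" "slow g" shows "slow (\<lambda>x. f x + g x)"
proof -
  obtain k B where B: "B \<ge> 0" "\<And>x. cmod (f x) \<le> B * (1 + norm x) ^ k" using slowE[OF assms(1)] by metis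
  obtain l C where C: "C \<ge> 0" "\<And>x. cmod (g x) \<le> C * (1 + norm x) ^ l" using slowE[OF assms(2)] by metis
  have "cmod (f x + g x) \<le> (B + C) * (1 + norm x) ^ (k + l)" for x
  proof -
    have "cmod (f x + g x) \<le> B * (1 + norm x) ^ k + C * (1 + norm x) ^ l"
      using B(2)[of x] C(2)[of x] norm_triangle_ineq[of "f x" "g x"] by linarith
    also have "\<dots> \<le> B * (1 + norm x) ^ (k+l) + C * (1 + norm x) ^ (k+l)"
      using B C by (intro add_mono mult_left_mono power_increasing) auto
    finally show ?thesis by (simp add: algebra_simps)
  qed
  then show ?thesis unfolding slow_def by blast
qed

lemma slow_mult: assumes "slow f" "slow g" shows "slow (\<lambda>x. f x * g x)"
proof -
  obtain k B where B: "B \<ge> 0" "\<And>x. cmod (f x) \<le> B * (1 + norm x) ^ k" using slowE[OF assms(1)] by metis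
  obtain l C where C: "C \<ge> 0" "\<And>x. cmod (g x) \<le> C * (1 + norm x) ^ l" using slowE[OF assms(2)] by metis
  have "cmod (f x * g x) \<le> (B * C) * (1 + norm x) ^ (k + l)" for x
  proof -
    have "cmod (f x * g x) \<le> (B * (1 + norm x) ^ k) * (C * (1 + norm x) ^ l)"
      unfolding norm_mult using B C by (intro mult_mono) auto
    then show ?thesis by (simp add: power_add algebra_simps)
  qed
  then show ?thesis unfolding slow_def by blast
qed

lemma rapid_mult_slow: assumes "rapid f" "slow g" shows "rapid (\<lambda>x. f x * g x)"
  unfolding rapid_def
proof
  fix k
  obtain l C where C: "C \<ge> 0" "\<And>x. cmod (g x) \<le> C * (1 + norm x) ^ l" using slowE[OF assms(2)] by metis
  obtain B where B: "\<And>x. (1 + norm x) ^ (k+l) * cmod (f x) \<le> B"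
    using assms(1) unfolding rapid_def by metis
  have "(1 + norm x) ^ k * cmod (f x * g x) \<le> B * C" for x
  proof -
    have "(1 + norm x) ^ k * cmod (f x * g x) \<le> (1 + norm x) ^ k * (cmod (f x) * (C * (1 + norm x) ^ l))"
      unfolding norm_mult using C by (intro mult_left_mono) auto
    also have "\<dots> = (1 + norm x) ^ (k+l) * cmod (f x) * C" by (simp add: power_add algebra_simps)
    also have "\<dots> \<le> B * C" using B C by (intro mult_right_mono) auto
    finally show ?thesis .
  qed
  then show "\<exists>B. \<forall>x. (1 + norm x) ^ k * cmod (f x * g x) \<le> B" by blast
qed

lemma rapid_imp_slow: assumes "rapid f" shows "slow f"
proof -
  obtain B where "\<And>x. (1 + norm x) ^ 0 * cmod (f x) \<le> B"
    using assms unfolding rapid_def by blast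
  then show ?thesis unfolding slow_def by (intro exI[of _ 0] exI[of _ B]) auto
qed

lemma all_derivs_add:
  assumes "all_derivs R f" "all_derivs R g" and add: "\<And>g h. R g \<Longrightarrow> R h \<Longrightarrow> R (\<lambda>x. g x + h x)"
  shows "all_derivs R (\<lambda>x. f x + g x)"
proof -
  let ?C = "\<lambda>h. \<exists>f g. all_derivs R f \<and> all_derivs R g \<and> h = (\<lambda>x. f x + g x)"
  have "?C (\<lambda>x. f x + g x)" using assms by blast
  then show ?thesis
  proof (rule all_derivs_coinduct[where C = ?C], goal_cases)
    case (1 g x) then show ?case by (blast intro: differentiable_add all_derivs_differentiable)
  next
    case (2 g) then show ?case using add by (auto intro!: add dest: all_derivs_self)
  next
    case (3 g h) then show ?case by (rule add)
  next
    case (4 h i)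
    then obtain f g where fg: "all_derivs R f" "all_derivs R g" "h = (\<lambda>x. f x + g x)" by blast
    have "partial_deriv i h = (\<lambda>x. partial_deriv i f x + partial_deriv i g x)"
      unfolding fg(3) by (intro ext partial_deriv_add all_derivs_differentiable[OF fg(1)] all_derivs_differentiable[OF fg(2)])
    then show ?case using fg 4(2) all_derivs_partial by blast
  qed
qed

lemma all_derivs_mult:
  assumes "all_derivs R1 f" "all_derivs R2 g" and add: "\<And>g h. R g \<Longrightarrow> R h \<Longrightarrow> R (\<lambda>x. g x + h x)"
    and mult: "\<And>g h. R1 g \<Longrightarrow> R2 h \<Longrightarrow> R (\<lambda>x. g x * h x)"
  shows "all_derivs R (\<lambda>x. f x * g x)"
proof -
  let ?C = "\<lambda>h. \<exists>f g. all_derivs R1 f \<and> all_derivs R2 g \<and> h = (\<lambda>x. f x * g x)"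
  have "?C (\<lambda>x. f x * g x)" using assms by blast
  then show ?thesis
  proof (rule all_derivs_coinduct[where C = ?C], goal_cases)
    case (1 g x) then show ?case by (blast intro: differentiable_mult all_derivs_differentiable)
  next
    case (2 g) then show ?case using mult by (auto intro!: mult dest: all_derivs_self)
  next
    case (3 g h) then show ?case by (rule add)
  next
    case (4 h i)
    then obtain f g where fg: "all_derivs R1 f" "all_derivs R2 g" "h = (\<lambda>x. f x * g x)" by blast
    have "\<forall>x. partial_deriv i h x = f x * partial_deriv i g x + partial_deriv i f x * g x"
      unfolding fg(3) by (intro allI partial_deriv_mult all_derivs_differentiable[OF fg(1)] all_derivs_differentiable[OF fg(2)])
    moreover have "?C (\<lambda>x. f x * partial_deriv i g x)" "?C (\<lambda>x. partial_deriv i f x * g x)"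
      using fg 4(2) all_derivs_partial by blast+
    ultimately show ?case by blast
  qed
qed

lemma moderate_add: "moderate f \<Longrightarrow> moderate g \<Longrightarrow> moderate (\<lambda>x. f x + g x)"
  by (rule all_derivs_add[where R = slow]) (auto intro: slow_add)

lemma moderate_mult: "moderate f \<Longrightarrow> moderate g \<Longrightarrow> moderate (\<lambda>x. f x * g x)"
  by (rule all_derivs_mult[where ?R1.0 = slow and ?R2.0 = slow]) (auto intro: slow_add slow_mult)

lemma schwartz_add: "schwartz f \<Longrightarrow> schwartz g \<Longrightarrow> schwartz (\<lambda>x. f x + g x)"
  unfolding schwartz_iff by (rule all_derivs_add[where R = rapid]) (auto intro: rapid_add)

lemma schwartz_mult_moderate: "schwartz f \<Longrightarrow> moderate g \<Longrightarrow> schwartz (\<lambda>x. f x * g x)"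
  unfolding schwartz_iff
  by (rule all_derivs_mult[where ?R1.0 = rapid and ?R2.0 = slow]) (auto intro: rapid_add rapid_mult_slow)

lemma schwartz_imp_moderate: "schwartz f \<Longrightarrow> moderate f"
  unfolding schwartz_iff by (erule all_derivs_mono) (rule rapid_imp_slow)

lemma schwartz_differentiable: "schwartz f \<Longrightarrow> f differentiable (at x)"
  unfolding schwartz_iff by (rule all_derivs_differentiable)

lemma schwartz_partial: "schwartz f \<Longrightarrow> i \<in> Basis \<Longrightarrow> schwartz (partial_deriv i f)"
  unfolding schwartz_iff by (rule all_derivs_partial)

lemma schwartz_rapid: "schwartz f \<Longrightarrow> rapid f"
  unfolding schwartz_iff by (rule all_derivs_self)

lemma schwartz_continuous: "schwartz f \<Longrightarrow> continuous_on UNIV f"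
  by (intro continuous_at_imp_continuous_on ballI differentiable_imp_continuous_within
      schwartz_differentiable)

lemma moderate_continuous: "moderate f \<Longrightarrow> continuous_on UNIV f"
  by (intro continuous_at_imp_continuous_on ballI differentiable_imp_continuous_within
      all_derivs_differentiable)

lemma schwartz_measurable [measurable_dest]: "schwartz f \<Longrightarrow> f \<in> borel_measurable borel"
  by (intro borel_measurable_continuous_onI schwartz_continuous)

section \<open>Examples of moderate functions: polynomials, phases and powers of brackets\<close>

lemma moderate_const: "moderate (\<lambda>x::'a::euclidean_space. c)"
proof -
  let ?C = "\<lambda>h::'a \<Rightarrow> complex. \<exists>c. h = (\<lambda>x. c)"
  have "?C (\<lambda>x. c)" by blast
  then show ?thesis
  proof (rule all_derivs_coinduct[where C = ?C], goal_cases)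
    case (2 g)
    then obtain c where "g = (\<lambda>x. c)" by blast
    then show ?case unfolding slow_def by (intro exI[of _ 0] exI[of _ "cmod c"]) auto
  next
    case (4 g i)
    then obtain c where c: "g = (\<lambda>x. c)" by blast
    have "partial_deriv i g x = 0" for x unfolding c
      by (rule partial_deriv_eq[OF has_derivative_const])
    then have "partial_deriv i g = (\<lambda>x. 0)" by auto
    then show ?case by blast
  next
    case (3 g h) then show ?case by (rule slow_add)
  next
    case (1 g x) then show ?case by auto
  qed
qed

lemma schwartz_cmult: "schwartz f \<Longrightarrow> schwartz (\<lambda>x. c * f x)"
  using schwartz_mult_moderate[OF _ moderate_const] by (simp add: mult.commute)

lemma schwartz_diff: "schwartz f \<Longrightarrow> schwartz g \<Longrightarrow> schwartz (\<lambda>x. f x - g x)"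
  using schwartz_add[of f "\<lambda>x. -1 * g x"] schwartz_cmult[of g "-1"] by simp

lemma moderate_linear:
  assumes "bounded_linear (l :: 'a::euclidean_space \<Rightarrow> complex)" shows "moderate l"
  unfolding all_derivs_def
proof
  fix js :: "'a list" assume "js \<in> lists Basis"
  have d: "(l has_derivative l) (at x)" for x by (rule bounded_linear_imp_has_derivative[OF assms])
  obtain K where K: "\<And>x. norm (l x) \<le> norm x * K" "K > 0" using bounded_linear.pos_bounded[OF assms] by blast
  have sl: "slow l" unfolding slow_def
  proof (intro exI allI)
    fix x show "cmod (l x) \<le> K * (1 + norm x) ^ 1"
      using K(1)[of x] K(2) by (simp add: algebra_simps)
  qed
  have pd: "partial_deriv i l = (\<lambda>x. l i)" for i
    by (rule ext, rule partial_deriv_eq[OF d])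
  show "(\<forall>x. foldr partial_deriv js l differentiable (at x)) \<and> slow (foldr partial_deriv js l)"
  \<comment> \<open>The rightmost direction is differentiated first and leaves the constant
    \<open>l i\<close>.\<close>
  proof (cases js rule: rev_cases)
    case Nil then show ?thesis using d sl by (auto simp: differentiable_def)
  next
    case (snoc ks i)
    then show ?thesis using moderate_const[of "l i", unfolded all_derivs_def, rule_format, of ks]
        \<open>js \<in> lists Basis\<close> by (auto simp: pd)
  qed
qed

lemma moderate_of_real_linear:
  assumes "bounded_linear (l :: 'a::euclidean_space \<Rightarrow> real)"
  shows "moderate (\<lambda>x. complex_of_real (l x))"
  by (rule moderate_linear) (rule bounded_linear_compose[OF bounded_linear_of_real assms])

lemma moderate_power: "moderate f \<Longrightarrow> moderate (\<lambda>x. f x ^ n)"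
  by (induction n) (auto intro: moderate_const moderate_mult)

text \<open>Products \<open>g * exp (i q)\<close> with moderate \<open>g\<close> are stable under
  derivatives: the new factor is \<open>i g q' + g'\<close>, again moderate.\<close>

lemma moderate_cis:
  assumes q: "moderate (\<lambda>x. complex_of_real (q x))"
  shows "moderate (\<lambda>x. exp (\<i> * complex_of_real (q x)))"
proof -
  let ?C = "\<lambda>h. \<exists>g. moderate g \<and> h = (\<lambda>x. g x * exp (\<i> * complex_of_real (q x)))"
  let ?E = "\<lambda>x. exp (\<i> * complex_of_real (q x))"
  have d: "(?E has_derivative (\<lambda>h. \<i> * partial_deriv h (\<lambda>x. complex_of_real (q x)) x * ?E x)) (at x)" for x
  proof -
    have e: "(exp has_derivative (\<lambda>h. h * exp z)) (at z)" for z :: complex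
      using DERIV_exp[of z] unfolding has_field_derivative_def by (simp add: mult.commute[of _ "exp z"])
    show ?thesis
      using has_derivative_compose[OF has_derivative_mult_right[OF
        has_derivative_partial_deriv[OF all_derivs_differentiable[OF q]]] e, of \<i> x] by simp
  qed
  have "?C ?E" by (intro exI[of _ "\<lambda>x. 1"]) (auto intro: moderate_const)
  then show ?thesis
  proof (rule all_derivs_coinduct[where C = ?C], goal_cases)
    case (1 h x)
    then obtain g where g: "moderate g" "h = (\<lambda>x. g x * ?E x)" by blast
    show ?case unfolding g(2)
      by (rule differentiable_mult[OF all_derivs_differentiable[OF g(1)] differentiableI[OF d]])
  next
    case (2 g)
    then obtain k where "moderate k" "g = (\<lambda>x. k x * ?E x)" by blast
    moreover have "slow k" using \<open>moderate k\<close> by (rule all_derivs_self)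
    ultimately show ?case unfolding slow_def by (simp add: norm_mult)
  next
    case (4 h i)
    then obtain g where g: "moderate g" "h = (\<lambda>x. g x * ?E x)" by blast
    let ?k = "\<lambda>x. g x * (\<i> * partial_deriv i (\<lambda>x. complex_of_real (q x)) x) + partial_deriv i g x"
    have "partial_deriv i h x = ?k x * ?E x" for x
      unfolding g(2)
      by (subst partial_deriv_eq[OF has_derivative_mult[OF
            has_derivative_partial_deriv[OF all_derivs_differentiable[OF g(1)]] d]])
         (simp add: algebra_simps)
    moreover have "moderate ?k"
      using 4(2) by (intro moderate_add moderate_mult moderate_const g all_derivs_partial q)
    ultimately show ?case by blast
  next
    case (3 g h) then show ?case by (rule slow_add)
  qed
qed

text \<open>The exponent has to vary within the class: a derivative of the power lowers it by one,
  and the other term of the product rule is brought to the same exponent through a factor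
  \<open>1 + q^2\<close>. Real exponents are what the weights with powers \<open>s\<close> and
  \<open>b\<close> require.\<close>

lemma moderate_powr:
  assumes q: "moderate (\<lambda>x. complex_of_real (q x))"
  shows "moderate (\<lambda>x. complex_of_real ((1 + (q x)\<^sup>2) powr r))"
proof -
  let ?Q = "\<lambda>x. complex_of_real (q x)"
  let ?P = "\<lambda>r x. complex_of_real ((1 + (q x)\<^sup>2) powr r)"
  let ?C = "\<lambda>h. \<exists>g r. moderate g \<and> h = (\<lambda>x. g x * ?P r x)"
  have pos: "1 + (q x)\<^sup>2 > 0" for x by (rule add_pos_nonneg) auto
  have dQ: "(?Q has_derivative (\<lambda>h. partial_deriv h ?Q x)) (at x)" for x
    by (rule has_derivative_partial_deriv[OF all_derivs_differentiable[OF q]])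
  have dq: "(q has_derivative (\<lambda>h. Re (partial_deriv h ?Q x))) (at x)" for x
    using bounded_linear.has_derivative[OF bounded_linear_Re dQ] by simp
  have re: "complex_of_real (Re (partial_deriv h ?Q x)) = partial_deriv h ?Q x" for h x
  proof -
    have "(?Q has_derivative (\<lambda>h. complex_of_real (Re (partial_deriv h ?Q x)))) (at x)"
      by (rule bounded_linear.has_derivative[OF bounded_linear_of_real dq])
    from has_derivative_unique[OF this dQ] show ?thesis by metis
  qed
  have dP: "(?P r has_derivative (\<lambda>h. complex_of_real (2 * r * q x) * partial_deriv h ?Q x * ?P (r - 1) x)) (at x)" for r x
  proof -
    have "((\<lambda>x. (1 + (q x)\<^sup>2) powr r) has_derivative
       (\<lambda>h. r * (1 + (q x)\<^sup>2) powr (r - 1) * (2 * q x * Re (partial_deriv h ?Q x)))) (at x)"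
      using pos[of x]
      by (auto intro!: derivative_eq_intros dq simp: powr_diff field_simps)
    from bounded_linear.has_derivative[OF bounded_linear_of_real[where 'a=complex] this]
    show ?thesis by (simp add: re mult_ac)
  qed
  have "?C (?P r)" by (intro exI[of _ "\<lambda>x. 1"] exI[of _ r]) (auto intro: moderate_const)
  then show ?thesis
  proof (rule all_derivs_coinduct[where C = ?C], goal_cases)
    case (1 h x)
    then obtain g r where g: "moderate g" "h = (\<lambda>x. g x * ?P r x)" by blast
    show ?case unfolding g(2)
      by (rule differentiable_mult[OF all_derivs_differentiable[OF g(1)] differentiableI[OF dP]])
  next
    case (2 h)
    then obtain g r where g: "moderate g" "h = (\<lambda>x. g x * ?P r x)" by blast
    \<comment> \<open>Only growth is at stake, so the real power is dominated by a natural one,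
      which is moderate by repeated multiplication.\<close>
    obtain n :: nat where n: "r \<le> real n" using real_arch_simple by blast
    have gm: "moderate (\<lambda>x. g x * (1 + ?Q x ^ 2) ^ n)"
      by (intro moderate_mult moderate_power moderate_add moderate_const g q)
    obtain k B where B: "\<And>x. cmod (g x * (1 + ?Q x ^ 2) ^ n) \<le> B * (1 + norm x) ^ k"
      using slowE[OF all_derivs_self[OF gm]] by blast
    have "cmod (h x) \<le> B * (1 + norm x) ^ k" for x
    proof -
      have "(1 + (q x)\<^sup>2) powr r \<le> (1 + (q x)\<^sup>2) powr (real n)"
        by (rule powr_mono[OF n]) simp
      also have "\<dots> = (1 + (q x)\<^sup>2) ^ n" by (rule powr_realpow[OF pos])
      also have "\<dots> = cmod ((1 + ?Q x ^ 2) ^ n)"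
      proof -
        have "(1 + ?Q x ^ 2) ^ n = complex_of_real ((1 + (q x)\<^sup>2) ^ n)" by simp
        then show ?thesis using pos[of x] by (simp only: norm_of_real) simp
      qed
      finally have "cmod (?P r x) \<le> cmod ((1 + ?Q x ^ 2) ^ n)" by simp
      then have "cmod (h x) \<le> cmod (g x * (1 + ?Q x ^ 2) ^ n)"
        unfolding g(2) norm_mult by (intro mult_left_mono) auto
      then show ?thesis using B order_trans by blast
    qed
    then show ?case unfolding slow_def by blast
  next
    case (4 h i)
    then obtain g r where g: "moderate g" "h = (\<lambda>x. g x * ?P r x)" by blast
    let ?k = "\<lambda>x. g x * (complex_of_real (2 * r) * ?Q x * partial_deriv i ?Q x) + partial_deriv i g x * (1 + ?Q x ^ 2)"
    have "partial_deriv i h x = ?k x * ?P (r - 1) x" for x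
    proof -
      have "?P r x = (1 + ?Q x ^ 2) * ?P (r - 1) x"
      proof -
        have "(1 + (q x)\<^sup>2) powr r = (1 + (q x)\<^sup>2) * (1 + (q x)\<^sup>2) powr (r - 1)"
          using pos[of x] by (simp add: powr_diff)
        then show ?thesis by simp
      qed
      then show ?thesis unfolding g(2)
      by (subst partial_deriv_eq[OF has_derivative_mult[OF
            has_derivative_partial_deriv[OF all_derivs_differentiable[OF g(1)]] dP]])
         (simp add: algebra_simps)
    qed
    moreover have "moderate ?k"
      using 4(2) by (intro moderate_add moderate_mult moderate_const moderate_power g all_derivs_partial q)
    ultimately show ?case by blast
  next
    case (3 g h) then show ?case by (rule slow_add)
  qed
qed

section \<open>The Fourier transform on Schwartz functions\<close>

text \<open>Differentiation under the integral sign, by dominated convergence along sequences: the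
  mean value bound makes each integrand Lipschitz with constant \<open>B x\<close>, so the
  normalised remainder is dominated by \<open>2 * B x\<close>.\<close>

lemma has_derivative_integral:
  fixes F :: "'x \<Rightarrow> 'p::euclidean_space \<Rightarrow> complex"
  assumes int: "\<And>p. integrable M (\<lambda>x. F x p)"
    and d: "\<And>x p. (F x has_derivative F' x p) (at p)"
    and bound: "\<And>x p h. norm (F' x p h) \<le> B x * norm h"
    and B: "integrable M B"
    and meas: "\<And>p h. (\<lambda>x. F' x p h) \<in> borel_measurable M"
  shows "((\<lambda>p. LINT x|M. F x p) has_derivative (\<lambda>h. LINT x|M. F' x p h)) (at p)"
proof -
  have Bnn: "B x \<ge> 0" for x
  proof -
    \<comment> \<open>The derivative bound in the direction of a unit vector forces
      \<open>B x >= 0\<close>.\<close>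
    obtain b :: 'p where "b \<in> Basis" using nonempty_Basis by blast
    then show ?thesis using bound[of x p b] norm_ge_zero[of "F' x p b"] by (simp del: norm_ge_zero)
  qed
  have int': "integrable M (\<lambda>x. F' x p h)" for h
    by (rule Bochner_Integration.integrable_bound[OF integrable_mult_left[OF B, of "norm h"]])
       (use meas bound Bnn in \<open>auto simp: abs_mult\<close>)
  have lip: "norm (F x q - F x p) \<le> B x * norm (q - p)" for x q
    by (rule differentiable_bound[of UNIV _ "F' x"])
       (auto intro!: d has_derivative_at_withinI onorm_le bound)
  have bl: "bounded_linear (\<lambda>h. LINT x|M. F' x p h)"
  proof (rule bounded_linear_intro[where K = "LINT x|M. B x"])
    fix h k show "(LINT x|M. F' x p (h + k)) = (LINT x|M. F' x p h) + (LINT x|M. F' x p k)"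
      using has_derivative_bounded_linear[OF d, THEN bounded_linear.linear]
      by (subst Bochner_Integration.integral_add[symmetric]) (auto simp: int' linear_add)
  next
    fix r h show "(LINT x|M. F' x p (r *\<^sub>R h)) = r *\<^sub>R (LINT x|M. F' x p h)"
      using has_derivative_bounded_linear[OF d, THEN bounded_linear.linear]
      by (subst integral_scaleR_right[symmetric]) (auto simp: int' linear_cmul)
  next
    fix h
    have "norm (LINT x|M. F' x p h) \<le> (LINT x|M. norm (F' x p h))" by simp
    also have "\<dots> \<le> (LINT x|M. B x * norm h)"
      by (intro integral_mono integrable_norm int' integrable_mult_left B bound)
    finally show "norm (LINT x|M. F' x p h) \<le> norm h * (LINT x|M. B x)"
      by (simp add: mult.commute)
  qed
  show ?thesis unfolding has_derivative_iff_norm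
  proof (intro conjI bl)
    show "((\<lambda>y. norm ((LINT x|M. F x y) - (LINT x|M. F x p) - (LINT x|M. F' x p (y - p))) / norm (y - p)) \<longlongrightarrow> 0) (at p)"
      unfolding tendsto_at_iff_sequentially comp_def
    proof (intro allI impI)
      fix X :: "nat \<Rightarrow> 'p" assume X: "\<forall>i. X i \<in> UNIV - {p}" "X \<longlonglongrightarrow> p"
      let ?r = "\<lambda>i x. norm (F x (X i) - F x p - F' x p (X i - p)) / norm (X i - p)"
      have meas': "(\<lambda>x. ?r i x) \<in> borel_measurable M" for i
        using int[THEN borel_measurable_integrable] meas by measurable
      have rb: "norm (?r i x) \<le> 2 * B x" for i x
      proof -
        have "norm (F x (X i) - F x p - F' x p (X i - p)) \<le> B x * norm (X i - p) + B x * norm (X i - p)"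
          by (rule order_trans[OF norm_triangle_ineq4 add_mono[OF lip bound]])
        moreover have "norm (X i - p) > 0" using X by auto
        ultimately show ?thesis by (simp add: divide_le_eq)
      qed
      have lim: "(\<lambda>i. LINT x|M. ?r i x) \<longlonglongrightarrow> (LINT x|M. 0)"
      proof (rule integral_dominated_convergence[where w = "\<lambda>x. 2 * B x"])
        show "AE x in M. (\<lambda>i. ?r i x) \<longlonglongrightarrow> 0"
        proof (intro always_eventually allI)
          fix x
          from d[of x p] have "((\<lambda>y. norm (F x y - F x p - F' x p (y - p)) / norm (y - p)) \<longlongrightarrow> 0) (at p)"
            unfolding has_derivative_iff_norm by blast
          then show "(\<lambda>i. ?r i x) \<longlonglongrightarrow> 0"
            using X unfolding tendsto_at_iff_sequentially comp_def by blast
        qed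
      qed (use meas' rb B in auto)
      have le: "norm ((LINT x|M. F x (X i)) - (LINT x|M. F x p) - (LINT x|M. F' x p (X i - p))) / norm (X i - p)
         \<le> (LINT x|M. ?r i x)" for i
      proof -
        have "(LINT x|M. F x (X i)) - (LINT x|M. F x p) - (LINT x|M. F' x p (X i - p)) =
           (LINT x|M. F x (X i) - F x p - F' x p (X i - p))"
          by (simp add: int int')
        then have "norm ((LINT x|M. F x (X i)) - (LINT x|M. F x p) - (LINT x|M. F' x p (X i - p))) / norm (X i - p)
          \<le> (LINT x|M. norm (F x (X i) - F x p - F' x p (X i - p))) / norm (X i - p)"
          by (intro divide_right_mono) auto
        then show ?thesis by simp
      qed
      show "(\<lambda>i. norm ((LINT x|M. F x (X i)) - (LINT x|M. F x p) - (LINT x|M. F' x p (X i - p))) / norm (X i - p)) \<longlonglongrightarrow> 0"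
        by (rule tendsto_sandwich[OF _ _ tendsto_const lim[simplified]]) (use le in auto)
    qed
  qed
qed

text \<open>A product over coordinates, so that integrability in every dimension reduces to that of
  \<open>1 / (1 + x^2)\<close> on the line.\<close>

definition cauchy_weight :: "'a::euclidean_space \<Rightarrow> real" where
  "cauchy_weight x = (\<Prod>b\<in>Basis. 1 / (1 + (x \<bullet> b)\<^sup>2))"

lemma cauchy_weight_nonneg: "cauchy_weight x \<ge> 0"
  unfolding cauchy_weight_def by (intro prod_nonneg) auto

lemma cauchy_weight_measurable [measurable]: "cauchy_weight \<in> borel_measurable borel"
  unfolding cauchy_weight_def by measurable

lemma integrable_cauchy_real: "integrable lborel (\<lambda>x::real. 1 / (1 + x\<^sup>2))"
  using integrable_inverse_1_plus_square by (simp add: set_integrable_def inverse_eq_divide)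

lemma integrable_cauchy_weight: "integrable lborel (cauchy_weight :: 'a::euclidean_space \<Rightarrow> real)"
proof (rule integrableI_bounded)
  have "(\<integral>\<^sup>+x. norm (cauchy_weight (x::'a)) \<partial>lborel) = (\<integral>\<^sup>+x. (\<Prod>b\<in>Basis. ennreal (1 / (1 + ((x::'a) \<bullet> b)\<^sup>2))) \<partial>lborel)"
    by (intro nn_integral_cong)
       (simp add: prod_ennreal cauchy_weight_nonneg, simp add: cauchy_weight_def)
  also have "\<dots> = (\<Prod>b\<in>(Basis::'a set). \<integral>\<^sup>+x. ennreal (1 / (1 + x\<^sup>2)) \<partial>lborel)"
    by (rule nn_integral_lborel_prod) auto
  also have "\<dots> < \<infinity>"
    using nn_integral_eq_integral[OF integrable_cauchy_real]
    by (simp add: ennreal_power power_less_top_ennreal)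
  finally show "(\<integral>\<^sup>+x. norm (cauchy_weight (x::'a)) \<partial>lborel) < \<infinity>" .
qed simp

text \<open>Each of the \<open>DIM('a)\<close> factors \<open>1 + (x . b)^2\<close> is at most
  \<open>(1 + norm x)^2\<close>, which explains the exponent.\<close>

lemma le_cauchy_weight:
  fixes x :: "'a::euclidean_space"
  assumes "(1 + norm x) ^ (2 * DIM('a)) * c \<le> B" "c \<ge> 0"
  shows "c \<le> B * cauchy_weight x"
proof -
  let ?P = "\<Prod>b\<in>(Basis::'a set). 1 + (x \<bullet> b)\<^sup>2"
  have pos: "?P > 0" by (intro prod_pos) (auto intro: add_pos_nonneg)
  have "?P \<le> (\<Prod>b\<in>(Basis::'a set). (1 + norm x) ^ 2)"
  proof (intro prod_mono conjI)
    fix b :: 'a assume "b \<in> Basis"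
    then have "\<bar>x \<bullet> b\<bar> \<le> norm x" by (rule Basis_le_norm)
    then have "(x \<bullet> b)\<^sup>2 \<le> (norm x)\<^sup>2" by (metis abs_le_square_iff abs_norm_cancel)
    also have "(norm x)\<^sup>2 + 1 \<le> (1 + norm x) ^ 2" by (simp add: power2_eq_square algebra_simps)
    finally show "1 + (x \<bullet> b)\<^sup>2 \<le> (1 + norm x) ^ 2" by simp
  qed auto
  also have "\<dots> = (1 + norm x) ^ (2 * DIM('a))" by (simp add: power_mult)
  finally have "?P * c \<le> B" using assms by (meson mult_right_mono order_trans)
  then have "c \<le> B / ?P" using pos by (simp add: pos_le_divide_eq mult.commute)
  then show ?thesis by (simp add: cauchy_weight_def prod_dividef)
qed

lemma rapid_cauchy_weight:
  fixes f :: "'a::euclidean_space \<Rightarrow> complex"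
  assumes "rapid f"
  obtains B where "B \<ge> 0" "\<And>x. cmod (f x) \<le> B * cauchy_weight x"
proof -
  obtain B where B: "\<And>x. (1 + norm x) ^ (2 * DIM('a)) * cmod (f x) \<le> B"
    using assms unfolding rapid_def by blast
  have "cmod (f x) \<le> B * cauchy_weight x" for x
    by (rule le_cauchy_weight[OF B]) simp
  moreover have "B \<ge> 0" using order_trans[OF _ B[of 0]] by simp
  ultimately show ?thesis using that by blast
qed

lemma rapid_integrable:
  assumes "rapid f" "f \<in> borel_measurable borel" shows "integrable lborel f"
proof -
  obtain B where B: "B \<ge> 0" "\<And>x. cmod (f x) \<le> B * cauchy_weight x" using rapid_cauchy_weight[OF assms(1)] by metis
  show ?thesis
    by (rule Bochner_Integration.integrable_bound[OF integrable_mult_right[OF integrable_cauchy_weight, of B]])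
       (use B assms in \<open>auto simp: abs_mult abs_of_nonneg[OF cauchy_weight_nonneg]\<close>)
qed

lemma schwartz_integrable: "schwartz f \<Longrightarrow> integrable lborel f"
  by (intro rapid_integrable schwartz_rapid) (auto dest: schwartz_measurable)

lemma schwartz_bounded: assumes "schwartz f" obtains B where "\<And>x. cmod (f x) \<le> B"
proof -
  have "\<exists>B. \<forall>x. (1 + norm x) ^ 0 * cmod (f x) \<le> B"
    using schwartz_rapid[OF assms] unfolding rapid_def by blast
  then show ?thesis using that by auto
qed

text \<open>The transform without its dimension-dependent constant, so that transforms in one and in
  two variables compose without bookkeeping.\<close>

definition fourier_int :: "('a::euclidean_space \<Rightarrow> complex) \<Rightarrow> 'a \<Rightarrow> complex" where
  "fourier_int f \<xi> = (LINT x|lborel. exp (- (\<i> * complex_of_real (x \<bullet> \<xi>))) * f x)"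

lemma fourier_eq: "fourier f \<xi> = complex_of_real ((2 * pi) powr (- real DIM('a) / 2)) * fourier_int f (\<xi>::'a::euclidean_space)"
  by (simp add: fourier_def fourier_int_def)

lemma norm_cis_minus [simp]: "cmod (exp (- (\<i> * complex_of_real r))) = 1"
  using norm_exp_i_times[of "-r"] by simp

lemma integrable_cis_mult:
  assumes "integrable M f" "g \<in> borel_measurable M"
  shows "integrable M (\<lambda>x. exp (- (\<i> * complex_of_real (g x))) * (f x :: complex))"
  by (rule Bochner_Integration.integrable_bound[OF assms(1)]) (use assms in \<open>auto simp: norm_mult\<close>)

lemma moderate_inner: "moderate (\<lambda>x. complex_of_real (x \<bullet> (i::'a::euclidean_space)))"
  by (rule moderate_of_real_linear) (rule bounded_linear_inner_left)

lemma has_derivative_cis_inner: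
  "((\<lambda>\<xi>. exp (- (\<i> * complex_of_real (x \<bullet> \<xi>)))) has_derivative
     (\<lambda>h. - (\<i> * complex_of_real (x \<bullet> h)) * exp (- (\<i> * complex_of_real (x \<bullet> \<xi>))))) (at (\<xi>::'a::euclidean_space))"
proof -
  have e: "(exp has_derivative (\<lambda>h. h * exp z)) (at z)" for z :: complex
    using DERIV_exp[of z] unfolding has_field_derivative_def by (simp add: mult.commute[of _ "exp z"])
  have "((\<lambda>\<xi>. - (\<i> * complex_of_real (x \<bullet> \<xi>))) has_derivative (\<lambda>h. - (\<i> * complex_of_real (x \<bullet> h)))) (at \<xi>)"
    by (rule bounded_linear_imp_has_derivative)
       (intro bounded_linear_minus bounded_linear_compose[OF bounded_linear_mult_right]
         bounded_linear_compose[OF bounded_linear_of_real] bounded_linear_inner_right)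
  from has_derivative_compose[OF this e] show ?thesis .
qed

lemma fourier_int_has_derivative:
  fixes f :: "'a::euclidean_space \<Rightarrow> complex"
  assumes "schwartz f"
  shows "(fourier_int f has_derivative
     (\<lambda>h. LINT x|lborel. - (\<i> * complex_of_real (x \<bullet> h)) * exp (- (\<i> * complex_of_real (x \<bullet> \<xi>))) * f x)) (at \<xi>)"
proof -
  have [measurable]: "f \<in> borel_measurable borel" using assms by (rule schwartz_measurable)
  have B: "integrable lborel (\<lambda>x. norm x * cmod (f x))"
  proof -
    have "rapid (\<lambda>x. f x * complex_of_real (norm x))"
      by (rule rapid_mult_slow[OF schwartz_rapid[OF assms]])
         (auto simp: slow_def intro!: exI[of _ "1::nat"] exI[of _ "1::real"])
    then have "integrable lborel (\<lambda>x. f x * complex_of_real (norm x))"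
      by (rule rapid_integrable) measurable
    from integrable_norm[OF this] show ?thesis by (simp add: norm_mult mult.commute)
  qed
  have "((\<lambda>\<xi>. LINT x|lborel. exp (- (\<i> * complex_of_real (x \<bullet> \<xi>))) * f x) has_derivative
     (\<lambda>h. LINT x|lborel. - (\<i> * complex_of_real (x \<bullet> h)) * exp (- (\<i> * complex_of_real (x \<bullet> \<xi>))) * f x)) (at \<xi>)"
  proof (rule has_derivative_integral[OF _ _ _ B])
    show "integrable lborel (\<lambda>x. exp (- (\<i> * complex_of_real (x \<bullet> p))) * f x)" for p
      by (intro integrable_cis_mult schwartz_integrable assms) measurable
    show "((\<lambda>\<xi>. exp (- (\<i> * complex_of_real (x \<bullet> \<xi>))) * f x) has_derivative
      (\<lambda>h. - (\<i> * complex_of_real (x \<bullet> h)) * exp (- (\<i> * complex_of_real (x \<bullet> p))) * f x)) (at p)" for x p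
      by (rule has_derivative_mult_left[OF has_derivative_cis_inner])
    show "cmod (- (\<i> * complex_of_real (x \<bullet> h)) * exp (- (\<i> * complex_of_real (x \<bullet> p))) * f x)
       \<le> norm x * cmod (f x) * norm h" for x p h
      using mult_right_mono[OF Cauchy_Schwarz_ineq2[of x h], of "cmod (f x)"]
      by (simp add: norm_mult mult_ac)
  qed measurable
  then show ?thesis unfolding fourier_int_def[abs_def] .
qed

lemma partial_deriv_fourier_int:
  assumes "schwartz f"
  shows "partial_deriv i (fourier_int f) = fourier_int (\<lambda>x. - \<i> * (f x * complex_of_real (x \<bullet> i)))"
  by (rule ext, subst partial_deriv_eq[OF fourier_int_has_derivative[OF assms]])
     (simp add: fourier_int_def mult_ac)

text \<open>The integral of a translate of \<open>f\<close> does not depend on the translation;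
  differentiating it under the integral sign at translation 0 gives the claim in any dimension,
  without Fubini and without boundary terms.\<close>

lemma integral_partial_deriv:
  fixes f :: "'a::euclidean_space \<Rightarrow> complex"
  assumes "schwartz f" "i \<in> Basis"
  shows "(LINT x|lborel. partial_deriv i f x) = 0"
proof -
  note pd = schwartz_partial[OF assms]
  obtain K where K: "K \<ge> 0" "\<And>x. (1 + norm x) ^ (2 * DIM('a)) * cmod (partial_deriv i f x) \<le> K"
  proof -
    obtain K where K: "\<And>x. (1 + norm x) ^ (2 * DIM('a)) * cmod (partial_deriv i f x) \<le> K"
      using schwartz_rapid[OF pd] unfolding rapid_def by blast
    moreover have "K \<ge> 0" using order_trans[OF _ K[of 0]] by simp
    ultimately show ?thesis using that by blast
  qed
  \<comment> \<open>Translating by \<open>sin s\<close> instead of \<open>s\<close> keeps the dominating function independent of \<open>s\<close>.\<close>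
  define g where "g = (\<lambda>x s. f (x + sin s *\<^sub>R i))"
  have [measurable]: "f \<in> borel_measurable borel" "partial_deriv i f \<in> borel_measurable borel"
    using assms pd by (auto dest: schwartz_measurable)
  have der: "(g x has_derivative (\<lambda>h. (h * cos s) *\<^sub>R partial_deriv i f (x + sin s *\<^sub>R i))) (at s)" for x s
  proof -
    have "((\<lambda>s. x + sin s *\<^sub>R i) has_derivative (\<lambda>h. (h * cos s) *\<^sub>R i)) (at s)"
      by (auto intro!: derivative_eq_intros simp: mult.commute)
    from has_derivative_compose[OF this has_derivative_partial_deriv[OF schwartz_differentiable[OF assms(1)]]]
    have "(g x has_derivative (\<lambda>h. partial_deriv ((h * cos s) *\<^sub>R i) f (x + sin s *\<^sub>R i))) (at s)"
      unfolding g_def .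
    moreover have "partial_deriv (r *\<^sub>R i) f y = r *\<^sub>R partial_deriv i f y" for r y
      using linear_cmul[OF has_derivative_linear[OF has_derivative_partial_deriv[OF schwartz_differentiable[OF assms(1)]]]] .
    ultimately show ?thesis by simp
  qed
  \<comment> \<open>A shift of length at most 1 changes \<open>1 + norm x\<close> by a factor of at
    most 2; raised to the power \<open>2 * DIM('a)\<close> this is
    \<open>4 ^ DIM('a)\<close>.\<close>
  let ?B = "\<lambda>x::'a. (4 ^ DIM('a) * K) * cauchy_weight x"
  have bnd: "cmod (partial_deriv i f (x + sin s *\<^sub>R i)) \<le> ?B x" for x s
  proof -
    let ?y = "x + sin s *\<^sub>R i"
    have "norm x \<le> norm ?y + norm (sin s *\<^sub>R i)"
      using norm_triangle_ineq4[of ?y "sin s *\<^sub>R i"] by simp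
    moreover have "norm (sin s *\<^sub>R i) \<le> 1" using assms(2) by simp
    moreover have "1 + a \<le> 2 * (1 + c)" if "a \<le> c + d" "d \<le> 1" "0 \<le> c" for a c d :: real
      using that by argo
    ultimately have "1 + norm x \<le> 2 * (1 + norm ?y)" using norm_ge_zero by blast
    then have "(1 + norm x) ^ (2 * DIM('a)) \<le> (2 * (1 + norm ?y)) ^ (2 * DIM('a))"
      by (intro power_mono) auto
    also have "\<dots> = 4 ^ DIM('a) * (1 + norm ?y) ^ (2 * DIM('a))"
      by (simp only: power_mult_distrib) (simp add: power_mult)
    finally have "(1 + norm x) ^ (2 * DIM('a)) * cmod (partial_deriv i f ?y) \<le>
       4 ^ DIM('a) * (1 + norm ?y) ^ (2 * DIM('a)) * cmod (partial_deriv i f ?y)"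
      by (rule mult_right_mono) simp
    also have "\<dots> \<le> 4 ^ DIM('a) * K" using K(2)[of ?y] by (simp add: mult.assoc)
    finally have 1: "(1 + norm x) ^ (2 * DIM('a)) * cmod (partial_deriv i f ?y) \<le> 4 ^ DIM('a) * K" .
    show ?thesis by (rule le_cauchy_weight[OF 1]) simp
  qed
  have transl: "(LINT x|lborel. h (x + c)) = (LINT x|lborel. h x)"
    if "h \<in> borel_measurable borel" for h :: "'a \<Rightarrow> complex" and c
  proof -
    have "(LINT x|lborel. h x) = (LINT x|distr lborel borel ((+) c). h x)"
      by (simp only: lborel_distr_plus)
    also have "\<dots> = (LINT x|lborel. h (c + x))"
      by (rule integral_distr) (use that in auto)
    finally show ?thesis by (simp add: add.commute)
  qed
  have "((\<lambda>s. LINT x|lborel. g x s) has_derivative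
      (\<lambda>h. LINT x|lborel. (h * cos 0) *\<^sub>R partial_deriv i f (x + sin 0 *\<^sub>R i))) (at 0)"
  proof (rule has_derivative_integral[where B = ?B])
    show "integrable lborel (\<lambda>x. g x s)" for s
      unfolding g_def
    proof -
      have "integrable (distr lborel borel ((+) (sin s *\<^sub>R i))) f"
        by (simp only: lborel_distr_plus) (rule schwartz_integrable[OF assms(1)])
      then have "integrable lborel (\<lambda>x. f (sin s *\<^sub>R i + x))"
        by (subst (asm) integrable_distr_eq) auto
      then show "integrable lborel (\<lambda>x. f (x + sin s *\<^sub>R i))" by (simp add: add.commute)
    qed
    show "(g x has_derivative (\<lambda>h. (h * cos s) *\<^sub>R partial_deriv i f (x + sin s *\<^sub>R i))) (at s)" for x s
      by (rule der)
    show "cmod ((h * cos s) *\<^sub>R partial_deriv i f (x + sin s *\<^sub>R i)) \<le> ?B x * norm h" for x s h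
    proof -
      have "\<bar>h * cos s\<bar> \<le> \<bar>h\<bar>" by (simp add: abs_mult mult_left_le)
      then have "cmod ((h * cos s) *\<^sub>R partial_deriv i f (x + sin s *\<^sub>R i)) \<le> \<bar>h\<bar> * ?B x"
        unfolding norm_scaleR using bnd by (intro mult_mono) auto
      then show ?thesis by (simp add: mult.commute)
    qed
    show "integrable lborel ?B" by (intro integrable_mult_right integrable_cauchy_weight)
  qed measurable
  moreover have "(\<lambda>s. LINT x|lborel. g x s) = (\<lambda>s. LINT x|lborel. f x)"
    unfolding g_def by (rule ext, rule transl) simp
  ultimately have "((\<lambda>s::real. LINT x|lborel. f x) has_derivative
      (\<lambda>h. LINT x|lborel. h *\<^sub>R partial_deriv i f x)) (at 0)" by simp
  from has_derivative_unique[OF this has_derivative_const] have "(LINT x|lborel. (1::real) *\<^sub>R partial_deriv i f x) = 0"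
    by metis
  then show ?thesis by simp
qed

lemma moderate_cis_inner: "moderate (\<lambda>x. exp (- (\<i> * complex_of_real (x \<bullet> (\<xi>::'a::euclidean_space)))))"
  using moderate_cis[OF moderate_inner[of "-\<xi>"]] by simp

text \<open>Integration by parts, in the form that the derivative of \<open>f\<close> times the
  character has integral zero.\<close>

lemma fourier_int_partial_deriv:
  fixes f :: "'a::euclidean_space \<Rightarrow> complex"
  assumes "schwartz f" "i \<in> Basis"
  shows "fourier_int (partial_deriv i f) \<xi> = \<i> * complex_of_real (\<xi> \<bullet> i) * fourier_int f \<xi>"
proof -
  let ?E = "\<lambda>x. exp (- (\<i> * complex_of_real (x \<bullet> \<xi>)))"
  have E: "(?E has_derivative (\<lambda>h. - (\<i> * complex_of_real (\<xi> \<bullet> h)) * ?E x)) (at x)" for x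
    using has_derivative_cis_inner[of \<xi> x] by (simp add: inner_commute)
  have "(LINT x|lborel. partial_deriv i (\<lambda>x. f x * ?E x) x) = 0"
    by (intro integral_partial_deriv schwartz_mult_moderate assms moderate_cis_inner)
  also have "partial_deriv i (\<lambda>x. f x * ?E x) = (\<lambda>x. ?E x * partial_deriv i f x - \<i> * complex_of_real (\<xi> \<bullet> i) * (?E x * f x))"
    by (rule ext, subst partial_deriv_eq[OF has_derivative_mult[OF
            has_derivative_partial_deriv[OF schwartz_differentiable[OF assms(1)]] E]])
       (simp add: algebra_simps)
  also have "(LINT x|lborel. ?E x * partial_deriv i f x - \<i> * complex_of_real (\<xi> \<bullet> i) * (?E x * f x)) =
     fourier_int (partial_deriv i f) \<xi> - \<i> * complex_of_real (\<xi> \<bullet> i) * fourier_int f \<xi>"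
    unfolding fourier_int_def
    by (subst Bochner_Integration.integral_diff)
       (auto intro!: integrable_mult_right integrable_cis_mult schwartz_integrable[OF assms(1)]
          schwartz_integrable[OF schwartz_partial[OF assms]])
  finally show ?thesis by simp
qed

text \<open>Induction on the power of \<open>norm xi\<close>: one factor is distributed over the
  coordinates by the l1 bound and then traded for a derivative of \<open>f\<close>, which is again a
  Schwartz function.\<close>

lemma rapid_fourier_int:
  fixes f :: "'a::euclidean_space \<Rightarrow> complex"
  assumes "schwartz f" shows "rapid (fourier_int f)"
proof -
  have "\<exists>B. \<forall>\<xi>. norm \<xi> ^ k * cmod (fourier_int f \<xi>) \<le> B" for k
    using assms
  proof (induction k arbitrary: f)
    case 0
    have "cmod (fourier_int f \<xi>) \<le> (LINT x|lborel. cmod (f x))" for \<xi>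
    proof -
      have "cmod (fourier_int f \<xi>) \<le> (LINT x|lborel. cmod (exp (- (\<i> * complex_of_real (x \<bullet> \<xi>))) * f x))"
        unfolding fourier_int_def by (rule integral_norm_bound)
      then show ?thesis by (simp add: norm_mult)
    qed
    then show ?case by auto
  next
    case (Suc k)
    have "\<forall>i\<in>Basis. \<exists>B. \<forall>\<xi>. norm \<xi> ^ k * cmod (fourier_int (partial_deriv i f) \<xi>) \<le> B"
      using Suc schwartz_partial by blast
    then obtain B where B: "\<And>i \<xi>. i \<in> Basis \<Longrightarrow> norm \<xi> ^ k * cmod (fourier_int (partial_deriv i f) \<xi>) \<le> B i"
      by metis
    have "norm \<xi> ^ Suc k * cmod (fourier_int f \<xi>) \<le> (\<Sum>i\<in>Basis. B i)" for \<xi>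
    proof -
      have "norm \<xi> ^ Suc k * cmod (fourier_int f \<xi>) = norm \<xi> * (norm \<xi> ^ k * cmod (fourier_int f \<xi>))" by simp
      also have "\<dots> \<le> (\<Sum>i\<in>Basis. \<bar>\<xi> \<bullet> i\<bar>) * (norm \<xi> ^ k * cmod (fourier_int f \<xi>))"
        by (intro mult_right_mono norm_le_l1) auto
      also have "\<dots> = (\<Sum>i\<in>Basis. norm \<xi> ^ k * cmod (fourier_int (partial_deriv i f) \<xi>))"
        unfolding sum_distrib_right
          by (intro sum.cong refl) (simp add: fourier_int_partial_deriv[OF Suc.prems] norm_mult mult_ac)
      also have "\<dots> \<le> (\<Sum>i\<in>Basis. B i)" by (intro sum_mono B)
      finally show ?thesis .
    qed
    then show ?case by blast
  qed
  then show ?thesis unfolding rapid_iff_bounded bounded_iff by simp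
qed

text \<open>Transforms of Schwartz functions are stable under derivatives, because a derivative of
  the transform is the transform of \<open>f\<close> times a coordinate.\<close>

lemma schwartz_fourier_int:
  assumes "schwartz (f :: 'a::euclidean_space \<Rightarrow> complex)" shows "schwartz (fourier_int f)"
proof -
  let ?C = "\<lambda>g. \<exists>f::'a \<Rightarrow> complex. schwartz f \<and> g = fourier_int f"
  have "?C (fourier_int f)" using assms by blast
  then have "all_derivs rapid (fourier_int f)"
  proof (rule all_derivs_coinduct[where C = ?C], goal_cases)
    case (1 g x) then show ?case using fourier_int_has_derivative differentiableI by blast
  next
    case (2 g) then show ?case using rapid_fourier_int by blast
  next
    case (3 g h) then show ?case by (rule rapid_add)
  next
    case (4 g i)
    then obtain f where f: "schwartz f" "g = fourier_int f" by blast
    have "schwartz (\<lambda>x. - \<i> * (f x * complex_of_real (x \<bullet> i)))"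
      by (intro schwartz_cmult schwartz_mult_moderate moderate_inner f)
    then show ?case using partial_deriv_fourier_int[OF f(1), of i] f(2) by blast
  qed
  then show ?thesis by (simp only: schwartz_iff)
qed

lemma schwartz_fourier: "schwartz f \<Longrightarrow> schwartz (fourier f)"
  using schwartz_cmult[OF schwartz_fourier_int] by (simp add: fourier_eq[abs_def])

lemma fourier_diff:
  assumes "integrable lborel f" "integrable lborel g"
  shows "fourier (\<lambda>x. f x - g x) \<xi> = fourier f \<xi> - fourier g \<xi>"
  unfolding fourier_def
  by (simp add: right_diff_distrib Bochner_Integration.integral_diff integrable_cis_mult assms)

lemma fourier_int_multiplication:
  fixes f g :: "'a::euclidean_space \<Rightarrow> complex"
  assumes f: "integrable lborel f" and g: "integrable lborel g"
  shows "(LINT x|lborel. fourier_int f x * g x) = (LINT x|lborel. f x * fourier_int g x)"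
proof -
  have [measurable]: "f \<in> borel_measurable borel" "g \<in> borel_measurable borel"
    using f g by (auto dest: borel_measurable_integrable)
  let ?F = "\<lambda>x y. exp (- (\<i> * complex_of_real (x \<bullet> y))) * f x * g y"
  have int: "integrable (lborel \<Otimes>\<^sub>M lborel) (\<lambda>(x, y). ?F x y)"
  proof (rule Bochner_Integration.integrable_bound)
    show "integrable (lborel \<Otimes>\<^sub>M lborel) (\<lambda>(x, y). f x * g y)"
      using f g by (intro lborel_pair.Fubini_integrable)
        (auto simp: norm_mult integrable_norm)
  qed (auto simp: norm_mult)
  have "(LINT x|lborel. f x * fourier_int g x) = (LINT x|lborel. LINT y|lborel. ?F x y)"
    unfolding fourier_int_def integral_mult_right_zero[symmetric]
    by (simp add: inner_commute mult_ac)
  also have "\<dots> = (LINT y|lborel. LINT x|lborel. ?F x y)"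
    by (rule lborel_pair.Fubini_integral[OF int, symmetric])
  also have "\<dots> = (LINT y|lborel. fourier_int f y * g y)"
    by (intro Bochner_Integration.integral_cong refl)
       (simp add: fourier_int_def mult.commute)
  finally show ?thesis by simp
qed

lemma fourier_multiplication:
  fixes f g :: "'a::euclidean_space \<Rightarrow> complex"
  assumes "integrable lborel f" and "integrable lborel g"
  shows "(LINT x|lborel. fourier f x * g x) = (LINT x|lborel. f x * fourier g x)"
  using fourier_int_multiplication[OF assms] by (simp add: fourier_eq mult.assoc mult.left_commute[of _ "complex_of_real _"])

section \<open>Affine substitutions, tensor products and cutoffs of Schwartz functions\<close>

lemma partial_deriv_expand:
  fixes f :: "'a::euclidean_space \<Rightarrow> complex"
  assumes "f differentiable (at x)"
  shows "partial_deriv h f x = (\<Sum>b\<in>Basis. complex_of_real (h \<bullet> b) * partial_deriv b f x)"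
proof -
  interpret linear "\<lambda>h. partial_deriv h f x"
    by (rule has_derivative_linear[OF has_derivative_partial_deriv[OF assms]])
  have "partial_deriv (\<Sum>b\<in>Basis. (h \<bullet> b) *\<^sub>R b) f x = (\<Sum>b\<in>Basis. complex_of_real (h \<bullet> b) * partial_deriv b f x)"
    by (simp add: sum scale scaleR_conv_of_real)
  then show ?thesis by (simp add: euclidean_representation)
qed

lemma all_derivs_sum:
  assumes "\<And>b. b \<in> B \<Longrightarrow> all_derivs R (f b)"
    and add: "\<And>g h. R g \<Longrightarrow> R h \<Longrightarrow> R (\<lambda>x. g x + h x)" and z: "all_derivs R (\<lambda>x. 0)"
  shows "all_derivs R (\<lambda>x. \<Sum>b\<in>B. f b x)"
  using assms(1)
proof (induction B rule: infinite_finite_induct)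
  case (insert b B)
  have "all_derivs R (\<lambda>x. f b x + (\<Sum>b\<in>B. f b x))"
    by (rule all_derivs_add[where R = R]) (use insert add in auto)
  then show ?case using insert by simp
qed (use z in auto)

lemma all_derivs_cmult:
  assumes g: "all_derivs R g" and cmult: "\<And>g. R g \<Longrightarrow> R (\<lambda>x. r * g x)"
    and add: "\<And>g h. R g \<Longrightarrow> R h \<Longrightarrow> R (\<lambda>x. g x + h x)"
  shows "all_derivs R (\<lambda>x. r * g x)"
proof -
  let ?C = "\<lambda>h. \<exists>g. all_derivs R g \<and> h = (\<lambda>x. r * g x)"
  have d: "((\<lambda>x. r * g x) has_derivative (\<lambda>h. r * partial_deriv h g x)) (at x)" if "all_derivs R g" for g x
    by (rule has_derivative_mult_right[OF has_derivative_partial_deriv[OF all_derivs_differentiable[OF that]]])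
  have "?C (\<lambda>x. r * g x)" using g by blast
  then show ?thesis
  proof (rule all_derivs_coinduct[where C = ?C], goal_cases)
    case (1 g x) then show ?case using d differentiableI by blast
  next
    case (2 g) then show ?case using cmult all_derivs_self by blast
  next
    case (3 g h) then show ?case by (rule add)
  next
    case (4 h i)
    then obtain g where g: "all_derivs R g" "h = (\<lambda>x. r * g x)" by blast
    have "partial_deriv i h = (\<lambda>x. r * partial_deriv i g x)"
      unfolding g(2) by (rule ext, rule partial_deriv_eq[OF d[OF g(1)]])
    then show ?case using all_derivs_partial[OF g(1) 4(2)] by blast
  qed
qed

text \<open>By the chain rule a derivative of the composition is a linear combination of derivatives
  of \<open>f\<close> composed with the same map. \<open>R\<close> and \<open>R'\<close> may differ
  because a projection destroys decay in the remaining directions; \<open>schwartz_tensor\<close>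
  relies on this.\<close>

lemma all_derivs_compose_affine:
  fixes l :: "'b::euclidean_space \<Rightarrow> 'a::euclidean_space"
  assumes f: "all_derivs R f" and l: "bounded_linear l"
    and comp: "\<And>g. R g \<Longrightarrow> R' (\<lambda>x. g (l x + c))"
    and add: "\<And>g h. R g \<Longrightarrow> R h \<Longrightarrow> R (\<lambda>x. g x + h x)"
    and add': "\<And>g h. R' g \<Longrightarrow> R' h \<Longrightarrow> R' (\<lambda>x. g x + h x)"
    and cmult: "\<And>g r. R g \<Longrightarrow> R (\<lambda>x. r * g x)"
  shows "all_derivs R' (\<lambda>x. f (l x + c))"
proof -
  let ?C = "\<lambda>h. \<exists>f. all_derivs R f \<and> h = (\<lambda>x. f (l x + c))"
  have cm: "all_derivs R (\<lambda>x. r * g x)" if g: "all_derivs R g" for r g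
    by (rule all_derivs_cmult[OF g]) (use cmult add in auto)
  have d: "((\<lambda>x. g (l x + c)) has_derivative (\<lambda>h. partial_deriv (l h) g (l x + c))) (at x)"
    if "all_derivs R g" for g x
    by (rule has_derivative_compose[of "\<lambda>x. l x + c" l x UNIV g, OF _ has_derivative_partial_deriv[OF all_derivs_differentiable[OF that]]])
       (use bounded_linear_imp_has_derivative[OF l] in \<open>auto intro!: derivative_eq_intros\<close>)
  have "?C (\<lambda>x. f (l x + c))" using f by blast
  then show ?thesis
  proof (rule all_derivs_coinduct[where C = ?C], goal_cases)
    case (1 g x) then show ?case using d differentiableI by blast
  next
    case (2 g) then show ?case using comp all_derivs_self by blast
  next
    case (3 g h) then show ?case by (rule add')
  next
    case (4 h i)
    then obtain g where g: "all_derivs R g" "h = (\<lambda>x. g (l x + c))" by blast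
    have "partial_deriv i h = (\<lambda>x. (\<Sum>b\<in>Basis. complex_of_real (l i \<bullet> b) * partial_deriv b g (l x + c)))"
      unfolding g(2) by (rule ext, subst partial_deriv_eq[OF d[OF g(1)]])
       (rule partial_deriv_expand[OF all_derivs_differentiable[OF g(1)]])
    moreover have "all_derivs R (\<lambda>y. \<Sum>b\<in>Basis. complex_of_real (l i \<bullet> b) * partial_deriv b g y)"
      \<comment> \<open>\<open>cm[of f 0]\<close> supplies the zero function, the value of the empty
        sum.\<close>
      using cm[of f 0] f by (intro all_derivs_sum cm all_derivs_partial g add) auto
    ultimately show ?case by blast
  qed
qed

lemma rapid_cmult: "rapid g \<Longrightarrow> rapid (\<lambda>x. r * g x)"
  using rapid_mult_slow[of g "\<lambda>_. r"] by (force simp: slow_def mult.commute intro: exI[of _ 0])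

lemma slow_cmult: "slow g \<Longrightarrow> slow (\<lambda>x. r * g x)"
  by (rule slow_mult) (force simp: slow_def intro: exI[of _ 0])

text \<open>Hypothesis \<open>K\<close> says that the affine map is bounded below, so decay along
  the image is decay along the argument. Shifts, reflections, the swap, slices and dilations are all
  instances.\<close>

lemma schwartz_compose_affine:
  fixes l :: "'b::euclidean_space \<Rightarrow> 'a::euclidean_space"
  assumes "schwartz f" "bounded_linear l" and K: "\<And>x. 1 + norm x \<le> K * (1 + norm (l x + c))"
  shows "schwartz (\<lambda>x. f (l x + c))"
  unfolding schwartz_iff
proof (rule all_derivs_compose_affine[where R = rapid, OF _ assms(2)])
  show "all_derivs rapid f" using assms(1) by (simp add: schwartz_iff)
  fix g :: "'a \<Rightarrow> complex" assume g: "rapid g"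
  show "rapid (\<lambda>x. g (l x + c))" unfolding rapid_def
  proof
    fix k
    obtain B where B: "\<And>x. (1 + norm x) ^ k * cmod (g x) \<le> B" using g unfolding rapid_def by blast
    have Kp: "K \<ge> 0"
    proof (rule ccontr)
      assume "\<not> K \<ge> 0"
      then have "K * (1 + norm (l 0 + c)) < 0" by (intro mult_neg_pos) (auto intro: add_pos_nonneg)
      with K[of 0] show False by simp
    qed
    have "(1 + norm x) ^ k * cmod (g (l x + c)) \<le> K ^ k * B" for x
    proof -
      have "(1 + norm x) ^ k * cmod (g (l x + c)) \<le> (K * (1 + norm (l x + c))) ^ k * cmod (g (l x + c))"
        using K by (intro mult_right_mono power_mono) auto
      also have "\<dots> = K ^ k * ((1 + norm (l x + c)) ^ k * cmod (g (l x + c)))" by (simp add: power_mult_distrib)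
      also have "\<dots> \<le> K ^ k * B" using Kp B by (intro mult_left_mono) auto
      finally show ?thesis .
    qed
    then show "\<exists>B. \<forall>x. (1 + norm x) ^ k * cmod (g (l x + c)) \<le> B" by blast
  qed
qed (auto intro: rapid_add rapid_cmult)

lemma moderate_compose_linear:
  fixes l :: "'b::euclidean_space \<Rightarrow> 'a::euclidean_space"
  assumes "moderate f" "bounded_linear l"
  shows "moderate (\<lambda>x. f (l x))"
proof -
  obtain K where K: "K > 0" "\<And>x. norm (l x) \<le> norm x * K"
    using bounded_linear.pos_bounded[OF assms(2)] by blast
  have "moderate (\<lambda>x. f (l x + 0))"
  proof (rule all_derivs_compose_affine[where R = slow, OF assms])
    fix g :: "'a \<Rightarrow> complex" assume "slow g"
    then obtain k B where B: "B \<ge> 0" "\<And>x. cmod (g x) \<le> B * (1 + norm x) ^ k" using slowE by metis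
    have "cmod (g (l x + 0)) \<le> (B * (1 + K) ^ k) * (1 + norm x) ^ k" for x
    proof -
      have "1 + norm (l x) \<le> (1 + K) * (1 + norm x)"
        using K(2)[of x] K(1) norm_ge_zero[of x] by (simp add: algebra_simps del: norm_ge_zero)
      then have "(1 + norm (l x)) ^ k \<le> ((1 + K) * (1 + norm x)) ^ k" by (intro power_mono) auto
      then have "B * (1 + norm (l x)) ^ k \<le> B * ((1 + K) * (1 + norm x)) ^ k"
        using B by (intro mult_left_mono) auto
      then show ?thesis using B(2)[of "l x"] by (simp add: power_mult_distrib mult.assoc)
    qed
    then show "slow (\<lambda>x. g (l x + 0))" unfolding slow_def by blast
  qed (auto intro: slow_add slow_cmult)
  then show ?thesis by simp
qed

lemma schwartz_uminus: "schwartz f \<Longrightarrow> schwartz (\<lambda>x. f (- x))"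
  using schwartz_compose_affine[of f uminus 1 0] by (simp add: bounded_linear_minus bounded_linear_ident)

lemma schwartz_shift: "schwartz f \<Longrightarrow> schwartz (\<lambda>x. f (x + c))"
proof (rule schwartz_compose_affine[of f "\<lambda>x. x" "1 + norm c"])
  fix x
  have "1 + norm x \<le> 1 + norm (x + c) + norm c"
    using norm_triangle_ineq4[of "x + c" c] by simp
  also have "\<dots> \<le> (1 + norm c) * (1 + norm (x + c))" by (simp add: algebra_simps)
  finally show "1 + norm x \<le> (1 + norm c) * (1 + norm (x + c))" .
qed (auto simp: bounded_linear_ident)

lemma schwartz_swap:
  fixes f :: "real \<times> real \<Rightarrow> complex" shows "schwartz f \<Longrightarrow> schwartz (\<lambda>(x, t). f (t, x))"
  using schwartz_compose_affine[of f "\<lambda>p. (snd p, fst p)" 1 0]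
  by (simp add: bounded_linear_Pair bounded_linear_fst bounded_linear_snd norm_Pair case_prod_beta' norm_prod_def add.commute)

lemma schwartz_reflect_fst:
  fixes f :: "real \<times> real \<Rightarrow> complex" shows "schwartz f \<Longrightarrow> schwartz (\<lambda>(x, t). f (- x, t))"
  using schwartz_compose_affine[of f "\<lambda>p. (- fst p, snd p)" 1 0]
  by (simp add: bounded_linear_Pair bounded_linear_fst bounded_linear_snd bounded_linear_minus norm_Pair case_prod_beta' norm_prod_def)

lemma schwartz_slice:
  fixes f :: "real \<times> real \<Rightarrow> complex" shows "schwartz f \<Longrightarrow> schwartz (\<lambda>x. f (x, t))"
  using schwartz_compose_affine[of f "\<lambda>x. (x, 0)" 1 "(0, t)"]
  by (simp add: bounded_linear_Pair bounded_linear_ident bounded_linear_zero norm_Pair real_le_rsqrt)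

lemma one_plus_norm_pair: "1 + norm (a, b) \<le> (1 + \<bar>a\<bar>) * (1 + \<bar>b\<bar>)" for a b :: real
proof -
  have "(1 + \<bar>a\<bar>) * (1 + \<bar>b\<bar>) = 1 + (\<bar>a\<bar> + \<bar>b\<bar>) + \<bar>a\<bar> * \<bar>b\<bar>" by (simp add: algebra_simps)
  moreover have "norm (a, b) \<le> \<bar>a\<bar> + \<bar>b\<bar>" using norm_Pair_le[of a b] by simp
  moreover have "0 \<le> \<bar>a\<bar> * \<bar>b\<bar>" by simp
  ultimately show ?thesis by linarith
qed

text \<open>\<open>f (fst p)\<close> and \<open>g (snd p)\<close> are not Schwartz functions on the
  plane, since each decays in one variable only. The predicate \<open>?R\<close> records decay along
  a single linear form, and \<open>1 + norm p <= (1 + |x|) * (1 + |t|)\<close> combines the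
  two.\<close>

lemma schwartz_tensor:
  fixes f g :: "real \<Rightarrow> complex"
  assumes "schwartz f" "schwartz g" shows "schwartz (\<lambda>(x, t). f x * g t)"
proof -
  let ?R = "\<lambda>l h. \<forall>k::nat. \<exists>B. \<forall>x::real \<times> real. (1 + \<bar>l x\<bar>) ^ k * cmod (h x) \<le> B"
  have add: "?R l (\<lambda>x. g x + h x)" if g: "?R l g" and h: "?R l h" for l g h
  proof
    fix k
    from g h obtain B C where B: "\<And>x. (1 + \<bar>l x\<bar>) ^ k * cmod (g x) \<le> B"
      and C: "\<And>x. (1 + \<bar>l x\<bar>) ^ k * cmod (h x) \<le> C" by metis
    have "(1 + \<bar>l x\<bar>) ^ k * cmod (g x + h x) \<le> B + C" for x
      by (rule order_trans[OF mult_left_mono[OF norm_triangle_ineq]])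
         (use add_mono[OF B[of x] C[of x]] in \<open>auto simp: distrib_left\<close>)
    then show "\<exists>B. \<forall>x. (1 + \<bar>l x\<bar>) ^ k * cmod (g x + h x) \<le> B" by blast
  qed
  have comp: "all_derivs (?R l) (\<lambda>x. f (l x))" if "schwartz f" "bounded_linear l"
    for f :: "real \<Rightarrow> complex" and l
  proof -
    have "all_derivs (?R l) (\<lambda>x. f (l x + 0))"
    proof (rule all_derivs_compose_affine[where R = rapid])
      show "all_derivs rapid f" using that by (simp add: schwartz_iff)
      show "?R l (\<lambda>x. g (l x + 0))" if "rapid g" for g :: "real \<Rightarrow> complex"
      proof
        fix k
        have "\<exists>B. \<forall>x. (1 + norm x) ^ k * cmod (g x) \<le> B" using that unfolding rapid_def by blast
        then obtain B where "\<And>x. (1 + norm x) ^ k * cmod (g x) \<le> B" by blast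
        then have "\<forall>x. (1 + \<bar>l x\<bar>) ^ k * cmod (g (l x + 0)) \<le> B" by simp
        then show "\<exists>B. \<forall>x. (1 + \<bar>l x\<bar>) ^ k * cmod (g (l x + 0)) \<le> B" by blast
      qed
    qed (use add that in \<open>auto intro: rapid_add rapid_cmult\<close>)
    then show ?thesis by simp
  qed
  have "all_derivs rapid (\<lambda>p::real \<times> real. f (fst p) * g (snd p))"
  proof (rule all_derivs_mult[OF comp[OF assms(1) bounded_linear_fst] comp[OF assms(2) bounded_linear_snd]])
    fix g h :: "real \<times> real \<Rightarrow> complex" assume g: "?R fst g" and h: "?R snd h"
    show "rapid (\<lambda>x. g x * h x)" unfolding rapid_def
    proof
      fix k
      from g h obtain B C where B: "\<And>x. (1 + \<bar>fst x\<bar>) ^ k * cmod (g x) \<le> B"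
        and C: "\<And>x. (1 + \<bar>snd x\<bar>) ^ k * cmod (h x) \<le> C" by metis
      have "(1 + norm x) ^ k * cmod (g x * h x) \<le> B * C" for x
      proof -
        have "1 + norm x \<le> (1 + \<bar>fst x\<bar>) * (1 + \<bar>snd x\<bar>)"
          using one_plus_norm_pair[of "fst x" "snd x"] by simp
        then have "(1 + norm x) ^ k * cmod (g x * h x) \<le> ((1 + \<bar>fst x\<bar>) * (1 + \<bar>snd x\<bar>)) ^ k * cmod (g x * h x)"
          by (intro mult_right_mono power_mono) auto
        also have "\<dots> = ((1 + \<bar>fst x\<bar>) ^ k * cmod (g x)) * ((1 + \<bar>snd x\<bar>) ^ k * cmod (h x))"
          by (simp add: norm_mult power_mult_distrib)
        also have "\<dots> \<le> B * C" using B C order_trans[OF _ B[of 0]] by (intro mult_mono) auto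
        finally show ?thesis .
      qed
      then show "\<exists>B. \<forall>x. (1 + norm x) ^ k * cmod (g x * h x) \<le> B" by blast
    qed
  qed (rule rapid_add)
  then show ?thesis by (simp add: schwartz_iff case_prod_beta')
qed

text \<open>Smooth functions vanishing for \<open>|t| > 2\<close> are stable under derivatives
  because that set is open; rapid decay is then boundedness on a compact interval.\<close>

lemma schwartz_cutoff:
  assumes "cutoff \<eta>" shows "schwartz (\<lambda>t. complex_of_real (\<eta> t))"
proof -
  let ?C = "\<lambda>h. \<exists>g::real \<Rightarrow> real. smooth g \<and> (\<forall>t. \<bar>t\<bar> > 2 \<longrightarrow> g t = 0) \<and> h = (\<lambda>t. complex_of_real (g t))"
  have sd: "(g has_derivative (\<lambda>h. partial_deriv h g t)) (at t)" if "smooth g" for g :: "real \<Rightarrow> real" and t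
    by (rule has_derivative_partial_deriv)
       (use that[unfolded smooth_def, rule_format, of "[]"] in auto)
  have sp: "smooth (partial_deriv 1 g)" if "smooth g" for g :: "real \<Rightarrow> real"
    unfolding smooth_def
  proof (intro ballI allI)
    fix js :: "real list" and x assume "js \<in> lists Basis"
    then have "js @ [1] \<in> lists Basis" by auto
    from that[unfolded smooth_def, rule_format, OF this, of x]
    show "foldr partial_deriv js (partial_deriv 1 g) differentiable (at x)" by simp
  qed
  have d: "((\<lambda>t. complex_of_real (g t)) has_derivative (\<lambda>h. complex_of_real (partial_deriv h g t))) (at t)"
    if "smooth g" for g :: "real \<Rightarrow> real" and t
    by (rule bounded_linear.has_derivative[OF bounded_linear_of_real sd[OF that]])
  have "?C (\<lambda>t. complex_of_real (\<eta> t))" using assms unfolding cutoff_def by blast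
  then have "all_derivs rapid (\<lambda>t. complex_of_real (\<eta> t))"
  proof (rule all_derivs_coinduct[where C = ?C], goal_cases)
    case (1 g x) then show ?case using d differentiableI by blast
  next
    case (2 h)
    then obtain g where g: "smooth g" "\<And>t. \<bar>t\<bar> > 2 \<Longrightarrow> g t = 0" "h = (\<lambda>t. complex_of_real (g t))" by blast
    have "continuous_on {-2..2} g"
      by (intro continuous_at_imp_continuous_on ballI has_derivative_continuous[OF sd[OF g(1)]])
    then have "bounded (g ` {-2..2})"
      by (intro compact_imp_bounded compact_continuous_image) auto
    then obtain B where "\<forall>t\<in>{-2..2}. \<bar>g t\<bar> \<le> B" unfolding bounded_iff by auto
    then have B: "\<bar>g t\<bar> \<le> B" if "\<bar>t\<bar> \<le> 2" for t using that by (auto simp: abs_le_iff)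
    have B0: "B \<ge> 0" using B[of 0] by simp
    \<comment> \<open>On the support \<open>1 + |t| <= 3\<close>.\<close>
    have "(1 + norm t) ^ k * cmod (h t) \<le> 3 ^ k * B" for k t
    proof (cases "\<bar>t\<bar> \<le> 2")
      case True
      then show ?thesis using B[OF True] unfolding g(3)
        by (intro mult_mono power_mono) auto
    qed (use g B0 in auto)
    then show ?case unfolding rapid_def by blast
  next
    case (3 g h) then show ?case by (rule rapid_add)
  next
    case (4 h i)
    then have i: "i = 1" by simp
    from 4 obtain g where g: "smooth g" "\<And>t. \<bar>t\<bar> > 2 \<Longrightarrow> g t = 0" "h = (\<lambda>t. complex_of_real (g t))" by blast
    have "partial_deriv 1 g t = 0" if "\<bar>t\<bar> > 2" for t
    proof -
      have "open {t::real. \<bar>t\<bar> > 2}" by (intro open_Collect_less continuous_intros)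
      from has_derivative_transform_within_open[OF has_derivative_const[of 0] this, of t g UNIV]
      have "(g has_derivative (\<lambda>h. 0)) (at t)" using that g(2) by auto
      then show ?thesis by (rule partial_deriv_eq)
    qed
    moreover have "partial_deriv i h = (\<lambda>t. complex_of_real (partial_deriv 1 g t))"
      unfolding g(3) i by (rule ext) (rule partial_deriv_eq[OF d[OF g(1)]])
    ultimately show ?case using sp[OF g(1)] by blast
  qed
  then show ?thesis by (simp add: schwartz_iff)
qed

lemma schwartz_dilate:
  fixes f :: "real \<Rightarrow> complex"
  assumes "schwartz f" "T > 0" shows "schwartz (\<lambda>t. f (t / T))"
proof -
  have "schwartz (\<lambda>t. f (t / T + 0))"
  proof (rule schwartz_compose_affine[where K = "1 + T"])
    show "bounded_linear (\<lambda>t. t / T)" by (rule bounded_linear_divide)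
    show "1 + norm x \<le> (1 + T) * (1 + norm (x / T + 0))" for x
      using assms(2) by (simp add: field_simps)
  qed (rule assms)
  then show ?thesis by simp
qed

subsection \<open>The partial Fourier transform in the first variable\<close>

lemma Basis_real_pair: "Basis = {(1, 0), (0, 1::real)::real \<times> real}"
  unfolding Basis_prod_def by auto

lemma partial_deriv_pair:
  fixes f :: "real \<times> real \<Rightarrow> complex"
  assumes "f differentiable (at p)"
  shows "partial_deriv (a, b) f p = complex_of_real a * partial_deriv (1, 0) f p + complex_of_real b * partial_deriv (0, 1) f p"
  by (subst partial_deriv_expand[OF assms]) (simp add: Basis_real_pair)

lemma rapid_pair_bound:
  fixes f :: "real \<times> real \<Rightarrow> complex"
  assumes "rapid f"
  obtains B where "B \<ge> 0" "\<And>x t. cmod (f (x, t)) \<le> B * (1 / (1 + x\<^sup>2)) * (1 / (1 + t\<^sup>2))"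
proof -
  obtain B where B: "B \<ge> 0" "\<And>x. cmod (f x) \<le> B * cauchy_weight x" using rapid_cauchy_weight[OF assms] by metis
  have "cauchy_weight (x, t) = 1 / (1 + x\<^sup>2) * (1 / (1 + t\<^sup>2))" for x t :: real
    by (simp add: cauchy_weight_def Basis_real_pair)
  then show ?thesis using that B by (metis mult.assoc)
qed

lemma rapid_pair_bound_fst:
  fixes f :: "real \<times> real \<Rightarrow> complex"
  assumes "rapid f"
  obtains B where "B \<ge> 0" "\<And>x t. cmod (f (x, t)) \<le> B * (1 / (1 + x\<^sup>2))"
proof -
  obtain B where B: "B \<ge> 0" "\<And>x t. cmod (f (x, t)) \<le> B * (1 / (1 + x\<^sup>2)) * (1 / (1 + t\<^sup>2))"
    using rapid_pair_bound[OF assms] by metis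
  have "cmod (f (x, t)) \<le> B * (1 / (1 + x\<^sup>2))" for x t
  proof -
    have "B * (1 / (1 + x\<^sup>2)) * (1 / (1 + t\<^sup>2)) \<le> B * (1 / (1 + x\<^sup>2)) * 1"
      using B(1) by (intro mult_left_mono) (auto simp: divide_le_eq_1 add_pos_nonneg)
    then show ?thesis using B(2)[of x t] by simp
  qed
  then show ?thesis using that B by blast
qed

text \<open>Formulated on pairs and not slice by slice, so that joint smoothness in frequency and
  time can be expressed.\<close>

definition pfourier :: "(real \<times> real \<Rightarrow> complex) \<Rightarrow> real \<times> real \<Rightarrow> complex" where
  "pfourier f p = (LINT x|lborel. exp (- (\<i> * complex_of_real (x * fst p))) * f (x, snd p))"

lemma pfourier_has_derivative:
  assumes f: "schwartz f"
  shows "(pfourier f has_derivative (\<lambda>h. LINT x|lborel. exp (- (\<i> * complex_of_real (x * fst p))) *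
     (- (\<i> * complex_of_real (x * fst h)) * f (x, snd p) + complex_of_real (snd h) * partial_deriv (0, 1) f (x, snd p)))) (at p)"
proof -
  have fm[measurable]: "f \<in> borel_measurable borel" using f by (rule schwartz_measurable)
  have pd: "schwartz (partial_deriv (0, 1) f)" using f by (rule schwartz_partial) (simp add: Basis_real_pair)
  then have [measurable]: "partial_deriv (0, 1) f \<in> borel_measurable borel" by (rule schwartz_measurable)
  have slice: "((\<lambda>q. f (x, snd q)) has_derivative (\<lambda>h. complex_of_real (snd h) * partial_deriv (0, 1) f (x, snd p))) (at p)"
    for x and p :: "real \<times> real"
  proof -
    have "((\<lambda>q. (x, snd q)) has_derivative (\<lambda>h. (0, snd h))) (at p)"
      by (auto intro!: derivative_eq_intros)
    from has_derivative_compose[OF this has_derivative_partial_deriv[OF schwartz_differentiable[OF f]]]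
    have "((\<lambda>q. f (x, snd q)) has_derivative (\<lambda>h. partial_deriv (0, snd h) f (x, snd p))) (at p)" .
    then show ?thesis
      by (rule has_derivative_eq_rhs) (rule ext, subst partial_deriv_pair[OF schwartz_differentiable[OF f]], simp)
  qed
  have sxf: "schwartz (\<lambda>q. f q * complex_of_real (q \<bullet> (1, 0)))"
    by (rule schwartz_mult_moderate[OF f moderate_inner])
  obtain B1 where B1: "B1 \<ge> 0" "\<And>x t. cmod (f (x, t) * complex_of_real ((x, t) \<bullet> (1, 0))) \<le> B1 * (1 / (1 + x\<^sup>2))"
    using rapid_pair_bound_fst[OF schwartz_rapid[OF sxf]] by metis
  obtain B2 where B2: "B2 \<ge> 0" "\<And>x t. cmod (partial_deriv (0, 1) f (x, t)) \<le> B2 * (1 / (1 + x\<^sup>2))"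
    using rapid_pair_bound_fst[OF schwartz_rapid[OF pd]] by metis
  have "((\<lambda>p. LINT x|lborel. exp (- (\<i> * complex_of_real (x * fst p))) * f (x, snd p)) has_derivative
     (\<lambda>h. LINT x|lborel. exp (- (\<i> * complex_of_real (x * fst p))) *
     (- (\<i> * complex_of_real (x * fst h)) * f (x, snd p) + complex_of_real (snd h) * partial_deriv (0, 1) f (x, snd p)))) (at p)"
  proof (rule has_derivative_integral[where B = "\<lambda>x. (B1 + B2) * (1 / (1 + x\<^sup>2))"])
    show "integrable lborel (\<lambda>x. exp (- (\<i> * complex_of_real (x * fst p))) * f (x, snd p))" for p
      by (intro integrable_cis_mult schwartz_integrable schwartz_slice f) measurable
    show "integrable lborel (\<lambda>x. (B1 + B2) * (1 / (1 + x\<^sup>2)))"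
      by (intro integrable_mult_right integrable_cauchy_real)
    show "((\<lambda>p. exp (- (\<i> * complex_of_real (x * fst p))) * f (x, snd p)) has_derivative
      (\<lambda>h. exp (- (\<i> * complex_of_real (x * fst p))) *
     (- (\<i> * complex_of_real (x * fst h)) * f (x, snd p) + complex_of_real (snd h) * partial_deriv (0, 1) f (x, snd p)))) (at p)" for x p
    proof -
      have "((\<lambda>p::real \<times> real. exp (- (\<i> * complex_of_real (x * fst p)))) has_derivative
        (\<lambda>h. - (\<i> * complex_of_real (x * fst h)) * exp (- (\<i> * complex_of_real (x * fst p))))) (at p)"
        using has_derivative_cis_inner[of "(x, 0::real)" p] by (simp add: inner_prod_def)
      from has_derivative_mult[OF this slice[of x p]] show ?thesis
        by (rule has_derivative_eq_rhs) (simp add: algebra_simps fun_eq_iff)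
    qed
    show "cmod (exp (- (\<i> * complex_of_real (x * fst p))) *
     (- (\<i> * complex_of_real (x * fst h)) * f (x, snd p) + complex_of_real (snd h) * partial_deriv (0, 1) f (x, snd p)))
      \<le> (B1 + B2) * (1 / (1 + x\<^sup>2)) * norm h" for x p h
    proof -
      have h: "\<bar>fst h\<bar> \<le> norm h" "\<bar>snd h\<bar> \<le> norm h"
        using norm_fst_le[of "fst h" "snd h"] norm_snd_le[of "snd h" "fst h"] by auto
      have "cmod (- (\<i> * complex_of_real (x * fst h)) * f (x, snd p) + complex_of_real (snd h) * partial_deriv (0, 1) f (x, snd p))
        \<le> cmod (f (x, snd p) * complex_of_real x) * \<bar>fst h\<bar> + cmod (partial_deriv (0, 1) f (x, snd p)) * \<bar>snd h\<bar>"
        by (rule order_trans[OF norm_triangle_ineq]) (simp add: norm_mult abs_mult mult_ac)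
      also have "\<dots> \<le> B1 * (1 / (1 + x\<^sup>2)) * norm h + B2 * (1 / (1 + x\<^sup>2)) * norm h"
        using B1 B2 h by (intro add_mono mult_mono) auto
      finally show ?thesis unfolding norm_mult[of "exp _"] norm_cis_minus mult_1 distrib_right .
    qed
  qed measurable
  then show ?thesis unfolding pfourier_def[abs_def] .
qed

lemma partial_deriv_pfourier_snd:
  assumes "schwartz f"
  shows "partial_deriv (0, 1) (pfourier f) = pfourier (partial_deriv (0, 1) f)"
  by (rule ext, subst partial_deriv_eq[OF pfourier_has_derivative[OF assms]])
     (simp add: pfourier_def)

lemma partial_deriv_pfourier_fst:
  assumes "schwartz f"
  shows "partial_deriv (1, 0) (pfourier f) = pfourier (\<lambda>q. - \<i> * (f q * complex_of_real (q \<bullet> (1, 0))))"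
  by (rule ext, subst partial_deriv_eq[OF pfourier_has_derivative[OF assms]])
     (simp add: pfourier_def mult_ac)

lemma pfourier_fourier_int: "pfourier f (\<xi>, t) = fourier_int (\<lambda>x. f (x, t)) \<xi>"
  by (simp add: pfourier_def fourier_int_def)

lemma partial_deriv_slice:
  assumes "schwartz (f :: real \<times> real \<Rightarrow> complex)"
  shows "partial_deriv 1 (\<lambda>x. f (x, t)) = (\<lambda>x. partial_deriv (1, 0) f (x, t))"
proof
  fix x :: real
  have "((\<lambda>x. (x, t)) has_derivative (\<lambda>h. (h, 0))) (at x)" by (auto intro!: derivative_eq_intros)
  from has_derivative_compose[OF this has_derivative_partial_deriv[OF schwartz_differentiable[OF assms]]]
  show "partial_deriv 1 (\<lambda>x. f (x, t)) x = partial_deriv (1, 0) f (x, t)" by (rule partial_deriv_eq)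
qed

lemma pfourier_partial_deriv_fst:
  assumes "schwartz f"
  shows "pfourier (partial_deriv (1, 0) f) (\<xi>, t) = \<i> * complex_of_real \<xi> * pfourier f (\<xi>, t)"
  using fourier_int_partial_deriv[OF schwartz_slice[OF assms], of 1 t \<xi>]
  by (simp add: pfourier_fourier_int partial_deriv_slice[OF assms])

text \<open>Decay in frequency comes from derivatives in \<open>x\<close>; decay in time comes from
  the factor \<open>t\<close>, which commutes with a transform in \<open>x\<close>.\<close>

lemma rapid_pfourier:
  assumes "schwartz f" shows "rapid (pfourier f)"
proof -
  have "\<exists>B. \<forall>p. norm p ^ k * cmod (pfourier f p) \<le> B" for k
    using assms
  proof (induction k arbitrary: f)
    case 0
    obtain B where B: "B \<ge> 0" "\<And>x t. cmod (f (x, t)) \<le> B * (1 / (1 + x\<^sup>2))"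
      using rapid_pair_bound_fst[OF schwartz_rapid[OF 0]] by metis
    have "cmod (pfourier f p) \<le> (LINT x|lborel. B * (1 / (1 + x\<^sup>2)))" for p
    proof -
      have "cmod (pfourier f p) \<le> (LINT x|lborel. cmod (exp (- (\<i> * complex_of_real (x * fst p))) * f (x, snd p)))"
        unfolding pfourier_def by (rule integral_norm_bound)
      also have "\<dots> \<le> (LINT x|lborel. B * (1 / (1 + x\<^sup>2)))"
        using B by (intro integral_mono integrable_norm integrable_cis_mult schwartz_integrable schwartz_slice 0
          integrable_mult_right integrable_cauchy_real) (auto simp: norm_mult)
      finally show ?thesis .
    qed
    then show ?case by auto
  next
    case (Suc k)
    let ?g = "\<lambda>q. f q * complex_of_real (q \<bullet> (0, 1))"
    have "schwartz (partial_deriv (1, 0) f)" "schwartz ?g"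
      using Suc.prems by (auto intro!: schwartz_partial schwartz_mult_moderate moderate_inner simp: Basis_real_pair)
    then obtain B C where B: "\<And>p. norm p ^ k * cmod (pfourier (partial_deriv (1, 0) f) p) \<le> B"
      and C: "\<And>p. norm p ^ k * cmod (pfourier ?g p) \<le> C" using Suc.IH by metis
    have "norm p ^ Suc k * cmod (pfourier f p) \<le> B + C" for p
    proof -
      obtain \<xi> t where p: "p = (\<xi>, t)" by force
      have "pfourier ?g p = complex_of_real t * pfourier f p"
        unfolding pfourier_def p by (simp add: mult_ac integral_mult_right_zero[symmetric] del: integral_mult_right_zero)
      then have 1: "\<bar>t\<bar> * cmod (pfourier f p) = cmod (pfourier ?g p)" by (simp add: norm_mult)
      have 2: "\<bar>\<xi>\<bar> * cmod (pfourier f p) = cmod (pfourier (partial_deriv (1, 0) f) p)"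
        using pfourier_partial_deriv_fst[OF Suc.prems, of \<xi> t] by (simp add: p norm_mult)
      have "norm p ^ Suc k * cmod (pfourier f p) = norm p * (norm p ^ k * cmod (pfourier f p))" by simp
      also have "\<dots> \<le> (\<bar>\<xi>\<bar> + \<bar>t\<bar>) * (norm p ^ k * cmod (pfourier f p))"
        using norm_Pair_le[of \<xi> t] by (intro mult_right_mono) (auto simp: p)
      also have "\<dots> = norm p ^ k * (\<bar>\<xi>\<bar> * cmod (pfourier f p)) + norm p ^ k * (\<bar>t\<bar> * cmod (pfourier f p))"
        by (simp add: algebra_simps)
      finally have "norm p ^ Suc k * cmod (pfourier f p) \<le>
         norm p ^ k * cmod (pfourier (partial_deriv (1, 0) f) p) + norm p ^ k * cmod (pfourier ?g p)"
        unfolding 1 2 .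
      then show ?thesis using B[of p] C[of p] by linarith
    qed
    then show ?case by blast
  qed
  then show ?thesis unfolding rapid_iff_bounded bounded_iff by simp
qed

lemma schwartz_pfourier:
  assumes "schwartz f" shows "schwartz (pfourier f)"
proof -
  let ?C = "\<lambda>g. \<exists>f. schwartz f \<and> g = pfourier f"
  have "?C (pfourier f)" using assms by blast
  then have "all_derivs rapid (pfourier f)"
  proof (rule all_derivs_coinduct[where C = ?C], goal_cases)
    case (1 g x) then show ?case using pfourier_has_derivative differentiableI by blast
  next
    case (2 g) then show ?case using rapid_pfourier by blast
  next
    case (3 g h) then show ?case by (rule rapid_add)
  next
    case (4 g i)
    then obtain f where f: "schwartz f" "g = pfourier f" by blast
    have "schwartz (\<lambda>q. - \<i> * (f q * complex_of_real (q \<bullet> (1, 0))))" "schwartz (partial_deriv (0, 1) f)"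
      by (intro schwartz_cmult schwartz_mult_moderate moderate_inner f schwartz_partial)+ (simp add: Basis_real_pair)
    moreover have "i = (1, 0) \<or> i = (0, 1)" using 4(2) by (simp add: Basis_real_pair)
    ultimately show ?case using partial_deriv_pfourier_fst[OF f(1)] partial_deriv_pfourier_snd[OF f(1)] f(2) by metis
  qed
  then show ?thesis by (simp only: schwartz_iff)
qed

subsection \<open>Averages in the time variable\<close>

text \<open>Substituting \<open>t' = r * t\<close> turns an integral over \<open>0..t\<close> into
  \<open>t\<close> times such an average with \<open>j = 0\<close>. The domain no longer depends on
  \<open>t\<close>, so both signs of \<open>t\<close> are treated alike and smoothness in
  \<open>t\<close> is visible; each time derivative raises \<open>j\<close> by one.\<close>

definition time_average :: "nat \<Rightarrow> (real \<times> real \<Rightarrow> complex) \<Rightarrow> real \<times> real \<Rightarrow> complex" where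
  "time_average j g p = (LINT r|lborel. indicator {0<..<1} r *\<^sub>R (complex_of_real (r ^ j) * g (fst p, r * snd p)))"

lemma integrable_unit_interval:
  fixes f :: "real \<Rightarrow> complex"
  assumes "\<And>r. r \<in> {0<..<1} \<Longrightarrow> cmod (f r) \<le> B" "f \<in> borel_measurable borel"
  shows "integrable lborel (\<lambda>r. indicator {0<..<1} r *\<^sub>R f r)"
proof (rule Bochner_Integration.integrable_bound[of _ "\<lambda>r. indicator {0<..<1} r * B"])
  show "integrable lborel (\<lambda>r. indicator {0<..<1::real} r * B)" by (intro integrable_mult_left integrable_real_indicator) auto
  have "B \<ge> 0" using order_trans[OF norm_ge_zero assms(1)[of "1/2"]] by simp
  then show "AE r in lborel. norm (indicator {0<..<1} r *\<^sub>R f r) \<le> norm (indicator {0<..<1} r * B)"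
    using assms(1) by (auto simp: indicator_def)
qed (use assms in measurable)

lemma time_average_has_derivative:
  assumes g: "schwartz g"
  shows "(time_average j g has_derivative (\<lambda>h. LINT r|lborel. indicator {0<..<1} r *\<^sub>R (complex_of_real (r ^ j) *
     (complex_of_real (fst h) * partial_deriv (1, 0) g (fst p, r * snd p) +
      complex_of_real (r * snd h) * partial_deriv (0, 1) g (fst p, r * snd p))))) (at p)"
proof -
  have pd: "schwartz (partial_deriv (0, 1) g)" "schwartz (partial_deriv (1, 0) g)"
    using g by (auto intro: schwartz_partial simp: Basis_real_pair)
  have [measurable]: "g \<in> borel_measurable borel" "partial_deriv (0, 1) g \<in> borel_measurable borel"
    "partial_deriv (1, 0) g \<in> borel_measurable borel"
    using pd g by (auto dest: schwartz_measurable)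
  obtain B where B: "\<And>x. cmod (g x) \<le> B" using schwartz_bounded[OF g] by blast
  obtain B1 where B1: "\<And>x. cmod (partial_deriv (1, 0) g x) \<le> B1" using schwartz_bounded[OF pd(2)] by blast
  obtain B2 where B2: "\<And>x. cmod (partial_deriv (0, 1) g x) \<le> B2" using schwartz_bounded[OF pd(1)] by blast
  have nn: "B \<ge> 0" "B1 \<ge> 0" "B2 \<ge> 0" using B B1 B2 norm_ge_zero order_trans by blast+
  have pw: "\<bar>r ^ j\<bar> \<le> 1" if "r \<in> {0<..<1}" for r :: real using that by (auto simp: power_le_one)
  have "((\<lambda>p. LINT r|lborel. indicator {0<..<1} r *\<^sub>R (complex_of_real (r ^ j) * g (fst p, r * snd p)))
    has_derivative (\<lambda>h. LINT r|lborel. indicator {0<..<1} r *\<^sub>R (complex_of_real (r ^ j) *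
     (complex_of_real (fst h) * partial_deriv (1, 0) g (fst p, r * snd p) +
      complex_of_real (r * snd h) * partial_deriv (0, 1) g (fst p, r * snd p))))) (at p)"
  proof (rule has_derivative_integral[where B = "\<lambda>r. indicator {0<..<1} r * (B1 + B2)"])
    show "integrable lborel (\<lambda>r. indicator {0<..<1} r *\<^sub>R (complex_of_real (r ^ j) * g (fst p, r * snd p)))" for p
    proof (rule integrable_unit_interval[where B = B])
      show "cmod (complex_of_real (r ^ j) * g (fst p, r * snd p)) \<le> B" if "r \<in> {0<..<1}" for r
        using pw[OF that] B[of "(fst p, r * snd p)"] nn
          mult_mono[of "\<bar>r ^ j\<bar>" 1 "cmod (g (fst p, r * snd p))" B]
        by (simp only: norm_mult norm_of_real) simp
    qed measurable
    show "integrable lborel (\<lambda>r. indicator {0<..<1::real} r * (B1 + B2))"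
      by (intro integrable_mult_left integrable_real_indicator) auto
    show "((\<lambda>p. indicator {0<..<1} r *\<^sub>R (complex_of_real (r ^ j) * g (fst p, r * snd p))) has_derivative
      (\<lambda>h. indicator {0<..<1} r *\<^sub>R (complex_of_real (r ^ j) *
     (complex_of_real (fst h) * partial_deriv (1, 0) g (fst p, r * snd p) +
      complex_of_real (r * snd h) * partial_deriv (0, 1) g (fst p, r * snd p))))) (at p)" for r p
    proof -
      have "((\<lambda>p. (fst p, r * snd p)) has_derivative (\<lambda>h. (fst h, r * snd h))) (at p)"
        by (auto intro!: derivative_eq_intros)
      from has_derivative_compose[OF this has_derivative_partial_deriv[OF schwartz_differentiable[OF g]]]
      have "((\<lambda>p. g (fst p, r * snd p)) has_derivative (\<lambda>h. partial_deriv (fst h, r * snd h) g (fst p, r * snd p))) (at p)" .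
      then have "((\<lambda>p. g (fst p, r * snd p)) has_derivative (\<lambda>h.
         complex_of_real (fst h) * partial_deriv (1, 0) g (fst p, r * snd p) +
         complex_of_real (r * snd h) * partial_deriv (0, 1) g (fst p, r * snd p))) (at p)"
        by (rule has_derivative_eq_rhs) (rule ext, rule partial_deriv_pair[OF schwartz_differentiable[OF g]])
      then show ?thesis by (intro has_derivative_scaleR_right has_derivative_mult_right)
    qed
    show "cmod (indicator {0<..<1} r *\<^sub>R (complex_of_real (r ^ j) *
     (complex_of_real (fst h) * partial_deriv (1, 0) g (fst p, r * snd p) +
      complex_of_real (r * snd h) * partial_deriv (0, 1) g (fst p, r * snd p)))) \<le> indicator {0<..<1} r * (B1 + B2) * norm h" for r p h
    proof (cases "r \<in> {0<..<1}")
      case True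
      have h: "\<bar>fst h\<bar> \<le> norm h" "\<bar>snd h\<bar> \<le> norm h"
        using norm_fst_le[of "fst h" "snd h"] norm_snd_le[of "snd h" "fst h"] by auto
      have h2: "\<bar>r * snd h\<bar> \<le> norm h"
        using True h(2) mult_mono[of "\<bar>r\<bar>" 1 "\<bar>snd h\<bar>" "norm h"] by (auto simp: abs_mult)
      have "cmod (complex_of_real (fst h) * partial_deriv (1, 0) g (fst p, r * snd p) +
      complex_of_real (r * snd h) * partial_deriv (0, 1) g (fst p, r * snd p)) \<le> norm h * B1 + norm h * B2"
        by (rule order_trans[OF norm_triangle_ineq])
           (use h h2 B1 B2 nn in \<open>auto simp only: norm_mult norm_of_real intro!: add_mono mult_mono\<close>, auto)
      then have "\<bar>r ^ j\<bar> * cmod (complex_of_real (fst h) * partial_deriv (1, 0) g (fst p, r * snd p) +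
      complex_of_real (r * snd h) * partial_deriv (0, 1) g (fst p, r * snd p)) \<le> 1 * (norm h * B1 + norm h * B2)"
        using pw[OF True] by (intro mult_mono) auto
      then show ?thesis using True by (simp only: norm_mult norm_scaleR norm_of_real) (simp add: algebra_simps)
    qed auto
  qed measurable
  then show ?thesis unfolding time_average_def[abs_def] .
qed

lemma partial_deriv_time_average:
  assumes "schwartz g"
  shows "partial_deriv (1, 0) (time_average j g) = time_average j (partial_deriv (1, 0) g)"
    and "partial_deriv (0, 1) (time_average j g) = time_average (Suc j) (partial_deriv (0, 1) g)"
  by (rule ext, subst partial_deriv_eq[OF time_average_has_derivative[OF assms]], simp add: time_average_def mult_ac)+

text \<open>The average alone decays in general only like \<open>1 / |t|\<close>, so a Schwartz
  factor \<open>\<omega>\<close> in time is carried along. Letting \<open>\<omega>\<close>,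
  \<open>j\<close> and \<open>g\<close> all vary makes the class stable under derivatives.\<close>

lemma schwartz_time_average:
  assumes "schwartz \<omega>" "schwartz g"
  shows "schwartz (\<lambda>p. \<omega> (snd p) * time_average j g p)"
proof -
  let ?C = "\<lambda>h. \<exists>\<omega> j g. schwartz \<omega> \<and> schwartz g \<and> h = (\<lambda>p. \<omega> (snd p) * time_average j g p)"
  have d\<omega>: "((\<lambda>p::real \<times> real. \<omega> (snd p)) has_derivative (\<lambda>h. complex_of_real (snd h) * partial_deriv 1 \<omega> (snd p))) (at p)"
    if "schwartz \<omega>" for \<omega> p
  proof -
    have "((\<lambda>p::real \<times> real. \<omega> (snd p)) has_derivative (\<lambda>h. partial_deriv (snd h) \<omega> (snd p))) (at p)"
      by (rule has_derivative_compose[OF _ has_derivative_partial_deriv[OF schwartz_differentiable[OF that]]])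
         (auto intro!: derivative_eq_intros)
    then show ?thesis
      by (rule has_derivative_eq_rhs) (rule ext, subst partial_deriv_expand[OF schwartz_differentiable[OF that]], simp)
  qed
  have "?C (\<lambda>p. \<omega> (snd p) * time_average j g p)" using assms by blast
  then have "all_derivs rapid (\<lambda>p. \<omega> (snd p) * time_average j g p)"
  proof (rule all_derivs_coinduct[where C = ?C], goal_cases)
    case (1 h x)
    then obtain \<omega> j g where h: "schwartz \<omega>" "schwartz g" "h = (\<lambda>p. \<omega> (snd p) * time_average j g p)" by blast
    show ?case unfolding h(3)
      by (rule differentiable_mult[OF differentiableI[OF d\<omega>[OF h(1)]]
            differentiableI[OF time_average_has_derivative[OF h(2)]]])
  next
    case (2 h)
    then obtain \<omega> j g where h: "schwartz \<omega>" "schwartz g" "h = (\<lambda>p. \<omega> (snd p) * time_average j g p)" by blast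
    have [measurable]: "g \<in> borel_measurable borel" by (rule schwartz_measurable[OF h(2)])
    have "\<exists>B. \<forall>p. (1 + norm p) ^ k * cmod (h p) \<le> B" for k
    proof -
      obtain A where A: "\<And>t. (1 + \<bar>t\<bar>) ^ k * cmod (\<omega> t) \<le> A"
        using schwartz_rapid[OF h(1)] unfolding rapid_def by auto
      obtain B where B: "\<And>p. (1 + norm p) ^ k * cmod (g p) \<le> B"
        using schwartz_rapid[OF h(2)] unfolding rapid_def by blast
      have B0: "B \<ge> 0" "A \<ge> 0" using order_trans[OF _ B[of 0]] order_trans[OF _ A[of 0]] by auto
      have "(1 + \<bar>\<xi>\<bar>) ^ k * cmod (time_average j g (\<xi>, t)) \<le> B" for \<xi> t
      proof -
        have le: "cmod (g (\<xi>, s)) \<le> B / (1 + \<bar>\<xi>\<bar>) ^ k" for s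
        proof -
          have "(1 + \<bar>\<xi>\<bar>) ^ k * cmod (g (\<xi>, s)) \<le> (1 + norm (\<xi>, s)) ^ k * cmod (g (\<xi>, s))"
            using norm_fst_le[of \<xi> s] by (intro mult_right_mono power_mono) auto
          then have "(1 + \<bar>\<xi>\<bar>) ^ k * cmod (g (\<xi>, s)) \<le> B" using B order_trans by blast
          then show ?thesis by (subst pos_le_divide_eq) (auto simp: mult.commute intro: zero_less_power add_pos_nonneg)
        qed
        have "cmod (time_average j g (\<xi>, t)) \<le> (LINT r|lborel. cmod (indicator {0<..<1} r *\<^sub>R (complex_of_real (r ^ j) * g (\<xi>, r * t))))"
          unfolding time_average_def by (simp only: fst_conv snd_conv) (rule integral_norm_bound)
        also have "\<dots> \<le> (LINT r|lborel. indicator {0<..<1::real} r * (B / (1 + \<bar>\<xi>\<bar>) ^ k))"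
        proof (rule integral_mono_AE')
          show "integrable lborel (\<lambda>r. indicator {0<..<1::real} r * (B / (1 + \<bar>\<xi>\<bar>) ^ k))"
            by (intro integrable_mult_left integrable_real_indicator) auto
          have "cmod (indicator {0<..<1} r *\<^sub>R (complex_of_real (r ^ j) * g (\<xi>, r * t))) \<le> indicator {0<..<1} r * (B / (1 + \<bar>\<xi>\<bar>) ^ k)" for r
          proof (cases "r \<in> {0<..<1}")
            case True
            then have "\<bar>r ^ j\<bar> * cmod (g (\<xi>, r * t)) \<le> 1 * (B / (1 + \<bar>\<xi>\<bar>) ^ k)"
              using le[of "r * t"] by (intro mult_mono) (auto simp: power_le_one)
            then show ?thesis using True by (simp only: norm_mult norm_scaleR norm_of_real) simp
          qed auto
          then show "AE r in lborel. cmod (indicator {0<..<1} r *\<^sub>R (complex_of_real (r ^ j) * g (\<xi>, r * t))) \<le> indicator {0<..<1} r * (B / (1 + \<bar>\<xi>\<bar>) ^ k)"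
            by auto
          show "AE r in lborel. 0 \<le> indicator {0<..<1::real} r * (B / (1 + \<bar>\<xi>\<bar>) ^ k)" using B0 by simp
        qed
        also have "\<dots> = B / (1 + \<bar>\<xi>\<bar>) ^ k" by simp
        finally show ?thesis
          by (subst (asm) pos_le_divide_eq) (auto simp: mult.commute intro: zero_less_power add_pos_nonneg)
      qed
      note ta = this
      have "(1 + norm p) ^ k * cmod (h p) \<le> A * B" for p
      proof -
        obtain \<xi> t where p: "p = (\<xi>, t)" by force
        have "1 + norm p \<le> (1 + \<bar>t\<bar>) * (1 + \<bar>\<xi>\<bar>)"
          unfolding p using one_plus_norm_pair[of \<xi> t] by (simp add: mult.commute)
        then have "(1 + norm p) ^ k * cmod (h p) \<le> ((1 + \<bar>t\<bar>) * (1 + \<bar>\<xi>\<bar>)) ^ k * cmod (h p)"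
          by (intro mult_right_mono power_mono) auto
        also have "\<dots> = ((1 + \<bar>t\<bar>) ^ k * cmod (\<omega> t)) * ((1 + \<bar>\<xi>\<bar>) ^ k * cmod (time_average j g (\<xi>, t)))"
          by (simp add: h(3) p norm_mult power_mult_distrib)
        also have "\<dots> \<le> A * B" using A ta B0 by (intro mult_mono) auto
        finally show ?thesis .
      qed
      then show ?thesis by blast
    qed
    then show ?case unfolding rapid_def by blast
  next
    case (3 g h) then show ?case by (rule rapid_add)
  next
    case (4 h i)
    then obtain \<omega> j g where h: "schwartz \<omega>" "schwartz g" "h = (\<lambda>p. \<omega> (snd p) * time_average j g p)" by blast
    have i: "i = (1, 0) \<or> i = (0, 1)" using 4(2) by (simp add: Basis_real_pair)
    have s: "schwartz (partial_deriv 1 \<omega>)" "schwartz (partial_deriv (1, 0) g)" "schwartz (partial_deriv (0, 1) g)"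
      using h by (auto intro: schwartz_partial simp: Basis_real_pair)
    have dt: "time_average j g differentiable (at x)" for x
      by (rule differentiableI[OF time_average_has_derivative[OF h(2)]])
    have pd: "partial_deriv i h x = \<omega> (snd x) * partial_deriv i (time_average j g) x +
        complex_of_real (snd i) * partial_deriv 1 \<omega> (snd x) * time_average j g x" for x
      unfolding h(3) by (rule partial_deriv_eq[OF has_derivative_mult[OF d\<omega>[OF h(1)] has_derivative_partial_deriv[OF dt]]])
    show ?case using i
    proof
      assume i: "i = (1, 0)"
      have "partial_deriv i h = (\<lambda>x. \<omega> (snd x) * time_average j (partial_deriv (1, 0) g) x)"
        by (rule ext) (unfold pd, simp add: i partial_deriv_time_average[OF h(2)])
      then show ?thesis using h s by blast
    next
      assume i: "i = (0, 1)"
      have "\<forall>x. partial_deriv i h x = \<omega> (snd x) * time_average (Suc j) (partial_deriv (0, 1) g) x +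
          partial_deriv 1 \<omega> (snd x) * time_average j g x"
        by (unfold pd) (simp add: i partial_deriv_time_average[OF h(2)])
      then show ?thesis using h s by blast
    qed
  qed
  then show ?thesis by (simp only: schwartz_iff)
qed

section \<open>Fourier inversion\<close>

text \<open>Characteristic functions carry the opposite sign in the exponent, hence the evaluation
  at \<open>- t\<close>.\<close>

lemma fourier_int_std_normal:
  "fourier_int (\<lambda>x. complex_of_real (std_normal_density x)) t = complex_of_real (exp (- t\<^sup>2 / 2))"
proof -
  have "char std_normal_distribution (- t) = (LINT x|lborel. std_normal_density x *\<^sub>R iexp (- t * x))"
    unfolding char_def by (subst integral_density) auto
  also have "\<dots> = fourier_int (\<lambda>x. complex_of_real (std_normal_density x)) t"
    unfolding fourier_int_def by (simp add: scaleR_conv_of_real mult_ac)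
  finally show ?thesis by (simp add: char_std_normal_distribution)
qed

lemma integrable_std_normal: "integrable lborel (\<lambda>x. complex_of_real (std_normal_density x))"
  using integrable_normal_density[of 1 0] by (intro integrable_of_real) auto

text \<open>Inversion at the origin. The transform is tested against widening Gaussians, which tend
  to a constant, while by the multiplication formula \<open>f\<close> is tested against their
  transforms, which concentrate at 0; both sides converge by dominated convergence.\<close>

lemma integral_fourier_int:
  fixes f :: "real \<Rightarrow> complex"
  assumes f: "schwartz f"
  shows "(LINT \<xi>|lborel. fourier_int f \<xi>) = complex_of_real (2 * pi) * f 0"
proof -
  \<comment> \<open>The successor keeps the width of the Gaussian nonzero for
    \<open>n = 0\<close>.\<close>
  let ?N = "\<lambda>n. real (Suc n)"
  let ?\<gamma> = "\<lambda>n \<xi>. complex_of_real (std_normal_density (\<xi> / ?N n))"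
  have fm[measurable]: "f \<in> borel_measurable borel" using f by (rule schwartz_measurable)
  have Ff: "schwartz (fourier_int f)" using f by (rule schwartz_fourier_int)
  then have Ffm[measurable]: "fourier_int f \<in> borel_measurable borel" by (rule schwartz_measurable)
  have g_int: "integrable lborel (?\<gamma> n)" for n
    using lborel_integrable_real_affine[OF integrable_std_normal, of "1 / ?N n" 0] by simp
  have g_four: "fourier_int (?\<gamma> n) x = complex_of_real (?N n * exp (- (?N n * x)\<^sup>2 / 2))" for n x
  proof -
    have "fourier_int (?\<gamma> n) x = \<bar>?N n\<bar> *\<^sub>R (LINT \<xi>|lborel. exp (- (\<i> * complex_of_real ((0 + ?N n * \<xi>) \<bullet> x))) * ?\<gamma> n (0 + ?N n * \<xi>))"
      unfolding fourier_int_def by (rule lborel_integral_real_affine) simp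
    also have "(LINT \<xi>|lborel. exp (- (\<i> * complex_of_real ((0 + ?N n * \<xi>) \<bullet> x))) * ?\<gamma> n (0 + ?N n * \<xi>))
      = fourier_int (\<lambda>x. complex_of_real (std_normal_density x)) (?N n * x)"
      unfolding fourier_int_def by (intro Bochner_Integration.integral_cong refl) (simp add: mult_ac del: of_nat_Suc)
    finally show ?thesis by (simp add: fourier_int_std_normal scaleR_conv_of_real del: of_nat_Suc)
  qed
  have eq: "(LINT \<xi>|lborel. fourier_int f \<xi> * ?\<gamma> n \<xi>) =
      (LINT y|lborel. f (y / ?N n) * complex_of_real (exp (- y\<^sup>2 / 2)))" for n
  proof -
    have "(LINT \<xi>|lborel. fourier_int f \<xi> * ?\<gamma> n \<xi>) = (LINT x|lborel. f x * fourier_int (?\<gamma> n) x)"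
      by (rule fourier_int_multiplication[OF schwartz_integrable[OF f] g_int])
    also have "\<dots> = (LINT x|lborel. f x * complex_of_real (?N n * exp (- (?N n * x)\<^sup>2 / 2)))"
      by (simp only: g_four)
    also have "\<dots> = \<bar>1 / ?N n\<bar> *\<^sub>R (LINT y|lborel. f (0 + 1 / ?N n * y) * complex_of_real (?N n * exp (- (?N n * (0 + 1 / ?N n * y))\<^sup>2 / 2)))"
      by (rule lborel_integral_real_affine) simp
    also have "\<dots> = (LINT y|lborel. \<bar>1 / ?N n\<bar> *\<^sub>R (f (0 + 1 / ?N n * y) * complex_of_real (?N n * exp (- (?N n * (0 + 1 / ?N n * y))\<^sup>2 / 2))))"
      by simp
    also have "\<dots> = (LINT y|lborel. f (y / ?N n) * complex_of_real (exp (- y\<^sup>2 / 2)))"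
      by (intro Bochner_Integration.integral_cong refl) (simp add: scaleR_conv_of_real del: of_nat_Suc)
    finally show ?thesis .
  qed
  have N0: "(\<lambda>n. y / ?N n) \<longlonglongrightarrow> 0" for y :: real
    using tendsto_mult_right[OF LIMSEQ_inverse_real_of_nat, of y] by (simp add: divide_inverse mult.commute)
  have snd_cont: "isCont std_normal_density x" for x
    unfolding std_normal_density_def by (intro continuous_intros) auto
  have lim1: "(\<lambda>n. LINT \<xi>|lborel. fourier_int f \<xi> * ?\<gamma> n \<xi>) \<longlonglongrightarrow> (LINT \<xi>|lborel. fourier_int f \<xi> * complex_of_real (std_normal_density 0))"
  proof (rule integral_dominated_convergence[where w = "\<lambda>\<xi>. cmod (fourier_int f \<xi>) * 1"])
    show "integrable lborel (\<lambda>\<xi>. cmod (fourier_int f \<xi>) * 1)"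
      by (intro integrable_mult_left integrable_norm schwartz_integrable Ff)
    show "AE x in lborel. (\<lambda>i. fourier_int f x * ?\<gamma> i x) \<longlonglongrightarrow> fourier_int f x * complex_of_real (std_normal_density 0)"
      by (intro always_eventually allI tendsto_intros isCont_tendsto_compose[OF snd_cont] N0)
    have "std_normal_density y \<le> 1" for y
    proof -
      have "1 / sqrt (2 * pi) \<le> 1" using pi_gt3 by (simp add: divide_le_eq_1)
      moreover have "exp (- y\<^sup>2 / 2) \<le> 1" by simp
      ultimately show ?thesis unfolding std_normal_density_def
        using mult_mono[of "1 / sqrt (2 * pi)" 1 "exp (- y\<^sup>2 / 2)" 1] by simp
    qed
    then have "cmod (fourier_int f x * ?\<gamma> i x) \<le> cmod (fourier_int f x) * 1" for i x
      unfolding norm_mult norm_of_real by (intro mult_left_mono) (auto simp: abs_of_nonneg normal_density_nonneg)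
    then show "AE x in lborel. cmod (fourier_int f x * ?\<gamma> i x) \<le> cmod (fourier_int f x) * 1" for i by auto
  qed measurable
  obtain B where B: "\<And>x. cmod (f x) \<le> B" using schwartz_bounded[OF f] by blast
  have e_int: "integrable lborel (\<lambda>y::real. exp (- y\<^sup>2 / 2))"
  proof -
    have "integrable lborel (\<lambda>y. sqrt (2 * pi) * std_normal_density y)"
      using integrable_normal_density[of 1 0] by (intro integrable_mult_right) auto
    then show ?thesis by (simp add: std_normal_density_def)
  qed
  have e_val: "(LINT y|lborel. exp (- (y::real)\<^sup>2 / 2)) = sqrt (2 * pi)"
  proof -
    have "(LINT y|lborel. sqrt (2 * pi) * std_normal_density y) = sqrt (2 * pi) * 1"
      using integral_normal_density[of 1 0] by simp
    then show ?thesis by (simp add: std_normal_density_def)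
  qed
  have lim2: "(\<lambda>n. LINT y|lborel. f (y / ?N n) * complex_of_real (exp (- y\<^sup>2 / 2))) \<longlonglongrightarrow>
     (LINT y|lborel. f 0 * complex_of_real (exp (- y\<^sup>2 / 2)))"
  proof (rule integral_dominated_convergence[where w = "\<lambda>y. B * exp (- y\<^sup>2 / 2)"])
    show "integrable lborel (\<lambda>y. B * exp (- y\<^sup>2 / 2))" by (intro integrable_mult_right e_int)
    have "isCont f x" for x using schwartz_continuous[OF f] by (simp add: continuous_on_eq_continuous_at)
    then show "AE y in lborel. (\<lambda>i. f (y / ?N i) * complex_of_real (exp (- y\<^sup>2 / 2))) \<longlonglongrightarrow> f 0 * complex_of_real (exp (- y\<^sup>2 / 2))"
      by (intro always_eventually allI tendsto_intros isCont_tendsto_compose[of 0 f] N0)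
    show "AE y in lborel. cmod (f (y / ?N i) * complex_of_real (exp (- y\<^sup>2 / 2))) \<le> B * exp (- y\<^sup>2 / 2)" for i
      using B by (auto simp: norm_mult intro!: mult_right_mono)
  qed measurable
  have "(LINT y|lborel. f 0 * complex_of_real (exp (- y\<^sup>2 / 2))) = f 0 * complex_of_real (sqrt (2 * pi))"
    using e_val integral_of_real[of lborel "\<lambda>y. exp (- y\<^sup>2 / 2)", where 'a = complex] by simp
  with LIMSEQ_unique[OF lim1 lim2[folded eq]]
  have "(LINT \<xi>|lborel. fourier_int f \<xi>) * complex_of_real (1 / sqrt (2 * pi)) = f 0 * complex_of_real (sqrt (2 * pi))"
    by (simp add: std_normal_density_def)
  then have "(LINT \<xi>|lborel. fourier_int f \<xi>) * complex_of_real (1 / sqrt (2 * pi) * sqrt (2 * pi)) = f 0 * complex_of_real (sqrt (2 * pi) * sqrt (2 * pi))"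
    by (simp only: of_real_mult mult.assoc[symmetric])
  then show ?thesis by (simp add: mult.commute)
qed

text \<open>A translation moves the point to the origin and acts on the transform as multiplication
  by a character.\<close>

lemma fourier_int_inversion_real:
  fixes f :: "real \<Rightarrow> complex"
  assumes f: "schwartz f"
  shows "fourier_int (fourier_int f) (- x) = complex_of_real (2 * pi) * f x"
proof -
  have g: "schwartz (\<lambda>y. f (y + x))" using f by (rule schwartz_shift)
  have "fourier_int (\<lambda>y. f (y + x)) \<xi> = exp (- (\<i> * complex_of_real (\<xi> \<bullet> (- x)))) * fourier_int f \<xi>" for \<xi>
  proof -
    have "fourier_int f \<xi> = \<bar>1\<bar> *\<^sub>R (LINT y|lborel. exp (- (\<i> * complex_of_real ((x + 1 * y) \<bullet> \<xi>))) * f (x + 1 * y))"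
      unfolding fourier_int_def by (rule lborel_integral_real_affine) simp
    also have "\<dots> = (LINT y|lborel. exp (\<i> * complex_of_real (\<xi> \<bullet> (- x))) * (exp (- (\<i> * complex_of_real (y \<bullet> \<xi>))) * f (y + x)))"
    proof -
      have "exp (- (\<i> * complex_of_real ((x + 1 * y) \<bullet> \<xi>))) =
          exp (\<i> * complex_of_real (\<xi> \<bullet> (- x))) * exp (- (\<i> * complex_of_real (y \<bullet> \<xi>)))" for y
        unfolding exp_add[symmetric] by (simp add: algebra_simps)
      then show ?thesis by (simp only: mult.assoc abs_one scaleR_one mult_1 add.commute)
    qed
    also have "\<dots> = exp (\<i> * complex_of_real (\<xi> \<bullet> (- x))) * fourier_int (\<lambda>y. f (y + x)) \<xi>"
      unfolding fourier_int_def by simp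
    finally show ?thesis by (simp add: mult.assoc[symmetric] exp_minus)
  qed
  then have "(LINT \<xi>|lborel. fourier_int (\<lambda>y. f (y + x)) \<xi>) = fourier_int (fourier_int f) (- x)"
    unfolding fourier_int_def[of "fourier_int f"] by simp
  with integral_fourier_int[OF g] show ?thesis by simp
qed

lemma two_pi_powr: "(2 * pi) powr (- real DIM(real) / 2) = 1 / sqrt (2 * pi)"
  "(2 * pi) powr (- real DIM(real \<times> real) / 2) = 1 / (2 * pi)"
  by (auto simp: powr_minus powr_half_sqrt inverse_eq_divide)

lemma fourier_eq_real: "fourier f \<xi> = complex_of_real (1 / sqrt (2 * pi)) * fourier_int f (\<xi>::real)"
  unfolding fourier_eq two_pi_powr ..

lemma fourier_eq_pair: "fourier f p = complex_of_real (1 / (2 * pi)) * fourier_int f (p::real \<times> real)"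
  unfolding fourier_eq two_pi_powr ..

lemma fourier_int_cmult: "fourier_int (\<lambda>x. c * f x) \<xi> = c * fourier_int f \<xi>"
  unfolding fourier_int_def by (simp add: mult.left_commute)

lemma fourier_inversion_real:
  fixes f :: "real \<Rightarrow> complex"
  assumes "schwartz f" shows "fourier (fourier f) x = f (- x)"
proof -
  have "fourier (fourier f) x = complex_of_real (1 / sqrt (2 * pi)) * (complex_of_real (1 / sqrt (2 * pi)) * fourier_int (fourier_int f) x)"
    unfolding fourier_eq_real[abs_def] fourier_int_cmult ..
  also have "fourier_int (fourier_int f) x = complex_of_real (2 * pi) * f (- x)"
    using fourier_int_inversion_real[OF assms, of "- x"] by simp
  also have "complex_of_real (1 / sqrt (2 * pi)) * (complex_of_real (1 / sqrt (2 * pi)) * (complex_of_real (2 * pi) * f (- x))) =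
     complex_of_real (1 / sqrt (2 * pi) * (1 / sqrt (2 * pi)) * (2 * pi)) * f (- x)"
    by (simp only: of_real_mult mult.assoc)
  also have "1 / sqrt (2 * pi) * (1 / sqrt (2 * pi)) * (2 * pi) = 1" by simp
  finally show ?thesis by simp
qed

section \<open>Transforms and inversion in two variables\<close>

lemma schwartz_slice_snd:
  fixes f :: "real \<times> real \<Rightarrow> complex" assumes "schwartz f" shows "schwartz (\<lambda>t. f (x, t))"
  using schwartz_slice[OF schwartz_swap[OF assms], of x] by simp

lemma integral_pair:
  fixes h :: "'a::euclidean_space \<times> 'b::euclidean_space \<Rightarrow> complex"
  assumes "integrable lborel h"
  shows "(LINT p|lborel. h p) = (LINT x|lborel. LINT t|lborel. h (x, t))"
    and "(LINT p|lborel. h p) = (LINT t|lborel. LINT x|lborel. h (x, t))"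
  using lborel_pair.integral_fst'[of h] lborel_pair.integral_snd[of "\<lambda>x t. h (x, t)"] assms
  by (simp_all add: lborel_prod)

lemma fourier_int_pair:
  fixes f :: "real \<times> real \<Rightarrow> complex"
  assumes f: "schwartz f"
  shows "fourier_int f (\<xi>, \<tau>) = fourier_int (\<lambda>t. pfourier f (\<xi>, t)) \<tau>"
    and "fourier_int f (\<xi>, \<tau>) = fourier_int (\<lambda>x. fourier_int (\<lambda>t. f (x, t)) \<tau>) \<xi>"
proof -
  have int: "integrable lborel (\<lambda>p. exp (- (\<i> * complex_of_real (p \<bullet> (\<xi>, \<tau>)))) * f p)"
    by (intro integrable_cis_mult schwartz_integrable f) measurable
  have e: "exp (- (\<i> * complex_of_real ((x, t) \<bullet> (\<xi>, \<tau>)))) =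
     exp (- (\<i> * complex_of_real (t * \<tau>))) * exp (- (\<i> * complex_of_real (x * \<xi>)))" for x t
    by (simp add: exp_add[symmetric] algebra_simps)
  show "fourier_int f (\<xi>, \<tau>) = fourier_int (\<lambda>t. pfourier f (\<xi>, t)) \<tau>"
    unfolding fourier_int_def integral_pair(2)[OF int] e pfourier_def mult.assoc by simp
  show "fourier_int f (\<xi>, \<tau>) = fourier_int (\<lambda>x. fourier_int (\<lambda>t. f (x, t)) \<tau>) \<xi>"
    unfolding fourier_int_def integral_pair(1)[OF int] e mult.commute[of "exp (- (\<i> * complex_of_real (_ * \<tau>)))" "exp _"] mult.assoc
    by simp
qed

lemma pfourier_inversion:
  assumes f: "schwartz f"
  shows "fourier_int (\<lambda>\<tau>. fourier_int f (\<xi>, \<tau>)) (- t) = complex_of_real (2 * pi) * pfourier f (\<xi>, t)"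
  unfolding fourier_int_pair(1)[OF f]
  by (rule fourier_int_inversion_real[OF schwartz_slice_snd[OF schwartz_pfourier[OF f]]])

text \<open>One-dimensional inversion, applied in time and then in space.\<close>

lemma fourier_inversion_pair:
  fixes f :: "real \<times> real \<Rightarrow> complex"
  assumes f: "schwartz f" shows "fourier (fourier f) p = f (- p)"
proof -
  obtain x t where p: "p = (x, t)" by force
  have "fourier_int (fourier_int f) (x, t) = fourier_int (\<lambda>\<xi>. fourier_int (\<lambda>\<tau>. fourier_int f (\<xi>, \<tau>)) t) x"
    by (rule fourier_int_pair(2)[OF schwartz_fourier_int[OF f]])
  also have "\<dots> = complex_of_real (2 * pi) * fourier_int (\<lambda>\<xi>. fourier_int (\<lambda>y. f (y, - t)) \<xi>) x"
    using pfourier_inversion[OF f, of _ "- t"] by (simp add: fourier_int_cmult pfourier_fourier_int)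
  also have "fourier_int (\<lambda>\<xi>. fourier_int (\<lambda>y. f (y, - t)) \<xi>) x = complex_of_real (2 * pi) * f (- x, - t)"
    using fourier_int_inversion_real[OF schwartz_slice[OF f], of "- t" "- x"] by simp
  finally show ?thesis
    unfolding fourier_eq_pair[abs_def] fourier_int_cmult p by simp
qed

section \<open>The free evolution and the Duhamel operator on Schwartz functions\<close>

lemma moderate_measurable [measurable_dest]: "moderate f \<Longrightarrow> f \<in> borel_measurable borel"
  by (intro borel_measurable_continuous_onI moderate_continuous)

abbreviation moderate_phase :: "(real \<Rightarrow> real) \<Rightarrow> bool" where
  "moderate_phase \<phi> \<equiv> moderate (\<lambda>\<xi>. complex_of_real (\<phi> \<xi>))"

lemma moderate_dispersion: "moderate_phase (dispersion \<alpha> \<beta>)"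
proof -
  have id: "moderate (\<lambda>\<xi>::real. complex_of_real \<xi>)" by (rule moderate_of_real_linear) simp
  have "moderate (\<lambda>\<xi>. complex_of_real \<alpha> * complex_of_real \<xi> ^ 5 + complex_of_real (- \<beta>) * complex_of_real \<xi> ^ 3)"
    by (intro moderate_add moderate_mult moderate_const moderate_power id)
  then show ?thesis by (simp add: dispersion_def)
qed

lemma moderate_cis_phase:
  assumes "moderate_phase \<phi>"
  shows "moderate (\<lambda>p. exp (\<i> * complex_of_real (snd p * \<phi> (fst p))))"
    and "moderate (\<lambda>p. exp (- (\<i> * complex_of_real (snd p * \<phi> (fst p)))))"
    and "moderate (\<lambda>\<xi>. exp (- (\<i> * complex_of_real (t * \<phi> \<xi>))))"
proof -
  have m: "moderate (\<lambda>p::real \<times> real. complex_of_real (c * (snd p * \<phi> (fst p))))" for c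
    using moderate_mult[OF moderate_const[of "complex_of_real c"] moderate_mult[OF moderate_of_real_linear[OF bounded_linear_snd] moderate_compose_linear[OF assms bounded_linear_fst]]]
    by simp
  show "moderate (\<lambda>p. exp (\<i> * complex_of_real (snd p * \<phi> (fst p))))"
    using moderate_cis[OF m[of 1]] by simp
  show "moderate (\<lambda>p. exp (- (\<i> * complex_of_real (snd p * \<phi> (fst p)))))"
    using moderate_cis[OF m[of "-1"]] by simp
  have "moderate (\<lambda>\<xi>. complex_of_real (- t * \<phi> \<xi>))"
    using moderate_mult[OF moderate_const[of "complex_of_real (-t)"] assms] by simp
  from moderate_cis[OF this] show "moderate (\<lambda>\<xi>. exp (- (\<i> * complex_of_real (t * \<phi> \<xi>))))" by simp
qed

text \<open>The evolution is itself a Fourier transform, evaluated at \<open>- x\<close>; its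
  regularity, its own transform and its linearity then follow from those of
  \<open>fourier\<close>.\<close>

lemma free_evolution_eq:
  "free_evolution \<phi> t f x = fourier (\<lambda>\<xi>. exp (- (\<i> * complex_of_real (t * \<phi> \<xi>))) * fourier f \<xi>) (- x)"
proof -
  have "exp (\<i> * complex_of_real (x * \<xi>) - \<i> * complex_of_real (t * \<phi> \<xi>)) * fourier f \<xi> =
     exp (- (\<i> * complex_of_real (\<xi> \<bullet> (- x)))) * (exp (- (\<i> * complex_of_real (t * \<phi> \<xi>))) * fourier f \<xi>)" for \<xi>
    unfolding mult.assoc[symmetric] exp_add[symmetric] by (simp add: algebra_simps)
  then show ?thesis
    unfolding free_evolution_def fourier_eq_real[of "\<lambda>\<xi>. exp (- (\<i> * complex_of_real (t * \<phi> \<xi>))) * fourier f \<xi>"]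
      fourier_int_def[of "\<lambda>\<xi>. exp (- (\<i> * complex_of_real (t * \<phi> \<xi>))) * fourier f \<xi>"] by (simp only:)
qed

lemma schwartz_evolution_symbol:
  assumes "moderate_phase \<phi>" "schwartz f"
  shows "schwartz (\<lambda>\<xi>. exp (- (\<i> * complex_of_real (t * \<phi> \<xi>))) * f \<xi>)"
  using schwartz_mult_moderate[OF assms(2) moderate_cis_phase(3)[OF assms(1)]] by (simp add: mult.commute)

lemma schwartz_free_evolution:
  assumes "moderate_phase \<phi>" "schwartz f"
  shows "schwartz (free_evolution \<phi> t f)"
  unfolding free_evolution_eq[abs_def]
  by (intro schwartz_uminus schwartz_fourier schwartz_evolution_symbol assms)

lemma fourier_reflect: "fourier (\<lambda>x. f (- x)) \<xi> = fourier f (- \<xi>)" for f :: "real \<Rightarrow> complex"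
proof -
  have "fourier_int f (- \<xi>) = \<bar>-1\<bar> *\<^sub>R (LINT x|lborel. exp (- (\<i> * complex_of_real ((0 + (-1) * x) \<bullet> (- \<xi>)))) * f (0 + (-1) * x))"
    unfolding fourier_int_def by (rule lborel_integral_real_affine) simp
  then show ?thesis unfolding fourier_eq_real by (simp add: fourier_int_def)
qed

lemma fourier_free_evolution:
  assumes "moderate_phase \<phi>" "schwartz f"
  shows "fourier (free_evolution \<phi> t f) \<xi> = exp (- (\<i> * complex_of_real (t * \<phi> \<xi>))) * fourier f \<xi>"
  unfolding free_evolution_eq[abs_def] fourier_reflect
    fourier_inversion_real[OF schwartz_evolution_symbol[OF assms(1) schwartz_fourier[OF assms(2)]]] by simp

lemma free_evolution_diff:
  assumes "moderate_phase \<phi>" "schwartz f" "schwartz g"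
  shows "free_evolution \<phi> t (\<lambda>x. f x - g x) x = free_evolution \<phi> t f x - free_evolution \<phi> t g x"
  unfolding free_evolution_eq fourier_diff[OF schwartz_integrable[OF assms(2)] schwartz_integrable[OF assms(3)]] right_diff_distrib
  by (intro fourier_diff schwartz_integrable schwartz_evolution_symbol assms schwartz_fourier)

text \<open>Exhibits the localised evolution as the partial transform of a Schwartz function: the
  tensor product of \<open>fourier f\<close> with the cutoff, times a moderate phase.\<close>

lemma local_free_evolution_eq:
  "local_free_evolution \<phi> \<eta> f (x, t) = complex_of_real (1 / sqrt (2 * pi)) *
     pfourier (\<lambda>p. exp (- (\<i> * complex_of_real (snd p * \<phi> (fst p)))) * (fourier f (fst p) * complex_of_real (\<eta> (snd p)))) (- x, t)"
proof -
  define g where "g \<xi> = exp (- (\<i> * complex_of_real (t * \<phi> \<xi>))) * fourier f \<xi>" for \<xi>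
  have eq: "(\<lambda>\<xi>. exp (- (\<i> * complex_of_real (t * \<phi> \<xi>))) * (fourier f \<xi> * complex_of_real (\<eta> t))) = (\<lambda>\<xi>. complex_of_real (\<eta> t) * g \<xi>)"
    by (simp add: g_def mult_ac)
  show ?thesis
    unfolding local_free_evolution_def pfourier_fourier_int free_evolution_eq prod.case fst_conv snd_conv eq
      fourier_int_cmult g_def[symmetric] fourier_eq_real[of g] by (rule mult.left_commute)
qed

lemma schwartz_local_free_evolution:
  assumes "moderate_phase \<phi>" "cutoff \<eta>" "schwartz f"
  shows "schwartz (local_free_evolution \<phi> \<eta> f)"
proof -
  let ?K = "\<lambda>p. (fourier f (fst p) * complex_of_real (\<eta> (snd p))) * exp (- (\<i> * complex_of_real (snd p * \<phi> (fst p))))"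
  have "schwartz (\<lambda>p. fourier f (fst p) * complex_of_real (\<eta> (snd p)))"
    using schwartz_tensor[OF schwartz_fourier[OF assms(3)] schwartz_cutoff[OF assms(2)]]
    by (simp only: case_prod_beta')
  then have "schwartz ?K" by (rule schwartz_mult_moderate[OF _ moderate_cis_phase(2)[OF assms(1)]])
  from schwartz_cmult[OF schwartz_reflect_fst[OF schwartz_pfourier[OF this]], of "complex_of_real (1 / sqrt (2 * pi))"]
  have "schwartz (\<lambda>p. complex_of_real (1 / sqrt (2 * pi)) * (case p of (x, t) \<Rightarrow> pfourier ?K (- x, t)))" .
  moreover have "(\<lambda>p. complex_of_real (1 / sqrt (2 * pi)) * (case p of (x, t) \<Rightarrow> pfourier ?K (- x, t))) = local_free_evolution \<phi> \<eta> f"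
  proof (rule ext, clarify)
    fix x t
    show "complex_of_real (1 / sqrt (2 * pi)) * pfourier ?K (- x, t) = local_free_evolution \<phi> \<eta> f (x, t)"
      unfolding local_free_evolution_eq by (simp only: mult.commute)
  qed
  ultimately show ?thesis by simp
qed

lemma local_free_evolution_diff:
  assumes "moderate_phase \<phi>" "schwartz f" "schwartz g"
  shows "local_free_evolution \<phi> \<eta> (\<lambda>x. f x - g x) p = local_free_evolution \<phi> \<eta> f p - local_free_evolution \<phi> \<eta> g p"
  unfolding local_free_evolution_def
  by (simp add: case_prod_beta' free_evolution_diff[OF assms] right_diff_distrib)

section \<open>The Duhamel operator in Fourier variables\<close>

lemma interval_integral_time_average:
  fixes E :: "real \<Rightarrow> complex"
  shows "(LBINT t'=0..t. E t') = complex_of_real t * (LINT r|lborel. indicator {0<..<1} r *\<^sub>R E (r * t))"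
proof (cases "t = 0")
  case False
  have aff: "(LINT t'|lborel. h t') = \<bar>t\<bar> *\<^sub>R (LINT r|lborel. h (0 + t * r))" for h :: "real \<Rightarrow> complex"
    using False by (rule lborel_integral_real_affine)
  show ?thesis
  proof (cases "t > 0")
    case True
    have "(LBINT t'=0..t. E t') = (LINT t'|lborel. indicator {0<..<t} t' *\<^sub>R E t')"
      using True unfolding interval_lebesgue_integral_def set_lebesgue_integral_def zero_ereal_def by simp
    also have "\<dots> = complex_of_real t * (LINT r|lborel. indicator {0<..<t} (0 + t * r) *\<^sub>R E (0 + t * r))"
      using True by (subst aff) (simp add: scaleR_conv_of_real)
    also have "(\<lambda>r. indicator {0<..<t} (0 + t * r) *\<^sub>R E (0 + t * r)) = (\<lambda>r. indicator {0<..<1} r *\<^sub>R E (r * t))"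
      using True by (auto simp: fun_eq_iff indicator_def zero_less_mult_iff mult.commute)
    finally show ?thesis .
  next
    case f: False
    then have neg: "t < 0" using False by simp
    have "(LBINT t'=0..t. E t') = - (LINT t'|lborel. indicator {t<..<0} t' *\<^sub>R E t')"
      using neg unfolding interval_lebesgue_integral_def set_lebesgue_integral_def zero_ereal_def by simp
    also have "\<dots> = complex_of_real t * (LINT r|lborel. indicator {t<..<0} (0 + t * r) *\<^sub>R E (0 + t * r))"
      using neg by (subst aff) (simp add: scaleR_conv_of_real)
    also have "(\<lambda>r. indicator {t<..<0} (0 + t * r) *\<^sub>R E (0 + t * r)) = (\<lambda>r. indicator {0<..<1} r *\<^sub>R E (r * t))"
      using neg by (auto simp: fun_eq_iff indicator_def mult_less_0_iff mult.commute)
    finally show ?thesis .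
  qed
qed (simp add: zero_ereal_def)

definition forcing :: "(real \<times> real \<Rightarrow> complex) \<Rightarrow> (real \<times> real \<Rightarrow> complex) \<Rightarrow> real \<times> real \<Rightarrow> complex" where
  "forcing v w = (\<lambda>(\<xi>, t). fourier (\<lambda>y. partial_deriv (1, 0) (\<lambda>p. v p * w p) (y, t)) \<xi>)"

text \<open>For \<open>G\<close> the spatial transform of a forcing term F, this is the spatial
  transform of the integral of U(t - t') F(t') over t' from 0 to t: the phase at time
  \<open>t\<close> is pulled out and the integral is written as an average.\<close>

definition duhamel_symbol :: "(real \<Rightarrow> real) \<Rightarrow> (real \<times> real \<Rightarrow> complex) \<Rightarrow> real \<times> real \<Rightarrow> complex" where
  "duhamel_symbol \<phi> G = (\<lambda>p. exp (- (\<i> * complex_of_real (snd p * \<phi> (fst p)))) *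
     (complex_of_real (snd p) * time_average 0 (\<lambda>q. G q * exp (\<i> * complex_of_real (snd q * \<phi> (fst q)))) p))"

lemma schwartz_mult: "schwartz v \<Longrightarrow> schwartz w \<Longrightarrow> schwartz (\<lambda>p. v p * w p)"
  by (rule schwartz_mult_moderate[OF _ schwartz_imp_moderate])

lemma schwartz_forcing:
  assumes "schwartz v" "schwartz w" shows "schwartz (forcing v w)"
proof -
  have "schwartz (partial_deriv (1, 0) (\<lambda>p. v p * w p))"
    by (intro schwartz_partial schwartz_mult assms) (simp add: Basis_real_pair)
  from schwartz_cmult[OF schwartz_pfourier[OF this], of "complex_of_real (1 / sqrt (2 * pi))"]
  show ?thesis by (simp add: forcing_def fourier_eq_real pfourier_fourier_int[symmetric] case_prod_beta')
qed

lemma schwartz_forcing_phase: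
  assumes "moderate_phase \<phi>" "schwartz G"
  shows "schwartz (\<lambda>q. G q * exp (\<i> * complex_of_real (snd q * \<phi> (fst q))))"
  by (rule schwartz_mult_moderate[OF assms(2) moderate_cis_phase(1)[OF assms(1)]])

lemma integrable_tensor:
  fixes f :: "'a::euclidean_space \<Rightarrow> real" and g :: "'b::euclidean_space \<Rightarrow> real"
  assumes "integrable lborel f" "integrable lborel g"
  shows "integrable (lborel \<Otimes>\<^sub>M lborel) (\<lambda>(x, y). f x * g y)"
proof -
  have [measurable]: "f \<in> borel_measurable borel" "g \<in> borel_measurable borel"
    using assms by (auto dest: borel_measurable_integrable)
  show ?thesis
    using assms by (intro lborel_pair.Fubini_integrable) (auto simp: abs_mult)
qed

text \<open>Fubini exchanges the time average with the frequency integral of the free evolution; the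
  decay of the forcing in frequency, uniform in time, is the dominating function.\<close>

lemma local_duhamel_eq:
  assumes \<phi>: "moderate_phase \<phi>" and v: "schwartz v" and w: "schwartz w"
  shows "local_duhamel \<phi> \<eta> T v w (x, t) = complex_of_real (1 / sqrt (2 * pi)) *
     (complex_of_real (\<eta> (t / T)) * (LINT \<xi>|lborel. exp (- (\<i> * complex_of_real (\<xi> * (- x)))) * duhamel_symbol \<phi> (forcing v w) (\<xi>, t)))"
proof -
  let ?c = "complex_of_real (1 / sqrt (2 * pi))"
  let ?G = "forcing v w"
  let ?e = "\<lambda>\<xi>. exp (- (\<i> * complex_of_real (\<xi> * (- x))))"
  let ?e2 = "\<lambda>r \<xi>. exp (- (\<i> * complex_of_real ((t - r * t) * \<phi> \<xi>)))"
  have G: "schwartz ?G" by (rule schwartz_forcing[OF v w])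
  have [measurable]: "?G \<in> borel_measurable borel" by (rule schwartz_measurable[OF G])
  have [measurable]: "\<phi> \<in> borel_measurable borel"
    using moderate_measurable[OF \<phi>] by (simp add: borel_measurable_complex_iff)
  have E: "free_evolution \<phi> (t - s) (\<lambda>y. partial_deriv (1, 0) (\<lambda>p. v p * w p) (y, s)) x =
     ?c * (LINT \<xi>|lborel. ?e \<xi> * (exp (- (\<i> * complex_of_real ((t - s) * \<phi> \<xi>))) * ?G (\<xi>, s)))" for s
    unfolding free_evolution_eq fourier_eq_real[of _ "- x"] fourier_int_def forcing_def by simp
  obtain B where B: "B \<ge> 0" "\<And>\<xi> s. cmod (?G (\<xi>, s)) \<le> B * (1 / (1 + \<xi>\<^sup>2))"
    using rapid_pair_bound_fst[OF schwartz_rapid[OF G]] by metis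
  let ?F = "\<lambda>r \<xi>. indicator {0<..<1} r *\<^sub>R (?e \<xi> * (?e2 r \<xi> * ?G (\<xi>, r * t)))"
  have int: "integrable (lborel \<Otimes>\<^sub>M lborel) (\<lambda>(r, \<xi>). ?F r \<xi>)"
  proof (rule Bochner_Integration.integrable_bound)
    show "integrable (lborel \<Otimes>\<^sub>M lborel) (\<lambda>(r::real, \<xi>::real). indicator {0<..<1} r * (B * (1 / (1 + \<xi>\<^sup>2))))"
      by (intro integrable_tensor integrable_mult_right integrable_cauchy_real integrable_real_indicator) auto
    show "AE p in lborel \<Otimes>\<^sub>M lborel. cmod (case p of (r, \<xi>) \<Rightarrow> ?F r \<xi>) \<le> norm (case p of (r::real, \<xi>::real) \<Rightarrow> indicator {0<..<1} r * (B * (1 / (1 + \<xi>\<^sup>2))))"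
    proof (intro always_eventually allI)
      fix p :: "real \<times> real"
      obtain r \<xi> where p: "p = (r, \<xi>)" by force
      have "cmod (?F r \<xi>) = indicator {0<..<1} r * cmod (?G (\<xi>, r * t))"
        unfolding norm_scaleR norm_mult[of "exp _"] norm_cis_minus mult_1 by simp
      also have "\<dots> \<le> indicator {0<..<1} r * (B * (1 / (1 + \<xi>\<^sup>2)))"
        by (intro mult_left_mono B) auto
      also have "\<dots> \<le> norm (indicator {0<..<1} r * (B * (1 / (1 + \<xi>\<^sup>2))))"
        unfolding real_norm_def by (rule abs_ge_self)
      finally show "cmod (case p of (r, \<xi>) \<Rightarrow> ?F r \<xi>) \<le> norm (case p of (r::real, \<xi>::real) \<Rightarrow> indicator {0<..<1} r * (B * (1 / (1 + \<xi>\<^sup>2))))"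
        by (simp only: p prod.case)
    qed
  qed measurable
  have "local_duhamel \<phi> \<eta> T v w (x, t) = complex_of_real (\<eta> (t / T)) *
     (complex_of_real t * (LINT r|lborel. indicator {0<..<1} r *\<^sub>R (?c * (LINT \<xi>|lborel. ?e \<xi> * (?e2 r \<xi> * ?G (\<xi>, r * t))))))"
    unfolding local_duhamel_def prod.case interval_integral_time_average E ..
  also have "(\<lambda>r. indicator {0<..<1} r *\<^sub>R (?c * (LINT \<xi>|lborel. ?e \<xi> * (?e2 r \<xi> * ?G (\<xi>, r * t))))) =
      (\<lambda>r. ?c * (LINT \<xi>|lborel. ?F r \<xi>))"
    by (rule ext) (simp only: integral_scaleR_right mult_scaleR_right)
  also have "(LINT r|lborel. ?c * (LINT \<xi>|lborel. ?F r \<xi>)) = ?c * (LINT \<xi>|lborel. LINT r|lborel. ?F r \<xi>)"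
    by (simp only: integral_mult_right_zero lborel_pair.Fubini_integral[OF int, symmetric])
  also have "(\<lambda>\<xi>. LINT r|lborel. ?F r \<xi>) = (\<lambda>\<xi>. ?e \<xi> * (exp (- (\<i> * complex_of_real (t * \<phi> \<xi>))) *
       time_average 0 (\<lambda>q. ?G q * exp (\<i> * complex_of_real (snd q * \<phi> (fst q)))) (\<xi>, t)))"
  proof
    fix \<xi>
    have "?F r \<xi> = (?e \<xi> * exp (- (\<i> * complex_of_real (t * \<phi> \<xi>)))) *
      (indicator {0<..<1} r *\<^sub>R (complex_of_real (r ^ 0) * (?G (\<xi>, r * t) * exp (\<i> * complex_of_real (r * t * \<phi> \<xi>)))))" for r
    proof -
      have "?e2 r \<xi> = exp (- (\<i> * complex_of_real (t * \<phi> \<xi>))) * exp (\<i> * complex_of_real (r * t * \<phi> \<xi>))"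
        unfolding exp_add[symmetric] by (simp add: algebra_simps)
      then show ?thesis by (simp add: mult_ac)
    qed
    then show "(LINT r|lborel. ?F r \<xi>) = ?e \<xi> * (exp (- (\<i> * complex_of_real (t * \<phi> \<xi>))) *
       time_average 0 (\<lambda>q. ?G q * exp (\<i> * complex_of_real (snd q * \<phi> (fst q)))) (\<xi>, t))"
      unfolding time_average_def fst_conv snd_conv by (simp only: integral_mult_right_zero mult.assoc)
  qed
  finally show ?thesis
    unfolding duhamel_symbol_def fst_conv snd_conv
    by (simp add: mult_ac integral_mult_right_zero[symmetric] del: integral_mult_right_zero integral_mult_left_zero)
qed

text \<open>The product of the scaled cutoff and \<open>t\<close> is the Schwartz function of time
  that \<open>schwartz_time_average\<close> asks for; the remaining phase is moderate.\<close>

lemma schwartz_local_duhamel: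
  assumes \<phi>: "moderate_phase \<phi>" and "cutoff \<eta>" "T > 0" "schwartz v" "schwartz w"
  shows "schwartz (local_duhamel \<phi> \<eta> T v w)"
proof -
  let ?w = "\<lambda>t. complex_of_real (\<eta> (t / T)) * complex_of_real t"
  let ?g = "\<lambda>q. forcing v w q * exp (\<i> * complex_of_real (snd q * \<phi> (fst q)))"
  have 1: "schwartz ?w"
    by (intro schwartz_mult_moderate moderate_of_real_linear bounded_linear_ident
        schwartz_dilate[OF schwartz_cutoff] assms)
  have 2: "schwartz ?g" by (intro schwartz_forcing_phase schwartz_forcing assms)
  let ?K = "\<lambda>p. (?w (snd p) * time_average 0 ?g p) * exp (- (\<i> * complex_of_real (snd p * \<phi> (fst p))))"
  have "schwartz ?K"
    by (intro schwartz_mult_moderate schwartz_time_average moderate_cis_phase 1 2 \<phi>)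
  from schwartz_cmult[OF schwartz_reflect_fst[OF schwartz_pfourier[OF this]], of "complex_of_real (1 / sqrt (2 * pi))"]
  have "schwartz (\<lambda>(x, t). complex_of_real (1 / sqrt (2 * pi)) * pfourier ?K (- x, t))" by (simp add: case_prod_beta')
  moreover have "(\<lambda>(x, t). complex_of_real (1 / sqrt (2 * pi)) * pfourier ?K (- x, t)) = local_duhamel \<phi> \<eta> T v w"
  proof (rule ext, clarify)
    fix x t
    have "pfourier ?K (- x, t) = complex_of_real (\<eta> (t / T)) * (LINT \<xi>|lborel. exp (- (\<i> * complex_of_real (\<xi> * (- x)))) * duhamel_symbol \<phi> (forcing v w) (\<xi>, t))"
      unfolding pfourier_def integral_mult_right_zero[symmetric] duhamel_symbol_def fst_conv snd_conv
      by (intro Bochner_Integration.integral_cong refl) (simp only: mult_ac)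
    then show "complex_of_real (1 / sqrt (2 * pi)) * pfourier ?K (- x, t) = local_duhamel \<phi> \<eta> T v w (x, t)"
      unfolding local_duhamel_eq[OF \<phi> assms(4,5)] by simp
  qed
  ultimately show ?thesis by simp
qed

text \<open>The factor \<open>|t|\<close> in the second claim is the source of smallness as
  \<open>t\<close> tends to 0. Its constant depends on the individual Schwartz function, so it
  serves one approximant at a time.\<close>

lemma integrable_duhamel_symbol:
  assumes \<phi>: "moderate_phase \<phi>" and G: "schwartz G"
  shows "integrable lborel (\<lambda>\<xi>. duhamel_symbol \<phi> G (\<xi>, t))"
    and "\<And>B. (\<And>\<xi> s. cmod (G (\<xi>, s)) \<le> B * (1 / (1 + \<xi>\<^sup>2))) \<Longrightarrow>
      cmod (duhamel_symbol \<phi> G (\<xi>, t)) \<le> \<bar>t\<bar> * (B * (1 / (1 + \<xi>\<^sup>2)))"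
proof -
  let ?g = "\<lambda>q. G q * exp (\<i> * complex_of_real (snd q * \<phi> (fst q)))"
  have g: "schwartz ?g" by (intro schwartz_forcing_phase assms)
  have [measurable]: "G \<in> borel_measurable borel" by (rule schwartz_measurable[OF G])
  have [measurable]: "\<phi> \<in> borel_measurable borel"
    using moderate_measurable[OF \<phi>] by (simp add: borel_measurable_complex_iff)
  show bnd: "cmod (duhamel_symbol \<phi> G (\<xi>, t)) \<le> \<bar>t\<bar> * (B * (1 / (1 + \<xi>\<^sup>2)))"
    if B: "\<And>\<xi> s. cmod (G (\<xi>, s)) \<le> B * (1 / (1 + \<xi>\<^sup>2))" for B \<xi>
  proof -
    have "cmod (time_average 0 ?g (\<xi>, t)) \<le> (LINT r|lborel. indicator {0<..<1::real} r * (B * (1 / (1 + \<xi>\<^sup>2))))"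
    proof -
      have "cmod (time_average 0 ?g (\<xi>, t)) \<le> (LINT r|lborel. cmod (indicator {0<..<1} r *\<^sub>R (complex_of_real (r ^ 0) * ?g (\<xi>, r * t))))"
        unfolding time_average_def fst_conv snd_conv by (rule integral_norm_bound)
      also have "\<dots> \<le> (LINT r|lborel. indicator {0<..<1::real} r * (B * (1 / (1 + \<xi>\<^sup>2))))"
      proof (rule integral_mono_AE')
        show "integrable lborel (\<lambda>r. indicator {0<..<1::real} r * (B * (1 / (1 + \<xi>\<^sup>2))))"
          by (intro integrable_mult_left integrable_real_indicator) auto
        have nB: "norm (exp (\<i> * complex_of_real y)) = 1" for y by simp
        show "AE r in lborel. cmod (indicator {0<..<1} r *\<^sub>R (complex_of_real (r ^ 0) * ?g (\<xi>, r * t))) \<le> indicator {0<..<1::real} r * (B * (1 / (1 + \<xi>\<^sup>2)))"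
          unfolding norm_scaleR norm_mult nB fst_conv snd_conv
          using B by (intro always_eventually allI) (auto simp: indicator_def)
        have "B * (1 / (1 + \<xi>\<^sup>2)) \<ge> 0" using B[of \<xi> 0] norm_ge_zero order_trans by blast
        then show "AE r in lborel. 0 \<le> indicator {0<..<1::real} r * (B * (1 / (1 + \<xi>\<^sup>2)))"
          by (intro always_eventually allI mult_nonneg_nonneg[OF indicator_pos_le])
      qed
      finally show ?thesis .
    qed
    also have "\<dots> = B * (1 / (1 + \<xi>\<^sup>2))" by simp
    finally have "cmod (time_average 0 ?g (\<xi>, t)) \<le> B * (1 / (1 + \<xi>\<^sup>2))" .
    then show ?thesis
      unfolding duhamel_symbol_def fst_conv snd_conv norm_mult norm_cis_minus mult_1 norm_of_real
      by (intro mult_left_mono) auto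
  qed
  obtain B where B: "B \<ge> 0" "\<And>\<xi> s. cmod (G (\<xi>, s)) \<le> B * (1 / (1 + \<xi>\<^sup>2))"
    using rapid_pair_bound_fst[OF schwartz_rapid[OF G]] by metis
  show "integrable lborel (\<lambda>\<xi>. duhamel_symbol \<phi> G (\<xi>, t))"
  proof (rule Bochner_Integration.integrable_bound)
    show "integrable lborel (\<lambda>\<xi>. \<bar>t\<bar> * (B * (1 / (1 + \<xi>\<^sup>2))))"
      by (intro integrable_mult_right integrable_cauchy_real)
    show "AE \<xi> in lborel. cmod (duhamel_symbol \<phi> G (\<xi>, t)) \<le> norm (\<bar>t\<bar> * (B * (1 / (1 + \<xi>\<^sup>2))))"
      using bnd[OF B(2)] by (intro always_eventually allI) (metis abs_ge_self order_trans real_norm_def)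
    show "(\<lambda>\<xi>. duhamel_symbol \<phi> G (\<xi>, t)) \<in> borel_measurable lborel"
      unfolding duhamel_symbol_def time_average_def fst_conv snd_conv by measurable
  qed
qed

lemma duhamel_symbol_diff:
  assumes \<phi>: "moderate_phase \<phi>" and "schwartz G" "schwartz H"
  shows "duhamel_symbol \<phi> (\<lambda>q. G q - H q) p = duhamel_symbol \<phi> G p - duhamel_symbol \<phi> H p"
proof -
  let ?g = "\<lambda>G q. G q * exp (\<i> * complex_of_real (snd q * \<phi> (fst q)))"
  have int: "integrable lborel (\<lambda>r. indicator {0<..<1} r *\<^sub>R (complex_of_real (r ^ 0) * ?g G (fst p, r * snd p)))"
    if "schwartz G" for G
  proof -
    have g: "schwartz (?g G)" by (intro schwartz_forcing_phase \<phi> that)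
    have [measurable]: "G \<in> borel_measurable borel" by (rule schwartz_measurable[OF that])
    have [measurable]: "\<phi> \<in> borel_measurable borel"
      using moderate_measurable[OF \<phi>] by (simp add: borel_measurable_complex_iff)
    obtain B where B: "\<And>q. cmod (?g G q) \<le> B" using schwartz_bounded[OF g] by blast
    show ?thesis
    proof (rule integrable_unit_interval[where B = B])
      show "cmod (complex_of_real (r ^ 0) * ?g G (fst p, r * snd p)) \<le> B" for r
        using B[of "(fst p, r * snd p)"] by (simp only: power_0 of_real_1 mult_1)
    qed (unfold fst_conv snd_conv, measurable)
  qed
  have "time_average 0 (?g (\<lambda>q. G q - H q)) p = time_average 0 (?g G) p - time_average 0 (?g H) p"
    unfolding time_average_def
    by (subst Bochner_Integration.integral_diff[symmetric, OF int int])
       (use assms in \<open>auto simp: algebra_simps\<close>)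
  then show ?thesis unfolding duhamel_symbol_def by (simp only: right_diff_distrib)
qed

lemma forcing_diff:
  assumes "schwartz v" "schwartz v'" "schwartz w"
  shows "forcing (\<lambda>p. v p - v' p) w = (\<lambda>q. forcing v w q - forcing v' w q)"
    and "forcing w (\<lambda>p. v p - v' p) = (\<lambda>q. forcing w v q - forcing w v' q)"
proof -
  have s: "schwartz (partial_deriv (1, 0) (\<lambda>p. v p * w p))" if "schwartz v" "schwartz w" for v w :: "real \<times> real \<Rightarrow> complex"
    by (intro schwartz_partial schwartz_mult that) (simp add: Basis_real_pair)
  have pd: "partial_deriv (1, 0) (\<lambda>p. (v p - v' p) * w p) =
      (\<lambda>p. partial_deriv (1, 0) (\<lambda>p. v p * w p) p - partial_deriv (1, 0) (\<lambda>p. v' p * w p) p)"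
    unfolding left_diff_distrib
    by (rule ext, rule partial_deriv_eq[OF has_derivative_diff[OF has_derivative_partial_deriv has_derivative_partial_deriv]])
       (intro schwartz_differentiable schwartz_mult assms)+
  show 1: "forcing (\<lambda>p. v p - v' p) w = (\<lambda>q. forcing v w q - forcing v' w q)"
    unfolding forcing_def pd
    by (auto simp: fun_eq_iff intro!: fourier_diff schwartz_integrable schwartz_slice s assms)
  have sym: "forcing v w = forcing w v" for v w unfolding forcing_def by (simp add: mult.commute)
  show "forcing w (\<lambda>p. v p - v' p) = (\<lambda>q. forcing w v q - forcing w v' q)"
    using 1 by (simp add: sym[of w])
qed

lemma local_duhamel_diff:
  assumes \<phi>: "moderate_phase \<phi>" and "schwartz v" "schwartz v'" "schwartz w"
  shows "local_duhamel \<phi> \<eta> T (\<lambda>p. v p - v' p) w p = local_duhamel \<phi> \<eta> T v w p - local_duhamel \<phi> \<eta> T v' w p"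
    and "local_duhamel \<phi> \<eta> T w (\<lambda>p. v p - v' p) p = local_duhamel \<phi> \<eta> T w v p - local_duhamel \<phi> \<eta> T w v' p"
proof -
  obtain x t where p: "p = (x, t)" by force
  have int: "integrable lborel (\<lambda>\<xi>. exp (- (\<i> * complex_of_real (\<xi> * (- x)))) * duhamel_symbol \<phi> G (\<xi>, t))"
    if "schwartz G" for G
    by (intro integrable_cis_mult integrable_duhamel_symbol(1) \<phi> that) measurable
  have *: "complex_of_real (1 / sqrt (2 * pi)) *
     (complex_of_real (\<eta> (t / T)) * (LINT \<xi>|lborel. exp (- (\<i> * complex_of_real (\<xi> * (- x)))) * duhamel_symbol \<phi> (\<lambda>q. G q - H q) (\<xi>, t)))
   = complex_of_real (1 / sqrt (2 * pi)) *
     (complex_of_real (\<eta> (t / T)) * (LINT \<xi>|lborel. exp (- (\<i> * complex_of_real (\<xi> * (- x)))) * duhamel_symbol \<phi> G (\<xi>, t)))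
   - complex_of_real (1 / sqrt (2 * pi)) *
     (complex_of_real (\<eta> (t / T)) * (LINT \<xi>|lborel. exp (- (\<i> * complex_of_real (\<xi> * (- x)))) * duhamel_symbol \<phi> H (\<xi>, t)))"
    if "schwartz G" "schwartz H" for G H
    unfolding duhamel_symbol_diff[OF \<phi> that] right_diff_distrib
      Bochner_Integration.integral_diff[OF int[OF that(1)] int[OF that(2)]] ..
  show "local_duhamel \<phi> \<eta> T (\<lambda>p. v p - v' p) w p = local_duhamel \<phi> \<eta> T v w p - local_duhamel \<phi> \<eta> T v' w p"
    unfolding p local_duhamel_eq[OF \<phi> schwartz_diff[OF assms(2,3)] assms(4)] local_duhamel_eq[OF \<phi> assms(2,4)]
      local_duhamel_eq[OF \<phi> assms(3,4)] forcing_diff[OF assms(2-4)]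
    by (rule *; intro schwartz_forcing assms)
  show "local_duhamel \<phi> \<eta> T w (\<lambda>p. v p - v' p) p = local_duhamel \<phi> \<eta> T w v p - local_duhamel \<phi> \<eta> T w v' p"
    unfolding p local_duhamel_eq[OF \<phi> assms(4) schwartz_diff[OF assms(2,3)]] local_duhamel_eq[OF \<phi> assms(4,2)]
      local_duhamel_eq[OF \<phi> assms(4,3)] forcing_diff[OF assms(2-4)]
    by (rule *; intro schwartz_forcing assms)
qed

section \<open>Weighted Fourier norms and the completion of the Schwartz functions\<close>

lemma Cauchy_Schwarz_integral:
  fixes A B :: "'a \<Rightarrow> real"
  assumes [measurable]: "A \<in> borel_measurable M" "B \<in> borel_measurable M"
    and A: "integrable M (\<lambda>x. (A x)\<^sup>2)" and B: "integrable M (\<lambda>x. (B x)\<^sup>2)"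
  shows "integrable M (\<lambda>x. A x * B x)"
    and "(LINT x|M. \<bar>A x * B x\<bar>) \<le> sqrt (LINT x|M. (A x)\<^sup>2) * sqrt (LINT x|M. (B x)\<^sup>2)"
proof -
  show int: "integrable M (\<lambda>x. A x * B x)"
  proof (rule Bochner_Integration.integrable_bound[OF Bochner_Integration.integrable_add[OF A B]])
    have "\<bar>A x * B x\<bar> \<le> (A x)\<^sup>2 + (B x)\<^sup>2" for x
    proof -
      have "0 \<le> (\<bar>A x\<bar> - \<bar>B x\<bar>)\<^sup>2" by simp
      then have "2 * \<bar>A x * B x\<bar> \<le> (A x)\<^sup>2 + (B x)\<^sup>2" by (simp add: power2_eq_square algebra_simps abs_mult)
      then show ?thesis using abs_ge_zero[of "A x * B x"] by linarith
    qed
    then show "AE x in M. norm (A x * B x) \<le> norm ((A x)\<^sup>2 + (B x)\<^sup>2)" by simp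
  qed simp
  define I where "I = (LINT x|M. \<bar>A x * B x\<bar>)"
  have I0: "I \<ge> 0" unfolding I_def by (rule Bochner_Integration.integral_nonneg) simp
  have "ennreal (I\<^sup>2) = (\<integral>\<^sup>+x. ennreal \<bar>A x\<bar> * ennreal \<bar>B x\<bar> \<partial>M)\<^sup>2"
  proof -
    have "(\<integral>\<^sup>+x. ennreal \<bar>A x\<bar> * ennreal \<bar>B x\<bar> \<partial>M) = (\<integral>\<^sup>+x. ennreal \<bar>A x * B x\<bar> \<partial>M)"
      by (simp add: abs_mult ennreal_mult)
    also have "\<dots> = ennreal I"
      unfolding I_def by (rule nn_integral_eq_integral) (use int in auto)
    finally show ?thesis using I0 by (simp add: ennreal_power)
  qed
  also have "\<dots> \<le> (\<integral>\<^sup>+x. (ennreal \<bar>A x\<bar>)\<^sup>2 \<partial>M) * (\<integral>\<^sup>+x. (ennreal \<bar>B x\<bar>)\<^sup>2 \<partial>M)"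
    by (rule Cauchy_Schwarz_nn_integral) auto
  also have "(\<integral>\<^sup>+x. (ennreal \<bar>A x\<bar>)\<^sup>2 \<partial>M) = ennreal (LINT x|M. (A x)\<^sup>2)"
    using nn_integral_eq_integral[OF A] by (simp add: ennreal_power)
  also have "(\<integral>\<^sup>+x. (ennreal \<bar>B x\<bar>)\<^sup>2 \<partial>M) = ennreal (LINT x|M. (B x)\<^sup>2)"
    using nn_integral_eq_integral[OF B] by (simp add: ennreal_power)
  finally have "I\<^sup>2 \<le> (LINT x|M. (A x)\<^sup>2) * (LINT x|M. (B x)\<^sup>2)"
    by (simp add: ennreal_mult[symmetric])
  then show "(LINT x|M. \<bar>A x * B x\<bar>) \<le> sqrt (LINT x|M. (A x)\<^sup>2) * sqrt (LINT x|M. (B x)\<^sup>2)"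
    unfolding I_def[symmetric] real_sqrt_mult[symmetric] using real_le_rsqrt by blast
qed

lemma schwartz_cnj:
  assumes "schwartz (f :: 'a::euclidean_space \<Rightarrow> complex)" shows "schwartz (\<lambda>x. cnj (f x))"
proof -
  let ?C = "\<lambda>h. \<exists>f::'a \<Rightarrow> complex. schwartz f \<and> h = (\<lambda>x. cnj (f x))"
  have d: "((\<lambda>x. cnj (f x)) has_derivative (\<lambda>h. cnj (partial_deriv h f x))) (at x)"
    if "schwartz f" for f :: "'a \<Rightarrow> complex" and x
    by (rule bounded_linear.has_derivative[OF bounded_linear_cnj has_derivative_partial_deriv[OF schwartz_differentiable[OF that]]])
  have "?C (\<lambda>x. cnj (f x))" using assms by blast
  then have "all_derivs rapid (\<lambda>x. cnj (f x))"
  proof (rule all_derivs_coinduct[where C = ?C], goal_cases)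
    case (1 g x) then show ?case using d differentiableI by blast
  next
    case (2 g) then show ?case using schwartz_rapid unfolding rapid_def by fastforce
  next
    case (3 g h) then show ?case by (rule rapid_add)
  next
    case (4 h i)
    then obtain g where g: "schwartz g" "h = (\<lambda>x. cnj (g x))" by blast
    have "partial_deriv i h = (\<lambda>x. cnj (partial_deriv i g x))"
      unfolding g(2) by (rule ext, rule partial_deriv_eq[OF d[OF g(1)]])
    then show ?case using schwartz_partial[OF g(1) 4(2)] by blast
  qed
  then show ?thesis by (simp only: schwartz_iff)
qed

text \<open>Common form of the Sobolev and Bourgain norms, so that the theory of completions and
  extensions is done once.\<close>

definition wnorm :: "('a::euclidean_space \<Rightarrow> real) \<Rightarrow> ('a \<Rightarrow> complex) \<Rightarrow> real" where
  "wnorm W f = sqrt (LINT p|lborel. (W p * cmod (fourier f p))\<^sup>2)"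

lemma wnorm_nonneg: "wnorm W f \<ge> 0"
  unfolding wnorm_def by (auto intro!: Bochner_Integration.integral_nonneg)

text \<open>Smoothness is asked of the square of \<open>W\<close>, because the argument with inner
  products multiplies a Schwartz function by it; for the inverse square a growth bound suffices for
  integrability. Inversion is an assumption so that the locale covers one and two variables
  alike.\<close>

locale fourier_weight =
  fixes W :: "'a::euclidean_space \<Rightarrow> real"
  assumes W_pos: "W p > 0"
    and W_sq: "moderate (\<lambda>p. complex_of_real ((W p)\<^sup>2))"
    and W_inv: "slow (\<lambda>p. complex_of_real (1 / (W p)\<^sup>2))"
    and W_measurable [measurable]: "W \<in> borel_measurable borel"
    and inversion: "schwartz f \<Longrightarrow> fourier (fourier f) p = f (- p)"
begin

lemma weighted_square_integrable:
  assumes "schwartz f"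
  shows "integrable lborel (\<lambda>p. (W p * cmod (f p))\<^sup>2)" and "integrable lborel (\<lambda>p. (cmod (f p) / W p)\<^sup>2)"
proof -
  have [measurable]: "f \<in> borel_measurable borel" using assms by (rule schwartz_measurable)
  have r: "rapid f" using assms by (rule schwartz_rapid)
  have "integrable lborel (\<lambda>p. f p * f p * complex_of_real ((W p)\<^sup>2))"
    by (intro rapid_integrable rapid_mult_slow r rapid_imp_slow all_derivs_self[OF W_sq]) measurable
  from integrable_norm[OF this] show "integrable lborel (\<lambda>p. (W p * cmod (f p))\<^sup>2)"
    by (simp add: norm_mult power2_eq_square mult_ac abs_mult abs_of_pos[OF W_pos] del: of_real_mult of_real_power)
  have "integrable lborel (\<lambda>p. f p * f p * complex_of_real (1 / (W p)\<^sup>2))"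
    by (intro rapid_integrable rapid_mult_slow r rapid_imp_slow W_inv) measurable
  from integrable_norm[OF this] show "integrable lborel (\<lambda>p. (cmod (f p) / W p)\<^sup>2)"
    by (simp add: norm_mult norm_divide power2_eq_square mult_ac abs_mult abs_of_pos[OF W_pos] del: of_real_mult of_real_power of_real_divide)
qed

lemma fourier_measurable: "schwartz f \<Longrightarrow> fourier f \<in> borel_measurable borel"
  by (intro schwartz_measurable schwartz_fourier)

lemma wnorm_sq: "(wnorm W f)\<^sup>2 = (LINT p|lborel. (W p * cmod (fourier f p))\<^sup>2)"
  unfolding wnorm_def by (intro real_sqrt_pow2 Bochner_Integration.integral_nonneg) auto

text \<open>Stated through a pointwise inequality between transforms, so that all variants of the
  triangle inequality below are instances.\<close>

lemma wnorm_triangle_gen: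
  assumes "schwartz f" "schwartz g" "schwartz h"
    and le: "\<And>p. cmod (fourier h p) \<le> cmod (fourier f p) + cmod (fourier g p)"
  shows "wnorm W h \<le> wnorm W f + wnorm W g"
proof -
  note [measurable] = fourier_measurable[OF assms(1)] fourier_measurable[OF assms(2)]
  let ?A = "\<lambda>f p. W p * cmod (fourier f p)"
  note int = weighted_square_integrable(1)[OF schwartz_fourier]
  have cs: "integrable lborel (\<lambda>p. ?A f p * ?A g p)"
    "(LINT p|lborel. \<bar>?A f p * ?A g p\<bar>) \<le> wnorm W f * wnorm W g"
    unfolding wnorm_def by (rule Cauchy_Schwarz_integral; use int assms in measurable)+
  have "(wnorm W h)\<^sup>2 \<le> (LINT p|lborel. (?A f p)\<^sup>2 + (?A g p)\<^sup>2 + 2 * (?A f p * ?A g p))"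
    unfolding wnorm_sq
  proof (rule integral_mono)
    show "integrable lborel (\<lambda>p. (?A f p)\<^sup>2 + (?A g p)\<^sup>2 + 2 * (?A f p * ?A g p))"
      by (intro Bochner_Integration.integrable_add integrable_mult_right cs int assms)
    fix p
    have "?A h p \<le> ?A f p + ?A g p"
      using mult_left_mono[OF le[of p], of "W p"] W_pos[of p] by (simp add: distrib_left)
    moreover have "0 \<le> ?A h p" using W_pos[of p] by simp
    ultimately have "(?A h p)\<^sup>2 \<le> (?A f p + ?A g p)\<^sup>2" by (rule power_mono)
    then show "(?A h p)\<^sup>2 \<le> (?A f p)\<^sup>2 + (?A g p)\<^sup>2 + 2 * (?A f p * ?A g p)" by (simp add: power2_sum)
  qed (intro int assms)
  also have "\<dots> = (wnorm W f)\<^sup>2 + (wnorm W g)\<^sup>2 + 2 * (LINT p|lborel. ?A f p * ?A g p)"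
    unfolding wnorm_sq using cs(1) int[OF assms(1)] int[OF assms(2)] by simp
  also have "\<dots> \<le> (wnorm W f)\<^sup>2 + (wnorm W g)\<^sup>2 + 2 * (wnorm W f * wnorm W g)"
  proof -
    have "(LINT p|lborel. ?A f p * ?A g p) \<le> (LINT p|lborel. \<bar>?A f p * ?A g p\<bar>)"
      by (intro integral_mono integrable_abs cs) auto
    then show ?thesis using cs(2) by linarith
  qed
  also have "\<dots> = (wnorm W f + wnorm W g)\<^sup>2" by (simp add: power2_sum)
  finally show ?thesis by (rule power2_le_imp_le) (simp add: wnorm_nonneg)
qed

lemma fourier_schwartz_diff:
  "schwartz f \<Longrightarrow> schwartz g \<Longrightarrow> fourier (\<lambda>x. f x - g x) p = fourier f p - fourier g p"
  by (intro fourier_diff schwartz_integrable)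

lemma wnorm_triangle:
  assumes "schwartz f" "schwartz g" "schwartz h"
  shows "wnorm W (\<lambda>x. f x - h x) \<le> wnorm W (\<lambda>x. f x - g x) + wnorm W (\<lambda>x. g x - h x)"
proof (rule wnorm_triangle_gen)
  show "cmod (fourier (\<lambda>x. f x - h x) p) \<le> cmod (fourier (\<lambda>x. f x - g x) p) + cmod (fourier (\<lambda>x. g x - h x) p)" for p
    using norm_triangle_ineq[of "fourier f p - fourier g p" "fourier g p - fourier h p"]
    by (simp add: fourier_schwartz_diff assms)
qed (intro schwartz_diff assms)+

lemma wnorm_diff_le:
  assumes "schwartz f" "schwartz g"
  shows "wnorm W (\<lambda>x. f x - g x) \<le> wnorm W f + wnorm W g" and "wnorm W f \<le> wnorm W (\<lambda>x. f x - g x) + wnorm W g"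
proof -
  show "wnorm W (\<lambda>x. f x - g x) \<le> wnorm W f + wnorm W g"
    by (rule wnorm_triangle_gen) (auto simp: fourier_schwartz_diff assms norm_triangle_ineq4 intro: schwartz_diff assms)
  show "wnorm W f \<le> wnorm W (\<lambda>x. f x - g x) + wnorm W g"
  proof (rule wnorm_triangle_gen)
    show "cmod (fourier f p) \<le> cmod (fourier (\<lambda>x. f x - g x) p) + cmod (fourier g p)" for p
      using norm_triangle_ineq[of "fourier f p - fourier g p" "fourier g p"] by (simp add: fourier_schwartz_diff assms)
  qed (intro schwartz_diff assms)+
qed

lemma wnorm_diff_commute:
  assumes "schwartz f" "schwartz g"
  shows "wnorm W (\<lambda>x. f x - g x) = wnorm W (\<lambda>x. g x - f x)"
  unfolding wnorm_def by (simp add: fourier_schwartz_diff assms norm_minus_commute)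

text \<open>Writing \<open>\<psi>\<close> as the Fourier transform of some \<open>k\<close>, the pairing of \<open>h\<close> with \<open>\<psi>\<close> becomes the
  integral of \<open>fourier h\<close> against \<open>k\<close>.\<close>

lemma pairing_bound:
  assumes \<psi>: "schwartz \<psi>"
  obtains C where "C \<ge> 0" "\<And>h. schwartz h \<Longrightarrow> cmod (LINT x|lborel. h x * \<psi> x) \<le> C * wnorm W h"
proof -
  define k where "k = fourier (\<lambda>x. \<psi> (- x))"
  have k: "schwartz k" unfolding k_def by (intro schwartz_fourier schwartz_uminus \<psi>)
  have [measurable]: "k \<in> borel_measurable borel" by (rule schwartz_measurable[OF k])
  have \<psi>_eq: "\<psi> x = fourier k x" for x
    unfolding k_def using inversion[OF schwartz_uminus[OF \<psi>], of x] by simp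
  have "cmod (LINT x|lborel. h x * \<psi> x) \<le> sqrt (LINT p|lborel. (cmod (k p) / W p)\<^sup>2) * wnorm W h"
    if h: "schwartz h" for h
  proof -
    note [measurable] = fourier_measurable[OF h]
    have cs: "(LINT p|lborel. \<bar>(cmod (k p) / W p) * (W p * cmod (fourier h p))\<bar>) \<le> sqrt (LINT p|lborel. (cmod (k p) / W p)\<^sup>2) * wnorm W h"
      unfolding wnorm_def by (rule Cauchy_Schwarz_integral)
        (use weighted_square_integrable(1)[OF schwartz_fourier[OF h]] weighted_square_integrable(2)[OF k] in measurable)
    have "(LINT x|lborel. h x * \<psi> x) = (LINT x|lborel. fourier h x * k x)"
      unfolding \<psi>_eq by (intro fourier_multiplication[symmetric] schwartz_integrable h k)
    then have "cmod (LINT x|lborel. h x * \<psi> x) \<le> (LINT x|lborel. cmod (fourier h x * k x))"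
      by simp
    also have "\<dots> = (LINT p|lborel. \<bar>(cmod (k p) / W p) * (W p * cmod (fourier h p))\<bar>)"
      using W_pos by (intro Bochner_Integration.integral_cong refl) (simp add: norm_mult abs_mult less_imp_neq[OF W_pos, symmetric])
    finally show ?thesis using cs by linarith
  qed
  then show ?thesis
    by (intro that[of "sqrt (LINT p|lborel. (cmod (k p) / W p)\<^sup>2)"]) (auto intro!: Bochner_Integration.integral_nonneg)
qed

lemma pairing_diff:
  assumes "schwartz f" "schwartz g" "schwartz \<psi>"
  shows "(LINT x|lborel. (f x - g x) * \<psi> x) = (LINT x|lborel. f x * \<psi> x) - (LINT x|lborel. g x * \<psi> x)"
  unfolding left_diff_distrib
  by (intro Bochner_Integration.integral_diff schwartz_integrable schwartz_mult_moderate schwartz_imp_moderate assms)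

lemma schwartz_test_fun: "schwartz (Rep_test_fun \<psi>)"
  using Rep_test_fun[of \<psi>] by simp

text \<open>Testing against \<open>\<psi> = fourier (W\<^sup>2 * cnj (fourier (h n)))\<close> gives the inner product with \<open>h n\<close>.\<close>

lemma null_distribution_null_norm:
  assumes h: "\<And>n. schwartz (h n)"
    and C: "\<And>e. e > 0 \<Longrightarrow> \<exists>M. \<forall>m\<ge>M. \<forall>n\<ge>M. wnorm W (\<lambda>x. h m x - h n x) < e"
    and lim: "\<And>\<psi>. (\<lambda>n. LINT x|lborel. h n x * Rep_test_fun \<psi> x) \<longlonglongrightarrow> 0"
  shows "(\<lambda>n. wnorm W (h n)) \<longlonglongrightarrow> 0"
proof (rule LIMSEQ_I)
  fix e :: real assume "e > 0"
  then have "e / 2 > 0" by simp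
  from C[OF this] obtain M where M: "\<And>m n. m \<ge> M \<Longrightarrow> n \<ge> M \<Longrightarrow> wnorm W (\<lambda>x. h m x - h n x) < e / 2" by blast
  have "wnorm W (h n) \<le> e / 2" if n: "n \<ge> M" for n
  proof -
    define k where "k = (\<lambda>p. cnj (fourier (h n) p) * complex_of_real ((W p)\<^sup>2))"
    have k: "schwartz k" unfolding k_def
      by (intro schwartz_mult_moderate[OF _ W_sq] schwartz_cnj schwartz_fourier h)
    have [measurable]: "k \<in> borel_measurable borel" by (rule schwartz_measurable[OF k])
    note [measurable] = fourier_measurable[OF h]
    have pair: "(LINT p|lborel. fourier g p * k p) = (LINT x|lborel. g x * fourier k x)" if "schwartz g" for g
      by (intro fourier_multiplication schwartz_integrable that k)
    have self: "(LINT p|lborel. fourier (h n) p * k p) = complex_of_real ((wnorm W (h n))\<^sup>2)"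
    proof -
      have "fourier (h n) p * k p = complex_of_real ((W p * cmod (fourier (h n) p))\<^sup>2)" for p
        unfolding k_def by (simp add: complex_norm_square power_mult_distrib mult_ac del: of_real_power)
      then show ?thesis unfolding wnorm_sq by (simp only: integral_complex_of_real)
    qed
    \<comment> \<open>With \<open>n\<close> fixed, \<open>h n\<close> is compared with
      \<open>h m\<close>: the first term is small by the Cauchy property, and the second tends to 0
      as \<open>m\<close> grows.\<close>
    have bnd: "(wnorm W (h n))\<^sup>2 \<le> e / 2 * wnorm W (h n) + cmod (LINT x|lborel. h m x * fourier k x)" if m: "m \<ge> M" for m
    proof -
      let ?d = "\<lambda>x. h n x - h m x"
      have d: "schwartz ?d" by (intro schwartz_diff h)
      note [measurable] = fourier_measurable[OF d]
      have cs: "(LINT p|lborel. \<bar>(W p * cmod (fourier ?d p)) * (W p * cmod (fourier (h n) p))\<bar>) \<le> wnorm W ?d * wnorm W (h n)"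
        unfolding wnorm_def by (rule Cauchy_Schwarz_integral)
          (use weighted_square_integrable(1)[OF schwartz_fourier[OF d]] weighted_square_integrable(1)[OF schwartz_fourier[OF h]] in measurable)
      have "complex_of_real ((wnorm W (h n))\<^sup>2) = (LINT x|lborel. h n x * fourier k x)"
        using self pair[OF h] by simp
      also have "\<dots> = (LINT x|lborel. ?d x * fourier k x) + (LINT x|lborel. h m x * fourier k x)"
        by (subst pairing_diff) (auto intro: h schwartz_fourier k)
      also have "(LINT x|lborel. ?d x * fourier k x) = (LINT p|lborel. fourier ?d p * k p)"
        by (rule pair[OF d, symmetric])
      finally have "(wnorm W (h n))\<^sup>2 \<le> cmod (LINT p|lborel. fourier ?d p * k p) + cmod (LINT x|lborel. h m x * fourier k x)"
        using norm_triangle_ineq[of "LINT p|lborel. fourier ?d p * k p" "LINT x|lborel. h m x * fourier k x"]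
        by (metis abs_of_nonneg norm_of_real zero_le_power2)
      also have "cmod (LINT p|lborel. fourier ?d p * k p) \<le> (LINT p|lborel. cmod (fourier ?d p * k p))" by simp
      also have "\<dots> = (LINT p|lborel. \<bar>(W p * cmod (fourier ?d p)) * (W p * cmod (fourier (h n) p))\<bar>)"
        unfolding k_def using W_pos
        by (intro Bochner_Integration.integral_cong refl)
           (simp add: norm_mult abs_mult power2_eq_square abs_of_pos[OF W_pos] mult_ac)
      also have "\<dots> \<le> e / 2 * wnorm W (h n)"
        using cs mult_right_mono[OF less_imp_le[OF M[OF n m]] wnorm_nonneg[of W "h n"]] by linarith
      finally show ?thesis by simp
    qed
    have "(\<lambda>m. LINT x|lborel. h m x * fourier k x) \<longlonglongrightarrow> 0"
      using lim[of "Abs_test_fun (fourier k)"] schwartz_fourier[OF k] by (simp add: Abs_test_fun_inverse)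
    then have "(\<lambda>m. e / 2 * wnorm W (h n) + cmod (LINT x|lborel. h m x * fourier k x)) \<longlonglongrightarrow> e / 2 * wnorm W (h n) + cmod 0"
      by (intro tendsto_intros)
    then have "(wnorm W (h n))\<^sup>2 \<le> e / 2 * wnorm W (h n) + cmod 0"
      by (rule LIMSEQ_le_const) (use bnd in blast)
    then have "wnorm W (h n) * wnorm W (h n) \<le> e / 2 * wnorm W (h n)" by (simp add: power2_eq_square)
    then show ?thesis using wnorm_nonneg[of W "h n"] \<open>e > 0\<close>
      by (cases "wnorm W (h n) = 0") (auto simp: mult_le_cancel_right)
  qed
  then have "norm (wnorm W (h n) - 0) < e" if "n \<ge> M" for n
    using that \<open>e > 0\<close> wnorm_nonneg[of W "h n"] by fastforce
  then show "\<exists>M. \<forall>n\<ge>M. norm (wnorm W (h n) - 0) < e" by blast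
qed

section \<open>Approximating sequences and their limits in the completion\<close>

lemma approximates_schwartz: "approximates (wnorm W) f v \<Longrightarrow> schwartz (f n)"
  unfolding approximates_def by blast

lemma approximates_Cauchy:
  "approximates (wnorm W) f v \<Longrightarrow> e > 0 \<Longrightarrow> \<exists>M. \<forall>m\<ge>M. \<forall>n\<ge>M. wnorm W (\<lambda>x. f m x - f n x) < e"
  unfolding approximates_def by blast

lemma approximates_tendsto:
  "approximates (wnorm W) f v \<Longrightarrow> (\<lambda>n. LINT x|lborel. f n x * Rep_test_fun \<psi> x) \<longlonglongrightarrow> v \<psi>"
  unfolding approximates_def by blast

lemma approximates_unique: "approximates (wnorm W) f v \<Longrightarrow> approximates (wnorm W) f w \<Longrightarrow> v = w"
  by (intro ext) (blast intro: LIMSEQ_unique approximates_tendsto)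

lemma approximates_bounded:
  assumes "approximates (wnorm W) f v"
  obtains K where "K > 0" "\<And>n. wnorm W (f n) \<le> K"
proof -
  note s = approximates_schwartz[OF assms]
  from approximates_Cauchy[OF assms, of 1] obtain M where M: "\<And>m n. m \<ge> M \<Longrightarrow> n \<ge> M \<Longrightarrow> wnorm W (\<lambda>x. f m x - f n x) < 1"
    by auto
  define K where "K = Max (insert (1 + wnorm W (f M)) ((\<lambda>n. wnorm W (f n)) ` {..M}))"
  have fin: "finite (insert (1 + wnorm W (f M)) ((\<lambda>n. wnorm W (f n)) ` {..M}))" by simp
  have "wnorm W (f n) \<le> K" for n
  proof (cases "n \<le> M")
    case True then show ?thesis unfolding K_def by (intro Max_ge fin) auto
  next
    case False
    then have "wnorm W (f n) \<le> 1 + wnorm W (f M)"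
      using wnorm_diff_le(2)[OF s[of n] s[of M]] M[of n M] by simp
    also have "\<dots> \<le> K" unfolding K_def by (intro Max_ge fin) auto
    finally show ?thesis .
  qed
  moreover have "K > 0"
  proof -
    have "0 < 1 + wnorm W (f M)" using wnorm_nonneg[of W "f M"] by simp
    also have "\<dots> \<le> K" unfolding K_def by (intro Max_ge fin) auto
    finally show ?thesis .
  qed
  ultimately show ?thesis using that by blast
qed

lemma approximates_diff:
  assumes f: "approximates (wnorm W) f v" and g: "approximates (wnorm W) g w"
  shows "approximates (wnorm W) (\<lambda>n x. f n x - g n x) (\<lambda>\<psi>. v \<psi> - w \<psi>)"
  unfolding approximates_def
proof (intro conjI allI impI)
  note sf = approximates_schwartz[OF f] and sg = approximates_schwartz[OF g]
  show "schwartz (\<lambda>x. f n x - g n x)" for n by (intro schwartz_diff sf sg)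
  show "\<exists>M. \<forall>m\<ge>M. \<forall>n\<ge>M. wnorm W (\<lambda>x. (f m x - g m x) - (f n x - g n x)) < e" if "e > 0" for e
  proof -
    have "e / 2 > 0" using that by simp
    from approximates_Cauchy[OF f this] approximates_Cauchy[OF g this] obtain M1 M2 where
      M: "\<And>m n. m \<ge> M1 \<Longrightarrow> n \<ge> M1 \<Longrightarrow> wnorm W (\<lambda>x. f m x - f n x) < e / 2"
      "\<And>m n. m \<ge> M2 \<Longrightarrow> n \<ge> M2 \<Longrightarrow> wnorm W (\<lambda>x. g m x - g n x) < e / 2" by blast
    have "wnorm W (\<lambda>x. (f m x - g m x) - (f n x - g n x)) < e" if "m \<ge> max M1 M2" "n \<ge> max M1 M2" for m n
    proof -
      have "wnorm W (\<lambda>x. (f m x - f n x) - (g m x - g n x)) \<le> wnorm W (\<lambda>x. f m x - f n x) + wnorm W (\<lambda>x. g m x - g n x)"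
        by (intro wnorm_diff_le schwartz_diff sf sg)
      also have "\<dots> < e" using M(1)[of m n] M(2)[of m n] that by simp
      finally show ?thesis by (simp add: algebra_simps)
    qed
    then show ?thesis by blast
  qed
  fix \<psi>
  from tendsto_diff[OF approximates_tendsto[OF f, of \<psi>] approximates_tendsto[OF g, of \<psi>]]
  show "(\<lambda>n. LINT x|lborel. (f n x - g n x) * Rep_test_fun \<psi> x) \<longlonglongrightarrow> v \<psi> - w \<psi>"
    by (simp add: pairing_diff sf sg schwartz_test_fun)
qed

lemma approximates_difference_null:
  assumes "approximates (wnorm W) f v" and "approximates (wnorm W) g v"
  shows "(\<lambda>n. wnorm W (\<lambda>x. f n x - g n x)) \<longlonglongrightarrow> 0"
proof -
  note d = approximates_diff[OF assms]
  show ?thesis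
    by (rule null_distribution_null_norm)
       (use approximates_schwartz[OF d] approximates_Cauchy[OF d] approximates_tendsto[OF d] in auto)
qed

text \<open>By \<open>pairing_bound\<close> a perturbation that is null in norm is null as a
  distribution. Together with \<open>approximates_difference_null\<close> this makes extensions
  independent of the approximating sequence.\<close>

lemma approximates_perturb:
  assumes f: "approximates (wnorm W) f v" and g: "\<And>n. schwartz (g n)"
    and null: "(\<lambda>n. wnorm W (\<lambda>x. f n x - g n x)) \<longlonglongrightarrow> 0"
  shows "approximates (wnorm W) g v"
  unfolding approximates_def
proof (intro conjI allI impI)
  note sf = approximates_schwartz[OF f]
  show "schwartz (g n)" for n by (rule g)
  show "\<exists>M. \<forall>m\<ge>M. \<forall>n\<ge>M. wnorm W (\<lambda>x. g m x - g n x) < e" if "e > 0" for e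
  proof -
    have e3: "e / 3 > 0" using that by simp
    from approximates_Cauchy[OF f e3] obtain M1 where
      M1: "\<And>m n. m \<ge> M1 \<Longrightarrow> n \<ge> M1 \<Longrightarrow> wnorm W (\<lambda>x. f m x - f n x) < e / 3" by blast
    from LIMSEQ_D[OF null e3] obtain M2 where M2: "\<And>n. n \<ge> M2 \<Longrightarrow> wnorm W (\<lambda>x. f n x - g n x) < e / 3"
      by (auto simp: wnorm_nonneg)
    have "wnorm W (\<lambda>x. g m x - g n x) < e" if "m \<ge> max M1 M2" "n \<ge> max M1 M2" for m n
    proof -
      have "wnorm W (\<lambda>x. g m x - g n x) \<le> wnorm W (\<lambda>x. g m x - f m x) + wnorm W (\<lambda>x. f m x - g n x)"
        by (rule wnorm_triangle[OF g sf g])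
      also have "wnorm W (\<lambda>x. f m x - g n x) \<le> wnorm W (\<lambda>x. f m x - f n x) + wnorm W (\<lambda>x. f n x - g n x)"
        by (rule wnorm_triangle[OF sf sf g])
      finally show ?thesis using M1[of m n] M2[of m] M2[of n] that wnorm_diff_commute[OF g sf, of m m] by simp
    qed
    then show ?thesis by blast
  qed
  fix \<psi>
  obtain C where C: "C \<ge> 0" "\<And>h. schwartz h \<Longrightarrow> cmod (LINT x|lborel. h x * Rep_test_fun \<psi> x) \<le> C * wnorm W h"
    using pairing_bound[OF schwartz_test_fun] by blast
  have "(\<lambda>n. LINT x|lborel. (f n x - g n x) * Rep_test_fun \<psi> x) \<longlonglongrightarrow> 0"
    by (rule Lim_null_comparison[OF always_eventually tendsto_mult_right_zero[OF null, of C]])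
       (use C schwartz_diff[OF sf g] in auto)
  from tendsto_diff[OF approximates_tendsto[OF f, of \<psi>] this]
  show "(\<lambda>n. LINT x|lborel. g n x * Rep_test_fun \<psi> x) \<longlonglongrightarrow> v \<psi>"
    by (simp add: pairing_diff sf g schwartz_test_fun)
qed

text \<open>Completeness: the norm controls every pairing, so the pairings converge and define the
  limit distribution pointwise.\<close>

lemma Cauchy_approximates:
  assumes f: "\<And>n. schwartz (f n)"
    and C: "\<And>e. e > 0 \<Longrightarrow> \<exists>M. \<forall>m\<ge>M. \<forall>n\<ge>M. wnorm W (\<lambda>x. f m x - f n x) < e"
  obtains v where "approximates (wnorm W) f v"
proof -
  have "convergent (\<lambda>n. LINT x|lborel. f n x * Rep_test_fun \<psi> x)" for \<psi>
  proof -
    obtain K where K: "K \<ge> 0" "\<And>h. schwartz h \<Longrightarrow> cmod (LINT x|lborel. h x * Rep_test_fun \<psi> x) \<le> K * wnorm W h"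
      using pairing_bound[OF schwartz_test_fun] by blast
    have "Cauchy (\<lambda>n. LINT x|lborel. f n x * Rep_test_fun \<psi> x)"
    proof (rule CauchyI)
      fix e :: real assume "e > 0"
      \<comment> \<open>The summand 1 is there because \<open>K\<close> may vanish.\<close>
      then have "e / (K + 1) > 0" using K(1) by simp
      from C[OF this] obtain M where M: "\<And>m n. m \<ge> M \<Longrightarrow> n \<ge> M \<Longrightarrow> wnorm W (\<lambda>x. f m x - f n x) < e / (K + 1)" by blast
      have "norm ((LINT x|lborel. f m x * Rep_test_fun \<psi> x) - (LINT x|lborel. f n x * Rep_test_fun \<psi> x)) < e"
        if "m \<ge> M" "n \<ge> M" for m n
      proof -
        have "norm ((LINT x|lborel. f m x * Rep_test_fun \<psi> x) - (LINT x|lborel. f n x * Rep_test_fun \<psi> x)) \<le> K * wnorm W (\<lambda>x. f m x - f n x)"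
          using K(2)[OF schwartz_diff[OF f f], of m n] by (simp add: pairing_diff f schwartz_test_fun)
        also have "\<dots> \<le> K * (e / (K + 1))" using M[OF that] K(1) by (intro mult_left_mono) auto
        also have "\<dots> < e" using K(1) \<open>e > 0\<close> by (simp add: divide_less_eq)
        finally show ?thesis .
      qed
      then show "\<exists>M. \<forall>m\<ge>M. \<forall>n\<ge>M. norm ((LINT x|lborel. f m x * Rep_test_fun \<psi> x) - (LINT x|lborel. f n x * Rep_test_fun \<psi> x)) < e" by blast
    qed
    then show ?thesis by (simp add: Cauchy_convergent_iff)
  qed
  then have "approximates (wnorm W) f (\<lambda>\<psi>. lim (\<lambda>n. LINT x|lborel. f n x * Rep_test_fun \<psi> x))"
    unfolding approximates_def using f C convergent_LIMSEQ_iff by blast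
  then show ?thesis by (rule that)
qed

end

text \<open>The definite description in \<open>extension\<close> is attained. Boundedness carries
  Cauchy sequences to Cauchy sequences, which gives a limit \<open>z\<close>; two sequences for the
  same \<open>v\<close> differ by a null sequence, so all of them lead to \<open>z\<close>; and
  since \<open>v\<close> has an approximating sequence at all, \<open>z\<close> is the only
  candidate.\<close>

lemma extension_approximates:
  assumes "fourier_weight W" "fourier_weight W'"
    and A: "\<And>f. schwartz f \<Longrightarrow> schwartz (A f)"
    and diff: "\<And>f g. schwartz f \<Longrightarrow> schwartz g \<Longrightarrow> A (\<lambda>x. f x - g x) = (\<lambda>x. A f x - A g x)"
    and bound: "\<And>f. schwartz f \<Longrightarrow> wnorm W' (A f) \<le> C * wnorm W f"
    and f: "approximates (wnorm W) f v"
  shows "approximates (wnorm W') (\<lambda>n. A (f n)) (extension (wnorm W) (wnorm W') A v)"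
proof -
  interpret W: fourier_weight W by fact
  interpret W': fourier_weight W' by fact
  note sf = W.approximates_schwartz[OF f]
  \<comment> \<open>\<open>C\<close> carries no sign condition, so its absolute value is
    used.\<close>
  have bd: "wnorm W' (\<lambda>x. A g x - A h x) \<le> \<bar>C\<bar> * wnorm W (\<lambda>x. g x - h x)" if "schwartz g" "schwartz h" for g h
  proof -
    have "wnorm W' (\<lambda>x. A g x - A h x) \<le> C * wnorm W (\<lambda>x. g x - h x)"
      using bound[OF schwartz_diff[OF that]] by (simp add: diff that)
    also have "\<dots> \<le> \<bar>C\<bar> * wnorm W (\<lambda>x. g x - h x)" by (intro mult_right_mono wnorm_nonneg) auto
    finally show ?thesis .
  qed
  obtain z where z: "approximates (wnorm W') (\<lambda>n. A (f n)) z"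
  proof (rule W'.Cauchy_approximates)
    show "schwartz (A (f n))" for n by (intro A sf)
    fix e :: real assume "e > 0"
    then have "e / (\<bar>C\<bar> + 1) > 0" by simp
    from W.approximates_Cauchy[OF f this] obtain M where M: "\<And>m n. m \<ge> M \<Longrightarrow> n \<ge> M \<Longrightarrow> wnorm W (\<lambda>x. f m x - f n x) < e / (\<bar>C\<bar> + 1)" by blast
    have "wnorm W' (\<lambda>x. A (f m) x - A (f n) x) < e" if "m \<ge> M" "n \<ge> M" for m n
    proof -
      have "wnorm W' (\<lambda>x. A (f m) x - A (f n) x) \<le> \<bar>C\<bar> * (e / (\<bar>C\<bar> + 1))"
        by (rule order_trans[OF bd[OF sf sf] mult_left_mono]) (use M[OF that] in auto)
      also have "\<dots> < e" using \<open>e > 0\<close> by (simp add: divide_less_eq)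
      finally show ?thesis .
    qed
    then show "\<exists>M. \<forall>m\<ge>M. \<forall>n\<ge>M. wnorm W' (\<lambda>x. A (f m) x - A (f n) x) < e" by blast
  qed
  have all: "\<forall>g. approximates (wnorm W) g v \<longrightarrow> approximates (wnorm W') (\<lambda>n. A (g n)) z"
  proof (intro allI impI)
    fix g assume g: "approximates (wnorm W) g v"
    note sg = W.approximates_schwartz[OF g]
    show "approximates (wnorm W') (\<lambda>n. A (g n)) z"
    proof (rule W'.approximates_perturb[OF z])
      show "schwartz (A (g n))" for n by (intro A sg)
      show "(\<lambda>n. wnorm W' (\<lambda>x. A (f n) x - A (g n) x)) \<longlonglongrightarrow> 0"
        by (rule Lim_null_comparison[OF always_eventually tendsto_mult_right_zero[OF W.approximates_difference_null[OF f g], of "\<bar>C\<bar>"]])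
           (use bd[OF sf sg] in \<open>auto simp: wnorm_nonneg\<close>)
    qed
  qed
  have "extension (wnorm W) (wnorm W') A v = z"
    unfolding extension_def
    by (rule the_equality) (use all f W'.approximates_unique z in blast)+
  then show ?thesis using z by simp
qed

text \<open>A bilinear map is Lipschitz only on bounded sets:
  \<open>A f g - A f' g' = A (f - f') g + A f' (g - g')\<close>. The argument for linear maps is
  repeated with the bounds \<open>K\<close> and \<open>L\<close> on the approximating
  sequences.\<close>

lemma bilinear_extension_approximates:
  assumes "fourier_weight W" "fourier_weight W'"
    and A: "\<And>f g. schwartz f \<Longrightarrow> schwartz g \<Longrightarrow> schwartz (A f g)"
    and diff1: "\<And>f f' g. schwartz f \<Longrightarrow> schwartz f' \<Longrightarrow> schwartz g \<Longrightarrow> A (\<lambda>x. f x - f' x) g = (\<lambda>x. A f g x - A f' g x)"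
    and diff2: "\<And>f f' g. schwartz f \<Longrightarrow> schwartz f' \<Longrightarrow> schwartz g \<Longrightarrow> A g (\<lambda>x. f x - f' x) = (\<lambda>x. A g f x - A g f' x)"
    and bound: "\<And>f g. schwartz f \<Longrightarrow> schwartz g \<Longrightarrow> wnorm W' (A f g) \<le> C * wnorm W f * wnorm W g" and "C \<ge> 0"
    and f: "approximates (wnorm W) f v" and g: "approximates (wnorm W) g w"
  shows "approximates (wnorm W') (\<lambda>n. A (f n) (g n)) (bilinear_extension (wnorm W) (wnorm W') A v w)"
proof -
  interpret W: fourier_weight W by fact
  interpret W': fourier_weight W' by fact
  have bd: "wnorm W' (\<lambda>x. A f g x - A f' g' x) \<le> C * wnorm W (\<lambda>x. f x - f' x) * wnorm W g + C * wnorm W f' * wnorm W (\<lambda>x. g x - g' x)"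
    if "schwartz f" "schwartz f'" "schwartz g" "schwartz g'" for f f' g g'
  proof -
    have "wnorm W' (\<lambda>x. A f g x - A f' g' x) \<le> wnorm W' (\<lambda>x. A f g x - A f' g x) + wnorm W' (\<lambda>x. A f' g x - A f' g' x)"
      by (intro W'.wnorm_triangle A that)
    also have "wnorm W' (\<lambda>x. A f g x - A f' g x) \<le> C * wnorm W (\<lambda>x. f x - f' x) * wnorm W g"
      using bound[OF schwartz_diff[OF that(1,2)] that(3)] by (simp add: diff1 that)
    also have "wnorm W' (\<lambda>x. A f' g x - A f' g' x) \<le> C * wnorm W f' * wnorm W (\<lambda>x. g x - g' x)"
      using bound[OF that(2) schwartz_diff[OF that(3,4)]] by (simp add: diff2 that)
    finally show ?thesis by simp
  qed
  note sf = W.approximates_schwartz[OF f] and sg = W.approximates_schwartz[OF g]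
  obtain K where K: "K > 0" "\<And>n. wnorm W (f n) \<le> K" using W.approximates_bounded[OF f] by blast
  obtain L where L: "L > 0" "\<And>n. wnorm W (g n) \<le> L" using W.approximates_bounded[OF g] by blast
  obtain z where z: "approximates (wnorm W') (\<lambda>n. A (f n) (g n)) z"
  proof (rule W'.Cauchy_approximates)
    show "schwartz (A (f n) (g n))" for n by (intro A sf sg)
    fix e :: real assume e: "e > 0"
    define d where "d = e / (C * L + C * K + 1)"
    have den: "C * L + C * K + 1 > 0" using K(1) L(1) \<open>C \<ge> 0\<close> by (intro add_nonneg_pos) auto
    then have d: "d > 0" unfolding d_def using e by simp
    from W.approximates_Cauchy[OF f d] W.approximates_Cauchy[OF g d] obtain M1 M2 where
      M: "\<And>m n. m \<ge> M1 \<Longrightarrow> n \<ge> M1 \<Longrightarrow> wnorm W (\<lambda>x. f m x - f n x) < d"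
        "\<And>m n. m \<ge> M2 \<Longrightarrow> n \<ge> M2 \<Longrightarrow> wnorm W (\<lambda>x. g m x - g n x) < d" by blast
    have "wnorm W' (\<lambda>x. A (f m) (g m) x - A (f n) (g n) x) < e" if mn: "m \<ge> max M1 M2" "n \<ge> max M1 M2" for m n
    proof -
      have "wnorm W' (\<lambda>x. A (f m) (g m) x - A (f n) (g n) x) \<le> C * wnorm W (\<lambda>x. f m x - f n x) * wnorm W (g m) + C * wnorm W (f n) * wnorm W (\<lambda>x. g m x - g n x)"
        by (rule bd[OF sf sf sg sg])
      also have "\<dots> \<le> C * d * L + C * K * d"
        using M(1)[of m n] M(2)[of m n] K L mn \<open>C \<ge> 0\<close> wnorm_nonneg d
        by (intro add_mono mult_mono mult_nonneg_nonneg) (auto simp: less_imp_le)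
      also have "\<dots> = (C * L + C * K) * d" by (simp add: algebra_simps)
      also have "\<dots> < (C * L + C * K + 1) * d" using d by simp
      also have "\<dots> = e" unfolding d_def using den by simp
      finally show ?thesis .
    qed
    then show "\<exists>M. \<forall>m\<ge>M. \<forall>n\<ge>M. wnorm W' (\<lambda>x. A (f m) (g m) x - A (f n) (g n) x) < e" by blast
  qed
  have all: "\<forall>f' g'. approximates (wnorm W) f' v \<and> approximates (wnorm W) g' w \<longrightarrow> approximates (wnorm W') (\<lambda>n. A (f' n) (g' n)) z"
  proof (intro allI impI, elim conjE)
    fix f' g' assume f': "approximates (wnorm W) f' v" and g': "approximates (wnorm W) g' w"
    note sf' = W.approximates_schwartz[OF f'] and sg' = W.approximates_schwartz[OF g']
    obtain K' where K': "K' > 0" "\<And>n. wnorm W (f' n) \<le> K'" using W.approximates_bounded[OF f'] by blast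
    show "approximates (wnorm W') (\<lambda>n. A (f' n) (g' n)) z"
    proof (rule W'.approximates_perturb[OF z])
      show "schwartz (A (f' n) (g' n))" for n by (intro A sf' sg')
      have "(\<lambda>n. C * wnorm W (\<lambda>x. f n x - f' n x) * L + C * K' * wnorm W (\<lambda>x. g n x - g' n x)) \<longlonglongrightarrow> C * 0 * L + C * K' * 0"
        by (intro tendsto_intros W.approximates_difference_null[OF f f'] W.approximates_difference_null[OF g g'])
      then have lim: "(\<lambda>n. C * wnorm W (\<lambda>x. f n x - f' n x) * L + C * K' * wnorm W (\<lambda>x. g n x - g' n x)) \<longlonglongrightarrow> 0" by simp
      have "wnorm W' (\<lambda>x. A (f n) (g n) x - A (f' n) (g' n) x) \<le> C * wnorm W (\<lambda>x. f n x - f' n x) * L + C * K' * wnorm W (\<lambda>x. g n x - g' n x)" for n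
        by (rule order_trans[OF bd[OF sf sf' sg sg']])
           (use L K' \<open>C \<ge> 0\<close> wnorm_nonneg in \<open>auto intro!: add_mono mult_mono mult_nonneg_nonneg\<close>)
      then show "(\<lambda>n. wnorm W' (\<lambda>x. A (f n) (g n) x - A (f' n) (g' n) x)) \<longlonglongrightarrow> 0"
        by (intro Lim_null_comparison[OF always_eventually lim]) (auto simp: wnorm_nonneg)
    qed
  qed
  have "bilinear_extension (wnorm W) (wnorm W') A v w = z"
    unfolding bilinear_extension_def
    by (rule the_equality) (use all f g W'.approximates_unique z in blast)+
  then show ?thesis using z by simp
qed

section \<open>Bounds for the resonance kernel\<close>

lemma nn_integral_powr_tail:
  assumes "p > 1" "a > 0"
  shows "(\<integral>\<^sup>+x. ennreal (x powr (- p)) * indicator {a..} x \<partial>lborel) = ennreal (a powr (1 - p) / (p - 1))"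
proof -
  have "((\<lambda>x. x powr (- p)) has_integral - (a powr (- p + 1)) / (- p + 1)) {a..}"
    using assms by (intro has_integral_powr_to_inf) auto
  from nn_integral_has_integral_lebesgue[OF _ this]
  have "(\<integral>\<^sup>+x. ennreal (indicator {a..} x * x powr (- p)) \<partial>lborel) = ennreal (- (a powr (- p + 1)) / (- p + 1))"
    by simp
  also have "- (a powr (- p + 1)) / (- p + 1) = a powr (1 - p) / (p - 1)"
    using assms by (simp add: field_simps)
  also have "(\<lambda>x. ennreal (indicator {a..} x * x powr (- p))) = (\<lambda>x. ennreal (x powr (- p)) * indicator {a..} x)"
    by (auto simp: fun_eq_iff indicator_def)
  finally show ?thesis .
qed

lemma nn_integral_even_le:
  fixes f :: "real \<Rightarrow> ennreal"
  assumes [measurable]: "f \<in> borel_measurable borel" and even: "\<And>x. f (- x) = f x"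
    and le: "(\<integral>\<^sup>+x. f x * indicator {0..} x \<partial>lborel) \<le> c"
  shows "(\<integral>\<^sup>+x. f x \<partial>lborel) \<le> 2 * c"
proof -
  have neg: "(\<integral>\<^sup>+x. f x * indicator {..0} x \<partial>lborel) = (\<integral>\<^sup>+x. f x * indicator {0..} x \<partial>lborel)"
    by (subst nn_integral_real_affine[where c = "-1" and t = 0])
       (auto simp: even indicator_def intro!: nn_integral_cong)
  have "(\<integral>\<^sup>+x. f x \<partial>lborel) \<le> (\<integral>\<^sup>+x. f x * indicator {0..} x + f x * indicator {..0} x \<partial>lborel)"
    by (intro nn_integral_mono) (auto simp: indicator_def)
  also have "\<dots> = (\<integral>\<^sup>+x. f x * indicator {0..} x \<partial>lborel) + (\<integral>\<^sup>+x. f x * indicator {..0} x \<partial>lborel)"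
    by (intro nn_integral_add) measurable
  also have "\<dots> \<le> c + c" unfolding neg using le by (intro add_mono)
  finally show ?thesis by (simp add: mult_2)
qed

lemma nn_integral_one_plus_abs_powr:
  assumes "p > 1"
  shows "(\<integral>\<^sup>+x. ennreal ((1 + \<bar>x\<bar>) powr (- p)) \<partial>lborel) \<le> ennreal (2 / (p - 1))"
proof -
  have "(\<integral>\<^sup>+x. ennreal ((1 + \<bar>x\<bar>) powr (- p)) * indicator {0..} x \<partial>lborel) = (\<integral>\<^sup>+x. ennreal (x powr (- p)) * indicator {1..} x \<partial>lborel)"
    by (subst (2) nn_integral_real_affine[where c = 1 and t = 1])
       (auto simp: indicator_def intro!: nn_integral_cong)
  also have "\<dots> = ennreal (1 / (p - 1))" using nn_integral_powr_tail[OF assms, of 1] by simp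
  finally have "(\<integral>\<^sup>+x. ennreal ((1 + \<bar>x\<bar>) powr (- p)) \<partial>lborel) \<le> 2 * ennreal (1 / (p - 1))"
    by (intro nn_integral_even_le) auto
  also have "\<dots> = ennreal (2 / (p - 1))"
    using assms by (simp add: ennreal_mult'[of 2, symmetric] flip: ennreal_numeral)
  finally show ?thesis .
qed

text \<open>The hypothesis on \<open>c\<close> says that \<open>h'\<close> does not change sign.\<close>

lemma nn_integral_monotone_substitution:
  fixes F :: "real \<Rightarrow> ennreal" and h h' :: "real \<Rightarrow> real"
  assumes [measurable]: "F \<in> borel_measurable borel"
    and d: "\<And>x. (h has_real_derivative h' x) (at x)" and cont: "continuous_on UNIV h'"
    and c: "c \<noteq> 0" "\<And>x. x \<in> {a..b} \<Longrightarrow> 0 \<le> c * h' x"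
  shows "(\<integral>\<^sup>+x. F (h x) * ennreal \<bar>h' x\<bar> * indicator {a..b} x \<partial>lborel) \<le> (\<integral>\<^sup>+x. F x \<partial>lborel)"
proof (cases "a < b")
  case True
  have sub: "(\<integral>\<^sup>+x. G (g x) * ennreal (g' x) * indicator {a..b} x \<partial>lborel) \<le> (\<integral>\<^sup>+x. G x \<partial>lborel)"
    if [measurable]: "G \<in> borel_measurable borel" and g: "\<And>x. (g has_real_derivative g' x) (at x)"
      "continuous_on {a..b} g'" "\<And>x. x \<in> {a..b} \<Longrightarrow> 0 \<le> g' x" for G :: "real \<Rightarrow> ennreal" and g g' :: "real \<Rightarrow> real"
  proof -
    have "(\<integral>\<^sup>+x. G (g x) * ennreal (g' x) * indicator {a..b} x \<partial>lborel) = (\<integral>\<^sup>+x. G x * indicator {g a..g b} x \<partial>lborel)"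
      by (rule nn_integral_substitution_aux[symmetric]) (use g True in auto)
    also have "\<dots> \<le> (\<integral>\<^sup>+x. G x \<partial>lborel)" by (intro nn_integral_mono) (auto simp: indicator_def)
    finally show ?thesis .
  qed
  have cont': "continuous_on {a..b} h'" using cont by (rule continuous_on_subset) auto
  show ?thesis
  proof (cases "c > 0")
    case True
    then have nn: "0 \<le> h' x" if "x \<in> {a..b}" for x using c(2)[OF that] by (simp add: zero_le_mult_iff)
    have "(\<integral>\<^sup>+x. F (h x) * ennreal \<bar>h' x\<bar> * indicator {a..b} x \<partial>lborel) = (\<integral>\<^sup>+x. F (h x) * ennreal (h' x) * indicator {a..b} x \<partial>lborel)"
      by (intro nn_integral_cong) (auto simp: indicator_def nn)
    also have "\<dots> \<le> (\<integral>\<^sup>+x. F x \<partial>lborel)" by (rule sub) (use d cont' nn in auto)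
    finally show ?thesis .
  next
    case False
    then have nn: "h' x \<le> 0" if "x \<in> {a..b}" for x using c(1) c(2)[OF that] by (auto simp: zero_le_mult_iff)
    have "(\<integral>\<^sup>+x. F (h x) * ennreal \<bar>h' x\<bar> * indicator {a..b} x \<partial>lborel) =
      (\<integral>\<^sup>+x. (\<lambda>y. F (- y)) (- h x) * ennreal (- h' x) * indicator {a..b} x \<partial>lborel)"
      by (intro nn_integral_cong) (use nn in \<open>auto simp: indicator_def abs_of_nonpos\<close>)
    also have "\<dots> \<le> (\<integral>\<^sup>+x. F (- x) \<partial>lborel)"
      by (rule sub) (use d cont' nn in \<open>auto intro!: DERIV_minus continuous_on_minus\<close>)
    also have "\<dots> = (\<integral>\<^sup>+x. F x \<partial>lborel)"
      by (subst (2) nn_integral_real_affine[where c = "-1" and t = 0]) auto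
    finally show ?thesis .
  qed
next
  case False
  have "AE x in lborel. x \<noteq> a" by (rule AE_lborel_singleton)
  then have "(\<integral>\<^sup>+x. F (h x) * ennreal \<bar>h' x\<bar> * indicator {a..b} x \<partial>lborel) = (\<integral>\<^sup>+x. 0 \<partial>(lborel :: real measure))"
    by (intro nn_integral_cong_AE) (use False in \<open>auto simp: indicator_def\<close>)
  then show ?thesis by simp
qed

lemma nn_integral_monotone_substitution_tail:
  fixes F :: "real \<Rightarrow> ennreal" and h h' :: "real \<Rightarrow> real"
  assumes [measurable]: "F \<in> borel_measurable borel"
    and d: "\<And>x. (h has_real_derivative h' x) (at x)" and cont: "continuous_on UNIV h'"
    and c: "c \<noteq> 0" "\<And>x. x \<in> {a..} \<Longrightarrow> 0 \<le> c * h' x"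
  shows "(\<integral>\<^sup>+x. F (h x) * ennreal \<bar>h' x\<bar> * indicator {a..} x \<partial>lborel) \<le> (\<integral>\<^sup>+x. F x \<partial>lborel)"
proof -
  have [measurable]: "h \<in> borel_measurable borel" "h' \<in> borel_measurable borel"
    using d cont by (auto intro!: borel_measurable_continuous_onI continuous_at_imp_continuous_on DERIV_isCont)
  let ?f = "\<lambda>n x. F (h x) * ennreal \<bar>h' x\<bar> * indicator {a..a + real n} x"
  have inc: "incseq ?f"
    by (rule incseq_SucI) (auto simp: le_fun_def indicator_def)
  have lim: "(\<lambda>n. ?f n x) \<longlonglongrightarrow> F (h x) * ennreal \<bar>h' x\<bar> * indicator {a..} x" for x
  proof (rule tendsto_eventually)
    obtain N :: nat where N: "x - a \<le> real N" using real_arch_simple by blast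
    have "?f n x = F (h x) * ennreal \<bar>h' x\<bar> * indicator {a..} x" if "n \<ge> N" for n
    proof -
      have "real N \<le> real n" using that by simp
      then have "x \<le> a + real n" using N by linarith
      then show ?thesis by (simp add: indicator_def)
    qed
    then show "eventually (\<lambda>n. ?f n x = F (h x) * ennreal \<bar>h' x\<bar> * indicator {a..} x) sequentially"
      unfolding eventually_sequentially by blast
  qed
  have "(\<lambda>n. integral\<^sup>N lborel (?f n)) \<longlonglongrightarrow> (\<integral>\<^sup>+x. F (h x) * ennreal \<bar>h' x\<bar> * indicator {a..} x \<partial>lborel)"
    by (rule nn_integral_LIMSEQ[OF inc _ lim]) measurable
  then show ?thesis
    by (rule LIMSEQ_le_const2)
       (use nn_integral_monotone_substitution[OF assms(1) d cont c(1)] c(2) in auto)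
qed

section \<open>The resonance function and its substitution estimates\<close>

definition resonance :: "(real \<Rightarrow> real) \<Rightarrow> real \<Rightarrow> real \<Rightarrow> real" where
  "resonance \<phi> x y = \<phi> (x + y) - \<phi> x - \<phi> y"

lemma resonance_commute: "resonance \<phi> x y = resonance \<phi> y x"
  by (simp add: resonance_def add.commute)

text \<open>The derivative in \<open>y\<close> is \<open>\<phi>' (x + y) - \<phi>' y\<close>,
  factored with the help of \<open>(x + y)^2 - y^2 = x * (x + 2 * y)\<close>. The factor
  \<open>x + 2 * y\<close> locates the critical point, and the last factor is of one sign at high
  frequency.\<close>

definition resonance_deriv :: "real \<Rightarrow> real \<Rightarrow> real \<Rightarrow> real \<Rightarrow> real" where
  "resonance_deriv \<alpha> \<beta> x y = x * (x + 2 * y) * (5 * \<alpha> * ((x + y)\<^sup>2 + y\<^sup>2) - 3 * \<beta>)"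

lemma resonance_has_derivative:
  "((\<lambda>y. resonance (dispersion \<alpha> \<beta>) x y + \<sigma>) has_real_derivative resonance_deriv \<alpha> \<beta> x y) (at y)"
  unfolding resonance_def dispersion_def resonance_deriv_def
  by (auto intro!: derivative_eq_intros simp: algebra_simps power2_eq_square eval_nat_numeral)

lemma resonance_deriv_continuous: "continuous_on UNIV (resonance_deriv \<alpha> \<beta> x)"
  unfolding resonance_deriv_def[abs_def] by (intro continuous_intros)

lemma resonance_measurable [measurable]:
  "(\<lambda>y. resonance (dispersion \<alpha> \<beta>) (f y) (g y)) \<in> borel_measurable M"
  if [measurable]: "f \<in> borel_measurable M" "g \<in> borel_measurable M"
  unfolding resonance_def dispersion_def by measurable

lemma resonance_deriv_measurable [measurable]:
  "(\<lambda>y. resonance_deriv \<alpha> \<beta> (f y) (g y)) \<in> borel_measurable M"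
  if [measurable]: "f \<in> borel_measurable M" "g \<in> borel_measurable M"
  unfolding resonance_deriv_def by measurable

text \<open>For frequencies beyond \<open>R\<close> the quintic part of the dispersion dominates the cubic one.\<close>

locale kawahara =
  fixes \<alpha> \<beta> R :: real
  assumes \<alpha>: "\<alpha> \<noteq> 0" and R: "R \<ge> 1" "3 * \<bar>\<beta>\<bar> \<le> \<bar>\<alpha>\<bar> * R\<^sup>2"
begin

abbreviation "Hr \<equiv> resonance (dispersion \<alpha> \<beta>)"
abbreviation "dHr \<equiv> resonance_deriv \<alpha> \<beta>"

text \<open>The cubic term costs at most \<open>|\<alpha>| * S\<close>, one of the five units in
  \<open>5 * |\<alpha>| * S\<close>; four remain, and the sign is that of
  \<open>\<alpha>\<close>.\<close>

lemma phase_factor: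
  assumes "S \<ge> R\<^sup>2"
  shows "4 * \<bar>\<alpha>\<bar> * S \<le> \<bar>5 * \<alpha> * S - 3 * \<beta>\<bar>" and "0 \<le> \<alpha> * (5 * \<alpha> * S - 3 * \<beta>)"
proof -
  have S: "S \<ge> 0" using assms zero_le_power2[of R] by linarith
  have b: "3 * \<bar>\<beta>\<bar> \<le> \<bar>\<alpha>\<bar> * S" using R(2) mult_left_mono[OF assms, of "\<bar>\<alpha>\<bar>"] by linarith
  have "\<bar>5 * \<alpha> * S\<bar> = 5 * (\<bar>\<alpha>\<bar> * S)" using S by (simp add: abs_mult)
  then show "4 * \<bar>\<alpha>\<bar> * S \<le> \<bar>5 * \<alpha> * S - 3 * \<beta>\<bar>" using b by linarith
  have "\<alpha> * (3 * \<beta>) \<le> \<bar>\<alpha>\<bar> * (3 * \<bar>\<beta>\<bar>)"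
    using abs_ge_self[of "\<alpha> * (3 * \<beta>)"] by (simp add: abs_mult)
  also have "\<dots> \<le> \<bar>\<alpha>\<bar> * (\<bar>\<alpha>\<bar> * S)" using b by (intro mult_left_mono) auto
  also have "\<dots> = \<alpha> * (\<alpha> * S)" by (simp add: mult.assoc[symmetric])
  also have "\<dots> \<le> \<alpha> * (5 * \<alpha> * S)"
  proof -
    have "0 \<le> \<alpha> * \<alpha> * S" using S by simp
    then show ?thesis by (simp add: mult_ac)
  qed
  finally show "0 \<le> \<alpha> * (5 * \<alpha> * S - 3 * \<beta>)" by (simp add: right_diff_distrib)
qed

lemma dHr_bound:
  assumes "(x + y)\<^sup>2 + y\<^sup>2 \<ge> R\<^sup>2"
  shows "\<bar>x\<bar> * \<bar>x + 2 * y\<bar> * (4 * \<bar>\<alpha>\<bar> * ((x + y)\<^sup>2 + y\<^sup>2)) \<le> \<bar>dHr x y\<bar>"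
  unfolding resonance_deriv_def abs_mult using phase_factor(1)[OF assms]
  by (intro mult_left_mono) auto

text \<open>\<open>k\<close> records the sign of \<open>x * (x + 2 * y)\<close> on an interval; its
  product with \<open>\<alpha>\<close> is the constant \<open>c\<close> of the substitution
  lemmas.\<close>

lemma dHr_sign:
  assumes "(x + y)\<^sup>2 + y\<^sup>2 \<ge> R\<^sup>2" "0 \<le> k * (x * (x + 2 * y))"
  shows "0 \<le> (\<alpha> * k) * dHr x y"
proof -
  have "0 \<le> (k * (x * (x + 2 * y))) * (\<alpha> * (5 * \<alpha> * ((x + y)\<^sup>2 + y\<^sup>2) - 3 * \<beta>))"
    using phase_factor(2)[OF assms(1)] assms(2) by (rule mult_nonneg_nonneg[rotated])
  then show ?thesis unfolding resonance_deriv_def by (simp only: mult_ac)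
qed

text \<open>The exponent is twice the 3/4 given to the columns in the Schur test; being below -1 it
  is integrable, with integral at most \<open>2 / (3/2 - 1) = 4\<close>.\<close>

definition F :: "real \<Rightarrow> ennreal" where "F y = ennreal ((1 + \<bar>y\<bar>) powr (- (3 / 2)))"

lemma F_measurable [measurable]: "F \<in> borel_measurable borel" unfolding F_def by measurable

lemma F_integral: "(\<integral>\<^sup>+x. F x \<partial>lborel) \<le> 4"
  using nn_integral_one_plus_abs_powr[of "3 / 2"] by (simp add: F_def)

text \<open>With \<open>Hr x y + \<sigma>\<close> as the new variable only the integral of
  \<open>F\<close> remains. This is the origin of all bounds that are uniform in the modulation and
  in \<open>x\<close>.\<close>

lemma substitution:
  assumes "k \<noteq> 0" "\<And>y. y \<in> {a..b} \<Longrightarrow> (x + y)\<^sup>2 + y\<^sup>2 \<ge> R\<^sup>2" "\<And>y. y \<in> {a..b} \<Longrightarrow> 0 \<le> k * (x * (x + 2 * y))"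
  shows "(\<integral>\<^sup>+y. F (Hr x y + \<sigma>) * ennreal \<bar>dHr x y\<bar> * indicator {a..b} y \<partial>lborel) \<le> 4"
  by (rule order_trans[OF nn_integral_monotone_substitution[OF F_measurable resonance_has_derivative resonance_deriv_continuous, of "\<alpha> * k"] F_integral])
     (use assms \<alpha> dHr_sign in auto)

lemma R_sq_le: "\<bar>y\<bar> \<ge> R \<Longrightarrow> R\<^sup>2 \<le> y\<^sup>2"
  using R(1) by (metis abs_ge_zero abs_le_square_iff abs_of_nonneg order_trans zero_le_one)

text \<open>The domain has a positive and a negative component, and the critical point
  \<open>- x / 2\<close> cuts one of them according to the sign of \<open>x\<close>. The four
  intervals cover the domain in either case, \<open>Hr x\<close> is monotone on each, and each
  contributes at most 4.\<close>

lemma row_subst: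
  "(\<integral>\<^sup>+y. F (Hr x y + \<sigma>) * ennreal \<bar>dHr x y\<bar> * indicator {y. R < \<bar>y\<bar> \<and> \<bar>y\<bar> \<le> \<bar>x\<bar>} y \<partial>lborel) \<le> 16"
proof (cases "x = 0")
  case True
  then have "{y. R < \<bar>y\<bar> \<and> \<bar>y\<bar> \<le> \<bar>x\<bar>} = {}" using R(1) by auto
  then show ?thesis by simp
next
  case x: False
  let ?G = "\<lambda>y. F (Hr x y + \<sigma>) * ennreal \<bar>dHr x y\<bar>"
  let ?I1 = "{max R (- x / 2)..\<bar>x\<bar>}" and ?I2 = "{R..min \<bar>x\<bar> (- x / 2)}"
  let ?I3 = "{max (- \<bar>x\<bar>) (- x / 2)..- R}" and ?I4 = "{- \<bar>x\<bar>..min (- R) (- x / 2)}"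
  have big: "R\<^sup>2 \<le> (x + y)\<^sup>2 + y\<^sup>2" if "R \<le> \<bar>y\<bar>" for y
    using R_sq_le[OF that] zero_le_power2[of "x + y"] by linarith
  have b1: "(\<integral>\<^sup>+y. ?G y * indicator ?I1 y \<partial>lborel) \<le> 4"
    by (rule substitution[where k = x]) (use x big in \<open>auto simp: mult.assoc[symmetric]\<close>)
  have b2: "(\<integral>\<^sup>+y. ?G y * indicator ?I2 y \<partial>lborel) \<le> 4"
    by (rule substitution[where k = "-x"]) (use x big in \<open>auto simp: mult.assoc[symmetric] mult_nonneg_nonpos\<close>)
  have b3: "(\<integral>\<^sup>+y. ?G y * indicator ?I3 y \<partial>lborel) \<le> 4"
    by (rule substitution[where k = x]) (use x big in \<open>auto simp: mult.assoc[symmetric]\<close>)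
  have b4: "(\<integral>\<^sup>+y. ?G y * indicator ?I4 y \<partial>lborel) \<le> 4"
    by (rule substitution[where k = "-x"]) (use x big in \<open>auto simp: mult.assoc[symmetric] mult_nonneg_nonpos\<close>)
  have "(\<integral>\<^sup>+y. ?G y * indicator {y. R < \<bar>y\<bar> \<and> \<bar>y\<bar> \<le> \<bar>x\<bar>} y \<partial>lborel) \<le>
     (\<integral>\<^sup>+y. (?G y * indicator ?I1 y + ?G y * indicator ?I2 y) + (?G y * indicator ?I3 y + ?G y * indicator ?I4 y) \<partial>lborel)"
  proof (rule nn_integral_mono)
    fix y
    show "?G y * indicator {y. R < \<bar>y\<bar> \<and> \<bar>y\<bar> \<le> \<bar>x\<bar>} y \<le>
      (?G y * indicator ?I1 y + ?G y * indicator ?I2 y) + (?G y * indicator ?I3 y + ?G y * indicator ?I4 y)"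
    proof (cases "R < \<bar>y\<bar> \<and> \<bar>y\<bar> \<le> \<bar>x\<bar>")
      case True
      then have "y \<in> ?I1 \<or> y \<in> ?I2 \<or> y \<in> ?I3 \<or> y \<in> ?I4" by (auto simp: abs_if split: if_splits)
      then have "indicator {y. R < \<bar>y\<bar> \<and> \<bar>y\<bar> \<le> \<bar>x\<bar>} y \<le>
        (indicator ?I1 y + indicator ?I2 y) + (indicator ?I3 y + indicator ?I4 y :: ennreal)"
        using True by (auto simp: indicator_def)
      from mult_left_mono[OF this, of "?G y"] show ?thesis by (simp add: distrib_left)
    qed auto
  qed
  also have "\<dots> = ((\<integral>\<^sup>+y. ?G y * indicator ?I1 y \<partial>lborel) + (\<integral>\<^sup>+y. ?G y * indicator ?I2 y \<partial>lborel)) +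
     ((\<integral>\<^sup>+y. ?G y * indicator ?I3 y \<partial>lborel) + (\<integral>\<^sup>+y. ?G y * indicator ?I4 y \<partial>lborel))"
    by (simp add: nn_integral_add)
  also have "\<dots> \<le> (4 + 4) + (4 + 4)" using b1 b2 b3 b4 by (intro add_mono)
  finally show ?thesis by simp
qed

text \<open>Away from the critical point \<open>x + 2 y = 0\<close> either \<open>|dHr x y|\<close> dominates \<open>1 + |Hr x y + \<sigma>|\<close>, or
  the integrand is \<open>O(1 / |x|)\<close>.\<close>

lemma row_bound:
  "(\<integral>\<^sup>+y. ennreal ((1 + \<bar>Hr x y + \<sigma>\<bar>) powr (- (1 / 2))) * indicator {y. R < \<bar>y\<bar> \<and> \<bar>y\<bar> \<le> \<bar>x\<bar>} y \<partial>lborel)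
     \<le> ennreal (17 + 2 / sqrt (2 * \<bar>\<alpha>\<bar>))"
proof (cases "\<bar>x\<bar> > R")
  case False
  then have "{y. R < \<bar>y\<bar> \<and> \<bar>y\<bar> \<le> \<bar>x\<bar>} = {}" by auto
  then show ?thesis by simp
next
  case True
  then have x1: "\<bar>x\<bar> \<ge> 1" using R(1) by linarith
  let ?S = "{y. R < \<bar>y\<bar> \<and> \<bar>y\<bar> \<le> \<bar>x\<bar>}"
  let ?G = "\<lambda>y. F (Hr x y + \<sigma>) * ennreal \<bar>dHr x y\<bar> * indicator ?S y"
  \<comment> \<open>\<open>?c\<close> is the inverse square root of the lower bound
    \<open>2 * |\<alpha>| * |x|^2\<close> for \<open>|dHr x y|\<close> found below, and
    \<open>?I\<close> is the interval of length one around the critical point on which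
    \<open>|x + 2 * y| <= 1\<close>.\<close>
  let ?c = "1 / (sqrt (2 * \<bar>\<alpha>\<bar>) * \<bar>x\<bar>)"
  let ?I = "{(- 1 - x) / 2..(1 - x) / 2}"
  have sp: "sqrt (2 * \<bar>\<alpha>\<bar>) > 0" using \<alpha> by simp
  have pt: "ennreal ((1 + \<bar>Hr x y + \<sigma>\<bar>) powr (- (1 / 2))) * indicator ?S y \<le>
      indicator ?I y + (?G y + ennreal ?c * indicator {-\<bar>x\<bar>..\<bar>x\<bar>} y)" for y
  proof (cases "y \<in> ?S")
    case y: True
    let ?h = "1 + \<bar>Hr x y + \<sigma>\<bar>"
    have h1: "?h \<ge> 1" by simp
    show ?thesis
    proof (cases "\<bar>x + 2 * y\<bar> \<le> 1")
      case True
      then have "y \<in> ?I" by (auto simp: abs_le_iff)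
      moreover have "?h powr (- (1 / 2)) \<le> 1" using powr_mono[of "- (1 / 2)" 0 ?h] h1 by simp
      then have "ennreal (?h powr (- (1 / 2))) \<le> 1" by simp
      then have "ennreal (?h powr (- (1 / 2))) * indicator ?S y \<le> indicator ?I y"
        using y \<open>y \<in> ?I\<close> by (simp add: indicator_def)
      then show ?thesis by (rule order_trans) (simp add: add_increasing2)
    next
      case False
      have yR: "R \<le> \<bar>y\<bar>" using y by simp
      have big: "R\<^sup>2 \<le> (x + y)\<^sup>2 + y\<^sup>2"
        using R_sq_le[OF yR] zero_le_power2[of "x + y"] by linarith
      \<comment> \<open>The sum on the right equals
        \<open>(x^2 + (x + 2 * y)^2) / 2\<close>.\<close>
      have S: "x\<^sup>2 / 2 \<le> (x + y)\<^sup>2 + y\<^sup>2"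
      proof -
        have "0 \<le> (x + 2 * y)\<^sup>2" by simp
        then show ?thesis by (simp add: power2_eq_square algebra_simps)
      qed
      have "2 * \<bar>\<alpha>\<bar> * \<bar>x\<bar>\<^sup>2 \<le> \<bar>x\<bar> * \<bar>x + 2 * y\<bar> * (4 * \<bar>\<alpha>\<bar> * ((x + y)\<^sup>2 + y\<^sup>2))"
      proof -
        have "1 * 1 * (4 * \<bar>\<alpha>\<bar> * (x\<^sup>2 / 2)) \<le> \<bar>x\<bar> * \<bar>x + 2 * y\<bar> * (4 * \<bar>\<alpha>\<bar> * ((x + y)\<^sup>2 + y\<^sup>2))"
          using x1 False S by (intro mult_mono mult_left_mono) auto
        then show ?thesis by simp
      qed
      also have "\<dots> \<le> \<bar>dHr x y\<bar>" by (rule dHr_bound[OF big])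
      finally have dge: "2 * \<bar>\<alpha>\<bar> * \<bar>x\<bar>\<^sup>2 \<le> \<bar>dHr x y\<bar>" .
      have dpos: "0 < 2 * \<bar>\<alpha>\<bar> * \<bar>x\<bar>\<^sup>2" using \<alpha> x1 by (intro mult_pos_pos) auto
      show ?thesis
      \<comment> \<open>If \<open>?h\<close> is at most \<open>|dHr x y|\<close>, then
        \<open>?h^(-1/2) = ?h^(-3/2) * ?h\<close> is at most the integrand of
        \<open>row_subst\<close>; otherwise \<open>?h\<close> inherits the lower bound for
        \<open>|dHr x y|\<close>.\<close>
      proof (cases "?h \<le> \<bar>dHr x y\<bar>")
        case True
        have "?h powr (- (1 / 2)) = ?h powr (- (3 / 2)) * ?h"
        proof -
          have "?h powr (- (3 / 2)) * ?h powr 1 = ?h powr (- (1 / 2))" by (simp only: powr_add[symmetric]) simp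
          then show ?thesis using h1 by simp
        qed
        also have "\<dots> \<le> ?h powr (- (3 / 2)) * \<bar>dHr x y\<bar>" using True by (intro mult_left_mono) auto
        finally have "ennreal (?h powr (- (1 / 2))) \<le> F (Hr x y + \<sigma>) * ennreal \<bar>dHr x y\<bar>"
          unfolding F_def by (simp add: ennreal_mult[symmetric] ennreal_leI)
        then have "ennreal (?h powr (- (1 / 2))) * indicator ?S y \<le> ?G y" by (intro mult_right_mono) auto
        then show ?thesis by (rule order_trans) (simp add: add_increasing add_increasing2)
      next
        case False
        have "?h powr (- (1 / 2)) \<le> (2 * \<bar>\<alpha>\<bar> * \<bar>x\<bar>\<^sup>2) powr (- (1 / 2))"
          using False dge dpos by (intro powr_mono2') auto
        also have "\<dots> = ?c"
        proof -
          have "(2 * \<bar>\<alpha>\<bar> * \<bar>x\<bar>\<^sup>2) powr (- (1 / 2)) = 1 / sqrt (2 * \<bar>\<alpha>\<bar> * \<bar>x\<bar>\<^sup>2)"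
            using dpos by (simp add: powr_minus powr_half_sqrt inverse_eq_divide)
          then show ?thesis by (simp add: real_sqrt_mult)
        qed
        finally have "ennreal (?h powr (- (1 / 2))) \<le> ennreal ?c" by (rule ennreal_leI)
        moreover have "y \<in> {-\<bar>x\<bar>..\<bar>x\<bar>}" using y by auto
        ultimately have "ennreal (?h powr (- (1 / 2))) * indicator ?S y \<le> ennreal ?c * indicator {-\<bar>x\<bar>..\<bar>x\<bar>} y"
          using y by (simp add: indicator_def)
        then show ?thesis by (rule order_trans) (simp add: add_increasing add_increasing2)
      qed
    qed
  qed simp
  have "(\<integral>\<^sup>+y. ennreal ((1 + \<bar>Hr x y + \<sigma>\<bar>) powr (- (1 / 2))) * indicator ?S y \<partial>lborel) \<le>
     (\<integral>\<^sup>+y. indicator ?I y + (?G y + ennreal ?c * indicator {-\<bar>x\<bar>..\<bar>x\<bar>} y) \<partial>lborel)"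
    by (intro nn_integral_mono pt)
  also have "\<dots> = (\<integral>\<^sup>+y. indicator ?I y \<partial>lborel) + ((\<integral>\<^sup>+y. ?G y \<partial>lborel) + (\<integral>\<^sup>+y. ennreal ?c * indicator {-\<bar>x\<bar>..\<bar>x\<bar>} y \<partial>lborel))"
    by (simp add: nn_integral_add)
  also have "\<dots> \<le> 1 + (16 + ennreal (2 / sqrt (2 * \<bar>\<alpha>\<bar>)))"
  proof (intro add_mono row_subst)
    have "emeasure lborel ?I = ennreal ((1 - x) / 2 - (- 1 - x) / 2)" by (subst emeasure_lborel_Icc) auto
    also have "(1 - x) / 2 - (- 1 - x) / 2 = 1" by (simp add: field_simps)
    finally show "(\<integral>\<^sup>+y. indicator ?I y \<partial>lborel) \<le> 1" by simp
    have "(\<integral>\<^sup>+y. ennreal ?c * indicator {-\<bar>x\<bar>..\<bar>x\<bar>} y \<partial>lborel) = ennreal ?c * emeasure lborel {-\<bar>x\<bar>..\<bar>x\<bar>}"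
      by (rule nn_integral_cmult_indicator) simp
    also have "\<dots> = ennreal (?c * (2 * \<bar>x\<bar>))"
      using sp by (subst emeasure_lborel_Icc) (auto simp: ennreal_mult'[symmetric])
    also have "?c * (2 * \<bar>x\<bar>) = 2 / sqrt (2 * \<bar>\<alpha>\<bar>)" using x1 by (simp add: field_simps)
    finally show "(\<integral>\<^sup>+y. ennreal ?c * indicator {-\<bar>x\<bar>..\<bar>x\<bar>} y \<partial>lborel) \<le> ennreal (2 / sqrt (2 * \<bar>\<alpha>\<bar>))" by simp
  qed
  also have "\<dots> = ennreal (17 + 2 / sqrt (2 * \<bar>\<alpha>\<bar>))"
  proof -
    have "ennreal (17 + 2 / sqrt (2 * \<bar>\<alpha>\<bar>)) = ennreal 17 + ennreal (2 / sqrt (2 * \<bar>\<alpha>\<bar>))" by (rule ennreal_plus) auto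
    then show ?thesis by (simp add: add.assoc[symmetric])
  qed
  finally show ?thesis .
qed

text \<open>Now \<open>x\<close> varies, and by symmetry of the resonance function the derivative in
  the second argument still serves. For \<open>|x| >= |y|\<close> there is no critical point, as
  \<open>|y + 2 * x| >= |x|\<close>; hence \<open>|dHr y x|\<close> is at least
  \<open>4 * |\<alpha>| * |x|^3 * |y|\<close>. The two half-lines contribute 4 each, and
  \<open>8 / (4 * |\<alpha>|)\<close> is the bound.\<close>

lemma column_bound:
  "(\<integral>\<^sup>+x. ennreal (\<bar>x\<bar> ^ 3 * \<bar>y\<bar> * (1 + \<bar>Hr x y + \<sigma>\<bar>) powr (- (3 / 2))) * indicator {x. R < \<bar>y\<bar> \<and> \<bar>y\<bar> \<le> \<bar>x\<bar>} x \<partial>lborel)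
     \<le> ennreal (2 / \<bar>\<alpha>\<bar>)"
proof (cases "\<bar>y\<bar> > R")
  case False then show ?thesis by simp
next
  case True
  then have y0: "\<bar>y\<bar> > 0" "y \<noteq> 0" using R(1) by auto
  let ?G = "\<lambda>x. F (Hr y x + \<sigma>) * ennreal \<bar>dHr y x\<bar>"
  have big: "R\<^sup>2 \<le> (y + x)\<^sup>2 + x\<^sup>2" if "\<bar>y\<bar> \<le> \<bar>x\<bar>" for x
    using R_sq_le[of x] that True zero_le_power2[of "y + x"] by linarith
  have b1: "(\<integral>\<^sup>+x. ?G x * indicator {\<bar>y\<bar>..} x \<partial>lborel) \<le> 4"
    by (rule order_trans[OF nn_integral_monotone_substitution_tail[OF F_measurable resonance_has_derivative resonance_deriv_continuous, of "\<alpha> * y"] F_integral])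
       (use y0 \<alpha> big dHr_sign[of y _ y] in \<open>auto simp: mult.assoc[symmetric] abs_le_iff\<close>)
  \<comment> \<open>The left half-line is reflected onto the right one; the reflected function has
    derivative \<open>- dHr y (- x)\<close>, which again has the sign of
    \<open>\<alpha> * y\<close>.\<close>
  have b2: "(\<integral>\<^sup>+x. ?G x * indicator {..-\<bar>y\<bar>} x \<partial>lborel) \<le> 4"
  proof -
    have "(\<integral>\<^sup>+x. ?G x * indicator {..-\<bar>y\<bar>} x \<partial>lborel) = (\<integral>\<^sup>+x. F (Hr y (- x) + \<sigma>) * ennreal \<bar>- dHr y (- x)\<bar> * indicator {\<bar>y\<bar>..} x \<partial>lborel)"
      by (subst nn_integral_real_affine[where c = "-1" and t = 0])
         (auto simp: indicator_def intro!: nn_integral_cong)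
    also have "\<dots> \<le> 4"
    proof (rule order_trans[OF nn_integral_monotone_substitution_tail[OF F_measurable _ _, of _ _ "\<alpha> * y"] F_integral])
      show "((\<lambda>x. Hr y (- x) + \<sigma>) has_real_derivative - dHr y (- x)) (at x)" for x
        using DERIV_chain2[OF resonance_has_derivative DERIV_minus[OF DERIV_ident]] by (auto intro: DERIV_cong)
      show "continuous_on UNIV (\<lambda>x. - dHr y (- x))"
        by (intro continuous_on_minus continuous_on_compose2[OF resonance_deriv_continuous] continuous_intros) auto
      show "\<alpha> * y \<noteq> 0" using y0 \<alpha> by simp
      show "0 \<le> \<alpha> * y * - dHr y (- x)" if "x \<in> {\<bar>y\<bar>..}" for x
      proof -
        have x: "x \<ge> \<bar>y\<bar>" using that by simp
        have "0 \<le> (\<alpha> * (- y)) * dHr y (- x)"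
        proof (rule dHr_sign)
          show "R\<^sup>2 \<le> (y + - x)\<^sup>2 + (- x)\<^sup>2" using big[of "- x"] x by simp
          have "y + 2 * - x \<le> 0" using x by (simp add: abs_le_iff)
          then have "(y * y) * (y + 2 * - x) \<le> 0" by (intro mult_nonneg_nonpos) auto
          then show "0 \<le> - y * (y * (y + 2 * - x))" by (simp add: mult.assoc)
        qed
        then show ?thesis by simp
      qed
    qed
    finally show ?thesis .
  qed
  have "(\<integral>\<^sup>+x. ennreal (\<bar>x\<bar> ^ 3 * \<bar>y\<bar> * (1 + \<bar>Hr x y + \<sigma>\<bar>) powr (- (3 / 2))) * indicator {x. R < \<bar>y\<bar> \<and> \<bar>y\<bar> \<le> \<bar>x\<bar>} x \<partial>lborel)
    \<le> (\<integral>\<^sup>+x. ennreal (1 / (4 * \<bar>\<alpha>\<bar>)) * (?G x * indicator {\<bar>y\<bar>..} x + ?G x * indicator {..-\<bar>y\<bar>} x) \<partial>lborel)"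
  proof (rule nn_integral_mono)
    fix x
    show "ennreal (\<bar>x\<bar> ^ 3 * \<bar>y\<bar> * (1 + \<bar>Hr x y + \<sigma>\<bar>) powr (- (3 / 2))) * indicator {x. R < \<bar>y\<bar> \<and> \<bar>y\<bar> \<le> \<bar>x\<bar>} x
      \<le> ennreal (1 / (4 * \<bar>\<alpha>\<bar>)) * (?G x * indicator {\<bar>y\<bar>..} x + ?G x * indicator {..-\<bar>y\<bar>} x)"
    proof (cases "\<bar>y\<bar> \<le> \<bar>x\<bar>")
      case yx: True
      have "\<bar>x\<bar> \<le> \<bar>y + 2 * x\<bar>" using yx by (simp add: abs_if split: if_splits)
      moreover have "x\<^sup>2 \<le> (y + x)\<^sup>2 + x\<^sup>2" by simp
      ultimately have "\<bar>y\<bar> * \<bar>x\<bar> * (4 * \<bar>\<alpha>\<bar> * x\<^sup>2) \<le> \<bar>y\<bar> * \<bar>y + 2 * x\<bar> * (4 * \<bar>\<alpha>\<bar> * ((y + x)\<^sup>2 + x\<^sup>2))"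
        by (intro mult_mono mult_left_mono) auto
      also have "\<dots> \<le> \<bar>dHr y x\<bar>" by (rule dHr_bound[OF big[OF yx]])
      also have "\<bar>y\<bar> * \<bar>x\<bar> * (4 * \<bar>\<alpha>\<bar> * x\<^sup>2) = 4 * \<bar>\<alpha>\<bar> * (\<bar>x\<bar> ^ 3 * \<bar>y\<bar>)"
      proof -
        have "x\<^sup>2 = \<bar>x\<bar> * \<bar>x\<bar>" by (simp add: power2_eq_square)
        then show ?thesis by (simp only: power3_eq_cube mult_ac)
      qed
      finally have "4 * \<bar>\<alpha>\<bar> * (\<bar>x\<bar> ^ 3 * \<bar>y\<bar>) \<le> \<bar>dHr y x\<bar>" .
      then have "\<bar>x\<bar> ^ 3 * \<bar>y\<bar> \<le> 1 / (4 * \<bar>\<alpha>\<bar>) * \<bar>dHr y x\<bar>"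
        using \<alpha> by (simp add: field_simps)
      then have "\<bar>x\<bar> ^ 3 * \<bar>y\<bar> * (1 + \<bar>Hr x y + \<sigma>\<bar>) powr (- (3 / 2)) \<le> 1 / (4 * \<bar>\<alpha>\<bar>) * \<bar>dHr y x\<bar> * (1 + \<bar>Hr y x + \<sigma>\<bar>) powr (- (3 / 2))"
        unfolding resonance_commute[of _ x y] by (rule mult_right_mono) simp
      then have "ennreal (\<bar>x\<bar> ^ 3 * \<bar>y\<bar> * (1 + \<bar>Hr x y + \<sigma>\<bar>) powr (- (3 / 2))) \<le> ennreal (1 / (4 * \<bar>\<alpha>\<bar>)) * ?G x"
        unfolding F_def by (simp add: ennreal_mult[symmetric] ennreal_leI mult_ac)
      moreover have "?G x \<le> ?G x * indicator {\<bar>y\<bar>..} x + ?G x * indicator {..-\<bar>y\<bar>} x"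
        using yx by (auto simp: indicator_def abs_if split: if_splits)
      ultimately have "ennreal (\<bar>x\<bar> ^ 3 * \<bar>y\<bar> * (1 + \<bar>Hr x y + \<sigma>\<bar>) powr (- (3 / 2))) \<le> ennreal (1 / (4 * \<bar>\<alpha>\<bar>)) * (?G x * indicator {\<bar>y\<bar>..} x + ?G x * indicator {..-\<bar>y\<bar>} x)"
        by (meson mult_left_mono order_trans zero_le)
      then show ?thesis by (simp add: indicator_def)
    qed simp
  qed
  also have "\<dots> = ennreal (1 / (4 * \<bar>\<alpha>\<bar>)) * ((\<integral>\<^sup>+x. ?G x * indicator {\<bar>y\<bar>..} x \<partial>lborel) + (\<integral>\<^sup>+x. ?G x * indicator {..-\<bar>y\<bar>} x \<partial>lborel))"
    by (simp add: nn_integral_cmult nn_integral_add)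
  also have "\<dots> \<le> ennreal (1 / (4 * \<bar>\<alpha>\<bar>)) * (4 + 4)" using b1 b2 by (intro mult_left_mono add_mono) auto
  also have "\<dots> = ennreal (2 / \<bar>\<alpha>\<bar>)"
  proof -
    have "ennreal (1 / (4 * \<bar>\<alpha>\<bar>)) * ennreal 8 = ennreal (1 / (4 * \<bar>\<alpha>\<bar>) * 8)" by (rule ennreal_mult[symmetric]) auto
    then show ?thesis by simp
  qed
  finally show ?thesis .
qed

end

section \<open>The weighted kernel and its bounds at high and at low frequency\<close>

lemma japanese_ge: "japanese x \<ge> 1" "japanese x \<ge> (1 + \<bar>x\<bar>) / 2"
proof -
  show 1: "japanese x \<ge> 1" unfolding japanese_def by simp
  have "\<bar>x\<bar> \<le> japanese x" unfolding japanese_def by (rule real_le_rsqrt) simp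
  with 1 show "japanese x \<ge> (1 + \<bar>x\<bar>) / 2" by simp
qed

lemma japanese_le: "japanese x \<le> 1 + \<bar>x\<bar>"
  unfolding japanese_def by (rule real_le_lsqrt) (auto simp: power2_eq_square algebra_simps)

lemma japanese_pos: "japanese x > 0"
  using japanese_ge(1)[of x] by linarith

lemma japanese_measurable [measurable]: "japanese \<in> borel_measurable borel"
  unfolding japanese_def[abs_def] by measurable

lemma powr_le_self: "x \<ge> 1 \<Longrightarrow> p \<le> 1 \<Longrightarrow> x powr p \<le> x" for x p :: real
  using powr_mono[of p 1 x] by simp

lemma powr_half: "(a / 2) powr (- p) = 2 powr p * a powr (- p)" for a p :: real
  by (simp add: powr_divide powr_minus field_simps)

lemma nn_integral_lborel_pair:
  fixes h :: "'a::euclidean_space \<times> 'b::euclidean_space \<Rightarrow> ennreal"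
  assumes "h \<in> borel_measurable borel"
  shows "(\<integral>\<^sup>+q. h q \<partial>lborel) = (\<integral>\<^sup>+s. \<integral>\<^sup>+x. h (x, s) \<partial>lborel \<partial>lborel)"
    and "(\<integral>\<^sup>+q. h q \<partial>lborel) = (\<integral>\<^sup>+x. \<integral>\<^sup>+s. h (x, s) \<partial>lborel \<partial>lborel)"
proof -
  have h: "h \<in> borel_measurable (lborel \<Otimes>\<^sub>M lborel)" using assms by (simp add: lborel_prod)
  show "(\<integral>\<^sup>+q. h q \<partial>lborel) = (\<integral>\<^sup>+s. \<integral>\<^sup>+x. h (x, s) \<partial>lborel \<partial>lborel)"
    using lborel_pair.nn_integral_snd[OF h] by (simp add: lborel_prod)
  show "(\<integral>\<^sup>+q. h q \<partial>lborel) = (\<integral>\<^sup>+x. \<integral>\<^sup>+s. h (x, s) \<partial>lborel \<partial>lborel)"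
    using lborel.nn_integral_fst[OF h] by (simp add: lborel_prod)
qed

lemma ennreal_square_le: "(I::ennreal)\<^sup>2 \<le> ennreal (c\<^sup>2) \<Longrightarrow> c \<ge> 0 \<Longrightarrow> I \<le> ennreal c"
proof (cases I)
  case (real r)
  assume "I\<^sup>2 \<le> ennreal (c\<^sup>2)" "c \<ge> 0"
  then have "r\<^sup>2 \<le> c\<^sup>2" using real by (simp add: ennreal_power)
  then show ?thesis using real \<open>c \<ge> 0\<close> by (auto intro: ennreal_leI power2_le_imp_le)
qed (simp add: top_power_ennreal top_unique)

text \<open>Square integrability of the modulation weight is what \<open>b > 1/2\<close> means here;
  it lets Cauchy-Schwarz integrate the modulations out.\<close>

lemma japanese_powr_integral:
  assumes "b > 1 / 2"
  shows "(\<integral>\<^sup>+s. ennreal ((japanese s powr (- b))\<^sup>2) \<partial>lborel) \<le> ennreal (2 powr (2 * b) * (2 / (2 * b - 1)))"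
proof -
  have "(\<integral>\<^sup>+s. ennreal ((japanese s powr (- b))\<^sup>2) \<partial>lborel) \<le> (\<integral>\<^sup>+s. ennreal (2 powr (2 * b)) * ennreal ((1 + \<bar>s\<bar>) powr (- (2 * b))) \<partial>lborel)"
  proof (rule nn_integral_mono)
    fix s
    have "(japanese s powr (- b))\<^sup>2 = japanese s powr (- (2 * b))"
      by (simp add: power2_eq_square powr_add[symmetric])
    also have "\<dots> \<le> ((1 + \<bar>s\<bar>) / 2) powr (- (2 * b))"
      using assms japanese_ge(2)[of s] by (intro powr_mono2') auto
    also have "\<dots> = 2 powr (2 * b) * (1 + \<bar>s\<bar>) powr (- (2 * b))"
      by (rule powr_half)
    finally show "ennreal ((japanese s powr (- b))\<^sup>2) \<le> ennreal (2 powr (2 * b)) * ennreal ((1 + \<bar>s\<bar>) powr (- (2 * b)))"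
      by (simp add: ennreal_mult[symmetric] ennreal_leI)
  qed
  also have "\<dots> = ennreal (2 powr (2 * b)) * (\<integral>\<^sup>+s. ennreal ((1 + \<bar>s\<bar>) powr (- (2 * b))) \<partial>lborel)"
    by (rule nn_integral_cmult) measurable
  also have "\<dots> \<le> ennreal (2 powr (2 * b)) * ennreal (2 / (2 * b - 1))"
    using assms by (intro mult_left_mono nn_integral_one_plus_abs_powr) auto
  also have "\<dots> = ennreal (2 powr (2 * b) * (2 / (2 * b - 1)))" using assms by (intro ennreal_mult[symmetric]) auto
  finally show ?thesis .
qed

text \<open>The weight exponent \<open>- s\<close> is replaced by \<open>1/2 - \<delta>\<close>,
  which lies between 0 and 1/2 with 1/2 excluded. A single kernel thus covers every s >
  -1/2.\<close>

locale kawahara_kernel = kawahara +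
  fixes \<delta> b :: real
  assumes \<delta>: "0 < \<delta>" "\<delta> \<le> 1 / 2" and b: "b > 1 / 2"
begin

definition ker :: "real \<Rightarrow> real \<Rightarrow> real \<Rightarrow> real" where
  "ker x y \<sigma> = \<bar>x + y\<bar> * japanese x powr (1 / 2 - \<delta>) * japanese y powr (1 / 2 - \<delta>) / (1 + \<bar>Hr x y + \<sigma>\<bar>)"

lemma ker_measurable [measurable]:
  "(\<lambda>z. ker (f z) (g z) (h z)) \<in> borel_measurable M"
  if [measurable]: "f \<in> borel_measurable M" "g \<in> borel_measurable M" "h \<in> borel_measurable M"
  unfolding ker_def by measurable

lemma ker_nonneg: "ker x y \<sigma> \<ge> 0"
  unfolding ker_def by auto

lemma ker_commute: "ker x y \<sigma> = ker y x \<sigma>"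
  unfolding ker_def resonance_commute[of _ x y] by (simp add: mult_ac add.commute)

text \<open>The squared brackets have exponent \<open>1 - 2 * \<delta> <= 1\<close> and cost at most
  \<open>sqrt 2 * |x|\<close> and \<open>sqrt 2 * |y|\<close>; with \<open>(2 * |x|)^2\<close> this
  makes the constant 8. The growth \<open>|x|^3 * |y|\<close> is the one that
  \<open>column_bound\<close> can absorb.\<close>

lemma ker_high:
  assumes "R < \<bar>y\<bar>" "\<bar>y\<bar> \<le> \<bar>x\<bar>"
  shows "(ker x y \<sigma>)\<^sup>2 \<le> 8 * (\<bar>x\<bar> ^ 3 * \<bar>y\<bar>) / (1 + \<bar>Hr x y + \<sigma>\<bar>)\<^sup>2"
proof -
  have y1: "\<bar>y\<bar> \<ge> 1" "\<bar>x\<bar> \<ge> 1" using assms R(1) by linarith+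
  have jz: "(japanese z powr (1 / 2 - \<delta>))\<^sup>2 \<le> sqrt 2 * \<bar>z\<bar>" if "\<bar>z\<bar> \<ge> 1" for z
  proof -
    have "(japanese z powr (1 / 2 - \<delta>))\<^sup>2 = japanese z powr (1 - 2 * \<delta>)"
      by (simp add: power2_eq_square powr_add[symmetric])
    also have "\<dots> \<le> japanese z" using \<delta> by (intro powr_le_self japanese_ge) auto
    also have "\<dots> \<le> sqrt 2 * \<bar>z\<bar>"
    proof -
      have "1 \<le> z\<^sup>2" using that by (metis abs_1 abs_le_square_iff one_power2)
      then have "sqrt (1 + z\<^sup>2) \<le> sqrt (2 * z\<^sup>2)" by simp
      then show ?thesis unfolding japanese_def by (simp add: real_sqrt_mult)
    qed
    finally show ?thesis .
  qed
  have "\<bar>x + y\<bar> \<le> 2 * \<bar>x\<bar>" using assms by linarith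
  then have s: "\<bar>x + y\<bar>\<^sup>2 \<le> (2 * \<bar>x\<bar>)\<^sup>2" by (intro power_mono) auto
  have "\<bar>x + y\<bar>\<^sup>2 * (japanese x powr (1 / 2 - \<delta>))\<^sup>2 * (japanese y powr (1 / 2 - \<delta>))\<^sup>2 \<le>
      (2 * \<bar>x\<bar>)\<^sup>2 * (sqrt 2 * \<bar>x\<bar>) * (sqrt 2 * \<bar>y\<bar>)"
    using s jz[OF y1(2)] jz[OF y1(1)] by (intro mult_mono) auto
  also have "\<dots> = 8 * (\<bar>x\<bar> ^ 3 * \<bar>y\<bar>)"
    by (simp add: power2_eq_square power3_eq_cube)
  finally show ?thesis unfolding ker_def power_divide power_mult_distrib
    by (rule divide_right_mono) simp
qed

text \<open>First summand: the squared supremum of the kernel on the square of side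
  \<open>8 * R\<close>, times its area. Second: the region \<open>|x| > 4 * R\<close>, where the
  factors 4 come from \<open>F\<close> and from comparing \<open>|x|\<close> with
  \<open>1 + |x|\<close>, and \<open>2 / (2 * \<delta>)\<close> from the integral of
  \<open>(1 + |x|)^(-1 - 2 \<delta>)\<close>.\<close>

definition low_const :: real where
  "low_const = (8 * R * (1 + 4 * R)\<^sup>2)\<^sup>2 * (8 * R) * (8 * R) + 16 * (1 + R)\<^sup>2 / \<bar>\<alpha>\<bar> * 4 * (4 * (2 / (2 * \<delta>)))"

lemma low_const_nonneg: "low_const \<ge> 0"
  unfolding low_const_def using R \<delta> by (intro add_nonneg_nonneg mult_nonneg_nonneg) auto

text \<open>Convergence of the integral over \<open>x\<close> requires \<open>\<delta> > 0\<close>, i.e. \<open>s > - 1/2\<close>.\<close>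

lemma ker_low:
  "(\<integral>\<^sup>+x. \<integral>\<^sup>+y. ennreal ((ker x y \<sigma>)\<^sup>2) * indicator {y. \<bar>y\<bar> \<le> \<bar>x\<bar> \<and> \<bar>y\<bar> \<le> R} y \<partial>lborel \<partial>lborel) \<le> ennreal low_const"
proof -
  let ?J = "{- (4 * R)..4 * R}"
  let ?cA = "(8 * R * (1 + 4 * R)\<^sup>2)\<^sup>2"
  let ?cB = "16 * (1 + R)\<^sup>2 / \<bar>\<alpha>\<bar>"
  let ?G = "\<lambda>x y. F (Hr x y + \<sigma>) * ennreal \<bar>dHr x y\<bar> * indicator {-R..R} y"
  have R0: "R > 0" using R by linarith
  have jle: "japanese z powr (1 / 2 - \<delta>) \<le> 1 + \<bar>z\<bar>" for z
    using powr_le_self[OF japanese_ge(1), of "1 / 2 - \<delta>" z] japanese_le[of z] \<delta> by simp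
  have m1: "1 / (1 + \<bar>u\<bar>) \<le> 1" for u :: real by simp
  have pt: "ennreal ((ker x y \<sigma>)\<^sup>2) * indicator {y. \<bar>y\<bar> \<le> \<bar>x\<bar> \<and> \<bar>y\<bar> \<le> R} y \<le>
      ennreal ?cA * indicator ?J x * indicator ?J y + ennreal (?cB * (4 * (1 + \<bar>x\<bar>) powr (- (1 + 2 * \<delta>)))) * (indicator {x. 4 * R < \<bar>x\<bar>} x * ?G x y)" for x y
  proof (cases "\<bar>y\<bar> \<le> \<bar>x\<bar> \<and> \<bar>y\<bar> \<le> R")
    case y: True
    show ?thesis
    proof (cases "\<bar>x\<bar> \<le> 4 * R")
      case True
      have "ker x y \<sigma> \<le> (8 * R) * (1 + 4 * R) * (1 + 4 * R) * 1"
      proof -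
        have "japanese x powr (1 / 2 - \<delta>) \<le> 1 + 4 * R" "japanese y powr (1 / 2 - \<delta>) \<le> 1 + 4 * R"
          using jle[of x] jle[of y] True y R0 by linarith+
        moreover have "\<bar>x + y\<bar> \<le> 8 * R" using True y R0 by linarith
        ultimately have "\<bar>x + y\<bar> * japanese x powr (1 / 2 - \<delta>) * japanese y powr (1 / 2 - \<delta>) * (1 / (1 + \<bar>Hr x y + \<sigma>\<bar>))
          \<le> (8 * R) * (1 + 4 * R) * (1 + 4 * R) * 1"
          using R0 m1 by (intro mult_mono) auto
        then show ?thesis unfolding ker_def by simp
      qed
      also have "(8 * R) * (1 + 4 * R) * (1 + 4 * R) * 1 = 8 * R * (1 + 4 * R)\<^sup>2"
        by (simp add: power2_eq_square)
      finally have "(ker x y \<sigma>)\<^sup>2 \<le> ?cA"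
        by (rule power_mono[OF _ ker_nonneg])
      then have "ennreal ((ker x y \<sigma>)\<^sup>2) * indicator {y. \<bar>y\<bar> \<le> \<bar>x\<bar> \<and> \<bar>y\<bar> \<le> R} y \<le> ennreal ?cA * indicator ?J x * indicator ?J y"
        using True y R0 by (auto simp: indicator_def abs_le_iff intro!: ennreal_leI)
      then show ?thesis by (rule order_trans) (simp add: add_increasing2)
    next
      case False
      \<comment> \<open>Here \<open>|x + 2 * y| >= |x| / 2\<close>, so \<open>|dHr x y|\<close> is
        at least \<open>|\<alpha>| * |x|^4\<close>, while the squared kernel grows like
        \<open>|x|^(3 - 2 \<delta>)\<close>. Trading \<open>|x|^4\<close> for the derivative leaves
        \<open>|x|^(-1 - 2 \<delta>)\<close>, which is integrable in \<open>x\<close>.\<close>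
      then have x4: "\<bar>x\<bar> > 4 * R" and x1: "\<bar>x\<bar> \<ge> 1" "\<bar>x\<bar> > 0" using R by linarith+
      let ?p = "1 / 2 - \<delta>" and ?m = "1 + \<bar>Hr x y + \<sigma>\<bar>"
      have "japanese x \<le> 2 * \<bar>x\<bar>" using japanese_le[of x] x1 by linarith
      then have "japanese x powr ?p \<le> (2 * \<bar>x\<bar>) powr ?p"
        using \<delta> japanese_pos[of x] by (intro powr_mono2) auto
      also have "\<dots> = 2 powr ?p * \<bar>x\<bar> powr ?p" by (simp add: powr_mult)
      also have "\<dots> \<le> 2 * \<bar>x\<bar> powr ?p" using \<delta> by (intro mult_right_mono powr_le_self) auto
      finally have jx: "japanese x powr ?p \<le> 2 * \<bar>x\<bar> powr ?p" .
      have jy: "japanese y powr ?p \<le> 1 + R" using jle[of y] y by linarith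
      have xy: "\<bar>x + y\<bar> \<le> 2 * \<bar>x\<bar>" using y by linarith
      have "ker x y \<sigma> \<le> (2 * \<bar>x\<bar>) * (2 * \<bar>x\<bar> powr ?p) * (1 + R) / ?m"
        unfolding ker_def using jx jy xy R0 by (intro divide_right_mono mult_mono) auto
      then have "(ker x y \<sigma>)\<^sup>2 \<le> ((2 * \<bar>x\<bar>) * (2 * \<bar>x\<bar> powr ?p) * (1 + R) / ?m)\<^sup>2"
        using ker_nonneg by (intro power_mono) auto
      also have "\<dots> = 16 * (1 + R)\<^sup>2 * (\<bar>x\<bar>\<^sup>2 * (\<bar>x\<bar> powr ?p)\<^sup>2) * (1 / ?m\<^sup>2)"
        by (simp add: power_mult_distrib power_divide)
      also have "\<bar>x\<bar>\<^sup>2 * (\<bar>x\<bar> powr ?p)\<^sup>2 = \<bar>x\<bar> powr (- (1 + 2 * \<delta>)) * \<bar>x\<bar> ^ 4"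
      proof -
        have "\<bar>x\<bar>\<^sup>2 * (\<bar>x\<bar> powr ?p)\<^sup>2 = \<bar>x\<bar> powr 2 * (\<bar>x\<bar> powr ?p * \<bar>x\<bar> powr ?p)"
          using x1 by (simp add: power2_eq_square)
        also have "\<dots> = \<bar>x\<bar> powr (- (1 + 2 * \<delta>)) * \<bar>x\<bar> powr 4"
          unfolding powr_add[symmetric] by simp
        finally show ?thesis using x1 by simp
      qed
      \<comment> \<open>The decay is weakened to that of \<open>F\<close>, so that
        \<open>substitution\<close> applies to the inner integral.\<close>
      also have "1 / ?m\<^sup>2 \<le> ?m powr (- (3 / 2))"
      proof -
        have "1 / ?m\<^sup>2 = ?m powr (- 2)" by (simp add: powr_minus inverse_eq_divide)
        also have "\<dots> \<le> ?m powr (- (3 / 2))" by (rule powr_mono) auto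
        finally show ?thesis .
      qed
      finally have k1: "(ker x y \<sigma>)\<^sup>2 \<le> 16 * (1 + R)\<^sup>2 * (\<bar>x\<bar> powr (- (1 + 2 * \<delta>)) * \<bar>x\<bar> ^ 4) * ?m powr (- (3 / 2))"
        by (simp add: mult_left_mono)
      have z: "x\<^sup>2 / 2 \<le> (x + y)\<^sup>2 + y\<^sup>2"
      proof -
        have "0 \<le> (x + 2 * y)\<^sup>2" by simp
        then show ?thesis by (simp add: power2_eq_square algebra_simps)
      qed
      have "R\<^sup>2 \<le> x\<^sup>2 / 2"
      proof -
        have "(4 * R)\<^sup>2 \<le> \<bar>x\<bar>\<^sup>2" using x4 R0 by (intro power_mono) auto
        then have "16 * R\<^sup>2 \<le> x\<^sup>2" by (simp add: power_mult_distrib)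
        then show ?thesis using zero_le_power2[of R] by linarith
      qed
      then have big: "R\<^sup>2 \<le> (x + y)\<^sup>2 + y\<^sup>2" using z by linarith
      have "\<bar>x\<bar> / 2 \<le> \<bar>x + 2 * y\<bar>" using x4 y by linarith
      then have "\<bar>x\<bar> * (\<bar>x\<bar> / 2) * (4 * \<bar>\<alpha>\<bar> * (x\<^sup>2 / 2)) \<le> \<bar>x\<bar> * \<bar>x + 2 * y\<bar> * (4 * \<bar>\<alpha>\<bar> * ((x + y)\<^sup>2 + y\<^sup>2))"
        using z by (intro mult_mono mult_left_mono) auto
      also have "\<dots> \<le> \<bar>dHr x y\<bar>" by (rule dHr_bound[OF big])
      also have "\<bar>x\<bar> * (\<bar>x\<bar> / 2) * (4 * \<bar>\<alpha>\<bar> * (x\<^sup>2 / 2)) = \<bar>\<alpha>\<bar> * \<bar>x\<bar> ^ 4"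
      proof -
        have "x\<^sup>2 = \<bar>x\<bar> * \<bar>x\<bar>" by (simp add: power2_eq_square)
        moreover have "r * (r / 2) * (4 * c * (r * r / 2)) = c * r ^ 4" for r c :: real
          by (simp add: power4_eq_xxxx)
        ultimately show ?thesis by (simp only:)
      qed
      finally have dx: "\<bar>x\<bar> ^ 4 \<le> 1 / \<bar>\<alpha>\<bar> * \<bar>dHr x y\<bar>" using \<alpha> by (simp add: field_simps)
      have px: "\<bar>x\<bar> powr (- (1 + 2 * \<delta>)) \<le> 4 * (1 + \<bar>x\<bar>) powr (- (1 + 2 * \<delta>))"
      proof -
        have "\<bar>x\<bar> powr (- (1 + 2 * \<delta>)) \<le> ((1 + \<bar>x\<bar>) / 2) powr (- (1 + 2 * \<delta>))"
          using x1 \<delta> by (intro powr_mono2') auto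
        also have "\<dots> = 2 powr (1 + 2 * \<delta>) * (1 + \<bar>x\<bar>) powr (- (1 + 2 * \<delta>))"
          by (rule powr_half)
        also have "2 powr (1 + 2 * \<delta>) \<le> 2 powr 2" using \<delta> by (intro powr_mono) auto
        finally show ?thesis by (simp add: mult_right_mono)
      qed
      have "(ker x y \<sigma>)\<^sup>2 \<le> 16 * (1 + R)\<^sup>2 * ((4 * (1 + \<bar>x\<bar>) powr (- (1 + 2 * \<delta>))) * (1 / \<bar>\<alpha>\<bar> * \<bar>dHr x y\<bar>)) * ?m powr (- (3 / 2))"
        by (rule order_trans[OF k1]) (intro mult_right_mono mult_left_mono mult_mono dx px; simp)
      also have "\<dots> = (?cB * (4 * (1 + \<bar>x\<bar>) powr (- (1 + 2 * \<delta>)))) * (?m powr (- (3 / 2)) * \<bar>dHr x y\<bar>)"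
        by simp
      finally have "ennreal ((ker x y \<sigma>)\<^sup>2) \<le> ennreal (?cB * (4 * (1 + \<bar>x\<bar>) powr (- (1 + 2 * \<delta>)))) * (F (Hr x y + \<sigma>) * ennreal \<bar>dHr x y\<bar>)"
        unfolding F_def by (simp only: ennreal_mult[symmetric] ennreal_leI powr_ge_zero abs_ge_zero mult_nonneg_nonneg zero_le_power2 zero_le_numeral divide_nonneg_nonneg)
      then have "ennreal ((ker x y \<sigma>)\<^sup>2) * indicator {y. \<bar>y\<bar> \<le> \<bar>x\<bar> \<and> \<bar>y\<bar> \<le> R} y \<le>
          ennreal (?cB * (4 * (1 + \<bar>x\<bar>) powr (- (1 + 2 * \<delta>)))) * (indicator {x. 4 * R < \<bar>x\<bar>} x * ?G x y)"
        using y x4 by (auto simp: indicator_def abs_le_iff)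
      then show ?thesis by (rule order_trans) (simp add: add_increasing)
    qed
  qed simp
  have inner: "(\<integral>\<^sup>+y. indicator {x. 4 * R < \<bar>x\<bar>} x * ?G x y \<partial>lborel) \<le> 4" for x
  proof (cases "4 * R < \<bar>x\<bar>")
    case True
    have "(\<integral>\<^sup>+y. ?G x y \<partial>lborel) \<le> 4"
    \<comment> \<open>As \<open>|y| <= R < |x| / 4\<close>, the numbers \<open>x\<close> and
      \<open>x + 2 * y\<close> have the same sign, and one interval is enough.\<close>
    proof (rule substitution[where k = 1])
      fix y assume y: "y \<in> {-R..R}"
      have "0 \<le> (x + 2 * y)\<^sup>2" by simp
      then have z: "x\<^sup>2 / 2 \<le> (x + y)\<^sup>2 + y\<^sup>2" by (simp add: power2_eq_square algebra_simps)
      have "(4 * R)\<^sup>2 \<le> \<bar>x\<bar>\<^sup>2" using True R0 by (intro power_mono) auto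
      then have "16 * R\<^sup>2 \<le> x\<^sup>2" by (simp add: power_mult_distrib)
      then have "R\<^sup>2 \<le> x\<^sup>2 / 2" using zero_le_power2[of R] by linarith
      then show "R\<^sup>2 \<le> (x + y)\<^sup>2 + y\<^sup>2" using z by linarith
      show "0 \<le> 1 * (x * (x + 2 * y))"
      proof (cases "x \<ge> 0")
        case t: True
        then have "x + 2 * y \<ge> 0" using True y by simp
        then show ?thesis using t by simp
      next
        case f: False
        then have "x + 2 * y \<le> 0" using True y by simp
        then show ?thesis using f by (simp add: mult_nonpos_nonpos)
      qed
    qed simp
    then show ?thesis using True by simp
  qed simp
  have "(\<integral>\<^sup>+x. \<integral>\<^sup>+y. ennreal ((ker x y \<sigma>)\<^sup>2) * indicator {y. \<bar>y\<bar> \<le> \<bar>x\<bar> \<and> \<bar>y\<bar> \<le> R} y \<partial>lborel \<partial>lborel) \<le>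
    (\<integral>\<^sup>+x. \<integral>\<^sup>+y. ennreal ?cA * indicator ?J x * indicator ?J y + ennreal (?cB * (4 * (1 + \<bar>x\<bar>) powr (- (1 + 2 * \<delta>)))) * (indicator {x. 4 * R < \<bar>x\<bar>} x * ?G x y) \<partial>lborel \<partial>lborel)"
    by (intro nn_integral_mono pt)
  also have "\<dots> = (\<integral>\<^sup>+x. ennreal ?cA * indicator ?J x * ennreal (8 * R) + ennreal (?cB * (4 * (1 + \<bar>x\<bar>) powr (- (1 + 2 * \<delta>)))) * (\<integral>\<^sup>+y. indicator {x. 4 * R < \<bar>x\<bar>} x * ?G x y \<partial>lborel) \<partial>lborel)"
    using R0 by (intro nn_integral_cong) (simp add: nn_integral_add nn_integral_cmult nn_integral_cmult_indicator)
  also have "\<dots> \<le> (\<integral>\<^sup>+x. ennreal (?cA * (8 * R)) * indicator ?J x + ennreal (?cB * 4 * 4) * ennreal ((1 + \<bar>x\<bar>) powr (- (1 + 2 * \<delta>))) \<partial>lborel)"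
  proof (intro nn_integral_mono add_mono)
    fix x
    show "ennreal ?cA * indicator ?J x * ennreal (8 * R) \<le> ennreal (?cA * (8 * R)) * indicator ?J x"
      using R0 by (simp add: ennreal_mult mult_ac)
    have "ennreal (?cB * (4 * (1 + \<bar>x\<bar>) powr (- (1 + 2 * \<delta>)))) * (\<integral>\<^sup>+y. indicator {x. 4 * R < \<bar>x\<bar>} x * ?G x y \<partial>lborel)
      \<le> ennreal (?cB * (4 * (1 + \<bar>x\<bar>) powr (- (1 + 2 * \<delta>)))) * ennreal 4"
      using inner[of x] by (intro mult_left_mono) auto
    also have "\<dots> = ennreal (?cB * (4 * (1 + \<bar>x\<bar>) powr (- (1 + 2 * \<delta>))) * 4)"
      by (intro ennreal_mult[symmetric]) auto
    also have "?cB * (4 * (1 + \<bar>x\<bar>) powr (- (1 + 2 * \<delta>))) * 4 = (?cB * 4 * 4) * (1 + \<bar>x\<bar>) powr (- (1 + 2 * \<delta>))"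
      by (simp only: mult_ac)
    also have "ennreal \<dots> = ennreal (?cB * 4 * 4) * ennreal ((1 + \<bar>x\<bar>) powr (- (1 + 2 * \<delta>)))"
      by (intro ennreal_mult) auto
    finally show "ennreal (?cB * (4 * (1 + \<bar>x\<bar>) powr (- (1 + 2 * \<delta>)))) * (\<integral>\<^sup>+y. indicator {x. 4 * R < \<bar>x\<bar>} x * ?G x y \<partial>lborel)
      \<le> ennreal (?cB * 4 * 4) * ennreal ((1 + \<bar>x\<bar>) powr (- (1 + 2 * \<delta>)))" .
  qed
  also have "\<dots> = ennreal (?cA * (8 * R)) * emeasure lborel ?J + ennreal (?cB * 4 * 4) * (\<integral>\<^sup>+x. ennreal ((1 + \<bar>x\<bar>) powr (- (1 + 2 * \<delta>))) \<partial>lborel)"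
    by (subst nn_integral_add) (auto simp: nn_integral_cmult nn_integral_cmult_indicator)
  also have "\<dots> \<le> ennreal (?cA * (8 * R)) * ennreal (8 * R) + ennreal (?cB * 4 * 4) * ennreal (2 / (2 * \<delta>))"
  proof (intro add_mono mult_left_mono)
    show "emeasure lborel ?J \<le> ennreal (8 * R)" using R0 by simp
    show "(\<integral>\<^sup>+x. ennreal ((1 + \<bar>x\<bar>) powr (- (1 + 2 * \<delta>))) \<partial>lborel) \<le> ennreal (2 / (2 * \<delta>))"
      using nn_integral_one_plus_abs_powr[of "1 + 2 * \<delta>"] \<delta> by simp
  qed auto
  also have "\<dots> = ennreal (?cA * (8 * R) * (8 * R)) + ennreal (?cB * 4 * 4 * (2 / (2 * \<delta>)))"
    using R0 \<delta> by (subst (1 2) ennreal_mult[symmetric]) auto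
  also have "\<dots> = ennreal (?cA * (8 * R) * (8 * R) + ?cB * 4 * 4 * (2 / (2 * \<delta>)))"
    using R0 \<delta> by (intro ennreal_plus[symmetric]) auto
  also have "?cA * (8 * R) * (8 * R) + ?cB * 4 * 4 * (2 / (2 * \<delta>)) = low_const"
    unfolding low_const_def by (simp add: mult_ac)
  finally show ?thesis .
qed

end

lemma powr_square: "((u::real) powr a)\<^sup>2 = u powr (2 * a)"
  by (simp add: power2_eq_square powr_add[symmetric])

lemma fst_snd_borel [measurable (raw)]:
  fixes f :: "'a \<Rightarrow> real \<times> real"
  assumes "f \<in> M \<rightarrow>\<^sub>M borel"
  shows "(\<lambda>x. fst (f x)) \<in> M \<rightarrow>\<^sub>M borel" "(\<lambda>x. snd (f x)) \<in> M \<rightarrow>\<^sub>M borel"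
  using assms by (auto intro!: measurable_compose[OF assms] borel_measurable_continuous_onI continuous_intros)

section \<open>The bilinear form on the high, low and full frequency regions\<close>

context kawahara_kernel
begin

definition J :: "real \<Rightarrow> real" where "J s = japanese s powr (- b)"

lemma J_measurable [measurable]: "J \<in> borel_measurable borel"
  unfolding J_def[abs_def] by measurable

lemma J_nonneg: "J s \<ge> 0"
  by (simp add: J_def)

definition cJ :: real where "cJ = 2 powr (2 * b) * (2 / (2 * b - 1))"

lemma cJ_nonneg: "cJ \<ge> 0"
  unfolding cJ_def using b by (intro mult_nonneg_nonneg) auto

lemma J_integral: "(\<integral>\<^sup>+s. ennreal ((J s)\<^sup>2) \<partial>lborel) \<le> ennreal cJ"
  unfolding J_def cJ_def by (rule japanese_powr_integral[OF b])

definition high :: "real \<Rightarrow> real \<Rightarrow> bool" where "high x y \<longleftrightarrow> R < \<bar>y\<bar> \<and> \<bar>y\<bar> \<le> \<bar>x\<bar>"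
definition low :: "real \<Rightarrow> real \<Rightarrow> bool" where "low x y \<longleftrightarrow> \<bar>y\<bar> \<le> \<bar>x\<bar> \<and> \<bar>y\<bar> \<le> R"

lemma high_low_measurable [measurable]:
  "Measurable.pred M (\<lambda>z. high (f z) (g z))" "Measurable.pred M (\<lambda>z. low (f z) (g z))"
  if [measurable]: "f \<in> borel_measurable M" "g \<in> borel_measurable M"
  unfolding high_def low_def by measurable

text \<open>A point is a pair of frequency and modulation. \<open>A1\<close> and \<open>A2\<close>
  stand for transforms already multiplied by the Bourgain weights, so that their L2 norms are the
  norms of the factors; \<open>J\<close> and \<open>ker\<close> contain the inverse weights.\<close>

definition part :: "(real \<Rightarrow> real \<Rightarrow> bool) \<Rightarrow> (real \<times> real \<Rightarrow> ennreal) \<Rightarrow> (real \<times> real \<Rightarrow> ennreal) \<Rightarrow> real \<times> real \<Rightarrow> real \<times> real \<Rightarrow> ennreal" where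
  "part P A1 A2 p q = A1 p * A2 q * (ennreal (J (snd p) * J (snd q) * ker (fst p) (fst q) (snd p + snd q)) *
     of_bool (P (fst p) (fst q)))"

lemma iterated_eq_pair:
  fixes f :: "(real \<times> real) \<times> (real \<times> real) \<Rightarrow> ennreal"
  assumes "f \<in> borel_measurable (lborel \<Otimes>\<^sub>M lborel)"
  shows "(\<integral>\<^sup>+z. f z \<partial>(lborel \<Otimes>\<^sub>M lborel)) = (\<integral>\<^sup>+p. \<integral>\<^sup>+q. f (p, q) \<partial>lborel \<partial>lborel)"
    and "(\<integral>\<^sup>+z. f z \<partial>(lborel \<Otimes>\<^sub>M lborel)) = (\<integral>\<^sup>+q. \<integral>\<^sup>+p. f (p, q) \<partial>lborel \<partial>lborel)"
  using lborel.nn_integral_fst[OF assms] lborel_pair.nn_integral_snd[OF assms] by simp_all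

text \<open>A frequency integral bounded uniformly in the modulation is all that is asked; the
  modulation integral of \<open>J^2\<close> then costs \<open>cJ\<close>.\<close>

lemma weighted_slice_bound:
  fixes k :: "real \<Rightarrow> real \<Rightarrow> ennreal"
  assumes [measurable]: "(\<lambda>q. k (fst q) (snd q)) \<in> borel_measurable borel"
    and k: "\<And>s. (\<integral>\<^sup>+x. k x s \<partial>lborel) \<le> c"
  shows "(\<integral>\<^sup>+q. ennreal ((J (snd q))\<^sup>2) * k (fst q) (snd q) \<partial>lborel) \<le> ennreal cJ * c"
proof -
  have [measurable]: "(\<lambda>x. k x s) \<in> borel_measurable borel" for s
    using measurable_compose[OF _ assms(1), of "\<lambda>x. (x, s)"] by simp
  have "(\<integral>\<^sup>+q. ennreal ((J (snd q))\<^sup>2) * k (fst q) (snd q) \<partial>lborel) =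
     (\<integral>\<^sup>+s. \<integral>\<^sup>+x. ennreal ((J s)\<^sup>2) * k x s \<partial>lborel \<partial>lborel)"
    by (subst nn_integral_lborel_pair(1)) auto
  also have "\<dots> = (\<integral>\<^sup>+s. ennreal ((J s)\<^sup>2) * (\<integral>\<^sup>+x. k x s \<partial>lborel) \<partial>lborel)"
    by (intro nn_integral_cong nn_integral_cmult) measurable
  also have "\<dots> \<le> (\<integral>\<^sup>+s. ennreal ((J s)\<^sup>2) * c \<partial>lborel)"
    by (intro nn_integral_mono mult_left_mono k) auto
  also have "\<dots> = (\<integral>\<^sup>+s. ennreal ((J s)\<^sup>2) \<partial>lborel) * c"
    by (rule nn_integral_multc) measurable
  also have "\<dots> \<le> ennreal cJ * c" by (intro mult_right_mono J_integral) auto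
  finally show ?thesis .
qed

lemma slice_bound:
  fixes A :: "real \<times> real \<Rightarrow> ennreal" and f :: "real \<times> real \<Rightarrow> real \<times> real \<Rightarrow> ennreal"
  assumes [measurable]: "A \<in> borel_measurable borel"
    and f: "\<And>p. (\<integral>\<^sup>+q. f p q \<partial>lborel) \<le> c" "\<And>p. f p \<in> borel_measurable borel"
  shows "(\<integral>\<^sup>+p. \<integral>\<^sup>+q. (A p)\<^sup>2 * f p q \<partial>lborel \<partial>lborel) \<le> c * (\<integral>\<^sup>+p. (A p)\<^sup>2 \<partial>lborel)"
proof -
  have "(\<integral>\<^sup>+p. \<integral>\<^sup>+q. (A p)\<^sup>2 * f p q \<partial>lborel \<partial>lborel) = (\<integral>\<^sup>+p. (A p)\<^sup>2 * (\<integral>\<^sup>+q. f p q \<partial>lborel) \<partial>lborel)"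
    using f(2) by (intro nn_integral_cong nn_integral_cmult) auto
  also have "\<dots> \<le> (\<integral>\<^sup>+p. c * (A p)\<^sup>2 \<partial>lborel)"
    by (intro nn_integral_mono) (use f(1) in \<open>auto simp: mult.commute intro: mult_right_mono\<close>)
  also have "\<dots> = c * (\<integral>\<^sup>+p. (A p)\<^sup>2 \<partial>lborel)" by (rule nn_integral_cmult) measurable
  finally show ?thesis .
qed

definition row_const :: real where "row_const = 17 + 2 / sqrt (2 * \<bar>\<alpha>\<bar>)"

text \<open>Schur test as Cauchy-Schwarz on the product space. Each density is grouped with the
  modulation weight of the other variable: in \<open>f^2\<close> the inner integral runs over
  \<open>q\<close> against \<open>J (snd q)^2\<close>, which is a row, and in \<open>g^2\<close>
  over \<open>p\<close> against \<open>J (snd p)^2\<close>, which is a column.\<close>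

lemma high_part:
  fixes A1 A2 :: "real \<times> real \<Rightarrow> ennreal"
  assumes [measurable]: "A1 \<in> borel_measurable borel" "A2 \<in> borel_measurable borel"
  shows "(\<integral>\<^sup>+p. \<integral>\<^sup>+q. part high A1 A2 p q \<partial>lborel \<partial>lborel)\<^sup>2 \<le>
     (ennreal (cJ * (8 * row_const)) * (\<integral>\<^sup>+p. (A1 p)\<^sup>2 \<partial>lborel)) * (ennreal (cJ * (2 / \<bar>\<alpha>\<bar>)) * (\<integral>\<^sup>+p. (A2 p)\<^sup>2 \<partial>lborel))"
proof -
  let ?m = "\<lambda>p q. 1 + \<bar>Hr (fst p) (fst q) + (snd p + snd q)\<bar>"
  define f :: "(real \<times> real) \<times> (real \<times> real) \<Rightarrow> ennreal" where
    "f = (\<lambda>(p, q). A1 p * ennreal (J (snd q) * (sqrt 8 * ?m p q powr (- (1 / 4)))) * of_bool (high (fst p) (fst q)))"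
  define g :: "(real \<times> real) \<times> (real \<times> real) \<Rightarrow> ennreal" where
    "g = (\<lambda>(p, q). A2 q * ennreal (J (snd p) * (sqrt (\<bar>fst p\<bar> ^ 3 * \<bar>fst q\<bar>) * ?m p q powr (- (3 / 4)))) * of_bool (high (fst p) (fst q)))"
  have fm[measurable]: "f \<in> borel_measurable (lborel \<Otimes>\<^sub>M lborel)" unfolding f_def by measurable
  have gm[measurable]: "g \<in> borel_measurable (lborel \<Otimes>\<^sub>M lborel)" unfolding g_def by measurable
  have pt: "part high A1 A2 p q \<le> f (p, q) * g (p, q)" for p q
  proof (cases "high (fst p) (fst q)")
    case True
    let ?a = "\<bar>fst p\<bar> ^ 3 * \<bar>fst q\<bar>"
    have m: "?m p q > 0" by (simp add: add_pos_nonneg)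
    have "ker (fst p) (fst q) (snd p + snd q) \<le> sqrt (8 * ?a / (?m p q)\<^sup>2)"
      using ker_high[of "fst q" "fst p" "snd p + snd q"] True unfolding high_def
      by (intro real_le_rsqrt) auto
    also have "\<dots> = sqrt 8 * sqrt ?a * (1 / ?m p q)"
      using m by (simp add: real_sqrt_divide real_sqrt_mult)
    also have "1 / ?m p q = ?m p q powr (- (1 / 4)) * ?m p q powr (- (3 / 4))"
      unfolding powr_add[symmetric] using m by (simp add: powr_minus_divide)
    finally have k: "ker (fst p) (fst q) (snd p + snd q) \<le>
       (sqrt 8 * ?m p q powr (- (1 / 4))) * (sqrt ?a * ?m p q powr (- (3 / 4)))" by (simp only: mult_ac)
    have "ennreal (J (snd p) * J (snd q) * ker (fst p) (fst q) (snd p + snd q)) \<le>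
       ennreal ((J (snd q) * (sqrt 8 * ?m p q powr (- (1 / 4)))) * (J (snd p) * (sqrt ?a * ?m p q powr (- (3 / 4)))))"
      by (intro ennreal_leI order_trans[OF mult_left_mono[OF k]]) (auto simp: J_nonneg)
    also have "\<dots> = ennreal (J (snd q) * (sqrt 8 * ?m p q powr (- (1 / 4)))) * ennreal (J (snd p) * (sqrt ?a * ?m p q powr (- (3 / 4))))"
      by (intro ennreal_mult) (auto simp: J_nonneg)
    finally have "A1 p * A2 q * ennreal (J (snd p) * J (snd q) * ker (fst p) (fst q) (snd p + snd q)) \<le>
      A1 p * A2 q * (ennreal (J (snd q) * (sqrt 8 * ?m p q powr (- (1 / 4)))) * ennreal (J (snd p) * (sqrt ?a * ?m p q powr (- (3 / 4)))))"
      by (rule mult_left_mono) simp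
    then show ?thesis using True by (simp add: part_def f_def g_def mult_ac)
  qed (simp add: part_def)
  have "(\<integral>\<^sup>+p. \<integral>\<^sup>+q. part high A1 A2 p q \<partial>lborel \<partial>lborel) \<le> (\<integral>\<^sup>+z. f z * g z \<partial>(lborel \<Otimes>\<^sub>M lborel))"
    by (subst iterated_eq_pair(1)) (auto intro!: nn_integral_mono pt)
  then have "(\<integral>\<^sup>+p. \<integral>\<^sup>+q. part high A1 A2 p q \<partial>lborel \<partial>lborel)\<^sup>2 \<le> (\<integral>\<^sup>+z. f z * g z \<partial>(lborel \<Otimes>\<^sub>M lborel))\<^sup>2"
    by (rule power_mono) simp
  also have "\<dots> \<le> (\<integral>\<^sup>+z. f z ^ 2 \<partial>(lborel \<Otimes>\<^sub>M lborel)) * (\<integral>\<^sup>+z. g z ^ 2 \<partial>(lborel \<Otimes>\<^sub>M lborel))"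
    by (rule Cauchy_Schwarz_nn_integral) measurable
  also have "\<dots> \<le> (ennreal (cJ * (8 * row_const)) * (\<integral>\<^sup>+p. (A1 p)\<^sup>2 \<partial>lborel)) * (ennreal (cJ * (2 / \<bar>\<alpha>\<bar>)) * (\<integral>\<^sup>+p. (A2 p)\<^sup>2 \<partial>lborel))"
  proof (rule mult_mono)
    let ?k1 = "\<lambda>p x s. ennreal (8 * (1 + \<bar>Hr (fst p) x + (snd p + s)\<bar>) powr (- (1 / 2))) * of_bool (high (fst p) x)"
    have f2: "f (p, q) ^ 2 = (A1 p)\<^sup>2 * (ennreal ((J (snd q))\<^sup>2) * ?k1 p (fst q) (snd q))" for p q
      unfolding f_def
      by (simp add: power_mult_distrib ennreal_power J_nonneg powr_square ennreal_mult' of_bool_def)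
    have "(\<integral>\<^sup>+q. ennreal ((J (snd q))\<^sup>2) * ?k1 p (fst q) (snd q) \<partial>lborel) \<le> ennreal cJ * ennreal (8 * row_const)" for p
    proof (rule weighted_slice_bound)
      fix s
      have "(\<integral>\<^sup>+x. ?k1 p x s \<partial>lborel) = (\<integral>\<^sup>+x. ennreal 8 * (ennreal ((1 + \<bar>Hr (fst p) x + (snd p + s)\<bar>) powr (- (1 / 2))) * indicator {y. R < \<bar>y\<bar> \<and> \<bar>y\<bar> \<le> \<bar>fst p\<bar>} x) \<partial>lborel)"
        by (intro nn_integral_cong) (auto simp: high_def ennreal_mult' indicator_def)
      also have "\<dots> = ennreal 8 * (\<integral>\<^sup>+x. ennreal ((1 + \<bar>Hr (fst p) x + (snd p + s)\<bar>) powr (- (1 / 2))) * indicator {y. R < \<bar>y\<bar> \<and> \<bar>y\<bar> \<le> \<bar>fst p\<bar>} x \<partial>lborel)"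
        by (rule nn_integral_cmult) measurable
      also have "\<dots> \<le> ennreal 8 * ennreal row_const" unfolding row_const_def
        by (intro mult_left_mono row_bound) auto
      also have "\<dots> = ennreal (8 * row_const)" by (simp add: ennreal_mult')
      finally show "(\<integral>\<^sup>+x. ?k1 p x s \<partial>lborel) \<le> ennreal (8 * row_const)" .
    qed measurable
    then have r1: "(\<integral>\<^sup>+q. ennreal ((J (snd q))\<^sup>2) * ?k1 p (fst q) (snd q) \<partial>lborel) \<le> ennreal (cJ * (8 * row_const))" for p
      by (simp add: ennreal_mult' cJ_nonneg)
    show "(\<integral>\<^sup>+z. f z ^ 2 \<partial>(lborel \<Otimes>\<^sub>M lborel)) \<le> ennreal (cJ * (8 * row_const)) * (\<integral>\<^sup>+p. (A1 p)\<^sup>2 \<partial>lborel)"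
      unfolding iterated_eq_pair(1)[OF borel_measurable_power_ennreal[OF fm]] f2
      by (rule slice_bound[OF _ r1]) measurable
    let ?k2 = "\<lambda>q x s. ennreal (\<bar>x\<bar> ^ 3 * \<bar>fst q\<bar> * (1 + \<bar>Hr x (fst q) + (s + snd q)\<bar>) powr (- (3 / 2))) * of_bool (high x (fst q))"
    have g2: "g (p, q) ^ 2 = (A2 q)\<^sup>2 * (ennreal ((J (snd p))\<^sup>2) * ?k2 q (fst p) (snd p))" for p q
      unfolding g_def
      by (simp add: power_mult_distrib ennreal_power J_nonneg powr_square ennreal_mult' of_bool_def)
    have "(\<integral>\<^sup>+p. ennreal ((J (snd p))\<^sup>2) * ?k2 q (fst p) (snd p) \<partial>lborel) \<le> ennreal cJ * ennreal (2 / \<bar>\<alpha>\<bar>)" for q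
    proof (rule weighted_slice_bound)
      fix s
      have "(\<integral>\<^sup>+x. ?k2 q x s \<partial>lborel) = (\<integral>\<^sup>+x. ennreal (\<bar>x\<bar> ^ 3 * \<bar>fst q\<bar> * (1 + \<bar>Hr x (fst q) + (s + snd q)\<bar>) powr (- (3 / 2))) * indicator {x. R < \<bar>fst q\<bar> \<and> \<bar>fst q\<bar> \<le> \<bar>x\<bar>} x \<partial>lborel)"
        by (intro nn_integral_cong) (auto simp: high_def indicator_def)
      also have "\<dots> \<le> ennreal (2 / \<bar>\<alpha>\<bar>)" by (rule column_bound)
      finally show "(\<integral>\<^sup>+x. ?k2 q x s \<partial>lborel) \<le> ennreal (2 / \<bar>\<alpha>\<bar>)" .
    qed measurable
    then have r2: "(\<integral>\<^sup>+p. ennreal ((J (snd p))\<^sup>2) * ?k2 q (fst p) (snd p) \<partial>lborel) \<le> ennreal (cJ * (2 / \<bar>\<alpha>\<bar>))" for q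
      unfolding ennreal_mult'[OF cJ_nonneg] .
    show "(\<integral>\<^sup>+z. g z ^ 2 \<partial>(lborel \<Otimes>\<^sub>M lborel)) \<le> ennreal (cJ * (2 / \<bar>\<alpha>\<bar>)) * (\<integral>\<^sup>+p. (A2 p)\<^sup>2 \<partial>lborel)"
      unfolding iterated_eq_pair(2)[OF borel_measurable_power_ennreal[OF gm]] g2
      by (rule slice_bound[OF _ r2]) measurable
  qed auto
  finally show ?thesis .
qed

text \<open>Cauchy-Schwarz separates the densities from the kernel. In the Hilbert-Schmidt norm of
  the kernel the frequencies are integrated first, for fixed modulations, by \<open>ker_low\<close>;
  each of the two modulations then contributes a factor \<open>cJ\<close>.\<close>

lemma low_part:
  fixes A1 A2 :: "real \<times> real \<Rightarrow> ennreal"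
  assumes [measurable]: "A1 \<in> borel_measurable borel" "A2 \<in> borel_measurable borel"
  shows "(\<integral>\<^sup>+p. \<integral>\<^sup>+q. part low A1 A2 p q \<partial>lborel \<partial>lborel)\<^sup>2 \<le>
     ((\<integral>\<^sup>+p. (A1 p)\<^sup>2 \<partial>lborel) * (\<integral>\<^sup>+p. (A2 p)\<^sup>2 \<partial>lborel)) * (ennreal cJ * (ennreal cJ * ennreal low_const))"
proof -
  define f :: "(real \<times> real) \<times> (real \<times> real) \<Rightarrow> ennreal" where "f = (\<lambda>(p, q). A1 p * A2 q)"
  define g :: "(real \<times> real) \<times> (real \<times> real) \<Rightarrow> ennreal" where
    "g = (\<lambda>(p, q). ennreal (J (snd p) * J (snd q) * ker (fst p) (fst q) (snd p + snd q)) * of_bool (low (fst p) (fst q)))"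
  have fm[measurable]: "f \<in> borel_measurable (lborel \<Otimes>\<^sub>M lborel)" unfolding f_def by measurable
  have gm[measurable]: "g \<in> borel_measurable (lborel \<Otimes>\<^sub>M lborel)" unfolding g_def by measurable
  have "(\<integral>\<^sup>+p. \<integral>\<^sup>+q. part low A1 A2 p q \<partial>lborel \<partial>lborel) = (\<integral>\<^sup>+z. f z * g z \<partial>(lborel \<Otimes>\<^sub>M lborel))"
    by (subst iterated_eq_pair(1)) (auto simp: part_def[abs_def] f_def g_def)
  then have "(\<integral>\<^sup>+p. \<integral>\<^sup>+q. part low A1 A2 p q \<partial>lborel \<partial>lborel)\<^sup>2 = (\<integral>\<^sup>+z. f z * g z \<partial>(lborel \<Otimes>\<^sub>M lborel))\<^sup>2" by simp
  also have "\<dots> \<le> (\<integral>\<^sup>+z. f z ^ 2 \<partial>(lborel \<Otimes>\<^sub>M lborel)) * (\<integral>\<^sup>+z. g z ^ 2 \<partial>(lborel \<Otimes>\<^sub>M lborel))"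
    by (rule Cauchy_Schwarz_nn_integral) measurable
  also have "\<dots> \<le> ((\<integral>\<^sup>+p. (A1 p)\<^sup>2 \<partial>lborel) * (\<integral>\<^sup>+p. (A2 p)\<^sup>2 \<partial>lborel)) * (ennreal cJ * (ennreal cJ * ennreal low_const))"
  proof (rule mult_mono)
    have "(\<integral>\<^sup>+z. f z ^ 2 \<partial>(lborel \<Otimes>\<^sub>M lborel)) = (\<integral>\<^sup>+p. \<integral>\<^sup>+q. (A1 p)\<^sup>2 * (A2 q)\<^sup>2 \<partial>lborel \<partial>lborel)"
      unfolding iterated_eq_pair(1)[OF borel_measurable_power_ennreal[OF fm]] by (simp add: f_def power_mult_distrib)
    also have "\<dots> \<le> (\<integral>\<^sup>+p. (A2 p)\<^sup>2 \<partial>lborel) * (\<integral>\<^sup>+p. (A1 p)\<^sup>2 \<partial>lborel)"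
      by (rule slice_bound) auto
    finally show "(\<integral>\<^sup>+z. f z ^ 2 \<partial>(lborel \<Otimes>\<^sub>M lborel)) \<le> (\<integral>\<^sup>+p. (A1 p)\<^sup>2 \<partial>lborel) * (\<integral>\<^sup>+p. (A2 p)\<^sup>2 \<partial>lborel)"
      by (simp add: mult.commute)
    let ?k = "\<lambda>x y \<sigma>. ennreal ((ker x y \<sigma>)\<^sup>2) * indicator {y. \<bar>y\<bar> \<le> \<bar>x\<bar> \<and> \<bar>y\<bar> \<le> R} y"
    have g2: "g (p, q) ^ 2 = ennreal ((J (snd p))\<^sup>2) * (ennreal ((J (snd q))\<^sup>2) * ?k (fst p) (fst q) (snd p + snd q))" for p q
      unfolding g_def low_def
      by (auto simp: power_mult_distrib ennreal_power J_nonneg ker_nonneg ennreal_mult' of_bool_def indicator_def mult_ac)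
    have "(\<integral>\<^sup>+z. g z ^ 2 \<partial>(lborel \<Otimes>\<^sub>M lborel)) =
       (\<integral>\<^sup>+p. ennreal ((J (snd p))\<^sup>2) * (\<integral>\<^sup>+q. ennreal ((J (snd q))\<^sup>2) * ?k (fst p) (fst q) (snd p + snd q) \<partial>lborel) \<partial>lborel)"
      unfolding iterated_eq_pair(1)[OF borel_measurable_power_ennreal[OF gm]] g2
      by (intro nn_integral_cong nn_integral_cmult) measurable
    also have "\<dots> \<le> ennreal cJ * (ennreal cJ * ennreal low_const)"
    proof (rule weighted_slice_bound[where k = "\<lambda>x s. \<integral>\<^sup>+q. ennreal ((J (snd q))\<^sup>2) * ?k x (fst q) (s + snd q) \<partial>lborel"])
      fix s
      have "(\<integral>\<^sup>+x. \<integral>\<^sup>+q. ennreal ((J (snd q))\<^sup>2) * ?k x (fst q) (s + snd q) \<partial>lborel \<partial>lborel) =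
        (\<integral>\<^sup>+q. \<integral>\<^sup>+x. ennreal ((J (snd q))\<^sup>2) * ?k x (fst q) (s + snd q) \<partial>lborel \<partial>lborel)"
        by (rule lborel_pair.Fubini'[symmetric]) measurable
      also have "\<dots> = (\<integral>\<^sup>+q. ennreal ((J (snd q))\<^sup>2) * (\<integral>\<^sup>+x. ?k x (fst q) (s + snd q) \<partial>lborel) \<partial>lborel)"
        by (intro nn_integral_cong nn_integral_cmult) measurable
      also have "\<dots> \<le> ennreal cJ * ennreal low_const"
      proof (rule weighted_slice_bound[where k = "\<lambda>y t. \<integral>\<^sup>+x. ?k x y (s + t) \<partial>lborel"])
        fix t
        have "(\<integral>\<^sup>+y. \<integral>\<^sup>+x. ?k x y (s + t) \<partial>lborel \<partial>lborel) = (\<integral>\<^sup>+x. \<integral>\<^sup>+y. ?k x y (s + t) \<partial>lborel \<partial>lborel)"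
          by (rule lborel_pair.Fubini') measurable
        also have "\<dots> \<le> ennreal low_const" by (rule ker_low)
        finally show "(\<integral>\<^sup>+y. \<integral>\<^sup>+x. ?k x y (s + t) \<partial>lborel \<partial>lborel) \<le> ennreal low_const" .
      qed measurable
      finally show "(\<integral>\<^sup>+x. \<integral>\<^sup>+q. ennreal ((J (snd q))\<^sup>2) * ?k x (fst q) (s + snd q) \<partial>lborel \<partial>lborel) \<le> ennreal cJ * ennreal low_const" .
    qed measurable
    finally show "(\<integral>\<^sup>+z. g z ^ 2 \<partial>(lborel \<Otimes>\<^sub>M lborel)) \<le> ennreal cJ * (ennreal cJ * ennreal low_const)" .
  qed auto
  finally show ?thesis .
qed

text \<open>The square roots undo the squares in \<open>high_part\<close> and
  \<open>low_part\<close>.\<close>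

definition core_const :: real where
  "core_const = sqrt (cJ * (8 * row_const) * (cJ * (2 / \<bar>\<alpha>\<bar>))) + sqrt (cJ * (cJ * low_const))"

lemma core_const_nonneg: "core_const \<ge> 0"
  unfolding core_const_def row_const_def using cJ_nonneg low_const_nonneg
  by (intro add_nonneg_nonneg real_sqrt_ge_zero mult_nonneg_nonneg) auto

lemma ordered_part:
  fixes A1 A2 :: "real \<times> real \<Rightarrow> ennreal"
  assumes m[measurable]: "A1 \<in> borel_measurable borel" "A2 \<in> borel_measurable borel"
    and X: "X \<ge> 0" "(\<integral>\<^sup>+p. (A1 p)\<^sup>2 \<partial>lborel) \<le> ennreal (X\<^sup>2)"
    and Y: "Y \<ge> 0" "(\<integral>\<^sup>+p. (A2 p)\<^sup>2 \<partial>lborel) \<le> ennreal (Y\<^sup>2)"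
  shows "(\<integral>\<^sup>+p. \<integral>\<^sup>+q. part (\<lambda>x y. \<bar>y\<bar> \<le> \<bar>x\<bar>) A1 A2 p q \<partial>lborel \<partial>lborel) \<le> ennreal (core_const * X * Y)"
proof -
  have rc: "row_const \<ge> 0" unfolding row_const_def by (intro add_nonneg_nonneg) auto
  let ?h = "cJ * (8 * row_const) * (cJ * (2 / \<bar>\<alpha>\<bar>))" and ?l = "cJ * (cJ * low_const)"
  have h0: "?h \<ge> 0" "?l \<ge> 0" using cJ_nonneg rc low_const_nonneg by (auto intro!: mult_nonneg_nonneg)
  have "(\<integral>\<^sup>+p. \<integral>\<^sup>+q. part high A1 A2 p q \<partial>lborel \<partial>lborel)\<^sup>2 \<le> ennreal ((sqrt ?h * X * Y)\<^sup>2)"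
  proof (rule order_trans[OF high_part[OF m]])
    have "(ennreal (cJ * (8 * row_const)) * (\<integral>\<^sup>+p. (A1 p)\<^sup>2 \<partial>lborel)) * (ennreal (cJ * (2 / \<bar>\<alpha>\<bar>)) * (\<integral>\<^sup>+p. (A2 p)\<^sup>2 \<partial>lborel))
      \<le> (ennreal (cJ * (8 * row_const)) * ennreal (X\<^sup>2)) * (ennreal (cJ * (2 / \<bar>\<alpha>\<bar>)) * ennreal (Y\<^sup>2))"
      by (intro mult_mono mult_left_mono X Y) auto
    also have "\<dots> = ennreal (cJ * (8 * row_const) * X\<^sup>2 * (cJ * (2 / \<bar>\<alpha>\<bar>) * Y\<^sup>2))"
      using cJ_nonneg rc by (simp only: ennreal_mult[symmetric] mult_nonneg_nonneg zero_le_power2 zero_le_numeral divide_nonneg_nonneg abs_ge_zero)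
    also have "cJ * (8 * row_const) * X\<^sup>2 * (cJ * (2 / \<bar>\<alpha>\<bar>) * Y\<^sup>2) = (sqrt ?h * X * Y)\<^sup>2"
      using h0 by (simp only: power_mult_distrib real_sqrt_pow2 mult_ac)
    finally show "(ennreal (cJ * (8 * row_const)) * (\<integral>\<^sup>+p. (A1 p)\<^sup>2 \<partial>lborel)) * (ennreal (cJ * (2 / \<bar>\<alpha>\<bar>)) * (\<integral>\<^sup>+p. (A2 p)\<^sup>2 \<partial>lborel))
      \<le> ennreal ((sqrt ?h * X * Y)\<^sup>2)" .
  qed
  then have H: "(\<integral>\<^sup>+p. \<integral>\<^sup>+q. part high A1 A2 p q \<partial>lborel \<partial>lborel) \<le> ennreal (sqrt ?h * X * Y)"
    by (rule ennreal_square_le) (intro mult_nonneg_nonneg real_sqrt_ge_zero h0 X(1) Y(1))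
  have "(\<integral>\<^sup>+p. \<integral>\<^sup>+q. part low A1 A2 p q \<partial>lborel \<partial>lborel)\<^sup>2 \<le> ennreal ((sqrt ?l * X * Y)\<^sup>2)"
  proof (rule order_trans[OF low_part[OF m]])
    have "((\<integral>\<^sup>+p. (A1 p)\<^sup>2 \<partial>lborel) * (\<integral>\<^sup>+p. (A2 p)\<^sup>2 \<partial>lborel)) * (ennreal cJ * (ennreal cJ * ennreal low_const))
      \<le> (ennreal (X\<^sup>2) * ennreal (Y\<^sup>2)) * (ennreal cJ * (ennreal cJ * ennreal low_const))"
      by (intro mult_mono mult_right_mono X Y) auto
    also have "\<dots> = ennreal (X\<^sup>2 * Y\<^sup>2 * (cJ * (cJ * low_const)))"
      using cJ_nonneg low_const_nonneg by (simp only: ennreal_mult[symmetric] mult_nonneg_nonneg zero_le_power2)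
    also have "X\<^sup>2 * Y\<^sup>2 * (cJ * (cJ * low_const)) = (sqrt ?l * X * Y)\<^sup>2"
      using h0 by (simp only: power_mult_distrib real_sqrt_pow2 mult_ac)
    finally show "((\<integral>\<^sup>+p. (A1 p)\<^sup>2 \<partial>lborel) * (\<integral>\<^sup>+p. (A2 p)\<^sup>2 \<partial>lborel)) * (ennreal cJ * (ennreal cJ * ennreal low_const))
      \<le> ennreal ((sqrt ?l * X * Y)\<^sup>2)" .
  qed
  then have L: "(\<integral>\<^sup>+p. \<integral>\<^sup>+q. part low A1 A2 p q \<partial>lborel \<partial>lborel) \<le> ennreal (sqrt ?l * X * Y)"
    by (rule ennreal_square_le) (intro mult_nonneg_nonneg real_sqrt_ge_zero h0 X(1) Y(1))
  have "(\<integral>\<^sup>+p. \<integral>\<^sup>+q. part (\<lambda>x y. \<bar>y\<bar> \<le> \<bar>x\<bar>) A1 A2 p q \<partial>lborel \<partial>lborel) =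
     (\<integral>\<^sup>+p. \<integral>\<^sup>+q. part high A1 A2 p q + part low A1 A2 p q \<partial>lborel \<partial>lborel)"
    by (intro nn_integral_cong) (auto simp: part_def high_def low_def)
  also have "\<dots> = (\<integral>\<^sup>+p. (\<integral>\<^sup>+q. part high A1 A2 p q \<partial>lborel) + (\<integral>\<^sup>+q. part low A1 A2 p q \<partial>lborel) \<partial>lborel)"
    unfolding part_def by (intro nn_integral_cong nn_integral_add) measurable
  also have "\<dots> = (\<integral>\<^sup>+p. \<integral>\<^sup>+q. part high A1 A2 p q \<partial>lborel \<partial>lborel) + (\<integral>\<^sup>+p. \<integral>\<^sup>+q. part low A1 A2 p q \<partial>lborel \<partial>lborel)"
    unfolding part_def by (intro nn_integral_add) measurable
  also have "\<dots> \<le> ennreal (sqrt ?h * X * Y) + ennreal (sqrt ?l * X * Y)" using H L by (rule add_mono)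
  also have "\<dots> = ennreal (sqrt ?h * X * Y + sqrt ?l * X * Y)" by (intro ennreal_plus[symmetric] mult_nonneg_nonneg real_sqrt_ge_zero h0 X(1) Y(1))
  also have "sqrt ?h * X * Y + sqrt ?l * X * Y = core_const * X * Y" unfolding core_const_def by (simp only: distrib_right)
  finally show ?thesis .
qed

text \<open>Kernel and modulation weights are symmetric, so the region \<open>|x| <= |y|\<close> is
  the ordered one with \<open>A1\<close> and \<open>A2\<close> exchanged; this gives the factor
  2.\<close>

lemma full_part:
  fixes A1 A2 :: "real \<times> real \<Rightarrow> ennreal"
  assumes m[measurable]: "A1 \<in> borel_measurable borel" "A2 \<in> borel_measurable borel"
    and X: "X \<ge> 0" "(\<integral>\<^sup>+p. (A1 p)\<^sup>2 \<partial>lborel) \<le> ennreal (X\<^sup>2)"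
    and Y: "Y \<ge> 0" "(\<integral>\<^sup>+p. (A2 p)\<^sup>2 \<partial>lborel) \<le> ennreal (Y\<^sup>2)"
  shows "(\<integral>\<^sup>+p. \<integral>\<^sup>+q. part (\<lambda>x y. True) A1 A2 p q \<partial>lborel \<partial>lborel) \<le> ennreal (2 * core_const * X * Y)"
proof -
  let ?P = "\<lambda>x y. \<bar>y\<bar> \<le> (\<bar>x\<bar>::real)"
  have sw: "(\<integral>\<^sup>+p. \<integral>\<^sup>+q. part ?P A2 A1 q p \<partial>lborel \<partial>lborel) = (\<integral>\<^sup>+p. \<integral>\<^sup>+q. part ?P A2 A1 p q \<partial>lborel \<partial>lborel)"
    unfolding part_def by (rule lborel_pair.Fubini') measurable
  have pt: "part (\<lambda>x y. True) A1 A2 p q \<le> part ?P A1 A2 p q + part ?P A2 A1 q p" for p q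
  proof -
    have "part (\<lambda>x y. True) A2 A1 q p = part (\<lambda>x y. True) A1 A2 p q"
      unfolding part_def ker_commute[of "fst q"] by (simp add: mult_ac add.commute)
    moreover have "\<bar>fst q\<bar> \<le> \<bar>fst p\<bar> \<or> \<bar>fst p\<bar> \<le> \<bar>fst q\<bar>" by linarith
    then have "part ?P A1 A2 p q = part (\<lambda>x y. True) A1 A2 p q \<or> part ?P A2 A1 q p = part (\<lambda>x y. True) A2 A1 q p"
      by (auto simp: part_def)
    ultimately show ?thesis by (auto intro: add_increasing2 add_increasing)
  qed
  have "(\<integral>\<^sup>+p. \<integral>\<^sup>+q. part (\<lambda>x y. True) A1 A2 p q \<partial>lborel \<partial>lborel) \<le> (\<integral>\<^sup>+p. \<integral>\<^sup>+q. part ?P A1 A2 p q + part ?P A2 A1 q p \<partial>lborel \<partial>lborel)"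
    by (intro nn_integral_mono pt)
  also have "\<dots> = (\<integral>\<^sup>+p. (\<integral>\<^sup>+q. part ?P A1 A2 p q \<partial>lborel) + (\<integral>\<^sup>+q. part ?P A2 A1 q p \<partial>lborel) \<partial>lborel)"
    unfolding part_def by (intro nn_integral_cong nn_integral_add) measurable
  also have "\<dots> = (\<integral>\<^sup>+p. \<integral>\<^sup>+q. part ?P A1 A2 p q \<partial>lborel \<partial>lborel) + (\<integral>\<^sup>+p. \<integral>\<^sup>+q. part ?P A2 A1 q p \<partial>lborel \<partial>lborel)"
    unfolding part_def by (intro nn_integral_add) measurable
  also have "\<dots> \<le> ennreal (core_const * X * Y) + ennreal (core_const * Y * X)"
    unfolding sw by (intro add_mono ordered_part X Y) measurable
  also have "\<dots> = ennreal (core_const * X * Y + core_const * Y * X)"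
    by (intro ennreal_plus[symmetric] mult_nonneg_nonneg core_const_nonneg X(1) Y(1))
  also have "core_const * X * Y + core_const * Y * X = 2 * core_const * X * Y" by simp
  finally show ?thesis .
qed

end

lemma resonance_estimate:
  fixes \<alpha> \<beta> s b :: real
  assumes "\<alpha> \<noteq> 0" "s > - 1 / 2" "b > 1 / 2"
  obtains C where "C \<ge> 0" "\<And>A1 A2 X Y. A1 \<in> borel_measurable borel \<Longrightarrow> A2 \<in> borel_measurable borel \<Longrightarrow>
     X \<ge> 0 \<Longrightarrow> (\<integral>\<^sup>+p. (A1 p)\<^sup>2 \<partial>lborel) \<le> ennreal (X\<^sup>2) \<Longrightarrow> Y \<ge> 0 \<Longrightarrow> (\<integral>\<^sup>+p. (A2 p)\<^sup>2 \<partial>lborel) \<le> ennreal (Y\<^sup>2) \<Longrightarrow>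
     (\<integral>\<^sup>+p. \<integral>\<^sup>+q. A1 p * A2 q * ennreal (japanese (snd p) powr (- b) * japanese (snd q) powr (- b) *
        (\<bar>fst p + fst q\<bar> * japanese (fst p) powr (- s) * japanese (fst q) powr (- s) /
         (1 + \<bar>resonance (dispersion \<alpha> \<beta>) (fst p) (fst q) + (snd p + snd q)\<bar>))) \<partial>lborel \<partial>lborel) \<le> ennreal (C * X * Y)"
proof -
  \<comment> \<open>\<open>R >= 1\<close> turns the bound by \<open>|\<alpha>| * R\<close> into one
    by \<open>|\<alpha>| * R^2\<close>. Capping \<open>\<delta>\<close> at 1/2 keeps the exponent
    \<open>1/2 - \<delta>\<close> nonnegative; for \<open>s >= 0\<close> it is 0, that is, the
    bracket weights are bounded by 1.\<close>
  define R where "R = 1 + 3 * \<bar>\<beta>\<bar> / \<bar>\<alpha>\<bar>"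
  define \<delta> where "\<delta> = min (s + 1 / 2) (1 / 2)"
  have R1: "R \<ge> 1" unfolding R_def by simp
  have "3 * \<bar>\<beta>\<bar> \<le> \<bar>\<alpha>\<bar> * R" unfolding R_def using assms(1) by (simp add: field_simps)
  also have "\<dots> \<le> \<bar>\<alpha>\<bar> * R\<^sup>2" using R1 by (intro mult_left_mono) (auto simp: power2_eq_square)
  finally have R2: "3 * \<bar>\<beta>\<bar> \<le> \<bar>\<alpha>\<bar> * R\<^sup>2" .
  have d: "0 < \<delta>" using assms(2) by (simp add: \<delta>_def)
  have d': "\<delta> \<le> 1 / 2" unfolding \<delta>_def by (rule min.cobounded2)
  interpret kawahara_kernel \<alpha> \<beta> R \<delta> b
    using assms(1,3) R1 R2 d d' by unfold_locales
  have js: "japanese x powr (- s) \<le> japanese x powr (1 / 2 - \<delta>)" for x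
    by (intro powr_mono japanese_ge) (auto simp: \<delta>_def)
  show ?thesis
  proof (rule that[of "2 * core_const"])
    show "2 * core_const \<ge> 0" using core_const_nonneg by simp
    fix A1 A2 :: "real \<times> real \<Rightarrow> ennreal" and X Y
    assume A: "A1 \<in> borel_measurable borel" "A2 \<in> borel_measurable borel"
      "X \<ge> 0" "(\<integral>\<^sup>+p. (A1 p)\<^sup>2 \<partial>lborel) \<le> ennreal (X\<^sup>2)" "Y \<ge> 0" "(\<integral>\<^sup>+p. (A2 p)\<^sup>2 \<partial>lborel) \<le> ennreal (Y\<^sup>2)"
    show "(\<integral>\<^sup>+p. \<integral>\<^sup>+q. A1 p * A2 q * ennreal (japanese (snd p) powr (- b) * japanese (snd q) powr (- b) *
        (\<bar>fst p + fst q\<bar> * japanese (fst p) powr (- s) * japanese (fst q) powr (- s) /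
         (1 + \<bar>Hr (fst p) (fst q) + (snd p + snd q)\<bar>))) \<partial>lborel \<partial>lborel) \<le> ennreal (2 * core_const * X * Y)"
    proof (rule order_trans[OF _ full_part[OF A]], intro nn_integral_mono)
      fix p q :: "real \<times> real"
      show "A1 p * A2 q * ennreal (japanese (snd p) powr (- b) * japanese (snd q) powr (- b) *
        (\<bar>fst p + fst q\<bar> * japanese (fst p) powr (- s) * japanese (fst q) powr (- s) /
         (1 + \<bar>Hr (fst p) (fst q) + (snd p + snd q)\<bar>))) \<le> part (\<lambda>x y. True) A1 A2 p q"
        unfolding part_def J_def ker_def
        by (simp, intro mult_left_mono ennreal_leI divide_right_mono mult_mono js) auto
    qed
  qed
qed

section \<open>Sobolev and Bourgain norms\<close>

abbreviation c0 :: complex where "c0 \<equiv> complex_of_real (1 / sqrt (2 * pi))"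

definition Hs_weight :: "real \<Rightarrow> real \<Rightarrow> real" where
  "Hs_weight s \<xi> = japanese \<xi> powr s"

definition X_weight :: "(real \<Rightarrow> real) \<Rightarrow> real \<Rightarrow> real \<Rightarrow> real \<times> real \<Rightarrow> real" where
  "X_weight \<phi> s b p = japanese (fst p) powr s * japanese (snd p + \<phi> (fst p)) powr b"

lemma Hs_norm_wnorm: "Hs_norm s = wnorm (Hs_weight s)"
  by (simp add: fun_eq_iff Hs_norm_def wnorm_def Hs_weight_def)

lemma X_norm_wnorm: "X_norm \<phi> s b = wnorm (X_weight \<phi> s b)"
  by (simp add: fun_eq_iff X_norm_def wnorm_def X_weight_def case_prod_beta')

lemma japanese_powr_square: "(japanese x powr s)\<^sup>2 = (1 + x\<^sup>2) powr s"
proof -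
  have p: "1 + x\<^sup>2 > 0" by (simp add: add_pos_nonneg)
  have "japanese x = (1 + x\<^sup>2) powr (1 / 2)" unfolding japanese_def using p by (simp add: powr_half_sqrt)
  then show ?thesis by (simp add: powr_powr powr_square)
qed

lemma fourier_weight_Hs: "fourier_weight (Hs_weight s)"
proof
  have m: "moderate (\<lambda>\<xi>. complex_of_real ((1 + \<xi>\<^sup>2) powr r))" for r
    by (intro moderate_powr moderate_of_real_linear) simp
  show "Hs_weight s \<xi> > 0" for \<xi> unfolding Hs_weight_def using japanese_pos[of \<xi>] by simp
  show "moderate (\<lambda>\<xi>. complex_of_real ((Hs_weight s \<xi>)\<^sup>2))"
    unfolding Hs_weight_def japanese_powr_square by (rule m)
  show "slow (\<lambda>\<xi>. complex_of_real (1 / (Hs_weight s \<xi>)\<^sup>2))"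
    using all_derivs_self[OF m[of "-s"]] unfolding Hs_weight_def japanese_powr_square
    by (simp add: powr_minus_divide)
  show "Hs_weight s \<in> borel_measurable borel" unfolding Hs_weight_def[abs_def] by measurable
qed (rule fourier_inversion_real)

lemma phase_measurable: "moderate_phase \<phi> \<Longrightarrow> \<phi> \<in> borel_measurable borel"
  by (drule moderate_measurable) (simp add: borel_measurable_complex_iff)

lemma fourier_weight_X:
  assumes "moderate_phase \<phi>" shows "fourier_weight (X_weight \<phi> s b)"
proof
  note [measurable] = phase_measurable[OF assms]
  have m1: "moderate (\<lambda>p::real \<times> real. complex_of_real ((1 + (fst p)\<^sup>2) powr r))" for r
    by (intro moderate_powr moderate_of_real_linear bounded_linear_fst)
  have "moderate (\<lambda>p. complex_of_real (snd p) + complex_of_real (\<phi> (fst p)))"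
    by (rule moderate_add[OF moderate_of_real_linear[OF bounded_linear_snd] moderate_compose_linear[OF assms bounded_linear_fst]])
  then have m2: "moderate (\<lambda>p. complex_of_real ((1 + (snd p + \<phi> (fst p))\<^sup>2) powr r))" for r
    by (intro moderate_powr) simp
  have m: "moderate (\<lambda>p. complex_of_real ((1 + (fst p)\<^sup>2) powr q * (1 + (snd p + \<phi> (fst p))\<^sup>2) powr r))" for q r
    using moderate_mult[OF m1 m2] by simp
  show "X_weight \<phi> s b p > 0" for p unfolding X_weight_def
    using japanese_pos[of "fst p"] japanese_pos[of "snd p + \<phi> (fst p)"] by simp
  show "moderate (\<lambda>p. complex_of_real ((X_weight \<phi> s b p)\<^sup>2))"
    unfolding X_weight_def power_mult_distrib japanese_powr_square by (rule m)
  show "slow (\<lambda>p. complex_of_real (1 / (X_weight \<phi> s b p)\<^sup>2))"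
    using all_derivs_self[OF m[of "-s" "-b"]] unfolding X_weight_def power_mult_distrib japanese_powr_square
    by (simp add: powr_minus_divide)
  show "X_weight \<phi> s b \<in> borel_measurable borel" unfolding X_weight_def[abs_def] by measurable
qed (rule fourier_inversion_pair)

section \<open>Restriction of Schwartz functions to a fixed time\<close>

lemma (in fourier_weight) wnorm_nn_integral:
  assumes "schwartz f"
  shows "(\<integral>\<^sup>+p. ennreal ((W p * cmod (fourier f p))\<^sup>2) \<partial>lborel) = ennreal ((wnorm W f)\<^sup>2)"
  unfolding wnorm_sq
  by (rule nn_integral_eq_integral[OF weighted_square_integrable(1)[OF schwartz_fourier[OF assms]]]) auto

lemma fourier_slice:
  fixes u :: "real \<times> real \<Rightarrow> complex"
  assumes u: "schwartz u"
  shows "fourier (\<lambda>x. u (x, t)) \<xi> = c0 * (LINT \<tau>|lborel. exp (\<i> * complex_of_real (t * \<tau>)) * fourier u (\<xi>, \<tau>))"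
proof -
  have "(LINT \<tau>|lborel. exp (\<i> * complex_of_real (t * \<tau>)) * fourier u (\<xi>, \<tau>)) =
     complex_of_real (1 / (2 * pi)) * fourier_int (\<lambda>\<tau>. fourier_int u (\<xi>, \<tau>)) (- t)"
    unfolding fourier_eq_pair fourier_int_def[of "\<lambda>\<tau>. fourier_int u (\<xi>, \<tau>)"]
    by (simp only: mult.left_commute[of "exp _" "complex_of_real _"] integral_mult_right_zero) (simp add: mult.commute)
  also have "\<dots> = pfourier u (\<xi>, t)" unfolding pfourier_inversion[OF u] by simp
  finally show ?thesis by (simp add: pfourier_fourier_int fourier_eq_real)
qed

text \<open>The embedding into continuous functions with values in the Sobolev space, on Schwartz
  functions. The value at time \<open>t\<close> is an integral over \<open>\<tau>\<close>, and
  Cauchy-Schwarz against the inverse modulation weight costs a constant that translation invariance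
  makes independent of \<open>\<xi>\<close>.\<close>

lemma slice_bound_Hs:
  assumes \<phi>: "moderate_phase \<phi>" and b: "b > 1 / 2" and u: "schwartz u"
  shows "wnorm (Hs_weight s) (\<lambda>x. u (x, t)) \<le> sqrt (2 powr (2 * b) * (2 / (2 * b - 1))) * wnorm (X_weight \<phi> s b) u"
proof -
  interpret H: fourier_weight "Hs_weight s" by (rule fourier_weight_Hs)
  interpret X: fourier_weight "X_weight \<phi> s b" by (rule fourier_weight_X[OF \<phi>])
  let ?c = "2 powr (2 * b) * (2 / (2 * b - 1))"
  have c: "?c \<ge> 0" using b by simp
  note [measurable] = phase_measurable[OF \<phi>] schwartz_measurable[OF schwartz_fourier[OF u]]
  let ?f = "\<lambda>\<xi> \<tau>. ennreal (cmod (fourier u (\<xi>, \<tau>)))"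
  have int: "integrable lborel (\<lambda>\<tau>. exp (\<i> * complex_of_real (t * \<tau>)) * fourier u (\<xi>, \<tau>))" for \<xi>
    using integrable_cis_mult[OF schwartz_integrable[OF schwartz_slice_snd[OF schwartz_fourier[OF u]]], of "\<lambda>\<tau>. - (t * \<tau>)" \<xi>]
    by simp
  have pt: "ennreal ((Hs_weight s \<xi> * cmod (fourier (\<lambda>x. u (x, t)) \<xi>))\<^sup>2) \<le>
     ennreal ?c * (\<integral>\<^sup>+\<tau>. ennreal ((X_weight \<phi> s b (\<xi>, \<tau>) * cmod (fourier u (\<xi>, \<tau>)))\<^sup>2) \<partial>lborel)" for \<xi>
  proof -
    have "cmod (fourier (\<lambda>x. u (x, t)) \<xi>) = 1 / sqrt (2 * pi) * cmod (LINT \<tau>|lborel. exp (\<i> * complex_of_real (t * \<tau>)) * fourier u (\<xi>, \<tau>))"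
      unfolding fourier_slice[OF u] norm_mult norm_of_real by simp
    also have "\<dots> \<le> 1 * cmod (LINT \<tau>|lborel. exp (\<i> * complex_of_real (t * \<tau>)) * fourier u (\<xi>, \<tau>))"
      using pi_gt3 by (intro mult_right_mono) (auto simp: divide_le_eq_1)
    finally have "ennreal (cmod (fourier (\<lambda>x. u (x, t)) \<xi>)) \<le> ennreal (cmod (LINT \<tau>|lborel. exp (\<i> * complex_of_real (t * \<tau>)) * fourier u (\<xi>, \<tau>)))"
      by (simp add: ennreal_leI)
    also have "\<dots> \<le> (\<integral>\<^sup>+\<tau>. ennreal (cmod (exp (\<i> * complex_of_real (t * \<tau>)) * fourier u (\<xi>, \<tau>))) \<partial>lborel)"
      by (rule integral_norm_bound_ennreal[OF int])
    also have "\<dots> = (\<integral>\<^sup>+\<tau>. ?f \<xi> \<tau> \<partial>lborel)" by (simp add: norm_mult)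
    also have "\<dots> = (\<integral>\<^sup>+\<tau>. ennreal (japanese (\<tau> + \<phi> \<xi>) powr (- b)) * ennreal (japanese (\<tau> + \<phi> \<xi>) powr b * cmod (fourier u (\<xi>, \<tau>))) \<partial>lborel)"
    proof (intro nn_integral_cong)
      fix \<tau>
      have "japanese (\<tau> + \<phi> \<xi>) powr (- b) * (japanese (\<tau> + \<phi> \<xi>) powr b * cmod (fourier u (\<xi>, \<tau>))) = cmod (fourier u (\<xi>, \<tau>))"
        unfolding mult.assoc[symmetric] powr_add[symmetric] using japanese_pos[of "\<tau> + \<phi> \<xi>"] by simp
      then show "?f \<xi> \<tau> = ennreal (japanese (\<tau> + \<phi> \<xi>) powr (- b)) * ennreal (japanese (\<tau> + \<phi> \<xi>) powr b * cmod (fourier u (\<xi>, \<tau>)))"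
        by (subst ennreal_mult[symmetric]) auto
    qed
    finally have "(ennreal (cmod (fourier (\<lambda>x. u (x, t)) \<xi>)))\<^sup>2 \<le>
       (\<integral>\<^sup>+\<tau>. ennreal (japanese (\<tau> + \<phi> \<xi>) powr (- b)) * ennreal (japanese (\<tau> + \<phi> \<xi>) powr b * cmod (fourier u (\<xi>, \<tau>))) \<partial>lborel)\<^sup>2"
      by (rule power_mono) simp
    also have "\<dots> \<le> (\<integral>\<^sup>+\<tau>. (ennreal (japanese (\<tau> + \<phi> \<xi>) powr (- b)))\<^sup>2 \<partial>lborel) *
        (\<integral>\<^sup>+\<tau>. (ennreal (japanese (\<tau> + \<phi> \<xi>) powr b * cmod (fourier u (\<xi>, \<tau>))))\<^sup>2 \<partial>lborel)"
      by (rule Cauchy_Schwarz_nn_integral) measurable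
    also have "\<dots> \<le> ennreal ?c * (\<integral>\<^sup>+\<tau>. (ennreal (japanese (\<tau> + \<phi> \<xi>) powr b * cmod (fourier u (\<xi>, \<tau>))))\<^sup>2 \<partial>lborel)"
    proof (rule mult_right_mono)
      have "(\<integral>\<^sup>+\<tau>. ennreal ((japanese \<tau> powr (- b))\<^sup>2) \<partial>lborel) = ennreal \<bar>1\<bar> * (\<integral>\<^sup>+\<tau>. ennreal ((japanese (\<phi> \<xi> + 1 * \<tau>) powr (- b))\<^sup>2) \<partial>lborel)"
        by (rule nn_integral_real_affine) auto
      then have "(\<integral>\<^sup>+\<tau>. (ennreal (japanese (\<tau> + \<phi> \<xi>) powr (- b)))\<^sup>2 \<partial>lborel) = (\<integral>\<^sup>+\<tau>. ennreal ((japanese \<tau> powr (- b))\<^sup>2) \<partial>lborel)"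
        by (simp add: ennreal_power add.commute)
      then show "(\<integral>\<^sup>+\<tau>. (ennreal (japanese (\<tau> + \<phi> \<xi>) powr (- b)))\<^sup>2 \<partial>lborel) \<le> ennreal ?c"
        using japanese_powr_integral[OF b] by simp
    qed simp
    finally have sq: "(ennreal (cmod (fourier (\<lambda>x. u (x, t)) \<xi>)))\<^sup>2 \<le>
       ennreal ?c * (\<integral>\<^sup>+\<tau>. (ennreal (japanese (\<tau> + \<phi> \<xi>) powr b * cmod (fourier u (\<xi>, \<tau>))))\<^sup>2 \<partial>lborel)" .
    have "ennreal ((Hs_weight s \<xi> * cmod (fourier (\<lambda>x. u (x, t)) \<xi>))\<^sup>2) = ennreal ((Hs_weight s \<xi>)\<^sup>2) * (ennreal (cmod (fourier (\<lambda>x. u (x, t)) \<xi>)))\<^sup>2"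
      by (simp add: power_mult_distrib ennreal_mult ennreal_power)
    also have "\<dots> \<le> ennreal ((Hs_weight s \<xi>)\<^sup>2) * (ennreal ?c * (\<integral>\<^sup>+\<tau>. (ennreal (japanese (\<tau> + \<phi> \<xi>) powr b * cmod (fourier u (\<xi>, \<tau>))))\<^sup>2 \<partial>lborel))"
      by (rule mult_left_mono[OF sq]) simp
    also have "\<dots> = ennreal ?c * (\<integral>\<^sup>+\<tau>. ennreal ((Hs_weight s \<xi>)\<^sup>2) * (ennreal (japanese (\<tau> + \<phi> \<xi>) powr b * cmod (fourier u (\<xi>, \<tau>))))\<^sup>2 \<partial>lborel)"
      by (subst nn_integral_cmult) (auto simp: mult.left_commute)
    also have "(\<lambda>\<tau>. ennreal ((Hs_weight s \<xi>)\<^sup>2) * (ennreal (japanese (\<tau> + \<phi> \<xi>) powr b * cmod (fourier u (\<xi>, \<tau>))))\<^sup>2) =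
       (\<lambda>\<tau>. ennreal ((X_weight \<phi> s b (\<xi>, \<tau>) * cmod (fourier u (\<xi>, \<tau>)))\<^sup>2))"
      by (simp add: fun_eq_iff X_weight_def Hs_weight_def ennreal_power ennreal_mult[symmetric] power_mult_distrib mult.assoc)
    finally show ?thesis .
  qed
  have "ennreal ((wnorm (Hs_weight s) (\<lambda>x. u (x, t)))\<^sup>2) = (\<integral>\<^sup>+\<xi>. ennreal ((Hs_weight s \<xi> * cmod (fourier (\<lambda>x. u (x, t)) \<xi>))\<^sup>2) \<partial>lborel)"
    by (rule H.wnorm_nn_integral[OF schwartz_slice[OF u], symmetric])
  also have "\<dots> \<le> (\<integral>\<^sup>+\<xi>. ennreal ?c * (\<integral>\<^sup>+\<tau>. ennreal ((X_weight \<phi> s b (\<xi>, \<tau>) * cmod (fourier u (\<xi>, \<tau>)))\<^sup>2) \<partial>lborel) \<partial>lborel)"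
    by (intro nn_integral_mono pt)
  also have "\<dots> = ennreal ?c * (\<integral>\<^sup>+\<xi>. \<integral>\<^sup>+\<tau>. ennreal ((X_weight \<phi> s b (\<xi>, \<tau>) * cmod (fourier u (\<xi>, \<tau>)))\<^sup>2) \<partial>lborel \<partial>lborel)"
    unfolding X_weight_def fst_conv snd_conv by (intro nn_integral_cmult) measurable
  also have "\<dots> = ennreal ?c * (\<integral>\<^sup>+p. ennreal ((X_weight \<phi> s b p * cmod (fourier u p))\<^sup>2) \<partial>lborel)"
    by (subst nn_integral_lborel_pair(2)) (auto simp: X_weight_def)
  also have "\<dots> = ennreal ?c * ennreal ((wnorm (X_weight \<phi> s b) u)\<^sup>2)" by (simp only: X.wnorm_nn_integral[OF u])
  also have "\<dots> = ennreal (?c * (wnorm (X_weight \<phi> s b) u)\<^sup>2)" using c by (intro ennreal_mult[symmetric]) auto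
  also have "?c * (wnorm (X_weight \<phi> s b) u)\<^sup>2 = (sqrt ?c * wnorm (X_weight \<phi> s b) u)\<^sup>2"
    unfolding power_mult_distrib real_sqrt_pow2[OF c] ..
  finally have "(wnorm (Hs_weight s) (\<lambda>x. u (x, t)))\<^sup>2 \<le> (sqrt ?c * wnorm (X_weight \<phi> s b) u)\<^sup>2"
    by (simp only: ennreal_le_iff zero_le_power2)
  then show ?thesis
    by (rule power2_le_imp_le) (intro mult_nonneg_nonneg real_sqrt_ge_zero c wnorm_nonneg)
qed

section \<open>The nonlinear term in the Wiener algebra\<close>

text \<open>The convolution formula from the multiplication formula: \<open>f\<close> is written as
  the transform of its reflected transform, and the character at \<open>\<xi>\<close> shifts the
  transform of \<open>g\<close>.\<close>

lemma fourier_mult: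
  fixes f g :: "real \<Rightarrow> complex"
  assumes f: "schwartz f" and g: "schwartz g"
  shows "fourier (\<lambda>x. f x * g x) \<xi> = c0 * (LINT \<eta>|lborel. fourier f \<eta> * fourier g (\<xi> - \<eta>))"
proof -
  have k: "schwartz (\<lambda>\<eta>. fourier f (- \<eta>))" by (intro schwartz_uminus schwartz_fourier f)
  have fe: "fourier (\<lambda>\<eta>. fourier f (- \<eta>)) x = f x" for x
    using fourier_inversion_real[OF f, of "- x"] by (simp add: fourier_reflect)
  have mod: "schwartz (\<lambda>x. exp (- (\<i> * complex_of_real (x \<bullet> \<xi>))) * g x)"
    using schwartz_mult_moderate[OF g moderate_cis_inner[of \<xi>]] by (simp add: mult.commute)
  have shift: "fourier (\<lambda>x. exp (- (\<i> * complex_of_real (x \<bullet> \<xi>))) * g x) \<eta> = fourier g (\<xi> + \<eta>)" for \<eta>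
    unfolding fourier_eq_real fourier_int_def mult.assoc[symmetric] exp_add[symmetric]
    by (simp add: algebra_simps)
  have "fourier (\<lambda>x. f x * g x) \<xi> = c0 * (LINT x|lborel. f x * (exp (- (\<i> * complex_of_real (x \<bullet> \<xi>))) * g x))"
    unfolding fourier_eq_real fourier_int_def by (simp only: mult.left_commute)
  also have "(LINT x|lborel. f x * (exp (- (\<i> * complex_of_real (x \<bullet> \<xi>))) * g x)) =
      (LINT x|lborel. fourier (\<lambda>\<eta>. fourier f (- \<eta>)) x * (exp (- (\<i> * complex_of_real (x \<bullet> \<xi>))) * g x))"
    by (simp only: fe)
  also have "\<dots> = (LINT \<eta>|lborel. fourier f (- \<eta>) * fourier g (\<xi> + \<eta>))"
    using fourier_multiplication[OF schwartz_integrable[OF k] schwartz_integrable[OF mod]] by (simp only: shift)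
  also have "\<dots> = (LINT \<eta>|lborel. fourier f \<eta> * fourier g (\<xi> - \<eta>))"
    by (subst lborel_integral_real_affine[where c = "-1" and t = 0]) simp_all
  finally show ?thesis .
qed

lemma forcing_eq:
  assumes v: "schwartz v" and w: "schwartz w"
  shows "forcing v w (\<xi>, t) = \<i> * complex_of_real \<xi> * (c0 * (LINT \<eta>|lborel. fourier (\<lambda>x. v (x, t)) \<eta> * fourier (\<lambda>x. w (x, t)) (\<xi> - \<eta>)))"
proof -
  have s: "schwartz (\<lambda>p. v p * w p)" by (rule schwartz_mult[OF v w])
  have "forcing v w (\<xi>, t) = fourier (partial_deriv 1 (\<lambda>y. v (y, t) * w (y, t))) \<xi>"
    unfolding forcing_def using partial_deriv_slice[OF s, of t] by simp
  also have "\<dots> = \<i> * complex_of_real \<xi> * fourier (\<lambda>y. v (y, t) * w (y, t)) \<xi>"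
    using fourier_int_partial_deriv[OF schwartz_slice[OF s, of t], of 1 \<xi>] by (simp add: fourier_eq_real)
  also have "fourier (\<lambda>y. v (y, t) * w (y, t)) \<xi> = c0 * (LINT \<eta>|lborel. fourier (\<lambda>x. v (x, t)) \<eta> * fourier (\<lambda>x. w (x, t)) (\<xi> - \<eta>))"
    by (rule fourier_mult[OF schwartz_slice[OF v] schwartz_slice[OF w]])
  finally show ?thesis .
qed

text \<open>For \<open>|y| <= 2\<close> the trivial bound 1 is at most \<open>3 / (1 + |y|)\<close>;
  beyond, the exact primitive gives \<open>2 / |y|\<close>, again at most
  \<open>3 / (1 + |y|)\<close>. The bound decays in \<open>y\<close> uniformly in \<open>t\<close>,
  which makes the denominator of the kernel.\<close>

lemma oscillatory_average:
  "cmod (complex_of_real t * (LINT r|lborel. indicator {0<..<1} r *\<^sub>R exp (\<i> * complex_of_real (r * t * y)))) \<le> 3 / (1 + \<bar>y\<bar>)"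
  if "\<bar>t\<bar> \<le> 1"
proof -
  let ?I = "LINT r|lborel. indicator {0<..<1::real} r *\<^sub>R exp (\<i> * complex_of_real (r * t * y))"
  have n1: "cmod (complex_of_real t * ?I) \<le> 1"
  proof -
    have "cmod ?I \<le> (LINT r|lborel. cmod (indicator {0<..<1::real} r *\<^sub>R exp (\<i> * complex_of_real (r * t * y))))"
      by (rule integral_norm_bound)
    also have "\<dots> = (LINT r|lborel. indicator {0<..<1::real} r)" by (intro Bochner_Integration.integral_cong) auto
    finally have "cmod ?I \<le> 1" by simp
    then show ?thesis using that mult_mono[of "\<bar>t\<bar>" 1 "cmod ?I" 1] by (simp add: norm_mult)
  qed
  show ?thesis
  proof (cases "\<bar>y\<bar> \<le> 2")
    case True
    then have "1 \<le> 3 / (1 + \<bar>y\<bar>)" by (simp add: pos_le_divide_eq)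
    then show ?thesis using n1 by linarith
  next
    case False
    then have y: "y \<noteq> 0" by auto
    let ?F = "\<lambda>s. exp (\<i> * complex_of_real (s * y)) / (\<i> * complex_of_real y)"
    have "complex_of_real t * ?I = (LBINT s=0..t. exp (\<i> * complex_of_real (s * y)))"
      by (rule interval_integral_time_average[symmetric])
    also have "\<dots> = ?F t - ?F 0"
      unfolding zero_ereal_def
    proof (rule interval_integral_FTC_finite)
      show "continuous_on {min 0 t..max 0 t} (\<lambda>s. exp (\<i> * complex_of_real (s * y)))" by (intro continuous_intros)
      fix x
      have e: "(exp has_derivative (\<lambda>h. h * exp z)) (at z)" for z :: complex
        using DERIV_exp[of z] unfolding has_field_derivative_def by (simp add: mult.commute[of _ "exp z"])
      have l: "((\<lambda>s. \<i> * complex_of_real (s * y)) has_derivative (\<lambda>h. \<i> * complex_of_real (h * y))) (at x)"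
        by (auto intro!: derivative_eq_intros)
      have "(?F has_vector_derivative exp (\<i> * complex_of_real (x * y))) (at x)"
        unfolding has_vector_derivative_def divide_inverse
        by (rule has_derivative_eq_rhs[OF has_derivative_mult_left[OF has_derivative_compose[OF l e]]])
           (use y in \<open>auto simp: fun_eq_iff scaleR_conv_of_real field_simps\<close>)
      then show "(?F has_vector_derivative exp (\<i> * complex_of_real (x * y))) (at x within {min 0 t..max 0 t})"
        by (rule has_vector_derivative_at_within)
    qed
    finally have "cmod (complex_of_real t * ?I) = cmod (?F t - ?F 0)" by simp
    also have "\<dots> \<le> cmod (?F t) + cmod (?F 0)" by (rule norm_triangle_ineq4)
    also have "\<dots> = 2 / \<bar>y\<bar>" using y by (simp add: norm_divide norm_mult)
    also have "\<dots> \<le> 3 / (1 + \<bar>y\<bar>)" using False y by (simp add: field_simps)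
    finally show ?thesis .
  qed
qed

lemma integrable_cauchy_triple:
  "integrable lborel (\<lambda>q::real \<times> real \<times> real. 1 / (1 + (fst q)\<^sup>2) * (1 / (1 + (fst (snd q))\<^sup>2) * (1 / (1 + (snd (snd q))\<^sup>2))))"
proof -
  have "integrable (lborel \<Otimes>\<^sub>M lborel) (\<lambda>(x::real, y::real). 1 / (1 + x\<^sup>2) * (1 / (1 + y\<^sup>2)))"
    by (intro integrable_tensor integrable_cauchy_real)
  then have "integrable lborel (\<lambda>p::real \<times> real. 1 / (1 + (fst p)\<^sup>2) * (1 / (1 + (snd p)\<^sup>2)))"
    by (simp add: lborel_prod case_prod_beta')
  from integrable_tensor[OF integrable_cauchy_real this]
  show ?thesis by (simp add: lborel_prod case_prod_beta')
qed

lemma integral_product: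
  fixes f g :: "real \<Rightarrow> complex"
  assumes f: "integrable lborel f" and g: "integrable lborel g"
  shows "(LINT p|lborel. f (fst p) * g (snd p)) = (LINT x|lborel. f x) * (LINT y|lborel. g y)"
proof -
  have [measurable]: "f \<in> borel_measurable borel" "g \<in> borel_measurable borel"
    using f g by (auto dest: borel_measurable_integrable)
  have "integrable (lborel \<Otimes>\<^sub>M lborel) (\<lambda>(x, y). cmod (f x) * cmod (g y))"
    by (intro integrable_tensor integrable_norm f g)
  then have i: "integrable lborel (\<lambda>p. cmod (f (fst p)) * cmod (g (snd p)))" by (simp add: lborel_prod case_prod_beta')
  have "integrable lborel (\<lambda>p. f (fst p) * g (snd p))"
    by (rule Bochner_Integration.integrable_bound[OF i]) (auto simp: norm_mult)
  then show ?thesis by (subst integral_pair(1)) auto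
qed

section \<open>From the Duhamel symbol to the bilinear form in the modulations\<close>

context
  fixes \<phi> :: "real \<Rightarrow> real" and v w :: "real \<times> real \<Rightarrow> complex"
  assumes \<phi>: "moderate_phase \<phi>" and v: "schwartz v" and w: "schwartz w"
begin

text \<open>The variable is \<open>q = (\<eta>, \<tau>1, \<tau>2)\<close>. The spatial frequencies
  add up to \<open>\<xi>\<close>, while the two temporal ones are independent, as the product is
  taken at a fixed time.\<close>

private definition \<Phi> :: "real \<Rightarrow> real \<times> real \<times> real \<Rightarrow> complex" where
  "\<Phi> \<xi> q = fourier v (fst q, fst (snd q)) * fourier w (\<xi> - fst q, snd (snd q))"

private lemma meas:
  "\<phi> \<in> borel_measurable borel" "fourier v \<in> borel_measurable borel" "fourier w \<in> borel_measurable borel"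
  by (intro phase_measurable \<phi> schwartz_measurable schwartz_fourier v w)+

private lemma \<Phi>_measurable: "\<Phi> \<xi> \<in> borel_measurable borel"
proof -
  note [measurable] = meas
  have "\<Phi> \<xi> \<in> borel_measurable (lborel \<Otimes>\<^sub>M (lborel \<Otimes>\<^sub>M lborel))" unfolding \<Phi>_def[abs_def] by measurable
  then show ?thesis by (simp add: lborel_prod)
qed

text \<open>Decay in \<open>\<eta>\<close> is taken from \<open>v\<close> alone and that of
  \<open>w\<close> in \<open>\<xi> - \<eta>\<close> is dropped, which makes the bound uniform in
  \<open>\<xi>\<close>.\<close>

private lemma \<Phi>_bound:
  obtains B where "\<And>\<xi> q. cmod (\<Phi> \<xi> q) \<le> B * (1 / (1 + (fst q)\<^sup>2) * (1 / (1 + (fst (snd q))\<^sup>2) * (1 / (1 + (snd (snd q))\<^sup>2))))"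
proof -
  obtain B1 where B1: "B1 \<ge> 0" "\<And>x t. cmod (fourier v (x, t)) \<le> B1 * (1 / (1 + x\<^sup>2)) * (1 / (1 + t\<^sup>2))"
    using rapid_pair_bound[OF schwartz_rapid[OF schwartz_fourier[OF v]]] by metis
  obtain B2 where B2: "B2 \<ge> 0" "\<And>x t. cmod (fourier w (x, t)) \<le> B2 * (1 / (1 + x\<^sup>2)) * (1 / (1 + t\<^sup>2))"
    using rapid_pair_bound[OF schwartz_rapid[OF schwartz_fourier[OF w]]] by metis
  have B2': "cmod (fourier w (x, t)) \<le> B2 * (1 / (1 + t\<^sup>2))" for x t
  proof -
    have "B2 * (1 / (1 + x\<^sup>2)) * (1 / (1 + t\<^sup>2)) \<le> B2 * 1 * (1 / (1 + t\<^sup>2))"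
      using B2(1) by (intro mult_right_mono mult_left_mono) (auto simp: divide_le_eq_1 add_pos_nonneg)
    then show ?thesis using B2(2)[of x t] by simp
  qed
  have "cmod (\<Phi> \<xi> q) \<le> (B1 * B2) * (1 / (1 + (fst q)\<^sup>2) * (1 / (1 + (fst (snd q))\<^sup>2) * (1 / (1 + (snd (snd q))\<^sup>2))))" for \<xi> q
  proof -
    have "cmod (\<Phi> \<xi> q) \<le> (B1 * (1 / (1 + (fst q)\<^sup>2)) * (1 / (1 + (fst (snd q))\<^sup>2))) * (B2 * (1 / (1 + (snd (snd q))\<^sup>2)))"
      unfolding \<Phi>_def norm_mult using B1(1) by (intro mult_mono B1 B2') auto
    then show ?thesis by (simp only: mult_ac)
  qed
  then show ?thesis by (rule that)
qed

private lemma \<Phi>_integrable: "integrable lborel (\<Phi> \<xi>)"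
proof -
  obtain B where B: "\<And>\<xi> q. cmod (\<Phi> \<xi> q) \<le> B * (1 / (1 + (fst q)\<^sup>2) * (1 / (1 + (fst (snd q))\<^sup>2) * (1 / (1 + (snd (snd q))\<^sup>2))))"
    using \<Phi>_bound by blast
  have "cmod (\<Phi> \<xi> q) \<le> norm (B * (1 / (1 + (fst q)\<^sup>2) * (1 / (1 + (fst (snd q))\<^sup>2) * (1 / (1 + (snd (snd q))\<^sup>2)))))" for q
    unfolding real_norm_def by (rule order_trans[OF B abs_ge_self])
  then show ?thesis
    by (intro Bochner_Integration.integrable_bound[OF integrable_mult_right[OF integrable_cauchy_triple, of B]] always_eventually allI)
       (use \<Phi>_measurable in simp)
qed

private lemma integrable_phase:
  assumes "integrable lborel f" "g \<in> borel_measurable borel"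
  shows "integrable lborel (\<lambda>x. exp (\<i> * complex_of_real (g x)) * (f x :: complex))"
  using integrable_cis_mult[OF assms(1), of "\<lambda>x. - g x"] assms(2) by simp

text \<open>One factor \<open>c0\<close> stems from the convolution and one from the time inversion
  of each of \<open>v\<close> and \<open>w\<close>.\<close>

private lemma forcing_triple:
  "forcing v w (\<xi>, s) = \<i> * complex_of_real \<xi> * c0 ^ 3 *
     (LINT q|lborel. exp (\<i> * complex_of_real (s * (fst (snd q) + snd (snd q)))) * \<Phi> \<xi> q)"
proof -
  note [measurable] = meas
  let ?V = "\<lambda>\<eta> \<tau>. exp (\<i> * complex_of_real (s * \<tau>)) * fourier v (\<eta>, \<tau>)"
  let ?W = "\<lambda>\<eta> \<tau>. exp (\<i> * complex_of_real (s * \<tau>)) * fourier w (\<xi> - \<eta>, \<tau>)"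
  have Vi: "integrable lborel (?V \<eta>)" and Wi: "integrable lborel (?W \<eta>)" for \<eta>
    by (intro integrable_phase schwartz_integrable schwartz_slice_snd schwartz_fourier v w; measurable)+
  have eq: "exp (\<i> * complex_of_real (s * (fst (snd q) + snd (snd q)))) * \<Phi> \<xi> q = ?V (fst q) (fst (snd q)) * ?W (fst q) (snd (snd q))" for q
    unfolding \<Phi>_def by (simp add: distrib_left exp_add mult_ac)
  have eq': "exp (\<i> * complex_of_real (s * (fst p + snd p))) * \<Phi> \<xi> (\<eta>, p) = ?V \<eta> (fst p) * ?W \<eta> (snd p)" for \<eta> p
    using eq[of "(\<eta>, p)"] by (simp only: fst_conv snd_conv)
  have "integrable lborel (\<lambda>q. exp (\<i> * complex_of_real (s * (fst (snd q) + snd (snd q)))) * \<Phi> \<xi> q)"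
    by (intro integrable_phase \<Phi>_integrable) (auto intro!: borel_measurable_continuous_onI continuous_intros)
  then have "(LINT q|lborel. exp (\<i> * complex_of_real (s * (fst (snd q) + snd (snd q)))) * \<Phi> \<xi> q) =
     (LINT \<eta>|lborel. LINT p|lborel. ?V \<eta> (fst p) * ?W \<eta> (snd p))"
    by (simp only: integral_pair(1)) (simp only: eq' fst_conv snd_conv)
  also have "\<dots> = (LINT \<eta>|lborel. (LINT \<tau>|lborel. ?V \<eta> \<tau>) * (LINT \<tau>|lborel. ?W \<eta> \<tau>))"
    by (intro Bochner_Integration.integral_cong refl integral_product Vi Wi)
  finally have "(LINT q|lborel. exp (\<i> * complex_of_real (s * (fst (snd q) + snd (snd q)))) * \<Phi> \<xi> q) =
     (LINT \<eta>|lborel. (LINT \<tau>|lborel. ?V \<eta> \<tau>) * (LINT \<tau>|lborel. ?W \<eta> \<tau>))" .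
  moreover have "forcing v w (\<xi>, s) = \<i> * complex_of_real \<xi> * (c0 * (LINT \<eta>|lborel. (c0 * c0) * ((LINT \<tau>|lborel. ?V \<eta> \<tau>) * (LINT \<tau>|lborel. ?W \<eta> \<tau>))))"
    unfolding forcing_eq[OF v w] fourier_slice[OF v] fourier_slice[OF w] by (simp only: mult_ac)
  ultimately show ?thesis by (simp only: integral_mult_right_zero power3_eq_cube mult.assoc)
qed

text \<open>The average over \<open>r\<close> is taken before the integral over \<open>q\<close>:
  each triple of frequencies then sees the pure oscillation \<open>exp (i r t y)\<close> with
  \<open>y = \<phi> \<xi> + \<tau>1 + \<tau>2\<close>. The factor \<open>t\<close> stays with the
  average because \<open>oscillatory_average\<close> bounds their product. The constants
  \<open>c0\<close> are at most 1 in modulus.\<close>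

private lemma duhamel_symbol_bound:
  assumes t: "\<bar>t\<bar> \<le> 1"
  shows "ennreal (cmod (duhamel_symbol \<phi> (forcing v w) (\<xi>, t))) \<le>
    (\<integral>\<^sup>+q. ennreal (3 * (\<bar>\<xi>\<bar> * cmod (\<Phi> \<xi> q) / (1 + \<bar>\<phi> \<xi> + fst (snd q) + snd (snd q)\<bar>))) \<partial>lborel)"
proof -
  note [measurable] = meas \<Phi>_measurable
  let ?K = "\<i> * complex_of_real \<xi> * c0 ^ 3"
  let ?y = "\<lambda>q::real \<times> real \<times> real. \<phi> \<xi> + fst (snd q) + snd (snd q)"
  let ?E = "\<lambda>y. complex_of_real t * (LINT r|lborel. indicator {0<..<1::real} r *\<^sub>R exp (\<i> * complex_of_real (r * t * y)))"
  have ym[measurable]: "?y \<in> borel_measurable borel"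
    by (auto intro!: borel_measurable_continuous_onI continuous_intros)
  let ?F = "\<lambda>r q. indicator {0<..<1::real} r *\<^sub>R (exp (\<i> * complex_of_real (r * t * ?y q)) * \<Phi> \<xi> q)"
  have Fm: "(\<lambda>(r, q). ?F r q) \<in> borel_measurable (lborel \<Otimes>\<^sub>M lborel)"
  proof -
    have 1: "(\<lambda>z. ?y (snd z)) \<in> borel_measurable (lborel \<Otimes>\<^sub>M lborel)" "(\<lambda>z. \<Phi> \<xi> (snd z)) \<in> borel_measurable (lborel \<Otimes>\<^sub>M lborel)"
      using measurable_compose[OF measurable_snd ym] measurable_compose[OF measurable_snd \<Phi>_measurable] by simp_all
    have "(\<lambda>z. ?F (fst z) (snd z)) \<in> borel_measurable (lborel \<Otimes>\<^sub>M lborel)"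
      using 1 by measurable
    then show ?thesis by (simp add: case_prod_beta')
  qed
  have int: "integrable (lborel \<Otimes>\<^sub>M lborel) (\<lambda>(r, q). ?F r q)"
  proof (rule Bochner_Integration.integrable_bound[OF _ Fm])
    show "integrable (lborel \<Otimes>\<^sub>M lborel) (\<lambda>(r::real, q). indicator {0<..<1} r * cmod (\<Phi> \<xi> q))"
      by (intro integrable_tensor integrable_norm \<Phi>_integrable integrable_real_indicator) auto
  qed (auto simp: norm_mult)
  have phase: "forcing v w (\<xi>, s) * exp (\<i> * complex_of_real (s * \<phi> \<xi>)) = ?K * (LINT q|lborel. exp (\<i> * complex_of_real (s * ?y q)) * \<Phi> \<xi> q)" for s
  proof -
    have "(LINT q|lborel. exp (\<i> * complex_of_real (s * ?y q)) * \<Phi> \<xi> q) =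
       (LINT q|lborel. exp (\<i> * complex_of_real (s * \<phi> \<xi>)) * (exp (\<i> * complex_of_real (s * (fst (snd q) + snd (snd q)))) * \<Phi> \<xi> q))"
      unfolding mult.assoc[symmetric] exp_add[symmetric] by (simp add: algebra_simps)
    then show ?thesis unfolding forcing_triple by simp
  qed
  have "complex_of_real t * time_average 0 (\<lambda>q. forcing v w q * exp (\<i> * complex_of_real (snd q * \<phi> (fst q)))) (\<xi>, t)
    = complex_of_real t * (LINT r|lborel. indicator {0<..<1} r *\<^sub>R (?K * (LINT q|lborel. exp (\<i> * complex_of_real (r * t * ?y q)) * \<Phi> \<xi> q)))"
    unfolding time_average_def fst_conv snd_conv phase by simp
  also have "\<dots> = complex_of_real t * (?K * (LINT r|lborel. LINT q|lborel. ?F r q))"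
    by (simp only: mult_scaleR_right[symmetric, where x = ?K] integral_scaleR_right integral_mult_right_zero)
  also have "(LINT r|lborel. LINT q|lborel. ?F r q) = (LINT q|lborel. LINT r|lborel. ?F r q)"
    by (rule lborel_pair.Fubini_integral[OF int, symmetric])
  also have "\<dots> = (LINT q|lborel. (LINT r|lborel. indicator {0<..<1::real} r *\<^sub>R exp (\<i> * complex_of_real (r * t * ?y q))) * \<Phi> \<xi> q)"
    by (simp only: mult_scaleR_left[symmetric] integral_mult_left_zero)
  also have "complex_of_real t * (?K * \<dots>) = ?K * (LINT q|lborel. ?E (?y q) * \<Phi> \<xi> q)"
  proof -
    let ?L = "LINT q|lborel. (LINT r|lborel. indicator {0<..<1::real} r *\<^sub>R exp (\<i> * complex_of_real (r * t * ?y q))) * \<Phi> \<xi> q"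
    have "complex_of_real t * ?L = (LINT q|lborel. ?E (?y q) * \<Phi> \<xi> q)"
      by (simp only: mult.assoc integral_mult_right_zero)
    then show ?thesis by (simp only: mult.left_commute[of "complex_of_real t" ?K])
  qed
  finally have ds: "cmod (duhamel_symbol \<phi> (forcing v w) (\<xi>, t)) = cmod (?K * (LINT q|lborel. ?E (?y q) * \<Phi> \<xi> q))"
    unfolding duhamel_symbol_def fst_conv snd_conv norm_mult[of "exp _"] norm_cis_minus mult_1 by simp
  have Em: "(\<lambda>y. ?E y) \<in> borel_measurable borel" by measurable
  have EPm: "(\<lambda>q. ?E (?y q) * \<Phi> \<xi> q) \<in> borel_measurable borel"
    by (intro borel_measurable_times measurable_compose[OF ym Em] \<Phi>_measurable)
  have bnd: "cmod (?E (?y q) * \<Phi> \<xi> q) \<le> 3 / (1 + \<bar>?y q\<bar>) * cmod (\<Phi> \<xi> q)" for q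
    unfolding norm_mult[of "?E (?y q)"] by (rule mult_right_mono[OF oscillatory_average[OF t]]) simp
  have EPi: "integrable lborel (\<lambda>q. ?E (?y q) * \<Phi> \<xi> q)"
  proof (rule Bochner_Integration.integrable_bound[OF integrable_mult_right[OF integrable_norm[OF \<Phi>_integrable], of 3]])
    have "cmod (?E (?y q) * \<Phi> \<xi> q) \<le> 3 * cmod (\<Phi> \<xi> q)" for q
    proof (rule order_trans[OF bnd mult_right_mono])
      show "3 / (1 + \<bar>?y q\<bar>) \<le> 3" by (simp add: divide_le_eq)
    qed simp
    then show "AE q in lborel. cmod (?E (?y q) * \<Phi> \<xi> q) \<le> norm (3 * cmod (\<Phi> \<xi> q))" by (intro always_eventually allI) simp
  qed (use EPm in simp)
  have K: "cmod ?K \<le> \<bar>\<xi>\<bar>"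
  proof -
    have "cmod ?K = \<bar>\<xi>\<bar> * (1 / sqrt (2 * pi)) ^ 3" by (simp add: norm_mult norm_power norm_divide)
    also have "\<dots> \<le> \<bar>\<xi>\<bar> * 1 ^ 3" using pi_gt3 by (intro mult_left_mono power_mono) (auto simp: divide_le_eq_1)
    finally show ?thesis by simp
  qed
  have "ennreal (cmod (duhamel_symbol \<phi> (forcing v w) (\<xi>, t))) = ennreal (cmod ?K) * ennreal (cmod (LINT q|lborel. ?E (?y q) * \<Phi> \<xi> q))"
    unfolding ds norm_mult[of ?K] by (rule ennreal_mult) auto
  also have "\<dots> \<le> ennreal \<bar>\<xi>\<bar> * (\<integral>\<^sup>+q. ennreal (cmod (?E (?y q) * \<Phi> \<xi> q)) \<partial>lborel)"
    by (intro mult_mono ennreal_leI K integral_norm_bound_ennreal EPi) auto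
  also have "\<dots> \<le> ennreal \<bar>\<xi>\<bar> * (\<integral>\<^sup>+q. ennreal (3 / (1 + \<bar>?y q\<bar>) * cmod (\<Phi> \<xi> q)) \<partial>lborel)"
    by (intro mult_left_mono nn_integral_mono ennreal_leI bnd) auto
  also have "\<dots> = (\<integral>\<^sup>+q. ennreal \<bar>\<xi>\<bar> * ennreal (3 / (1 + \<bar>?y q\<bar>) * cmod (\<Phi> \<xi> q)) \<partial>lborel)"
    by (rule nn_integral_cmult[symmetric]) (use ym in measurable)
  also have "\<dots> = (\<integral>\<^sup>+q. ennreal (3 * (\<bar>\<xi>\<bar> * cmod (\<Phi> \<xi> q) / (1 + \<bar>?y q\<bar>))) \<partial>lborel)"
    by (intro nn_integral_cong) (simp add: ennreal_mult[symmetric] mult_ac)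
  finally show ?thesis .
qed

text \<open>The second coordinate is the modulation \<open>\<sigma> = \<tau> + \<phi> \<xi>\<close>.\<close>

private definition A :: "real \<Rightarrow> real \<Rightarrow> (real \<times> real \<Rightarrow> complex) \<Rightarrow> real \<times> real \<Rightarrow> ennreal" where
  "A s b u p = ennreal (X_weight \<phi> s b (fst p, snd p - \<phi> (fst p)) * cmod (fourier u (fst p, snd p - \<phi> (fst p))))"

private lemma A_square:
  assumes u: "schwartz u"
  shows "A s b u \<in> borel_measurable borel"
    and "(\<integral>\<^sup>+p. (A s b u p)\<^sup>2 \<partial>lborel) = ennreal ((wnorm (X_weight \<phi> s b) u)\<^sup>2)"
proof -
  note [measurable] = meas
  interpret X: fourier_weight "X_weight \<phi> s b" by (rule fourier_weight_X[OF \<phi>])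
  have [measurable]: "fourier u \<in> borel_measurable borel" by (rule X.fourier_measurable[OF u])
  have pm[measurable]: "(\<lambda>p::real \<times> real. (fst p, snd p - \<phi> (fst p))) \<in> borel \<rightarrow>\<^sub>M borel"
    by (intro borel_measurable_Pair) measurable
  show Am[measurable]: "A s b u \<in> borel_measurable borel"
    unfolding A_def[abs_def] by measurable
  have "(\<integral>\<^sup>+p. (A s b u p)\<^sup>2 \<partial>lborel) = (\<integral>\<^sup>+x. \<integral>\<^sup>+\<sigma>. (A s b u (x, \<sigma>))\<^sup>2 \<partial>lborel \<partial>lborel)"
    by (rule nn_integral_lborel_pair(2)) measurable
  also have "\<dots> = (\<integral>\<^sup>+x. \<integral>\<^sup>+\<tau>. ennreal ((X_weight \<phi> s b (x, \<tau>) * cmod (fourier u (x, \<tau>)))\<^sup>2) \<partial>lborel \<partial>lborel)"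
  proof (rule nn_integral_cong)
    fix x
    have "(\<integral>\<^sup>+\<sigma>. (A s b u (x, \<sigma>))\<^sup>2 \<partial>lborel) = ennreal \<bar>1\<bar> * (\<integral>\<^sup>+\<tau>. (A s b u (x, \<phi> x + 1 * \<tau>))\<^sup>2 \<partial>lborel)"
      by (rule nn_integral_real_affine) auto
    also have "\<dots> = (\<integral>\<^sup>+\<tau>. ennreal ((X_weight \<phi> s b (x, \<tau>) * cmod (fourier u (x, \<tau>)))\<^sup>2) \<partial>lborel)"
      unfolding A_def using X.W_pos by (simp add: ennreal_power less_imp_le)
    finally show "(\<integral>\<^sup>+\<sigma>. (A s b u (x, \<sigma>))\<^sup>2 \<partial>lborel) = (\<integral>\<^sup>+\<tau>. ennreal ((X_weight \<phi> s b (x, \<tau>) * cmod (fourier u (x, \<tau>)))\<^sup>2) \<partial>lborel)" .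
  qed
  also have "\<dots> = (\<integral>\<^sup>+p. ennreal ((X_weight \<phi> s b p * cmod (fourier u p))\<^sup>2) \<partial>lborel)"
    by (rule nn_integral_lborel_pair(2)[symmetric]) measurable
  also have "\<dots> = ennreal ((wnorm (X_weight \<phi> s b) u)\<^sup>2)" by (rule X.wnorm_nn_integral[OF u])
  finally show "(\<integral>\<^sup>+p. (A s b u p)\<^sup>2 \<partial>lborel) = ennreal ((wnorm (X_weight \<phi> s b) u)\<^sup>2)" .
qed

private lemma A_unweight:
  "A s b u (x, \<sigma>) * ennreal (japanese \<sigma> powr (- b) * japanese x powr (- s)) = ennreal (cmod (fourier u (x, \<sigma> - \<phi> x)))"
proof -
  have "X_weight \<phi> s b (x, \<sigma> - \<phi> x) * (japanese \<sigma> powr (- b) * japanese x powr (- s)) = 1"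
  proof -
    have "X_weight \<phi> s b (x, \<sigma> - \<phi> x) * (japanese \<sigma> powr (- b) * japanese x powr (- s)) =
      (japanese x powr s * japanese x powr (- s)) * (japanese \<sigma> powr b * japanese \<sigma> powr (- b))"
      unfolding X_weight_def by simp
    also have "\<dots> = 1" unfolding powr_add[symmetric] using japanese_pos[of x] japanese_pos[of \<sigma>] by simp
    finally show ?thesis .
  qed
  then have "X_weight \<phi> s b (x, \<sigma> - \<phi> x) * cmod (fourier u (x, \<sigma> - \<phi> x)) * (japanese \<sigma> powr (- b) * japanese x powr (- s)) = cmod (fourier u (x, \<sigma> - \<phi> x))"
    by (simp add: mult_ac)
  moreover have "0 \<le> X_weight \<phi> s b (x, \<sigma> - \<phi> x) * cmod (fourier u (x, \<sigma> - \<phi> x))" by (simp add: X_weight_def)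
  ultimately show ?thesis unfolding A_def fst_conv snd_conv by (simp only: ennreal_mult'[symmetric])
qed

text \<open>Changes of variables with unit Jacobian: \<open>x = \<xi> - \<eta>\<close> for the
  second frequency, then the modulations \<open>\<sigma>1 = \<tau>1 + \<phi> \<eta>\<close> and
  \<open>\<sigma>2 = \<tau>2 + \<phi> x\<close>. They turn
  \<open>\<phi> \<xi> + \<tau>1 + \<tau>2\<close> into the resonance function at the two frequencies
  plus \<open>\<sigma>1 + \<sigma>2\<close>, and \<open>A_unweight\<close> inserts the
  weights.\<close>

lemma duhamel_symbol_integral:
  assumes t: "\<bar>t\<bar> \<le> 1"
  shows "(\<integral>\<^sup>+\<xi>. ennreal (cmod (duhamel_symbol \<phi> (forcing v w) (\<xi>, t))) \<partial>lborel) \<le>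
    3 * (\<integral>\<^sup>+p. \<integral>\<^sup>+q. A s b v p * A s b w q * ennreal (japanese (snd p) powr (- b) * japanese (snd q) powr (- b) *
        (\<bar>fst p + fst q\<bar> * japanese (fst p) powr (- s) * japanese (fst q) powr (- s) /
         (1 + \<bar>resonance \<phi> (fst p) (fst q) + (snd p + snd q)\<bar>))) \<partial>lborel \<partial>lborel)"
proof -
  note [measurable] = meas \<Phi>_measurable
  let ?k = "\<lambda>\<xi> \<eta> \<tau>1 \<tau>2. ennreal (\<bar>\<xi>\<bar> * (cmod (fourier v (\<eta>, \<tau>1)) * cmod (fourier w (\<xi> - \<eta>, \<tau>2))) / (1 + \<bar>\<phi> \<xi> + \<tau>1 + \<tau>2\<bar>))"
  have "(\<integral>\<^sup>+\<xi>. ennreal (cmod (duhamel_symbol \<phi> (forcing v w) (\<xi>, t))) \<partial>lborel) \<le>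
     (\<integral>\<^sup>+\<xi>. \<integral>\<^sup>+q. ennreal (3 * (\<bar>\<xi>\<bar> * cmod (\<Phi> \<xi> q) / (1 + \<bar>\<phi> \<xi> + fst (snd q) + snd (snd q)\<bar>))) \<partial>lborel \<partial>lborel)"
    by (intro nn_integral_mono duhamel_symbol_bound t)
  also have "\<dots> = (\<integral>\<^sup>+\<xi>. \<integral>\<^sup>+\<eta>. \<integral>\<^sup>+\<tau>1. \<integral>\<^sup>+\<tau>2. 3 * ?k \<xi> \<eta> \<tau>1 \<tau>2 \<partial>lborel \<partial>lborel \<partial>lborel \<partial>lborel)"
  proof (rule nn_integral_cong)
    fix \<xi>
    have m1: "(\<lambda>q::real \<times> real \<times> real. ennreal (3 * (\<bar>\<xi>\<bar> * cmod (\<Phi> \<xi> q) / (1 + \<bar>\<phi> \<xi> + fst (snd q) + snd (snd q)\<bar>)))) \<in> borel_measurable borel"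
    proof -
      have "(\<lambda>q::real \<times> real \<times> real. \<phi> \<xi> + fst (snd q) + snd (snd q)) \<in> borel_measurable borel"
        by (auto intro!: borel_measurable_continuous_onI continuous_intros)
      then show ?thesis by measurable
    qed
    have m2: "(\<lambda>p::real \<times> real. ennreal (3 * (\<bar>\<xi>\<bar> * cmod (\<Phi> \<xi> (\<eta>, p)) / (1 + \<bar>\<phi> \<xi> + fst p + snd p\<bar>)))) \<in> borel_measurable borel" for \<eta>
      using measurable_compose[OF _ m1, of "\<lambda>p. (\<eta>, p)" borel] by simp
    show "(\<integral>\<^sup>+q. ennreal (3 * (\<bar>\<xi>\<bar> * cmod (\<Phi> \<xi> q) / (1 + \<bar>\<phi> \<xi> + fst (snd q) + snd (snd q)\<bar>))) \<partial>lborel) =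
      (\<integral>\<^sup>+\<eta>. \<integral>\<^sup>+\<tau>1. \<integral>\<^sup>+\<tau>2. 3 * ?k \<xi> \<eta> \<tau>1 \<tau>2 \<partial>lborel \<partial>lborel \<partial>lborel)"
      unfolding nn_integral_lborel_pair(2)[OF m1] fst_conv snd_conv
      by (intro nn_integral_cong, subst nn_integral_lborel_pair(2)[OF m2], intro nn_integral_cong)
         (simp only: \<Phi>_def norm_mult fst_conv snd_conv ennreal_mult'[of 3] zero_le_numeral ennreal_numeral)
  qed
  also have "\<dots> = (\<integral>\<^sup>+\<eta>. \<integral>\<^sup>+\<xi>. \<integral>\<^sup>+\<tau>1. \<integral>\<^sup>+\<tau>2. 3 * ?k \<xi> \<eta> \<tau>1 \<tau>2 \<partial>lborel \<partial>lborel \<partial>lborel \<partial>lborel)"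
    by (rule lborel_pair.Fubini'[symmetric]) measurable
  also have "\<dots> = (\<integral>\<^sup>+\<eta>. \<integral>\<^sup>+x. \<integral>\<^sup>+\<tau>1. \<integral>\<^sup>+\<tau>2. 3 * ?k (\<eta> + x) \<eta> \<tau>1 \<tau>2 \<partial>lborel \<partial>lborel \<partial>lborel \<partial>lborel)"
  proof (rule nn_integral_cong)
    fix \<eta>
    show "(\<integral>\<^sup>+\<xi>. \<integral>\<^sup>+\<tau>1. \<integral>\<^sup>+\<tau>2. 3 * ?k \<xi> \<eta> \<tau>1 \<tau>2 \<partial>lborel \<partial>lborel \<partial>lborel) =
      (\<integral>\<^sup>+x. \<integral>\<^sup>+\<tau>1. \<integral>\<^sup>+\<tau>2. 3 * ?k (\<eta> + x) \<eta> \<tau>1 \<tau>2 \<partial>lborel \<partial>lborel \<partial>lborel)"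
      by (subst nn_integral_real_affine[where c = 1 and t = \<eta>]) auto
  qed
  also have "\<dots> = (\<integral>\<^sup>+\<eta>. \<integral>\<^sup>+x. \<integral>\<^sup>+\<sigma>1. \<integral>\<^sup>+\<sigma>2. 3 * ?k (\<eta> + x) \<eta> (\<sigma>1 - \<phi> \<eta>) (\<sigma>2 - \<phi> x) \<partial>lborel \<partial>lborel \<partial>lborel \<partial>lborel)"
  proof (rule nn_integral_cong, rule nn_integral_cong)
    fix \<eta> x
    have "(\<integral>\<^sup>+\<tau>1. \<integral>\<^sup>+\<tau>2. 3 * ?k (\<eta> + x) \<eta> \<tau>1 \<tau>2 \<partial>lborel \<partial>lborel) =
      (\<integral>\<^sup>+\<sigma>1. \<integral>\<^sup>+\<tau>2. 3 * ?k (\<eta> + x) \<eta> (\<sigma>1 - \<phi> \<eta>) \<tau>2 \<partial>lborel \<partial>lborel)"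
      by (subst nn_integral_real_affine[where c = 1 and t = "- \<phi> \<eta>"]) auto
    also have "\<dots> = (\<integral>\<^sup>+\<sigma>1. \<integral>\<^sup>+\<sigma>2. 3 * ?k (\<eta> + x) \<eta> (\<sigma>1 - \<phi> \<eta>) (\<sigma>2 - \<phi> x) \<partial>lborel \<partial>lborel)"
      by (rule nn_integral_cong, subst nn_integral_real_affine[where c = 1 and t = "- \<phi> x"]) auto
    finally show "(\<integral>\<^sup>+\<tau>1. \<integral>\<^sup>+\<tau>2. 3 * ?k (\<eta> + x) \<eta> \<tau>1 \<tau>2 \<partial>lborel \<partial>lborel) =
      (\<integral>\<^sup>+\<sigma>1. \<integral>\<^sup>+\<sigma>2. 3 * ?k (\<eta> + x) \<eta> (\<sigma>1 - \<phi> \<eta>) (\<sigma>2 - \<phi> x) \<partial>lborel \<partial>lborel)" .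
  qed
  also have "\<dots> = (\<integral>\<^sup>+\<eta>. \<integral>\<^sup>+\<sigma>1. \<integral>\<^sup>+x. \<integral>\<^sup>+\<sigma>2. 3 * ?k (\<eta> + x) \<eta> (\<sigma>1 - \<phi> \<eta>) (\<sigma>2 - \<phi> x) \<partial>lborel \<partial>lborel \<partial>lborel \<partial>lborel)"
  proof (rule nn_integral_cong)
    fix \<eta>
    show "(\<integral>\<^sup>+x. \<integral>\<^sup>+\<sigma>1. \<integral>\<^sup>+\<sigma>2. 3 * ?k (\<eta> + x) \<eta> (\<sigma>1 - \<phi> \<eta>) (\<sigma>2 - \<phi> x) \<partial>lborel \<partial>lborel \<partial>lborel) =
      (\<integral>\<^sup>+\<sigma>1. \<integral>\<^sup>+x. \<integral>\<^sup>+\<sigma>2. 3 * ?k (\<eta> + x) \<eta> (\<sigma>1 - \<phi> \<eta>) (\<sigma>2 - \<phi> x) \<partial>lborel \<partial>lborel \<partial>lborel)"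
      by (rule lborel_pair.Fubini') measurable
  qed
  also have "\<dots> = (\<integral>\<^sup>+\<eta>. \<integral>\<^sup>+\<sigma>1. \<integral>\<^sup>+q. 3 * ?k (\<eta> + fst q) \<eta> (\<sigma>1 - \<phi> \<eta>) (snd q - \<phi> (fst q)) \<partial>lborel \<partial>lborel \<partial>lborel)"
    by (intro nn_integral_cong, subst nn_integral_lborel_pair(2)) auto
  also have "\<dots> = (\<integral>\<^sup>+p. \<integral>\<^sup>+q. 3 * ?k (fst p + fst q) (fst p) (snd p - \<phi> (fst p)) (snd q - \<phi> (fst q)) \<partial>lborel \<partial>lborel)"
    by (subst nn_integral_lborel_pair(2)) auto
  also have "\<dots> = (\<integral>\<^sup>+p. 3 * (\<integral>\<^sup>+q. ?k (fst p + fst q) (fst p) (snd p - \<phi> (fst p)) (snd q - \<phi> (fst q)) \<partial>lborel) \<partial>lborel)"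
    by (intro nn_integral_cong nn_integral_cmult) measurable
  also have "\<dots> = 3 * (\<integral>\<^sup>+p. \<integral>\<^sup>+q. ?k (fst p + fst q) (fst p) (snd p - \<phi> (fst p)) (snd q - \<phi> (fst q)) \<partial>lborel \<partial>lborel)"
    by (intro nn_integral_cmult) measurable
  also have "(\<lambda>p q. ?k (fst p + fst q) (fst p) (snd p - \<phi> (fst p)) (snd q - \<phi> (fst q))) =
    (\<lambda>p q. A s b v p * A s b w q * ennreal (japanese (snd p) powr (- b) * japanese (snd q) powr (- b) *
        (\<bar>fst p + fst q\<bar> * japanese (fst p) powr (- s) * japanese (fst q) powr (- s) /
         (1 + \<bar>resonance \<phi> (fst p) (fst q) + (snd p + snd q)\<bar>))))"
  proof (intro ext)
    fix p q :: "real \<times> real"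
    obtain x1 s1 x2 s2 where pq: "p = (x1, s1)" "q = (x2, s2)" by (metis surj_pair)
    let ?m = "\<bar>x1 + x2\<bar> / (1 + \<bar>resonance \<phi> x1 x2 + (s1 + s2)\<bar>)"
    have em: "ennreal (P * Q * M) = ennreal P * ennreal Q * ennreal M" if "0 \<le> P" "0 \<le> Q" for P Q M
      using that by (simp add: ennreal_mult')
    have m: "\<phi> (x1 + x2) + (s1 - \<phi> x1) + (s2 - \<phi> x2) = resonance \<phi> x1 x2 + (s1 + s2)" by (simp add: resonance_def)
    have "A s b v p * A s b w q * ennreal (japanese s1 powr (- b) * japanese s2 powr (- b) *
        (\<bar>x1 + x2\<bar> * japanese x1 powr (- s) * japanese x2 powr (- s) / (1 + \<bar>resonance \<phi> x1 x2 + (s1 + s2)\<bar>)))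
      = A s b v p * A s b w q * ennreal ((japanese s1 powr (- b) * japanese x1 powr (- s)) * (japanese s2 powr (- b) * japanese x2 powr (- s)) * ?m)"
      by (simp add: mult_ac)
    also have "\<dots> = (A s b v p * ennreal (japanese s1 powr (- b) * japanese x1 powr (- s))) * (A s b w q * ennreal (japanese s2 powr (- b) * japanese x2 powr (- s))) * ennreal ?m"
      unfolding em[OF mult_nonneg_nonneg[OF powr_ge_zero powr_ge_zero] mult_nonneg_nonneg[OF powr_ge_zero powr_ge_zero]]
      by (simp only: mult_ac)
    also have "\<dots> = ennreal (cmod (fourier v (x1, s1 - \<phi> x1))) * ennreal (cmod (fourier w (x2, s2 - \<phi> x2))) * ennreal ?m"
      unfolding pq A_unweight ..
    also have "\<dots> = ?k (x1 + x2) x1 (s1 - \<phi> x1) (s2 - \<phi> x2)"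
      unfolding m by (simp add: ennreal_mult[symmetric] mult_ac)
    finally show "?k (fst p + fst q) (fst p) (snd p - \<phi> (fst p)) (snd q - \<phi> (fst q)) =
      A s b v p * A s b w q * ennreal (japanese (snd p) powr (- b) * japanese (snd q) powr (- b) *
        (\<bar>fst p + fst q\<bar> * japanese (fst p) powr (- s) * japanese (fst q) powr (- s) /
         (1 + \<bar>resonance \<phi> (fst p) (fst q) + (snd p + snd q)\<bar>)))" unfolding pq fst_conv snd_conv by simp
  qed
  finally show ?thesis .
qed

text \<open>The bilinear estimate is a hypothesis because this context admits every moderate phase;
  \<open>resonance_estimate\<close> supplies it for the dispersion at hand.\<close>

lemma duhamel_symbol_L1_bound:
  assumes "\<bar>t\<bar> \<le> 1" and int: "\<And>A1 A2 X Y. A1 \<in> borel_measurable borel \<Longrightarrow> A2 \<in> borel_measurable borel \<Longrightarrow>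
     X \<ge> 0 \<Longrightarrow> (\<integral>\<^sup>+p. (A1 p)\<^sup>2 \<partial>lborel) \<le> ennreal (X\<^sup>2) \<Longrightarrow> Y \<ge> 0 \<Longrightarrow> (\<integral>\<^sup>+p. (A2 p)\<^sup>2 \<partial>lborel) \<le> ennreal (Y\<^sup>2) \<Longrightarrow>
     (\<integral>\<^sup>+p. \<integral>\<^sup>+q. A1 p * A2 q * ennreal (japanese (snd p) powr (- b) * japanese (snd q) powr (- b) *
        (\<bar>fst p + fst q\<bar> * japanese (fst p) powr (- s) * japanese (fst q) powr (- s) /
         (1 + \<bar>resonance \<phi> (fst p) (fst q) + (snd p + snd q)\<bar>))) \<partial>lborel \<partial>lborel) \<le> ennreal (C * X * Y)"
  shows "(\<integral>\<^sup>+\<xi>. ennreal (cmod (duhamel_symbol \<phi> (forcing v w) (\<xi>, t))) \<partial>lborel) \<le>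
    3 * ennreal (C * wnorm (X_weight \<phi> s b) v * wnorm (X_weight \<phi> s b) w)"
  by (rule order_trans[OF duhamel_symbol_integral[OF assms(1), of s b] mult_left_mono[OF int]])
     (use A_square[OF v] A_square[OF w] wnorm_nonneg in auto)

end

text \<open>\<open>C\<close> precedes all of \<open>v\<close>, \<open>w\<close>,
  \<open>\<eta>\<close>, \<open>T\<close>, \<open>x\<close> and \<open>t\<close>, which gives
  uniform convergence later. The condition on \<open>\<eta> (t / T)\<close> is pointwise since a
  cutoff may exceed 1 in modulus where its argument lies between 1 and 2.\<close>

lemma local_duhamel_sup_bound:
  fixes \<alpha> \<beta> s b :: real
  assumes "\<alpha> \<noteq> 0" "s > - 1 / 2" "b > 1 / 2"
  obtains C where "C \<ge> 0" "\<And>v w \<eta> T x t. schwartz v \<Longrightarrow> schwartz w \<Longrightarrow> \<bar>t\<bar> \<le> 1 \<Longrightarrow> \<bar>\<eta> (t / T)\<bar> \<le> 1 \<Longrightarrow>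
    cmod (local_duhamel (dispersion \<alpha> \<beta>) \<eta> T v w (x, t)) \<le>
      C * wnorm (X_weight (dispersion \<alpha> \<beta>) s b) v * wnorm (X_weight (dispersion \<alpha> \<beta>) s b) w"
proof -
  let ?\<phi> = "dispersion \<alpha> \<beta>"
  let ?N = "wnorm (X_weight ?\<phi> s b)"
  obtain C where C: "C \<ge> 0" "\<And>A1 A2 X Y. A1 \<in> borel_measurable borel \<Longrightarrow> A2 \<in> borel_measurable borel \<Longrightarrow>
     X \<ge> 0 \<Longrightarrow> (\<integral>\<^sup>+p. (A1 p)\<^sup>2 \<partial>lborel) \<le> ennreal (X\<^sup>2) \<Longrightarrow> Y \<ge> 0 \<Longrightarrow> (\<integral>\<^sup>+p. (A2 p)\<^sup>2 \<partial>lborel) \<le> ennreal (Y\<^sup>2) \<Longrightarrow>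
     (\<integral>\<^sup>+p. \<integral>\<^sup>+q. A1 p * A2 q * ennreal (japanese (snd p) powr (- b) * japanese (snd q) powr (- b) *
        (\<bar>fst p + fst q\<bar> * japanese (fst p) powr (- s) * japanese (fst q) powr (- s) /
         (1 + \<bar>resonance ?\<phi> (fst p) (fst q) + (snd p + snd q)\<bar>))) \<partial>lborel \<partial>lborel) \<le> ennreal (C * X * Y)"
    by (rule resonance_estimate[OF assms, of \<beta>], rule that)
  show ?thesis
  proof (rule that[of "3 * C"])
    show "3 * C \<ge> 0" using C(1) by simp
    fix v w :: "real \<times> real \<Rightarrow> complex" and \<eta> :: "real \<Rightarrow> real" and T x t :: real
    assume v: "schwartz v" and w: "schwartz w" and t: "\<bar>t\<bar> \<le> 1" and \<eta>: "\<bar>\<eta> (t / T)\<bar> \<le> 1"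
    let ?D = "\<lambda>\<xi>. duhamel_symbol ?\<phi> (forcing v w) (\<xi>, t)"
    let ?I = "LINT \<xi>|lborel. exp (- (\<i> * complex_of_real (\<xi> * (- x)))) * ?D \<xi>"
    have D: "integrable lborel ?D"
      by (rule integrable_duhamel_symbol(1)[OF moderate_dispersion schwartz_forcing[OF v w]])
    have nn: "0 \<le> 3 * C * ?N v * ?N w" using C(1) by (intro mult_nonneg_nonneg wnorm_nonneg) auto
    have "ennreal (cmod ?I) \<le> (\<integral>\<^sup>+\<xi>. ennreal (cmod (exp (- (\<i> * complex_of_real (\<xi> * (- x)))) * ?D \<xi>)) \<partial>lborel)"
      by (rule integral_norm_bound_ennreal[OF integrable_cis_mult[OF D]]) measurable
    also have "\<dots> = (\<integral>\<^sup>+\<xi>. ennreal (cmod (?D \<xi>)) \<partial>lborel)"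
      by (simp only: norm_mult norm_cis_minus mult_1)
    also have "\<dots> \<le> 3 * ennreal (C * ?N v * ?N w)"
      by (rule duhamel_symbol_L1_bound[OF moderate_dispersion v w t C(2)])
    also have "\<dots> = ennreal (3 * (C * ?N v * ?N w))" by (simp add: ennreal_mult')
    finally have I: "cmod ?I \<le> 3 * C * ?N v * ?N w"
      using nn by (subst (asm) ennreal_le_iff) (auto simp: mult.assoc)
    have "cmod (local_duhamel ?\<phi> \<eta> T v w (x, t)) = (1 / sqrt (2 * pi)) * (\<bar>\<eta> (t / T)\<bar> * cmod ?I)"
      unfolding local_duhamel_eq[OF moderate_dispersion v w] norm_mult norm_of_real by simp
    also have "\<dots> \<le> 1 * (1 * cmod ?I)"
      using \<eta> pi_gt3 by (intro mult_mono) (auto simp: divide_le_eq_1)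
    finally show "cmod (local_duhamel ?\<phi> \<eta> T v w (x, t)) \<le> 3 * C * ?N v * ?N w" using I by simp
  qed
qed

section \<open>Convergence to the initial data\<close>

lemma local_duhamel_small_time:
  assumes \<phi>: "moderate_phase \<phi>" and v: "schwartz v" and w: "schwartz w"
  obtains B where "B > 0" "\<And>\<eta> T x t. \<bar>\<eta> (t / T)\<bar> \<le> 1 \<Longrightarrow> cmod (local_duhamel \<phi> \<eta> T v w (x, t)) \<le> B * \<bar>t\<bar>"
proof -
  note G = schwartz_forcing[OF v w]
  obtain B where B: "B \<ge> 0" "\<And>\<xi> s. cmod (forcing v w (\<xi>, s)) \<le> B * (1 / (1 + \<xi>\<^sup>2))"
    using rapid_pair_bound_fst[OF schwartz_rapid[OF G]] by metis
  let ?c = "LINT \<xi>|lborel. 1 / (1 + (\<xi>::real)\<^sup>2)"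
  have c: "?c \<ge> 0" by (rule Bochner_Integration.integral_nonneg) simp
  show ?thesis
  \<comment> \<open>The summand 1 makes the constant positive; it is a divisor in the choice of the
    time interval.\<close>
  proof (rule that[of "B * ?c + 1"])
    show "B * ?c + 1 > 0" using B(1) c by (intro add_nonneg_pos mult_nonneg_nonneg) auto
    fix \<eta> :: "real \<Rightarrow> real" and T x t :: real
    assume \<eta>: "\<bar>\<eta> (t / T)\<bar> \<le> 1"
    let ?D = "\<lambda>\<xi>. duhamel_symbol \<phi> (forcing v w) (\<xi>, t)"
    let ?I = "LINT \<xi>|lborel. exp (- (\<i> * complex_of_real (\<xi> * (- x)))) * ?D \<xi>"
    have "cmod ?I \<le> (LINT \<xi>|lborel. cmod (exp (- (\<i> * complex_of_real (\<xi> * (- x)))) * ?D \<xi>))"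
      by (rule integral_norm_bound)
    also have "\<dots> = (LINT \<xi>|lborel. cmod (?D \<xi>))" by (simp only: norm_mult norm_cis_minus mult_1)
    also have "\<dots> \<le> (LINT \<xi>|lborel. \<bar>t\<bar> * (B * (1 / (1 + \<xi>\<^sup>2))))"
      by (intro integral_mono integrable_norm integrable_duhamel_symbol \<phi> G B integrable_mult_right integrable_cauchy_real)
    also have "\<dots> = B * ?c * \<bar>t\<bar>" unfolding integral_mult_right_zero by simp
    also have "\<dots> \<le> (B * ?c + 1) * \<bar>t\<bar>" by (intro mult_right_mono) auto
    finally have I: "cmod ?I \<le> (B * ?c + 1) * \<bar>t\<bar>" .
    have "cmod (local_duhamel \<phi> \<eta> T v w (x, t)) = (1 / sqrt (2 * pi)) * (\<bar>\<eta> (t / T)\<bar> * cmod ?I)"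
      unfolding local_duhamel_eq[OF \<phi> v w] norm_mult norm_of_real by simp
    also have "\<dots> \<le> 1 * (1 * cmod ?I)"
      using \<eta> pi_gt3 by (intro mult_mono) (auto simp: divide_le_eq_1)
    finally show "cmod (local_duhamel \<phi> \<eta> T v w (x, t)) \<le> (B * ?c + 1) * \<bar>t\<bar>" using I by simp
  qed
qed

section \<open>The supremum norm of a distributional limit\<close>

lemma Linfty_norm_nonneg: "0 \<le> Linfty_norm v"
  unfolding Linfty_norm_def
proof (rule INF_greatest)
  fix g :: "'a \<Rightarrow> complex"
  assume "g \<in> {g \<in> borel_measurable lborel. \<forall>\<psi>. v \<psi> = (LINT x|lborel. g x * Rep_test_fun \<psi> x)}"
  have "(0::ereal) = esssup (lborel :: 'a measure) (\<lambda>x. 0)" by (rule esssup_const[symmetric]) simp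
  also have "\<dots> \<le> esssup lborel (\<lambda>x. ereal (cmod (g x)))" by (rule esssup_mono) auto
  finally show "0 \<le> esssup lborel (\<lambda>x. ereal (cmod (g x)))" .
qed

lemma Linfty_norm_le:
  assumes [measurable]: "g \<in> borel_measurable lborel"
    and "\<And>\<psi>. v \<psi> = (LINT x|lborel. g x * Rep_test_fun \<psi> x)" and "\<And>x. cmod (g x) \<le> e"
  shows "Linfty_norm v \<le> ereal e"
  unfolding Linfty_norm_def
  by (rule INF_lower2[of g]) (use assms in auto)

text \<open>The uniform bound \<open>K\<close> times a test function dominates, so the
  distributional limit is represented by the pointwise limit, and a pointwise bound on the latter
  suffices.\<close>

lemma Linfty_norm_limit:
  fixes F :: "nat \<Rightarrow> 'a::euclidean_space \<Rightarrow> complex"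
  assumes F: "\<And>n. schwartz (F n)" and lim: "\<And>x. (\<lambda>n. F n x) \<longlonglongrightarrow> G x"
    and K: "\<And>n x. cmod (F n x) \<le> K"
    and v: "\<And>\<psi>. (\<lambda>n. LINT x|lborel. F n x * Rep_test_fun \<psi> x) \<longlonglongrightarrow> v \<psi>"
    and e: "\<And>x. cmod (G x) \<le> e"
  shows "Linfty_norm v \<le> ereal e"
proof (rule Linfty_norm_le[where g = G])
  have Fm[measurable]: "F n \<in> borel_measurable lborel" for n using schwartz_measurable[OF F] by simp
  show "G \<in> borel_measurable lborel" by (rule borel_measurable_LIMSEQ_metric[OF Fm lim])
  then have [measurable]: "G \<in> borel_measurable borel" by simp
  fix \<psi> :: "'a test_fun"
  have \<psi>: "schwartz (Rep_test_fun \<psi>)" using Rep_test_fun[of \<psi>] by simp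
  note [measurable] = schwartz_measurable[OF \<psi>]
  have "(\<lambda>n. LINT x|lborel. F n x * Rep_test_fun \<psi> x) \<longlonglongrightarrow> (LINT x|lborel. G x * Rep_test_fun \<psi> x)"
  proof (rule integral_dominated_convergence[where w = "\<lambda>x. K * cmod (Rep_test_fun \<psi> x)"])
    show "integrable lborel (\<lambda>x. K * cmod (Rep_test_fun \<psi> x))"
      by (intro integrable_mult_right integrable_norm schwartz_integrable \<psi>)
    show "AE x in lborel. (\<lambda>n. F n x * Rep_test_fun \<psi> x) \<longlonglongrightarrow> G x * Rep_test_fun \<psi> x"
      by (intro always_eventually allI tendsto_intros lim)
    show "AE x in lborel. cmod (F n x * Rep_test_fun \<psi> x) \<le> K * cmod (Rep_test_fun \<psi> x)" for n
      unfolding norm_mult by (intro always_eventually allI mult_right_mono K) auto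
  qed measurable
  from LIMSEQ_unique[OF v this] show "v \<psi> = (LINT x|lborel. G x * Rep_test_fun \<psi> x)" .
qed (rule e)

section \<open>The terms of the difference along approximating sequences\<close>

lemma wnorm_free_evolution:
  assumes "moderate_phase \<phi>" "schwartz f"
  shows "wnorm W (free_evolution \<phi> t f) = wnorm W f"
  unfolding wnorm_def fourier_free_evolution[OF assms] norm_mult norm_cis_minus by simp

lemma evolution_approximates:
  assumes \<phi>: "moderate_phase \<phi>" and f: "approximates (wnorm (Hs_weight s)) f u"
  shows "approximates (wnorm (Hs_weight s)) (\<lambda>n. free_evolution \<phi> t (f n)) (evolution \<phi> s t u)"
  unfolding evolution_def Hs_norm_wnorm
  by (rule extension_approximates[where C = 1, OF fourier_weight_Hs fourier_weight_Hs _ _ _ f])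
     (auto simp: wnorm_free_evolution[OF \<phi>] free_evolution_diff[OF \<phi>] fun_eq_iff intro: schwartz_free_evolution[OF \<phi>])

lemma at_time_approximates:
  assumes \<phi>: "moderate_phase \<phi>" and b: "b > 1 / 2" and f: "approximates (wnorm (X_weight \<phi> s b)) f u"
  shows "approximates (wnorm (Hs_weight s)) (\<lambda>n x. f n (x, t)) (at_time \<phi> s b t u)"
  unfolding at_time_def Hs_norm_wnorm X_norm_wnorm
  by (rule extension_approximates[OF fourier_weight_X[OF \<phi>] fourier_weight_Hs _ _ slice_bound_Hs[OF \<phi> b] f])
     (auto intro: schwartz_slice)

lemma local_duhamel_quadratic_diff:
  assumes \<phi>: "moderate_phase \<phi>" and "schwartz v" "schwartz w"
  shows "local_duhamel \<phi> \<eta> T v v p - local_duhamel \<phi> \<eta> T w w p =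
    local_duhamel \<phi> \<eta> T (\<lambda>p. v p - w p) v p + local_duhamel \<phi> \<eta> T w (\<lambda>p. v p - w p) p"
  using local_duhamel_diff[OF \<phi>, of v w v \<eta> T p] local_duhamel_diff[OF \<phi>, of v w w \<eta> T p] assms by simp

lemma cutoff_eq_one:
  assumes "cutoff \<eta>" "T > 0" "\<bar>t\<bar> \<le> T" shows "\<eta> (t / T) = 1"
  using assms by (auto simp: cutoff_def divide_le_eq)

lemma kawahara_convergence:
  fixes \<alpha> \<beta> s b :: real
  defines "\<phi> \<equiv> dispersion \<alpha> \<beta>"
  assumes \<alpha>: "\<alpha> \<noteq> 0" and s: "s > - 1 / 2" and b: "b > 1 / 2" and \<eta>: "cutoff \<eta>"
    and T: "0 < T" "T < 1"
    and free: "\<And>f. schwartz f \<Longrightarrow> X_norm \<phi> s b (local_free_evolution \<phi> \<eta> f) \<le> Cf * Hs_norm s f"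
    and duh: "\<And>v w. schwartz v \<Longrightarrow> schwartz w \<Longrightarrow>
      X_norm \<phi> s b (local_duhamel \<phi> \<eta> T v w) \<le> Cd * X_norm \<phi> s b v * X_norm \<phi> s b w" and "Cd \<ge> 0"
    and u0: "u0 \<in> schwartz_completion (Hs_norm s)" and u: "u \<in> schwartz_completion (X_norm \<phi> s b)"
    and eq: "\<And>\<psi>. u \<psi> = extension (Hs_norm s) (X_norm \<phi> s b) (local_free_evolution \<phi> \<eta>) u0 \<psi> -
        bilinear_extension (X_norm \<phi> s b) (X_norm \<phi> s b) (local_duhamel \<phi> \<eta> T) u u \<psi>"
  shows "((\<lambda>t. Linfty_norm (\<lambda>\<psi>. at_time \<phi> s b t u \<psi> - evolution \<phi> s t u0 \<psi>)) \<longlongrightarrow> 0) (at 0)"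
proof -
  let ?N = "wnorm (X_weight \<phi> s b)" and ?H = "wnorm (Hs_weight s)"
  have \<phi>: "moderate_phase \<phi>" unfolding \<phi>_def by (rule moderate_dispersion)
  interpret X: fourier_weight "X_weight \<phi> s b" by (rule fourier_weight_X[OF \<phi>])
  interpret H: fourier_weight "Hs_weight s" by (rule fourier_weight_Hs)
  obtain f where f: "approximates ?H f u0" using u0 unfolding schwartz_completion_def Hs_norm_wnorm by blast
  obtain v where v: "approximates ?N v u" using u unfolding schwartz_completion_def X_norm_wnorm by blast
  note sf = H.approximates_schwartz[OF f] and sv = X.approximates_schwartz[OF v]
  let ?L = "\<lambda>n. local_duhamel \<phi> \<eta> T (v n) (v n)"
  have sL: "schwartz (?L n)" for n by (rule schwartz_local_duhamel[OF \<phi> \<eta> T(1) sv sv])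
  have E: "approximates ?N (\<lambda>n. local_free_evolution \<phi> \<eta> (f n)) (extension ?H ?N (local_free_evolution \<phi> \<eta>) u0)"
    by (rule extension_approximates[where C = Cf, OF H.fourier_weight_axioms X.fourier_weight_axioms _ _ _ f])
       (use free in \<open>auto simp: local_free_evolution_diff[OF \<phi>] fun_eq_iff Hs_norm_wnorm X_norm_wnorm
          intro: schwartz_local_free_evolution[OF \<phi> \<eta>]\<close>)
  have D: "approximates ?N ?L (bilinear_extension ?N ?N (local_duhamel \<phi> \<eta> T) u u)"
    by (rule bilinear_extension_approximates[where C = Cd, OF X.fourier_weight_axioms X.fourier_weight_axioms _ _ _ _ _ v v])
       (use duh \<open>Cd \<ge> 0\<close> in \<open>auto simp: local_duhamel_diff[OF \<phi>] fun_eq_iff X_norm_wnorm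
          intro: schwartz_local_duhamel[OF \<phi> \<eta> T(1)]\<close>)
  \<comment> \<open>The integral equation provides a second approximating sequence of
    \<open>u\<close>, one whose time slices are explicit. Evaluation at a time does not depend on
    the sequence, so it may be computed along this one.\<close>
  have ED: "approximates ?N (\<lambda>n p. local_free_evolution \<phi> \<eta> (f n) p - ?L n p) u"
    by (rule subst[OF ext[OF eq, symmetric], of "approximates ?N _", unfolded Hs_norm_wnorm X_norm_wnorm, OF X.approximates_diff[OF E D]])
  define z where "z = (\<lambda>t \<psi>. at_time \<phi> s b t u \<psi> - evolution \<phi> s t u0 \<psi>)"
  \<comment> \<open>For \<open>|t| <= T < 1\<close> the cutoff of the free part equals 1; the free
    parts cancel exactly and only the Duhamel slices survive.\<close>
  have z: "(\<lambda>n. LINT x|lborel. (- ?L n (x, t)) * Rep_test_fun \<psi> x) \<longlonglongrightarrow> z t \<psi>" if t: "\<bar>t\<bar> \<le> T" for t \<psi>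
  proof -
    have "local_free_evolution \<phi> \<eta> (f n) (x, t) - ?L n (x, t) - free_evolution \<phi> t (f n) x = - ?L n (x, t)" for n x
      unfolding local_free_evolution_def using cutoff_eq_one[OF \<eta>, of 1 t] t T by simp
    then show ?thesis
      using H.approximates_tendsto[OF H.approximates_diff[OF at_time_approximates[OF \<phi> b ED, of t] evolution_approximates[OF \<phi> f, of t]], of \<psi>]
      unfolding z_def by simp
  qed
  have \<eta>1: "\<bar>\<eta> (t / T)\<bar> \<le> 1" if "\<bar>t\<bar> \<le> T" for t using cutoff_eq_one[OF \<eta> T(1) that] by simp
  obtain C where C: "C \<ge> 0" "\<And>v w x t. schwartz v \<Longrightarrow> schwartz w \<Longrightarrow> \<bar>t\<bar> \<le> 1 \<Longrightarrow> \<bar>\<eta> (t / T)\<bar> \<le> 1 \<Longrightarrow>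
    cmod (local_duhamel \<phi> \<eta> T v w (x, t)) \<le> C * ?N v * ?N w"
    by (rule local_duhamel_sup_bound[OF \<alpha> s b, of \<beta>, folded \<phi>_def]) (rule that)
  obtain K where K: "K > 0" "\<And>n. ?N (v n) \<le> K" using X.approximates_bounded[OF v] by blast
  have Lb: "cmod (?L n (x, t)) \<le> C * K * K" if "\<bar>t\<bar> \<le> T" for n x t
    using C(1) K \<eta>1[OF that] that T
    by (intro order_trans[OF C(2)[OF sv sv]] mult_mono mult_nonneg_nonneg) (auto simp: wnorm_nonneg)
  have Ld: "cmod (?L m (x, t) - ?L n (x, t)) \<le> 2 * C * K * ?N (\<lambda>p. v m p - v n p)" if t: "\<bar>t\<bar> \<le> T" for m n x t
  proof -
    let ?d = "\<lambda>p. v m p - v n p"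
    have sd: "schwartz ?d" by (intro schwartz_diff sv)
    have t1: "\<bar>t\<bar> \<le> 1" using t T by simp
    have "cmod (?L m (x, t) - ?L n (x, t)) \<le> cmod (local_duhamel \<phi> \<eta> T ?d (v m) (x, t)) + cmod (local_duhamel \<phi> \<eta> T (v n) ?d (x, t))"
      unfolding local_duhamel_quadratic_diff[OF \<phi> sv sv] by (rule norm_triangle_ineq)
    also have "\<dots> \<le> C * ?N ?d * ?N (v m) + C * ?N (v n) * ?N ?d"
      by (intro add_mono C(2) sd sv t1 \<eta>1[OF t])
    also have "\<dots> \<le> C * ?N ?d * K + C * K * ?N ?d"
      using C(1) K by (intro add_mono mult_left_mono mult_right_mono) (auto simp: wnorm_nonneg)
    finally show ?thesis by (simp add: algebra_simps)
  qed
  \<comment> \<open>Uniformity in \<open>x\<close> and in \<open>t\<close> lets the index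
    \<open>M\<close> be fixed before \<open>t\<close> is made small.\<close>
  have unif: "\<exists>M. \<forall>m\<ge>M. \<forall>n\<ge>M. \<forall>x t. \<bar>t\<bar> \<le> T \<longrightarrow> cmod (?L m (x, t) - ?L n (x, t)) < e" if e: "e > 0" for e
  proof -
    have ck: "2 * C * K + 1 > 0" using C(1) K(1) by (intro add_nonneg_pos) auto
    then have "e / (2 * C * K + 1) > 0" using e by simp
    from X.approximates_Cauchy[OF v this] obtain M where
      M: "\<And>m n. m \<ge> M \<Longrightarrow> n \<ge> M \<Longrightarrow> ?N (\<lambda>p. v m p - v n p) < e / (2 * C * K + 1)" by blast
    have "cmod (?L m (x, t) - ?L n (x, t)) < e" if "m \<ge> M" "n \<ge> M" "\<bar>t\<bar> \<le> T" for m n x t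
    proof -
      have "cmod (?L m (x, t) - ?L n (x, t)) \<le> 2 * C * K * (e / (2 * C * K + 1))"
        by (rule order_trans[OF Ld[OF that(3)] mult_left_mono]) (use M[OF that(1,2)] C(1) K(1) in auto)
      also have "\<dots> < (2 * C * K + 1) * (e / (2 * C * K + 1))" using \<open>e / (2 * C * K + 1) > 0\<close> by (intro mult_strict_right_mono) auto
      also have "\<dots> = e" using ck by simp
      finally show ?thesis .
    qed
    then show ?thesis by blast
  qed
  \<comment> \<open>For \<open>|t| > T\<close> the sequence need not converge and \<open>lim\<close>
    may be an arbitrary value; \<open>G\<close> is used only for \<open>|t| <= T\<close>.\<close>
  define G where "G = (\<lambda>t x. lim (\<lambda>n. ?L n (x, t)))"
  have G: "(\<lambda>n. ?L n (x, t)) \<longlonglongrightarrow> G t x" if "\<bar>t\<bar> \<le> T" for t x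
  proof -
    have "Cauchy (\<lambda>n. ?L n (x, t))"
      by (rule CauchyI) (use unif that in blast)
    then show ?thesis unfolding G_def by (simp add: Cauchy_convergent_iff convergent_LIMSEQ_iff)
  qed
  have small: "\<exists>d>0. \<forall>t. \<bar>t\<bar> < d \<longrightarrow> Linfty_norm (z t) \<le> ereal e" if e: "e > 0" for e
  proof -
    have "e / 2 > 0" using e by simp
    from unif[OF this] obtain M where M: "\<And>n x t. n \<ge> M \<Longrightarrow> \<bar>t\<bar> \<le> T \<Longrightarrow> cmod (?L n (x, t) - ?L M (x, t)) < e / 2" by blast
    obtain B where B: "B > 0" "\<And>x t. \<bar>\<eta> (t / T)\<bar> \<le> 1 \<Longrightarrow> cmod (?L M (x, t)) \<le> B * \<bar>t\<bar>"
      by (rule local_duhamel_small_time[OF \<phi> sv sv]) (rule that)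
    \<comment> \<open>Half of \<open>e\<close> is spent on replacing all later terms by the
      \<open>M\<close>-th, the other half on the bound \<open>B * |t|\<close> for that single term;
      the minimum with \<open>T\<close> keeps \<open>t\<close> where the free parts cancel.\<close>
    define d where "d = min T (e / (2 * B))"
    have d: "d > 0" unfolding d_def using T(1) e B(1) by simp
    have "Linfty_norm (z t) \<le> ereal e" if t: "\<bar>t\<bar> < d" for t
    proof (rule Linfty_norm_limit[where F = "\<lambda>n x. - ?L n (x, t)" and G = "\<lambda>x. - G t x" and K = "C * K * K"])
      have tT: "\<bar>t\<bar> \<le> T" using t unfolding d_def by simp
      show "schwartz (\<lambda>x. - ?L n (x, t))" for n
        using schwartz_cmult[OF schwartz_slice[OF sL], of "-1" n t] by simp
      show "(\<lambda>n. - ?L n (x, t)) \<longlonglongrightarrow> - G t x" for x by (intro tendsto_minus G tT)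
      show "cmod (- ?L n (x, t)) \<le> C * K * K" for n x using Lb[OF tT] by simp
      show "(\<lambda>n. LINT x|lborel. (- ?L n (x, t)) * Rep_test_fun \<psi> x) \<longlonglongrightarrow> z t \<psi>" for \<psi> by (rule z[OF tT])
      show "cmod (- G t x) \<le> e" for x
      proof -
        have "cmod (?L M (x, t)) \<le> B * \<bar>t\<bar>" by (rule B(2)[OF \<eta>1[OF tT]])
        also have "\<dots> \<le> B * (e / (2 * B))" using t B(1) unfolding d_def by (intro mult_left_mono) auto
        also have "\<dots> = e / 2" using B(1) by simp
        finally have LM: "cmod (?L M (x, t)) \<le> e / 2" .
        have "cmod (?L n (x, t)) \<le> e" if "n \<ge> M" for n
          using norm_triangle_ineq[of "?L n (x, t) - ?L M (x, t)" "?L M (x, t)"] M[OF that tT, of x] LM by simp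
        then have "cmod (G t x) \<le> e"
          by (intro LIMSEQ_le_const2[OF tendsto_norm[OF G[OF tT]]]) blast
        then show ?thesis by simp
      qed
    qed
    then show ?thesis using d by blast
  qed
  have "((\<lambda>t. Linfty_norm (z t)) \<longlongrightarrow> 0) (at 0)"
  proof (rule order_tendstoI)
    fix a :: ereal assume "a < 0"
    then show "eventually (\<lambda>t. a < Linfty_norm (z t)) (at 0)"
      using less_le_trans[OF _ Linfty_norm_nonneg] by (intro always_eventually) blast
  next
    fix a :: ereal assume "0 < a"
    then obtain e where e: "0 < ereal e" "ereal e < a" using ereal_dense2 by blast
    then obtain d where d: "d > 0" "\<And>t. \<bar>t\<bar> < d \<Longrightarrow> Linfty_norm (z t) \<le> ereal e" using small[of e] by auto
    have "Linfty_norm (z t) < a" if "\<bar>t\<bar> < d" for t by (rule le_less_trans[OF d(2)[OF that] e(2)])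
    then show "eventually (\<lambda>t. Linfty_norm (z t) < a) (at 0)"
      unfolding eventually_at using d(1) by (auto simp: dist_real_def)
  qed
  then show ?thesis unfolding z_def .
qed

theorem theorem1p5:
  fixes s :: real
  assumes "s > - 1/2"
  shows "\<exists>\<epsilon>\<^sub>0>0. \<forall>\<epsilon>. 0 < \<epsilon> \<and> \<epsilon> < \<epsilon>\<^sub>0 \<longrightarrow>
    (\<forall>(\<alpha>::real) (\<beta>::real) \<eta> C\<^sub>0 u\<^sub>0 T u.
       \<alpha> \<noteq> 0 \<longrightarrow>
       cutoff \<eta> \<longrightarrow>
       admissible_constant (dispersion \<alpha> \<beta>) \<eta> s \<epsilon> C\<^sub>0 \<longrightarrow>
       u\<^sub>0 \<in> schwartz_completion (Hs_norm s) \<longrightarrow>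
       0 < T \<longrightarrow> T < 1 \<longrightarrow>
       8 * C\<^sub>0\<^sup>2 * T powr (3 * \<epsilon> / 2) * completion_norm (Hs_norm s) u\<^sub>0 \<le> 1 \<longrightarrow>
       solution (dispersion \<alpha> \<beta>) \<eta> s (1/2 + \<epsilon>/2) C\<^sub>0 T u\<^sub>0 u \<longrightarrow>
       ((\<lambda>t. Linfty_norm (\<lambda>\<psi>.
            at_time (dispersion \<alpha> \<beta>) s (1/2 + \<epsilon>/2) t u \<psi> - evolution (dispersion \<alpha> \<beta>) s t u\<^sub>0 \<psi>))
          \<longlongrightarrow> 0) (at 0))"
\<comment> \<open>The estimates rest on \<open>b = 1/2 + \<epsilon>/2 > 1/2\<close>, true for every
  positive \<open>\<epsilon>\<close>, and on the two bounds that \<open>admissible_constant\<close>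
  contains; hence 1 can serve as the threshold.\<close>
proof (intro exI[of _ "1::real"] conjI allI impI)
  fix \<epsilon> \<alpha> \<beta> :: real and \<eta> :: "real \<Rightarrow> real" and C\<^sub>0 T :: real
    and u\<^sub>0 :: "real distribution" and u :: "(real \<times> real) distribution"
  assume \<epsilon>: "0 < \<epsilon> \<and> \<epsilon> < 1" and \<alpha>: "\<alpha> \<noteq> 0" and \<eta>: "cutoff \<eta>"
    and adm: "admissible_constant (dispersion \<alpha> \<beta>) \<eta> s \<epsilon> C\<^sub>0"
    and u\<^sub>0: "u\<^sub>0 \<in> schwartz_completion (Hs_norm s)" and T: "0 < T" "T < 1"
    and sol: "solution (dispersion \<alpha> \<beta>) \<eta> s (1/2 + \<epsilon>/2) C\<^sub>0 T u\<^sub>0 u"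
  have "C\<^sub>0 \<ge> 1" using adm unfolding admissible_constant_def by blast
  show "((\<lambda>t. Linfty_norm (\<lambda>\<psi>.
            at_time (dispersion \<alpha> \<beta>) s (1/2 + \<epsilon>/2) t u \<psi> - evolution (dispersion \<alpha> \<beta>) s t u\<^sub>0 \<psi>))
          \<longlongrightarrow> 0) (at 0)"
  proof (rule kawahara_convergence)
    show "1 / 2 < 1/2 + \<epsilon>/2" using \<epsilon> by simp
    show "X_norm (dispersion \<alpha> \<beta>) s (1/2 + \<epsilon>/2) (local_free_evolution (dispersion \<alpha> \<beta>) \<eta> f) \<le> C\<^sub>0 * Hs_norm s f"
      if "schwartz f" for f
      using adm that unfolding admissible_constant_def by blast
    show "X_norm (dispersion \<alpha> \<beta>) s (1/2 + \<epsilon>/2) (local_duhamel (dispersion \<alpha> \<beta>) \<eta> T v w) \<le>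
        C\<^sub>0 * T powr (3 * \<epsilon> / 2) * X_norm (dispersion \<alpha> \<beta>) s (1/2 + \<epsilon>/2) v * X_norm (dispersion \<alpha> \<beta>) s (1/2 + \<epsilon>/2) w"
      if "schwartz v" "schwartz w" for v w
      using adm that T unfolding admissible_constant_def by blast
    show "0 \<le> C\<^sub>0 * T powr (3 * \<epsilon> / 2)" using \<open>C\<^sub>0 \<ge> 1\<close> by simp
    show "u \<in> schwartz_completion (X_norm (dispersion \<alpha> \<beta>) s (1/2 + \<epsilon>/2))"
      using sol unfolding solution_def by blast
    show "u \<psi> = extension (Hs_norm s) (X_norm (dispersion \<alpha> \<beta>) s (1/2 + \<epsilon>/2)) (local_free_evolution (dispersion \<alpha> \<beta>) \<eta>) u\<^sub>0 \<psi> -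
        bilinear_extension (X_norm (dispersion \<alpha> \<beta>) s (1/2 + \<epsilon>/2)) (X_norm (dispersion \<alpha> \<beta>) s (1/2 + \<epsilon>/2))
          (local_duhamel (dispersion \<alpha> \<beta>) \<eta> T) u u \<psi>" for \<psi>
      using sol unfolding solution_def by blast
  qed (fact \<alpha> assms \<eta> T u\<^sub>0)+
qed simp

end
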